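(* Let $(\mathbf z_i)$ be the stationary $p$-dimensional process described in the context, and assume there exist $q>2$, $\alpha>0$, $\mu<\infty$, $C_0<\infty$ with $\max_{j\le p}\|Z_{ji}\|_{2q}\le\mu$ and $\Theta_{m,2q}\le C_0m^{-\alpha}$ for all $m\ge1$. Let $L_\alpha=n^{1/q-1}$, $n^{1/q-1}(\log n)^{1+1/q}$, $n^{-\alpha-1/2}$ and $J_\alpha=n^{-1/2}$, $n^{-1/2}\log n$, $n^{-\tilde\beta/2}$ for $\alpha>1/2-1/q$, $\alpha=1/2-1/q$, $\alpha<1/2-1/q$ respectively. Define $$D_\ast(u)=\max_{1\le k\le p}\sum_{j=1}^p(|\sigma_{jk}|\wedge u),\quad N_\ast(u)=\max_{1\le k\le p}\sum_{j=1}^p\mathbb I(|\sigma_{jk}|\ge u),$$ and $M_\ast(u)=L_\alpha p^{1/q}N_\ast^{1+1/q}(u)+J_\alpha(\log p)^{1/2}N_\ast(u)$. Then there exists a constant $C>0$, independent of $u$, $n$ and $p$, such that for all $u>0$ $$\big\|\rho\big(T_u(\hat\Sigma_n)-\Sigma\big)\big\|_2\lesssim D_\ast(u)+M_\ast(u/2)+p\min\Big(\frac1{\sqrt n},\frac{u^{1-q/2}}{n^{q/4}},\big(H(u)+G(Cu)\big)^{1/2}\Big).$$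
   Context: Let $(\boldsymbol\varepsilon_i)_{i\in\mathbb Z}$ be i.i.d. random vectors, $\mathcal F_i=(\ldots,\boldsymbol\varepsilon_{i-1},\boldsymbol\varepsilon_i)$, and $\mathbf z_i=\mathbf g(\mathcal F_i)=(Z_{1i},\ldots,Z_{pi})^\top$ with $\mathbf g=(g_1,\ldots,g_p)^\top$ measurable; assume $\mathbb E\mathbf z_i=0$ and $\Sigma=(\sigma_{jk})=\mathrm{cov}(\mathbf z_i)$. Data $\mathbf z_1,\dots,\mathbf z_n$; $\hat\Sigma_n=(\hat\sigma_{jk})=n^{-1}\sum_{i=1}^n\mathbf z_i\mathbf z_i^\top$; $T_u(\hat\Sigma_n)=(\hat\sigma_{jk}\mathbb I(|\hat\sigma_{jk}|\ge u))_{j,k}$. $\|X\|_w=(\mathbb E|X|^w)^{1/w}$. $\theta_{i,w,j}=\|Z_{ji}-g_j(\mathcal F_i')\|_w$ with $\mathcal F_i'=(\ldots,\boldsymbol\varepsilon_{-1},\boldsymbol\varepsilon_0',\boldsymbol\varepsilon_1,\ldots,\boldsymbol\varepsilon_i)$, $\boldsymbol\varepsilon_0'$ an i.i.d. copy of $\boldsymbol\varepsilon_0$ independent of $(\boldsymbol\varepsilon_l)$; $\Theta_{m,w}=\max_{j\le p}\sum_{l\ge m}\theta_{l,w,j}$. With $\tilde\alpha=\alpha\wedge(1/2-1/q)$, $\tilde\beta=(3+2\tilde\alpha q)/(1+q)$: $H(u)=u^{2-q}n^{1-q}$, $u^{2-q}n^{1-q}(\log n)^{1+q}$, $u^{2-q}n^{-q(\alpha+1/2)}$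 and $G(u)=(n^{-1}+u^2)e^{-nu^2}$, $(n^{-1}(\log n)^2+u^2)e^{-n(\log n)^{-2}u^2}$, $(n^{-\tilde\beta}+u^2)e^{-n^{\tilde\beta}u^2}$ for $\alpha>1/2-1/q$, $\alpha=1/2-1/q$, $\alpha<1/2-1/q$ respectively. $\rho(A)=\max\{|A\mathbf x|:|\mathbf x|=1\}$ is the spectral norm. $a\lesssim b$ means $a\le Cb$ with $C$ independent of $n$, $p$ and $u$. *)

theory Defs
  imports "HOL-Probability.Probability"
begin

definition Lnorm :: "'a measure \<Rightarrow> real \<Rightarrow> ('a \<Rightarrow> real) \<Rightarrow> ennreal" where
  "Lnorm M w X = (let I = (\<integral>\<^sup>+ x. ennreal (\<bar>X x\<bar> powr w) \<partial>M)
                  in if I = \<infinity> then \<infinity> else ennreal ((enn2real I) powr (1 / w)))"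

definition iid_innov :: "'a measure \<Rightarrow> 'e measure \<Rightarrow> (int \<Rightarrow> 'a \<Rightarrow> 'e) \<Rightarrow> ('a \<Rightarrow> 'e) \<Rightarrow> bool" where
  "iid_innov M E eps eps0' \<longleftrightarrow>
     prob_space.indep_vars M (\<lambda>_. E) (\<lambda>oi. case oi of None \<Rightarrow> eps0' | Some i \<Rightarrow> eps i) UNIV \<and>
     (\<forall>i. distr M E (eps i) = distr M E (eps 0)) \<and> distr M E eps0' = distr M E (eps 0)"

(* Z_{ji} = g_j(F_i), F_i = (..., eps_{i-1}, eps_i), encoded by lag: k \<mapsto> eps_{i-k} *)
definition Zproc :: "(nat \<Rightarrow> (nat \<Rightarrow> 'e) \<Rightarrow> real) \<Rightarrow> (int \<Rightarrow> 'a \<Rightarrow> 'e) \<Rightarrow> nat \<Rightarrow> int \<Rightarrow> 'a \<Rightarrow> real" where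
  "Zproc g eps j i \<omega> = g j (\<lambda>k. eps (i - int k) \<omega>)"

definition Zcoup :: "(nat \<Rightarrow> (nat \<Rightarrow> 'e) \<Rightarrow> real) \<Rightarrow> (int \<Rightarrow> 'a \<Rightarrow> 'e) \<Rightarrow> ('a \<Rightarrow> 'e) \<Rightarrow> nat \<Rightarrow> int \<Rightarrow> 'a \<Rightarrow> real" where
  "Zcoup g eps eps0' j i \<omega> = g j (\<lambda>k. if i - int k = 0 then eps0' \<omega> else eps (i - int k) \<omega>)"

definition theta_dep :: "'a measure \<Rightarrow> (nat \<Rightarrow> (nat \<Rightarrow> 'e) \<Rightarrow> real) \<Rightarrow> (int \<Rightarrow> 'a \<Rightarrow> 'e) \<Rightarrow> ('a \<Rightarrow> 'e)
    \<Rightarrow> int \<Rightarrow> real \<Rightarrow> nat \<Rightarrow> ennreal" where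
  "theta_dep M g eps eps0' i w j = Lnorm M w (\<lambda>\<omega>. Zproc g eps j i \<omega> - Zcoup g eps eps0' j i \<omega>)"

definition Theta_dep :: "'a measure \<Rightarrow> (nat \<Rightarrow> (nat \<Rightarrow> 'e) \<Rightarrow> real) \<Rightarrow> (int \<Rightarrow> 'a \<Rightarrow> 'e) \<Rightarrow> ('a \<Rightarrow> 'e)
    \<Rightarrow> nat \<Rightarrow> nat \<Rightarrow> real \<Rightarrow> ennreal" where
  "Theta_dep M g eps eps0' p m w = Max ((\<lambda>j. \<Sum>l. theta_dep M g eps eps0' (int (l + m)) w j) ` {..<p})"

(* population covariance sigma_{jk} = E[Z_{j0} Z_{k0}] (mean zero process) *)
definition Sigma_cov :: "'a measure \<Rightarrow> (nat \<Rightarrow> (nat \<Rightarrow> 'e) \<Rightarrow> real) \<Rightarrow> (int \<Rightarrow> 'a \<Rightarrow> 'e) \<Rightarrow> nat \<Rightarrow> nat \<Rightarrow> real" where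
  "Sigma_cov M g eps j k = (\<integral>\<omega>. Zproc g eps j 0 \<omega> * Zproc g eps k 0 \<omega> \<partial>M)"

definition Sigma_hat :: "nat \<Rightarrow> (nat \<Rightarrow> (nat \<Rightarrow> 'e) \<Rightarrow> real) \<Rightarrow> (int \<Rightarrow> 'a \<Rightarrow> 'e) \<Rightarrow> 'a \<Rightarrow> nat \<Rightarrow> nat \<Rightarrow> real" where
  "Sigma_hat n g eps \<omega> j k = (\<Sum>i=1..n. Zproc g eps j (int i) \<omega> * Zproc g eps k (int i) \<omega>) / real n"

definition thresh :: "real \<Rightarrow> (nat \<Rightarrow> nat \<Rightarrow> real) \<Rightarrow> nat \<Rightarrow> nat \<Rightarrow> real" where
  "thresh u A j k = (if \<bar>A j k\<bar> \<ge> u then A j k else 0)"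

definition spec_norm :: "nat \<Rightarrow> (nat \<Rightarrow> nat \<Rightarrow> real) \<Rightarrow> real" where
  "spec_norm p A = Sup {sqrt (\<Sum>j<p. (\<Sum>k<p. A j k * x k)\<^sup>2) | x. (\<Sum>k<p. (x k)\<^sup>2) = 1}"

definition alpha_t :: "real \<Rightarrow> real \<Rightarrow> real" where
  "alpha_t q \<alpha> = min \<alpha> (1/2 - 1/q)"

definition beta_t :: "real \<Rightarrow> real \<Rightarrow> real" where
  "beta_t q \<alpha> = (3 + 2 * alpha_t q \<alpha> * q) / (1 + q)"

definition H_fun :: "real \<Rightarrow> real \<Rightarrow> nat \<Rightarrow> real \<Rightarrow> real" where
  "H_fun q \<alpha> n u =
     (if \<alpha> > 1/2 - 1/q then u powr (2 - q) * real n powr (1 - q)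
      else if \<alpha> = 1/2 - 1/q then u powr (2 - q) * real n powr (1 - q) * ln (real n) powr (1 + q)
      else u powr (2 - q) * real n powr (- q * (\<alpha> + 1/2)))"

definition G_fun :: "real \<Rightarrow> real \<Rightarrow> nat \<Rightarrow> real \<Rightarrow> real" where
  "G_fun q \<alpha> n u =
     (if \<alpha> > 1/2 - 1/q then (1 / real n + u\<^sup>2) * exp (- (real n * u\<^sup>2))
      else if \<alpha> = 1/2 - 1/q then
        ((ln (real n))\<^sup>2 / real n + u\<^sup>2) * exp (- (real n * (ln (real n) powr (-2)) * u\<^sup>2))
      else (real n powr (- beta_t q \<alpha>) + u\<^sup>2) * exp (- ((real n powr (beta_t q \<alpha>)) * u\<^sup>2)))"

definition L_alpha :: "real \<Rightarrow> real \<Rightarrow> nat \<Rightarrow> real" where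
  "L_alpha q \<alpha> n =
     (if \<alpha> > 1/2 - 1/q then real n powr (1/q - 1)
      else if \<alpha> = 1/2 - 1/q then real n powr (1/q - 1) * ln (real n) powr (1 + 1/q)
      else real n powr (- \<alpha> - 1/2))"

definition J_alpha :: "real \<Rightarrow> real \<Rightarrow> nat \<Rightarrow> real" where
  "J_alpha q \<alpha> n =
     (if \<alpha> > 1/2 - 1/q then real n powr (- 1/2)
      else if \<alpha> = 1/2 - 1/q then real n powr (- 1/2) * ln (real n)
      else real n powr (- beta_t q \<alpha> / 2))"

definition D_star :: "nat \<Rightarrow> (nat \<Rightarrow> nat \<Rightarrow> real) \<Rightarrow> real \<Rightarrow> real" where
  "D_star p S u = Max ((\<lambda>k. \<Sum>j<p. min \<bar>S j k\<bar> u) ` {..<p})"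

definition N_star :: "nat \<Rightarrow> (nat \<Rightarrow> nat \<Rightarrow> real) \<Rightarrow> real \<Rightarrow> real" where
  "N_star p S u = Max ((\<lambda>k. \<Sum>j<p. if \<bar>S j k\<bar> \<ge> u then 1 else 0) ` {..<p})"

definition M_star :: "real \<Rightarrow> real \<Rightarrow> nat \<Rightarrow> nat \<Rightarrow> (nat \<Rightarrow> nat \<Rightarrow> real) \<Rightarrow> real \<Rightarrow> real" where
  "M_star q \<alpha> n p S u =
     L_alpha q \<alpha> n * real p powr (1/q) * N_star p S u powr (1 + 1/q)
     + J_alpha q \<alpha> n * sqrt (ln (real p)) * N_star p S u"

end

theory Submission
  imports Defs
begin

text \<open>Thresholding at \<open>u\<close> costs at most twice \<open>min |sigma_jk| u\<close> per entry, plus the error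
  \<open>X_jk\<close> of those sample covariances whose true value is at least \<open>u/2\<close>, plus the errors that exceed
  \<open>u/2\<close>. The first two contributions are controlled by row sums (Schur test), the last one by the Frobenius
  norm, so only the truncated second moments \<open>E X_jk^2 1(|X_jk| >= w)\<close> are needed; for the second
  contribution \<open>w\<close> is chosen so that the maximum over the relevant entries rarely exceeds it.

  The truncated moments come from a Nagaev inequality for the dependent products \<open>Z_ji Z_ki\<close>. These are
  projected onto their most recent innovations and decomposed along the lag into dyadic levels. On the level
  of lags of order \<open>2^l\<close>, sums over blocks of length \<open>2^l\<close> are independent for every second
  block, and their \<open>q\<close>-th moments are bounded by a martingale inequality in reversed time; the
  independent Nagaev inequality is applied on each level. Truncating the process and its memory is
  harmless because the bounds pass to the limit in \<open>L^1\<close>.\<close>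

section \<open>Elementary inequalities\<close>

text \<open>Conditioning on the innovations from some time on, rather than on the past, makes each
  projected term a function of finitely many innovations. Distant blocks are then exactly
  independent, and the price is a martingale structure that only appears in reversed time. Adjacent
  projections differ by averaging over a copy of one innovation, which is how the coupling
  coefficients enter. Products require moments of order 2q: Cauchy-Schwarz turns two factors in
  L^(2q) into a coupling bound in L^q. The three regimes come from one trade-off, how to divide a
  deviation among the dyadic levels: level l has a polynomial tail proportional to 2^(\<kappa> l)
  with \<kappa> = q/2 - \<alpha> q - 1, and the sign of \<kappa> separates them. The constants
  precede the quantifier over the probability space in the final statement. Hence every constant is
  explicit or obtained before a space is fixed, and the entrywise bounds are proved on the canonical
  space of sequences and then transported.\<close>

lemma powr_tangent_le:
  fixes a y q :: real
  assumes "q > 1" "a \<ge> 0" "y \<ge> 0"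
  shows "a powr q + q * a powr (q - 1) * (y - a) \<le> y powr q"
proof -
  have q': "1/q + 1/(q/(q-1)) = 1" "q/(q-1) > 1"
    using assms by (auto simp: field_simps)
  have "y * a powr (q-1) \<le> y powr q / q + (a powr (q-1)) powr (q/(q-1)) / (q/(q-1))"
    by (rule Youngs_inequality) (use assms q' in auto)
  also have "(a powr (q-1)) powr (q/(q-1)) = a powr q"
    using assms by (simp add: powr_powr)
  finally have "q * (y * a powr (q-1)) \<le> q * (y powr q / q + a powr q / (q/(q-1)))"
    using assms by (intro mult_left_mono) auto
  also have "\<dots> = y powr q + (q-1) * a powr q"
    using assms by (simp add: field_simps)
  finally have "q * (y * a powr (q-1)) \<le> y powr q + (q-1) * a powr q" .
  moreover have "a powr (q-1) * a = a powr q"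
    using assms by (cases "a = 0") (auto simp: powr_diff)
  then have "q * a powr (q - 1) * (y - a) = q * (y * a powr (q-1)) - q * a powr q"
    by (metis (no_types, opaque_lifting) mult.assoc mult.commute right_diff_distrib)
  moreover have "(q-1) * a powr q = q * a powr q - a powr q" by (simp add: left_diff_distrib)
  ultimately show ?thesis
    by linarith
qed

text \<open>Jensen for finite weights: in the weighted sum of the tangent lines at the mean the
  linear terms cancel, because the weights add up to one.\<close>

lemma sum_powr_convex:
  fixes w y :: "'i \<Rightarrow> real"
  assumes "q > 1" "finite I" "\<And>i. i \<in> I \<Longrightarrow> w i \<ge> 0" "\<And>i. i \<in> I \<Longrightarrow> y i \<ge> 0" "sum w I = 1"
  shows "(\<Sum>i\<in>I. w i * y i) powr q \<le> (\<Sum>i\<in>I. w i * y i powr q)"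
proof -
  define a where "a = (\<Sum>i\<in>I. w i * y i)"
  have "a \<ge> 0" unfolding a_def using assms by (intro sum_nonneg) auto
  have "a powr q = (\<Sum>i\<in>I. w i) * a powr q + q * a powr (q-1) * ((\<Sum>i\<in>I. w i * y i) - (\<Sum>i\<in>I. w i) * a)"
    using assms by (simp add: a_def)
  also have "\<dots> = (\<Sum>i\<in>I. w i * (a powr q + q * a powr (q - 1) * (y i - a)))"
    by (simp add: algebra_simps sum.distrib sum_subtractf sum_distrib_left sum_distrib_right)
  also have "\<dots> \<le> (\<Sum>i\<in>I. w i * y i powr q)"
    using assms \<open>a \<ge> 0\<close> by (intro sum_mono mult_left_mono powr_tangent_le) auto
  finally show ?thesis by (simp add: a_def)
qed

lemma one_plus_powr_le:
  fixes t q :: real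
  assumes "q > 2" "\<bar>t\<bar> \<le> 1/2"
  shows "(1 + t) powr q \<le> 1 + q * t + q * (q - 1) * 2 powr q * t\<^sup>2"
proof (cases "t = 0")
  case False
  define df where "df = (\<lambda>m::nat. if m = 0 then (\<lambda>x::real. (1 + x) powr q)
     else if m = 1 then (\<lambda>x. q * (1 + x) powr (q - 1)) else (\<lambda>x. q * (q - 1) * (1 + x) powr (q - 2)))"
  have "\<exists>s. (if t < 0 then t < s \<and> s < 0 else 0 < s \<and> s < t) \<and>
        df 0 t = (\<Sum>m<2. (df m 0 / fact m) * (t - 0)^m) + (df 2 s / fact 2) * (t - 0)^2"
  proof (rule Taylor[where a = "-1/2" and b = "1/2"])
    show "\<forall>m s. m < 2 \<and> -1/2 \<le> s \<and> s \<le> 1/2 \<longrightarrow> DERIV (df m) s :> df (Suc m) s"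
    proof (intro allI impI)
      fix m :: nat and s :: real assume "m < 2 \<and> -1/2 \<le> s \<and> s \<le> 1/2"
      then consider "m = 0" "s \<ge> -1/2" | "m = 1" "s \<ge> -1/2" by linarith
      then show "DERIV (df m) s :> df (Suc m) s"
        by cases (auto simp: df_def intro!: derivative_eq_intros)
    qed
  qed (use assms False in auto)
  then obtain s where s: "if t < 0 then t < s \<and> s < 0 else 0 < s \<and> s < t"
    and eq: "(1 + t) powr q = 1 + q * t + q * (q-1) * (1 + s) powr (q-2) / 2 * t\<^sup>2"
    by (auto simp: df_def numeral_2_eq_2)
  have s': "0 \<le> 1 + s" "1 + s \<le> 2" using s assms by (auto split: if_splits)
  have "(1+s) powr (q-2) \<le> 2 powr (q-2)" using s' assms by (intro powr_mono2) auto
  also have "\<dots> \<le> 2 powr q" by (intro powr_mono) auto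
  finally have "q * (q-1) * ((1 + s) powr (q-2)) \<le> q * (q-1) * 2 powr q"
    using assms by (intro mult_left_mono) auto
  moreover have "0 \<le> q * (q-1) * ((1 + s) powr (q-2))" using assms by auto
  ultimately have "q * (q-1) * (1 + s) powr (q-2) / 2 * t\<^sup>2 \<le> q * (q-1) * 2 powr q * t\<^sup>2"
    by (intro mult_right_mono) auto
  then show ?thesis using eq by simp
qed auto

text \<open>One summand for each estimate in \<open>abs_add_powr_le\<close>: 3^q for |x + y| \<le> 3
  |y| when y is large, q 2^(q-1) for absorbing a negative linear term in that case, and the Taylor
  remainder for small y.\<close>

definition taylor_const :: "real \<Rightarrow> real" where
  "taylor_const q = 3 powr q + q * 2 powr (q - 1) + q * (q - 1) * 2 powr q"

lemma taylor_const_ge_1: "q > 2 \<Longrightarrow> taylor_const q \<ge> 1"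
  unfolding taylor_const_def using ge_one_powr_ge_zero[of 3 q] by (auto intro!: add_increasing2)

text \<open>The analogue of expanding a square when q > 2. The linear term is kept exactly, without
  absolute values, so that it integrates to zero for martingale differences. For |y| \<le> |x|/2
  scale by x and use Taylor; otherwise y dominates and everything is absorbed into |y|^q.\<close>

lemma abs_add_powr_le:
  fixes q x y :: real
  assumes q: "q > 2"
  shows "\<bar>x + y\<bar> powr q \<le> \<bar>x\<bar> powr q + q * (sgn x * \<bar>x\<bar> powr (q - 1)) * y
           + taylor_const q * (\<bar>x\<bar> powr (q - 2) * y\<^sup>2 + \<bar>y\<bar> powr q)"
proof -
  define C where "C = taylor_const q"
  note C_def = C_def[unfolded taylor_const_def]
  have C1: "C \<ge> 1"
    using taylor_const_ge_1[OF q] by (simp add: C_def taylor_const_def)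
  have pos: "\<bar>x + y\<bar> powr q \<le> \<bar>x\<bar> powr q + q * (\<bar>x\<bar> powr (q - 1)) * y
           + C * (\<bar>x\<bar> powr (q - 2) * y\<^sup>2 + \<bar>y\<bar> powr q)" if x: "x > 0" for x y
  proof (cases "\<bar>y\<bar> \<le> x/2")
    case True
    define t where "t = y / x"
    have y: "y = x * t" using x by (simp add: t_def)
    have t: "\<bar>t\<bar> \<le> 1/2" using True x by (simp add: t_def divide_simps)
    have "\<bar>x+y\<bar> = x * (1 + t)"
      using x t by (simp add: y distrib_left[symmetric, of x 1 t, simplified] abs_mult)
    then have "\<bar>x+y\<bar> powr q = x powr q * (1+t) powr q"
      using x t by (simp add: powr_mult)
    also have "\<dots> \<le> x powr q * (1 + q * t + q * (q - 1) * 2 powr q * t\<^sup>2)"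
      by (intro mult_left_mono one_plus_powr_le q t) auto
    also have "\<dots> = x powr q + q * x powr (q-1) * y + (q * (q - 1) * 2 powr q) * (x powr (q-2) * y\<^sup>2)"
      using x by (simp add: y algebra_simps powr_diff power2_eq_square)
    also have "(q * (q - 1) * 2 powr q) * (x powr (q-2) * y\<^sup>2) \<le> C * (x powr (q-2) * y\<^sup>2)"
      unfolding C_def using q by (intro mult_right_mono) auto
    also have "\<dots> \<le> C * (\<bar>x\<bar> powr (q-2) * y\<^sup>2 + \<bar>y\<bar> powr q)"
      using C1 x by (intro mult_left_mono) auto
    finally show ?thesis using x by simp
  next
    case False
    then have y: "\<bar>y\<bar> > x/2" by simp
    have "\<bar>x+y\<bar> powr q \<le> (3 * \<bar>y\<bar>) powr q"
      using y x q by (intro powr_mono2) auto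
    also have "\<dots> = 3 powr q * \<bar>y\<bar> powr q" by (simp add: powr_mult)
    finally have 1: "\<bar>x+y\<bar> powr q \<le> 3 powr q * \<bar>y\<bar> powr q" .
    have "q * x powr (q-1) * (-y) \<le> q * x powr (q-1) * \<bar>y\<bar>"
      using q by (intro mult_left_mono) auto
    also have "\<dots> \<le> q * (2 * \<bar>y\<bar>) powr (q-1) * \<bar>y\<bar>"
      using q y x by (intro mult_right_mono mult_left_mono powr_mono2) auto
    also have "\<dots> = q * 2 powr (q-1) * (\<bar>y\<bar> powr (q-1) * \<bar>y\<bar>)" by (simp add: powr_mult)
    also have "\<bar>y\<bar> powr (q-1) * \<bar>y\<bar> = \<bar>y\<bar> powr q"
      using y x by (simp add: powr_diff)
    finally have 2: "q * x powr (q-1) * (-y) \<le> q * 2 powr (q-1) * \<bar>y\<bar> powr q" .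
    have "(3 powr q + q * 2 powr (q-1)) * \<bar>y\<bar> powr q \<le> C * \<bar>y\<bar> powr q"
      unfolding C_def using q by (intro mult_right_mono) auto
    also have "\<dots> \<le> C * (\<bar>x\<bar> powr (q-2) * y\<^sup>2 + \<bar>y\<bar> powr q)"
      using C1 x by (intro mult_left_mono) auto
    finally have 3: "(3 powr q + q * 2 powr (q-1)) * \<bar>y\<bar> powr q \<le> C * (\<bar>x\<bar> powr (q-2) * y\<^sup>2 + \<bar>y\<bar> powr q)" .
    have "0 \<le> x powr q" "\<bar>x\<bar> = x" using x by simp_all
    with 1 2 3 show ?thesis by (simp only: mult_minus_right distrib_right)
  qed
  have "\<bar>x + y\<bar> powr q \<le> \<bar>x\<bar> powr q + q * (sgn x * \<bar>x\<bar> powr (q - 1)) * y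
           + C * (\<bar>x\<bar> powr (q - 2) * y\<^sup>2 + \<bar>y\<bar> powr q)"
  proof -
    consider "x > 0" | "x = 0" | "x < 0" by linarith
    then show ?thesis
    proof cases
      case 1 then show ?thesis using pos[of x y] by simp
    next
      case 2 then show ?thesis using C1 q mult_right_mono[of 1 C "\<bar>y\<bar> powr q"] by simp
    next
      case 3 then show ?thesis using pos[of "-x" "-y"] by (simp add: abs_minus_commute add.commute[of x y])
    qed
  qed
  then show ?thesis by (simp add: C_def taylor_const_def)
qed

text \<open>Lets N^r grow by enough in one step to absorb N^(r-1). With r = q/2 this closes the
  induction on the number of martingale increments.\<close>

lemma Suc_powr_ge:
  fixes N r :: real
  assumes "r \<ge> 1" "N > 0"
  shows "N powr r + N powr (r - 1) \<le> (N + 1) powr r"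
proof -
  have "N powr r + N powr (r-1) = N powr (r-1) * (N + 1)"
    using assms by (simp add: distrib_left powr_diff)
  also have "\<dots> \<le> (N+1) powr (r-1) * (N+1)"
    using assms by (intro mult_right_mono powr_mono2) auto
  also have "\<dots> = (N+1) powr r" using assms by (simp add: powr_diff)
  finally show ?thesis .
qed

text \<open>Input for the generating function of a variable truncated from above. Up to q the
  exponential is quadratically controlled; beyond q the function exp(t) / t^q increases, so its
  value at t is compared with the one at T.\<close>

lemma exp_le_truncated:
  fixes t T q :: real
  assumes "q > 2" "T > 0" "t \<le> T"
  shows "exp t \<le> 1 + t + exp q * t\<^sup>2 + exp T * (\<bar>t\<bar> powr q / T powr q)"
proof (cases "t \<le> q")
  case True
  have "exp t \<le> 1 + t + exp q * t\<^sup>2"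
  proof (cases "t = 0")
    case False
    obtain s where s: "\<bar>s\<bar> \<le> \<bar>t\<bar>" "exp t = (\<Sum>m<2. t ^ m / fact m) + exp s / fact 2 * t ^ 2"
      using Maclaurin_exp_le[of t 2] by auto
    show ?thesis
    proof (cases "t > 0")
      case True
      then have "exp s \<le> exp q" using s \<open>t \<le> q\<close> by auto
      then have "exp s / 2 * t\<^sup>2 \<le> exp q * t\<^sup>2" by (intro mult_right_mono) (auto intro: order_trans[of "exp s" "exp q"])
      then show ?thesis using s by (simp add: numeral_2_eq_2)
    next
      case False
      define f where "f = (\<lambda>x::real. 1 + x + x\<^sup>2 - exp x)"
      have "f 0 \<le> f t"
      proof (rule DERIV_nonpos_imp_nonincreasing[of t 0 f])
        fix x assume x: "t \<le> x" "x \<le> 0"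
        show "\<exists>y. DERIV f x :> y \<and> y \<le> 0"
          unfolding f_def
          by (rule exI[of _ "1 + 2 * x - exp x"], rule conjI, (auto intro!: derivative_eq_intros)[1])
             (use exp_ge_add_one_self[of x] x in linarith)
      qed (use False in auto)
      then have "exp t \<le> 1 + t + t\<^sup>2" by (simp add: f_def)
      also have "t\<^sup>2 \<le> exp q * t\<^sup>2" using assms mult_right_mono[of 1 "exp q" "t\<^sup>2"] by simp
      finally show ?thesis by simp
    qed
  qed simp
  moreover have "0 \<le> exp T * (\<bar>t\<bar> powr q / T powr q)" by simp
  ultimately show ?thesis by linarith
next
  case False
  then have t: "t > q" "t > 0" using assms by auto
  define f where "f = (\<lambda>x::real. x - q * ln x)"
  have "f t \<le> f T"
  proof (rule DERIV_nonneg_imp_nondecreasing[of t T f])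
    fix x assume x: "t \<le> x" "x \<le> T"
    show "\<exists>y. DERIV f x :> y \<and> y \<ge> 0"
      unfolding f_def
      by (rule exI[of _ "1 - q * (1/x)"], rule conjI)
         (use x t in \<open>auto intro!: derivative_eq_intros simp: divide_simps\<close>)
  qed (use assms in auto)
  then have "t \<le> T + q * ln t - q * ln T" by (simp add: f_def)
  then have "exp t \<le> exp (T + q * ln t - q * ln T)" by simp
  also have "\<dots> = exp T * (\<bar>t\<bar> powr q / T powr q)"
    using t assms by (simp add: exp_add exp_diff powr_def)
  finally have "exp t \<le> exp T * (\<bar>t\<bar> powr q / T powr q)" .
  moreover have "0 \<le> 1 + t + exp q * t\<^sup>2" using t assms by auto
  ultimately show ?thesis by linarith
qed

section \<open>Moments of bounded random variables\<close>

text \<open>The bound is required on the whole type, so that sections at points outside the space need no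
  side condition.\<close>

definition bmeas :: "'a measure \<Rightarrow> ('a \<Rightarrow> real) \<Rightarrow> bool" where
  "bmeas M f \<longleftrightarrow> f \<in> borel_measurable M \<and> (\<exists>B. \<forall>x. \<bar>f x\<bar> \<le> B)"

named_theorems bmeas_intros

lemma bmeasI: "f \<in> borel_measurable M \<Longrightarrow> (\<And>x. \<bar>f x\<bar> \<le> B) \<Longrightarrow> bmeas M f"
  by (auto simp: bmeas_def)

lemma bmeasE:
  assumes "bmeas M f" obtains B where "B > 0" "\<And>x. \<bar>f x\<bar> \<le> B"
proof -
  obtain B where "\<forall>x. \<bar>f x\<bar> \<le> B" using assms by (auto simp: bmeas_def)
  then have "\<bar>f x\<bar> \<le> max B 1" for x by (meson max.coboundedI1)
  then show thesis using that[of "max B 1"] by auto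
qed

lemma bmeas_measurable [measurable_dest]: "bmeas M f \<Longrightarrow> f \<in> borel_measurable M"
  by (simp add: bmeas_def)

lemma bmeas_comp:
  assumes f: "bmeas M f" and \<phi>: "\<phi> \<in> borel_measurable borel" and b: "\<And>B. \<exists>B'. \<forall>x. \<bar>x\<bar> \<le> B \<longrightarrow> \<bar>\<phi> x\<bar> \<le> B'"
  shows "bmeas M (\<lambda>x. \<phi> (f x))"
proof -
  obtain B where B: "\<And>x. \<bar>f x\<bar> \<le> B" using f by (auto simp: bmeas_def)
  obtain B' where "\<forall>x. \<bar>x\<bar> \<le> B \<longrightarrow> \<bar>\<phi> x\<bar> \<le> B'" using b by blast
  with B have "\<bar>\<phi> (f x)\<bar> \<le> B'" for x by blast
  moreover have "(\<lambda>x. \<phi> (f x)) \<in> borel_measurable M"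
    using f \<phi> by (auto simp: bmeas_def intro: measurable_compose)
  ultimately show ?thesis by (intro bmeasI)
qed

lemma bmeas_const [bmeas_intros]: "bmeas M (\<lambda>_. c)"
  by (auto simp: bmeas_def)

lemma bmeas_add [bmeas_intros]:
  assumes "bmeas M f" "bmeas M g" shows "bmeas M (\<lambda>x. f x + g x)"
proof -
  obtain B where B: "\<And>x. \<bar>f x\<bar> \<le> B" using assms by (auto simp: bmeas_def)
  obtain B' where B': "\<And>x. \<bar>g x\<bar> \<le> B'" using assms by (auto simp: bmeas_def)
  have "\<bar>f x + g x\<bar> \<le> B + B'" for x using B[of x] B'[of x] by linarith
  with assms show ?thesis by (intro bmeasI[of _ _ "B + B'"]) (auto dest: bmeas_measurable)
qed

lemma bmeas_mult [bmeas_intros]: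
  assumes "bmeas M f" "bmeas M g" shows "bmeas M (\<lambda>x. f x * g x)"
proof -
  obtain B where B: "\<And>x. \<bar>f x\<bar> \<le> B" using assms by (auto simp: bmeas_def)
  obtain B' where B': "\<And>x. \<bar>g x\<bar> \<le> B'" using assms by (auto simp: bmeas_def)
  have "\<bar>f x * g x\<bar> \<le> B * B'" for x
    unfolding abs_mult using B B' by (intro mult_mono) (auto intro: order_trans[OF abs_ge_zero])
  with assms show ?thesis by (intro bmeasI[of _ _ "B * B'"]) (auto dest: bmeas_measurable)
qed

lemma bmeas_uminus [bmeas_intros]: "bmeas M f \<Longrightarrow> bmeas M (\<lambda>x. - f x)"
  using bmeas_mult[OF bmeas_const[of M "-1"]] by simp

lemma bmeas_diff [bmeas_intros]: "bmeas M f \<Longrightarrow> bmeas M g \<Longrightarrow> bmeas M (\<lambda>x. f x - g x)"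
  using bmeas_add[OF _ bmeas_uminus] by fastforce

lemma bmeas_divide [bmeas_intros]: "bmeas M f \<Longrightarrow> bmeas M (\<lambda>x. f x / c)"
  using bmeas_mult[OF _ bmeas_const[of M "inverse c"]] by (simp add: divide_inverse)

lemma bmeas_sum [bmeas_intros]:
  "(\<And>i. i \<in> I \<Longrightarrow> bmeas M (f i)) \<Longrightarrow> bmeas M (\<lambda>x. \<Sum>i\<in>I. f i x)"
  by (induction I rule: infinite_finite_induct) (auto intro!: bmeas_intros)

lemma bmeas_power [bmeas_intros]: "bmeas M f \<Longrightarrow> bmeas M (\<lambda>x. f x ^ n)"
  by (induction n) (auto intro!: bmeas_intros)

lemma bmeas_abs [bmeas_intros]: "bmeas M f \<Longrightarrow> bmeas M (\<lambda>x. \<bar>f x\<bar>)"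
  by (rule bmeas_comp) auto

lemma bmeas_abs_powr [bmeas_intros]:
  assumes "bmeas M f" "r \<ge> 0" shows "bmeas M (\<lambda>x. \<bar>f x\<bar> powr r)"
proof (rule bmeas_comp[OF assms(1), of "\<lambda>x. \<bar>x\<bar> powr r"])
  show "\<exists>B'. \<forall>x. \<bar>x\<bar> \<le> B \<longrightarrow> \<bar>\<bar>x\<bar> powr r\<bar> \<le> B'" for B
    using assms by (intro exI[of _ "B powr r"]) (auto intro!: powr_mono2)
qed auto

lemma bmeas_sgn [bmeas_intros]: "bmeas M f \<Longrightarrow> bmeas M (\<lambda>x. sgn (f x))"
  by (rule bmeas_comp[where \<phi> = sgn]) (auto simp: sgn_if intro!: exI[of _ 1])

lemma bmeas_exp [bmeas_intros]:
  assumes "bmeas M f" shows "bmeas M (\<lambda>x. exp (f x))"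
proof (rule bmeas_comp[OF assms, of exp])
  show "\<exists>B'. \<forall>x. \<bar>x\<bar> \<le> B \<longrightarrow> \<bar>exp x\<bar> \<le> B'" for B :: real
    by (intro exI[of _ "exp B"]) auto
qed auto

lemma bmeas_if [bmeas_intros]:
  assumes f: "bmeas M f" and P: "Measurable.pred borel P"
  shows "bmeas M (\<lambda>x. if P (f x) then f x else 0)"
  by (rule bmeas_comp[OF f, where \<phi> = "\<lambda>x. if P x then x else 0"]) (use P in \<open>auto intro!: exI\<close>)

lemma (in finite_measure) bmeas_integrable:
  assumes "bmeas M f" shows "integrable M f"
proof -
  obtain B where "\<And>x. \<bar>f x\<bar> \<le> B" using assms bmeasE by blast
  then show ?thesis using assms
    by (intro integrable_const_bound[of _ B]) (auto intro: bmeas_measurable)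
qed

context prob_space
begin

lemma bmeas_jensen:
  assumes X: "bmeas M X" and q: "q > 1"
  shows "\<bar>expectation X\<bar> powr q \<le> expectation (\<lambda>x. \<bar>X x\<bar> powr q)"
proof -
  define a where "a = expectation (\<lambda>x. \<bar>X x\<bar>)"
  have a: "0 \<le> a" "\<bar>expectation X\<bar> \<le> a" by (auto simp: a_def)
  have i: "integrable M (\<lambda>x. \<bar>X x\<bar>)" "integrable M (\<lambda>x. \<bar>X x\<bar> powr q)"
    using X q by (auto intro!: bmeas_integrable bmeas_intros)
  have "\<bar>expectation X\<bar> powr q \<le> a powr q" using a q by (intro powr_mono2) auto
  also have "\<dots> = expectation (\<lambda>x. a powr q + q * a powr (q - 1) * (\<bar>X x\<bar> - a))"
    using i by (simp add: a_def prob_space)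
  also have "\<dots> \<le> expectation (\<lambda>x. \<bar>X x\<bar> powr q)"
    using i q a by (intro integral_mono powr_tangent_le) auto
  finally show ?thesis .
qed

text \<open>Convexity with weights proportional to the individual bounds. These may vanish, so they
  are first replaced by strictly larger ones and the excess then tends to 0.\<close>

lemma bmeas_minkowski:
  assumes q: "q > 1" and I: "finite I" and X: "\<And>i. i \<in> I \<Longrightarrow> bmeas M (X i)"
    and a: "\<And>i. i \<in> I \<Longrightarrow> a i \<ge> 0"
    and le: "\<And>i. i \<in> I \<Longrightarrow> expectation (\<lambda>x. \<bar>X i x\<bar> powr q) \<le> a i powr q"
  shows "expectation (\<lambda>x. \<bar>\<Sum>i\<in>I. X i x\<bar> powr q) \<le> (\<Sum>i\<in>I. a i) powr q"
proof (cases "I = {}")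
  case False
  have *: "expectation (\<lambda>x. \<bar>\<Sum>i\<in>I. X i x\<bar> powr q) \<le> (\<Sum>i\<in>I. b i) powr q"
    if b: "\<And>i. i \<in> I \<Longrightarrow> b i > 0" and ab: "\<And>i. i \<in> I \<Longrightarrow> a i \<le> b i" for b
  proof -
    define s where "s = sum b I"
    have s: "s > 0" unfolding s_def using False I b by (intro sum_pos) auto
    have pt: "\<bar>\<Sum>i\<in>I. X i x\<bar> powr q \<le> s powr q * (\<Sum>i\<in>I. b i / s * (\<bar>X i x\<bar> powr q / b i powr q))" for x
    proof -
      have "\<bar>\<Sum>i\<in>I. X i x\<bar> \<le> s * (\<Sum>i\<in>I. b i / s * (\<bar>X i x\<bar> / b i))"
        using s less_imp_neq[OF b] by (auto simp: sum_distrib_left intro!: order_trans[OF sum_abs] sum_mono)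
      then have "\<bar>\<Sum>i\<in>I. X i x\<bar> powr q \<le> (s * (\<Sum>i\<in>I. b i / s * (\<bar>X i x\<bar> / b i))) powr q"
        using q by (intro powr_mono2) auto
      also have "\<dots> = s powr q * (\<Sum>i\<in>I. b i / s * (\<bar>X i x\<bar> / b i)) powr q"
        by (rule powr_mult)
      also have "\<dots> \<le> s powr q * (\<Sum>i\<in>I. b i / s * (\<bar>X i x\<bar> / b i) powr q)"
        using q I b s by (intro mult_left_mono sum_powr_convex)
          (auto simp: s_def sum_divide_distrib[symmetric] less_imp_le)
      also have "(\<Sum>i\<in>I. b i / s * (\<bar>X i x\<bar> / b i) powr q) = (\<Sum>i\<in>I. b i / s * (\<bar>X i x\<bar> powr q / b i powr q))"
        using b by (intro sum.cong) (auto simp: powr_divide less_imp_le)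
      finally show ?thesis .
    qed
    have i: "integrable M (\<lambda>x. \<bar>X i x\<bar> powr q)" if "i \<in> I" for i
      using X that q by (auto intro!: bmeas_integrable bmeas_intros)
    have "expectation (\<lambda>x. \<bar>\<Sum>i\<in>I. X i x\<bar> powr q)
        \<le> expectation (\<lambda>x. s powr q * (\<Sum>i\<in>I. b i / s * (\<bar>X i x\<bar> powr q / b i powr q)))"
      using X q i by (intro integral_mono pt) (auto intro!: bmeas_integrable bmeas_intros)
    also have "\<dots> = s powr q * (\<Sum>i\<in>I. b i / s * (expectation (\<lambda>x. \<bar>X i x\<bar> powr q) / b i powr q))"
      using i by simp
    also have "\<dots> \<le> s powr q * (\<Sum>i\<in>I. b i / s * 1)"
    proof (intro mult_left_mono sum_mono)
      fix i assume i: "i \<in> I"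
      have "expectation (\<lambda>x. \<bar>X i x\<bar> powr q) \<le> b i powr q"
        using le[OF i] a[OF i] ab[OF i] q by (auto intro: order_trans intro!: powr_mono2)
      then show "expectation (\<lambda>x. \<bar>X i x\<bar> powr q) / b i powr q \<le> 1"
        using b[OF i] by simp
    qed (use b s in \<open>auto simp: less_imp_le\<close>)
    also have "(\<Sum>i\<in>I. b i / s * 1) = 1"
      using s by (simp add: sum_divide_distrib[symmetric] s_def)
    finally show ?thesis by (simp add: s_def)
  qed
  have lim: "((\<lambda>\<eta>. (\<Sum>i\<in>I. a i + \<eta>) powr q) \<longlongrightarrow> (\<Sum>i\<in>I. a i + 0) powr q) (at_right 0)"
    using q a by (intro tendsto_powr' tendsto_intros)
      (auto simp: eventually_at_right_field intro!: exI[of _ 1] sum_nonneg)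
  have "expectation (\<lambda>x. \<bar>\<Sum>i\<in>I. X i x\<bar> powr q) \<le> (\<Sum>i\<in>I. a i + 0) powr q"
    by (rule tendsto_lowerbound[OF lim])
       (auto simp: eventually_at_right_field intro!: exI[of _ 1] * add_nonneg_pos a)
  then show ?thesis by simp
qed (use q in simp)

end

text \<open>In the induction of \<open>martingale_moment\<close> the mixed term costs two copies of
  \<open>taylor_const\<close>, the new increment a third.\<close>

definition mart_const :: "real \<Rightarrow> real" where
  "mart_const q = sqrt (3 * taylor_const q)"

lemma mart_const_ge_1: "q > 2 \<Longrightarrow> mart_const q \<ge> 1"
  using taylor_const_ge_1[of q] by (simp add: mart_const_def)

text \<open>The martingale property is stated in the only form in which it acts: each increment is
  orthogonal to the factor sgn(S) |S|^(q-1) of the linear term in \<open>abs_add_powr_le\<close>.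
  What remains is a mixed term, handled by Young's inequality, and |D|^q; together they let the q-th
  moment grow like N^(q/2).\<close>

lemma (in prob_space) martingale_moment:
  fixes q :: real and D :: "nat \<Rightarrow> 'a \<Rightarrow> real"
  assumes q: "q > 2" and \<delta>: "\<delta> \<ge> 0" and D: "\<And>j. j < N \<Longrightarrow> bmeas M (D j)"
    and le: "\<And>j. j < N \<Longrightarrow> (\<integral>x. \<bar>D j x\<bar> powr q \<partial>M) \<le> \<delta> powr q"
    and orth: "\<And>j. j < N \<Longrightarrow> (\<integral>x. sgn (\<Sum>i<j. D i x) * \<bar>\<Sum>i<j. D i x\<bar> powr (q - 1) * D j x \<partial>M) = 0"
  shows "(\<integral>x. \<bar>\<Sum>i<N. D i x\<bar> powr q \<partial>M) \<le> (mart_const q * sqrt (real N) * \<delta>) powr q"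
proof -
  define C where "C = taylor_const q"
  have C: "C \<ge> 1" unfolding C_def by (rule taylor_const_ge_1[OF q])
  note ineq = abs_add_powr_le[OF q, folded C_def]
  define L where "L = 3 * C"
  have L: "L \<ge> 1" using C by (simp add: L_def)
  \<comment> \<open>Strictly positive \<delta> first, because the argument divides by it; \<delta> =
    0 is reached by a limit.\<close>
  have main: "(\<integral>x. \<bar>\<Sum>i<N. D i x\<bar> powr q \<partial>M) \<le> (sqrt (L * real N) * \<delta>) powr q"
    if \<delta>: "\<delta> > 0" and le: "\<And>j. j < N \<Longrightarrow> (\<integral>x. \<bar>D j x\<bar> powr q \<partial>M) \<le> \<delta> powr q" for \<delta>
  proof -
    define S where "S = (\<lambda>n x. \<Sum>i<n. D i x)"
    have bS: "bmeas M (S n)" if "n \<le> N" for n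
      unfolding S_def using D that by (auto intro!: bmeas_intros)
    have "n \<le> N \<Longrightarrow> expectation (\<lambda>x. \<bar>S n x\<bar> powr q) \<le> (sqrt (L * real n) * \<delta>) powr q" for n
    proof (induction n)
      case 0
      then show ?case using q by (simp add: S_def)
    next
      case (Suc n)
      have n: "n < N" using Suc by simp
      have b: "bmeas M (S n)" "bmeas M (D n)" using bS[of n] D n by auto
      note bi = bmeas_integrable
      have iS: "integrable M (\<lambda>x. \<bar>S n x\<bar> powr q)" and iD: "integrable M (\<lambda>x. \<bar>D n x\<bar> powr q)"
        and io: "integrable M (\<lambda>x. sgn (S n x) * \<bar>S n x\<bar> powr (q - 1) * D n x)"
        and im: "integrable M (\<lambda>x. \<bar>S n x\<bar> powr (q - 2) * (D n x)\<^sup>2)"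
        and iSS: "integrable M (\<lambda>x. \<bar>S n x + D n x\<bar> powr q)"
        using b q by (auto intro!: bi bmeas_intros)
      have "expectation (\<lambda>x. \<bar>S (Suc n) x\<bar> powr q) = expectation (\<lambda>x. \<bar>S n x + D n x\<bar> powr q)"
        by (simp add: S_def)
      also have "\<dots> \<le> expectation (\<lambda>x. \<bar>S n x\<bar> powr q + q * (sgn (S n x) * \<bar>S n x\<bar> powr (q - 1) * D n x)
           + C * (\<bar>S n x\<bar> powr (q - 2) * (D n x)\<^sup>2 + \<bar>D n x\<bar> powr q))"
        using iS iD io im iSS ineq by (intro integral_mono) (auto simp: mult.assoc)
      also have "\<dots> = expectation (\<lambda>x. \<bar>S n x\<bar> powr q)
           + C * (expectation (\<lambda>x. \<bar>S n x\<bar> powr (q - 2) * (D n x)\<^sup>2) + expectation (\<lambda>x. \<bar>D n x\<bar> powr q))"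
        using iS iD io im orth n by (simp add: S_def)
      finally have step: "expectation (\<lambda>x. \<bar>S (Suc n) x\<bar> powr q) \<le> expectation (\<lambda>x. \<bar>S n x\<bar> powr q)
           + C * (expectation (\<lambda>x. \<bar>S n x\<bar> powr (q - 2) * (D n x)\<^sup>2) + expectation (\<lambda>x. \<bar>D n x\<bar> powr q))" .
      show ?case
      proof (cases "n = 0")
        case True
        have "expectation (\<lambda>x. \<bar>S (Suc n) x\<bar> powr q) \<le> \<delta> powr q"
          using le n True by (simp add: S_def)
        also have "\<dots> \<le> (sqrt (L * real (Suc n)) * \<delta>) powr q"
          using True L \<delta> q by (intro powr_mono2) (auto simp: mult_le_cancel_right1)
        finally show ?thesis .
      next
        case False
        define m where "m = real n"
        have m: "m \<ge> 1" using False by (simp add: m_def)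
        define a where "a = sqrt (L * m) * \<delta>"
        have a: "a > 0" using L m \<delta> by (simp add: a_def)
        have IH: "expectation (\<lambda>x. \<bar>S n x\<bar> powr q) \<le> a powr q"
          using Suc n by (simp add: a_def m_def)
        \<comment> \<open>Both factors are measured in units of their own bounds, \<open>a\<close>
          for the partial sum and \<delta> for the increment, so that each normalised q-th moment is
          at most 1.\<close>
        have young: "\<bar>s\<bar> powr (q-2) * d\<^sup>2 \<le> a powr (q-2) * \<delta>\<^sup>2 * (\<bar>s\<bar> powr q / a powr q + \<bar>d\<bar> powr q / \<delta> powr q)" for s d
        proof -
          define u v where "u = \<bar>s\<bar> / a" and "v = \<bar>d\<bar> / \<delta>"
          have uv: "u \<ge> 0" "v \<ge> 0" using a \<delta> by (auto simp: u_def v_def)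
          define w where "w = max u v"
          have "u powr (q-2) * v\<^sup>2 \<le> w powr (q-2) * w\<^sup>2"
            using uv q by (intro mult_mono powr_mono2 power_mono) (auto simp: w_def)
          also have "\<dots> = w powr q" using uv q by (cases "w = 0") (auto simp: w_def powr_diff)
          also have "\<dots> \<le> u powr q + v powr q" by (simp add: w_def max_def)
          finally have 1: "u powr (q-2) * v\<^sup>2 \<le> u powr q + v powr q" .
          have "\<bar>s\<bar> powr (q-2) * d\<^sup>2 = a powr (q-2) * \<delta>\<^sup>2 * (u powr (q-2) * v\<^sup>2)"
            using a \<delta> by (simp add: u_def v_def powr_divide power_divide)
          also have "\<dots> \<le> a powr (q-2) * \<delta>\<^sup>2 * (u powr q + v powr q)"
            using 1 by (intro mult_left_mono) auto
          finally show ?thesis using a \<delta> by (simp add: u_def v_def powr_divide)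
        qed
        have "expectation (\<lambda>x. \<bar>S n x\<bar> powr (q - 2) * (D n x)\<^sup>2)
          \<le> expectation (\<lambda>x. a powr (q-2) * \<delta>\<^sup>2 * (\<bar>S n x\<bar> powr q / a powr q + \<bar>D n x\<bar> powr q / \<delta> powr q))"
          using im iS iD by (intro integral_mono young) auto
        also have "\<dots> = a powr (q-2) * \<delta>\<^sup>2 * (expectation (\<lambda>x. \<bar>S n x\<bar> powr q) / a powr q + expectation (\<lambda>x. \<bar>D n x\<bar> powr q) / \<delta> powr q)"
          using iS iD by simp
        also have "\<dots> \<le> a powr (q-2) * \<delta>\<^sup>2 * (1 + 1)"
          using IH le n a \<delta> by (intro mult_left_mono add_mono) (auto simp: divide_le_eq_1)
        finally have mid: "expectation (\<lambda>x. \<bar>S n x\<bar> powr (q - 2) * (D n x)\<^sup>2) \<le> 2 * (a powr (q-2) * \<delta>\<^sup>2)" by simp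
        define r where "r = q / 2"
        have r: "r > 1" using q by (simp add: r_def)
        have apow: "a powr q = L powr r * m powr r * \<delta> powr q"
          using L m \<delta> by (simp add: a_def r_def powr_mult sqrt_def root_powr_inverse powr_powr)
        have apow2: "a powr (q-2) = L powr (r-1) * m powr (r-1) * \<delta> powr (q-2)"
          using L m \<delta> by (simp add: a_def r_def powr_mult sqrt_def root_powr_inverse powr_powr diff_divide_distrib)
        have d2: "\<delta> powr (q-2) * \<delta>\<^sup>2 = \<delta> powr q" using \<delta> by (simp add: powr_diff)
        have Lr: "L powr r = L * L powr (r-1)" using L by (simp add: powr_diff)
        have Lm: "1 \<le> L powr (r-1) * m powr (r-1)"
          using L m r mult_mono[of 1 "L powr (r-1)" 1 "m powr (r-1)"] by (simp add: ge_one_powr_ge_zero)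
        have "expectation (\<lambda>x. \<bar>S (Suc n) x\<bar> powr q) \<le> a powr q + C * (2 * (a powr (q-2) * \<delta>\<^sup>2) + \<delta> powr q)"
          using step IH mult_left_mono[OF add_mono[OF mid le[OF n]], of C] C by linarith
        also have "\<dots> = \<delta> powr q * (L powr r * m powr r + 2 * C * (L powr (r-1) * m powr (r-1)) + C)"
          unfolding apow apow2 d2[symmetric] by (simp add: algebra_simps)
        also have "\<dots> \<le> \<delta> powr q * (L powr r * m powr r + L * (L powr (r-1) * m powr (r-1)))"
          using C mult_left_mono[OF Lm, of C] by (intro mult_left_mono) (simp_all add: L_def algebra_simps)
        also have "\<dots> = \<delta> powr q * (L powr r * (m powr r + m powr (r-1)))"
          by (simp add: Lr algebra_simps)
        also have "\<dots> \<le> \<delta> powr q * (L powr r * (m + 1) powr r)"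
          using Suc_powr_ge[of r m] m r by (intro mult_left_mono) auto
        also have "\<dots> = (sqrt (L * real (Suc n)) * \<delta>) powr q"
          using L m \<delta> by (simp add: m_def r_def powr_mult sqrt_def root_powr_inverse powr_powr add.commute)
        finally show ?thesis .
      qed
    qed
    from this[of N] show ?thesis by (simp add: S_def)
  qed
    have lim: "((\<lambda>\<eta>. (sqrt (L * real N) * (\<delta> + \<eta>)) powr q) \<longlongrightarrow> (sqrt (L * real N) * (\<delta> + 0)) powr q) (at_right 0)"
      using q \<delta> L by (intro tendsto_powr' tendsto_intros)
        (auto simp: eventually_at_right_field intro!: exI[of _ 1])
    have "(\<integral>x. \<bar>\<Sum>i<N. D i x\<bar> powr q \<partial>M) \<le> (sqrt (L * real N) * (\<delta> + 0)) powr q"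
    proof (rule tendsto_lowerbound[OF lim])
      have "(\<integral>x. \<bar>\<Sum>i<N. D i x\<bar> powr q \<partial>M) \<le> (sqrt (L * real N) * (\<delta> + \<eta>)) powr q" if "\<eta> > 0" for \<eta>
      proof (rule main)
        have "\<delta> powr q \<le> (\<delta> + \<eta>) powr q" using \<delta> that q by (intro powr_mono2) auto
        then show "(\<integral>x. \<bar>D j x\<bar> powr q \<partial>M) \<le> (\<delta> + \<eta>) powr q" if "j < N" for j
          using le[OF that] by simp
      qed (use \<delta> that in auto)
      then show "\<forall>\<^sub>F \<eta> in at_right 0. (\<integral>x. \<bar>\<Sum>i<N. D i x\<bar> powr q \<partial>M) \<le> (sqrt (L * real N) * (\<delta> + \<eta>)) powr q"
        by (auto simp: eventually_at_right_field intro!: exI[of _ 1])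
    qed auto
    then show ?thesis
      by (simp add: real_sqrt_mult mart_const_def L_def C_def)
qed

section \<open>Deviation inequalities and truncated second moments\<close>

lemma bmeas_indicator [bmeas_intros]: "A \<in> sets M \<Longrightarrow> bmeas M (indicator A)"
  by (rule bmeasI[of _ _ 1]) (auto simp: indicator_def)

lemma (in prob_space) bmeas_markov:
  assumes X: "bmeas M X" and r: "r > 0" and t: "t > 0"
  shows "prob {x\<in>space M. t \<le> \<bar>X x\<bar>} \<le> expectation (\<lambda>x. \<bar>X x\<bar> powr r) / t powr r"
proof -
  note [measurable] = bmeas_measurable[OF X]
  have i: "integrable M (\<lambda>x. \<bar>X x\<bar> powr r)"
    using X r by (auto intro!: bmeas_integrable bmeas_intros)
  have "prob {x\<in>space M. t \<le> \<bar>X x\<bar>} = expectation (indicator {x\<in>space M. t \<le> \<bar>X x\<bar>})" by simp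
  also have "\<dots> \<le> expectation (\<lambda>x. \<bar>X x\<bar> powr r / t powr r)"
  proof (rule integral_mono)
    fix x assume "x \<in> space M"
    show "indicator {x\<in>space M. t \<le> \<bar>X x\<bar>} x \<le> \<bar>X x\<bar> powr r / t powr r"
      using t r powr_mono2[of r t "\<bar>X x\<bar>"] by (auto simp: indicator_def)
  qed (use i in \<open>auto intro!: bmeas_integrable bmeas_intros\<close>)
  finally show ?thesis using i by simp
qed

text \<open>Two constraints on h compete. \<open>h1\<close> keeps the quadratic term below h x / 4
  and produces the Gaussian bound; \<open>h2\<close> keeps the contribution of large jumps below 1.
  If \<open>h2\<close> is the smaller one, then h x = -2 ln R and exp(-3/4 h x) = R^(3/2) \<le> R,
  the polynomial bound.\<close>

lemma chernoff_parameter: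
  fixes C q x a N :: real
  assumes "C > 0" "q > 0" "x > 0" "a > 0" "N > 0" "N * a powr q / (x/2) powr q < 1"
  shows "\<exists>h>0. - h * x + N * (2 * C * h\<^sup>2 * a\<^sup>2 + exp (h * (x/2)) * (a powr q / (x/2) powr q))
     \<le> 1 - 3/4 * (h * x) \<and>
     exp (- (3/4 * (h * x))) \<le> N * a powr q / (x/2) powr q + exp (- (3 / (32 * C) * x\<^sup>2 / (N * a\<^sup>2)))"
proof -
  define R where "R = N * a powr q / (x/2) powr q"
  have R: "0 < R" "R < 1" using assms by (auto simp: R_def)
  define h1 where "h1 = x / (8 * C * N * a\<^sup>2)"
  define h2 where "h2 = 2 / x * (- ln R)"
  define h where "h = min h1 h2"
  have h12: "h1 > 0" "h2 > 0" using assms R by (auto simp: h1_def h2_def divide_less_0_iff)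
  then have h: "h > 0" "h \<le> h1" "h \<le> h2" by (auto simp: h_def)
  have "N * (exp (h * (x/2)) * (a powr q / (x/2) powr q)) = R * exp (h * (x/2))"
    by (simp add: R_def)
  also have "\<dots> \<le> R * exp (h2 * (x/2))" using h R assms by (intro mult_left_mono) auto
  also have "\<dots> = 1" using R assms by (simp add: h2_def exp_minus)
  finally have 1: "N * (exp (h * (x/2)) * (a powr q / (x/2) powr q)) \<le> 1" .
  have "N * (2 * C * h\<^sup>2 * a\<^sup>2) = h * (h * (2 * C * N * a\<^sup>2))" by (simp add: power2_eq_square)
  also have "\<dots> \<le> h * (h1 * (2 * C * N * a\<^sup>2))"
    using h assms by (intro mult_left_mono mult_right_mono) auto
  also have "h1 * (2 * C * N * a\<^sup>2) = x / 4" using assms by (simp add: h1_def divide_simps)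
  finally have 2: "N * (2 * C * h\<^sup>2 * a\<^sup>2) \<le> h * x / 4" by simp
  have 3: "exp (- (3/4 * (h * x))) \<le> R + exp (- (3 / (32 * C) * x\<^sup>2 / (N * a\<^sup>2)))"
  proof (cases "h1 \<le> h2")
    case True
    then have eq: "3/4 * (h * x) = 3 / (32 * C) * x\<^sup>2 / (N * a\<^sup>2)"
      using assms by (simp add: h_def h1_def power2_eq_square field_simps)
    show ?thesis unfolding eq using R by simp
  next
    case False
    then have "h * x = - 2 * ln R" using assms by (simp add: h_def h2_def)
    then have "exp (- (3/4 * (h * x))) = exp (3/2 * ln R)" by simp
    also have "\<dots> \<le> exp (ln R)" using ln_less_zero[OF R] by simp
    also have "\<dots> = R" using R by simp
    finally show ?thesis by (simp add: add_increasing2)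
  qed
  show ?thesis
    using 1 2 3 h by (intro exI[of _ h]) (auto simp: R_def distrib_left)
qed

text \<open>Summands above x/2 are set to 0. Either some summand is that large, which Markov's
  inequality bounds by R, or the truncated sum is large, which is a Chernoff bound. Truncating only
  from above lowers the mean, so the linear term of the generating function stays nonpositive. For R
  \<ge> 1 the claim is trivial.\<close>

lemma (in prob_space) nagaev_one_sided:
  fixes q :: real and X :: "'i \<Rightarrow> 'a \<Rightarrow> real"
  assumes q: "q > 2" and I: "finite I" "real (card I) \<le> N" "N > 0"
    and X: "\<And>i. i \<in> I \<Longrightarrow> bmeas M (X i)" and ind: "indep_vars (\<lambda>_. borel) X I"
    and zero: "\<And>i. i \<in> I \<Longrightarrow> (\<integral>\<omega>. X i \<omega> \<partial>M) = 0"
    and le: "\<And>i. i \<in> I \<Longrightarrow> (\<integral>\<omega>. \<bar>X i \<omega>\<bar> powr q \<partial>M) \<le> a powr q"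
    and a: "a > 0" and x: "x > 0"
  shows "measure M {\<omega>\<in>space M. x \<le> (\<Sum>i\<in>I. X i \<omega>)} \<le>
    4 * (2 powr q * (N * a powr q / x powr q) + exp (- (3 / (32 * exp q) * x\<^sup>2 / (N * a\<^sup>2)))) + (2 powr q * (N * a powr q / x powr q))"
proof -
  define R where "R = N * a powr q / (x/2) powr q"
  have R_eq: "R = 2 powr q * (N * a powr q / x powr q)"
    using x by (simp add: R_def powr_divide)
  have R0: "R > 0" using I a x by (simp add: R_def)
  define E where "E = exp (- (3 / (32 * exp q) * x\<^sup>2 / (N * a\<^sup>2)))"
  have E0: "E > 0" by (simp add: E_def)
  have "measure M {\<omega>\<in>space M. x \<le> (\<Sum>i\<in>I. X i \<omega>)} \<le> 4 * (R + E) + R"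
  proof (cases "R < 1")
    case False
    have "measure M {\<omega>\<in>space M. x \<le> (\<Sum>i\<in>I. X i \<omega>)} \<le> 1" by simp
    also have "1 \<le> 4 * (R + E) + R" using False E0 by simp
    finally show ?thesis .
  next
    case True
    obtain h where h: "h > 0"
      and hb: "- h * x + N * (2 * exp q * h\<^sup>2 * a\<^sup>2 + exp (h * (x/2)) * (a powr q / (x/2) powr q)) \<le> 1 - 3/4 * (h * x)"
      and he: "exp (- (3/4 * (h * x))) \<le> R + E"
      using chernoff_parameter[of "exp q" q x a N] True q x a I unfolding R_def E_def by auto
    define y where "y = x / 2"
    have y: "y > 0" using x by (simp add: y_def)
    define X' where "X' = (\<lambda>i \<omega>. if X i \<omega> \<le> y then X i \<omega> else 0)"
    have bX': "bmeas M (X' i)" if "i \<in> I" for i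
      unfolding X'_def using X[OF that] by (intro bmeas_intros) auto
    note [measurable] = bmeas_measurable[OF X] bmeas_measurable[OF bX']
    have mgf: "expectation (\<lambda>\<omega>. exp (h * X' i \<omega>)) \<le> exp (2 * exp q * h\<^sup>2 * a\<^sup>2 + exp (h * y) * (a powr q / y powr q))"
      if i: "i \<in> I" for i
    proof -
      have int: "integrable M (X' i)" "integrable M (X i)" "integrable M (\<lambda>\<omega>. \<bar>X i \<omega>\<bar> powr q)"
         "integrable M (\<lambda>\<omega>. exp (h * X' i \<omega>))"
        using bX'[OF i] X[OF i] q by (auto intro!: bmeas_integrable bmeas_intros)
      have "expectation (\<lambda>\<omega>. exp (h * X' i \<omega>)) \<le>
        expectation (\<lambda>\<omega>. 1 + h * X i \<omega> + exp q * h\<^sup>2 * (a\<^sup>2 * (1 + \<bar>X i \<omega>\<bar> powr q / a powr q)) + exp (h * y) * (\<bar>X i \<omega>\<bar> powr q / y powr q))"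
      proof (rule integral_mono)
        fix \<omega>
        have i1: "exp (h * X' i \<omega>) \<le> 1 + h * X' i \<omega> + exp q * (h * X' i \<omega>)\<^sup>2 + exp (h * y) * (\<bar>h * X' i \<omega>\<bar> powr q / (h * y) powr q)"
          using h y q by (intro exp_le_truncated) (auto simp: X'_def)
        have i2: "h * X' i \<omega> \<le> h * X i \<omega>" using h y by (intro mult_left_mono) (auto simp: X'_def)
        \<comment> \<open>The variance is read off the q-th moment through u^2 \<le> 1 + u^q with u
          = |X_i| / a; this is the origin of the factor 2 in front of \<open>exp q\<close>.\<close>
        have i3: "exp q * (h * X' i \<omega>)\<^sup>2 \<le> exp q * (h\<^sup>2 * (a\<^sup>2 * (1 + \<bar>X i \<omega>\<bar> powr q / a powr q)))"
        proof (intro mult_left_mono)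
          define u where "u = \<bar>X i \<omega>\<bar> / a"
          have u: "u \<ge> 0" using a by (simp add: u_def)
          have "u\<^sup>2 \<le> 1 + u powr q"
          proof (cases "u \<le> 1")
            case True
            then have "u\<^sup>2 \<le> 1" using u by (simp add: power_le_one)
            then show ?thesis by (simp add: add_increasing2)
          next
            case False
            then have "u\<^sup>2 = u powr 2" using u by simp
            also have "\<dots> \<le> u powr q" using False q by (intro powr_mono) auto
            finally show ?thesis by simp
          qed
          then have "a\<^sup>2 * u\<^sup>2 \<le> a\<^sup>2 * (1 + u powr q)" by (rule mult_left_mono) simp
          moreover have "a\<^sup>2 * u\<^sup>2 = (X i \<omega>)\<^sup>2" using a by (simp add: u_def power_divide)
          moreover have "(X' i \<omega>)\<^sup>2 \<le> (X i \<omega>)\<^sup>2" by (simp add: X'_def)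
          moreover have "u powr q = \<bar>X i \<omega>\<bar> powr q / a powr q" by (simp add: u_def powr_divide)
          ultimately have "(X' i \<omega>)\<^sup>2 \<le> a\<^sup>2 * (1 + \<bar>X i \<omega>\<bar> powr q / a powr q)"
            by (metis order_trans)
          then show "(h * X' i \<omega>)\<^sup>2 \<le> h\<^sup>2 * (a\<^sup>2 * (1 + \<bar>X i \<omega>\<bar> powr q / a powr q))"
            unfolding power_mult_distrib by (intro mult_left_mono) auto
        qed auto
        have i4: "\<bar>h * X' i \<omega>\<bar> powr q / (h * y) powr q = \<bar>X' i \<omega>\<bar> powr q / y powr q"
          using h y by (simp add: abs_mult powr_mult)
        have i5: "exp (h * y) * (\<bar>X' i \<omega>\<bar> powr q / y powr q) \<le> exp (h * y) * (\<bar>X i \<omega>\<bar> powr q / y powr q)"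
          using q by (intro mult_left_mono divide_right_mono powr_mono2) (auto simp: X'_def)
        show "exp (h * X' i \<omega>) \<le> 1 + h * X i \<omega> + exp q * h\<^sup>2 * (a\<^sup>2 * (1 + \<bar>X i \<omega>\<bar> powr q / a powr q)) + exp (h * y) * (\<bar>X i \<omega>\<bar> powr q / y powr q)"
          using i1 i2 i3 i5 unfolding i4 mult.assoc by linarith
      qed (use int in auto)
      also have "\<dots> = 1 + exp q * h\<^sup>2 * (a\<^sup>2 * (1 + expectation (\<lambda>\<omega>. \<bar>X i \<omega>\<bar> powr q) / a powr q)) + exp (h * y) * (expectation (\<lambda>\<omega>. \<bar>X i \<omega>\<bar> powr q) / y powr q)"
        using int zero[OF i] by (simp add: prob_space)
      also have "\<dots> \<le> 1 + exp q * h\<^sup>2 * (a\<^sup>2 * (1 + 1)) + exp (h * y) * (a powr q / y powr q)"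
        using le[OF i] a by (intro add_mono mult_left_mono divide_right_mono) (auto simp: divide_le_eq_1)
      also have "\<dots> \<le> exp (2 * exp q * h\<^sup>2 * a\<^sup>2 + exp (h * y) * (a powr q / y powr q))"
        using exp_ge_add_one_self[of "2 * exp q * h\<^sup>2 * a\<^sup>2 + exp (h * y) * (a powr q / y powr q)"] by (simp add: algebra_simps)
      finally show ?thesis .
    qed
    have indX': "indep_vars (\<lambda>_. borel) (\<lambda>i \<omega>. exp (h * X' i \<omega>)) I"
      unfolding X'_def by (rule indep_vars_compose2[OF ind]) measurable
    define Z where "Z = (\<lambda>\<omega>. \<Sum>i\<in>I. X' i \<omega>)"
    have [measurable]: "Z \<in> borel_measurable M" unfolding Z_def by simp
    have bZ: "bmeas M Z" unfolding Z_def by (intro bmeas_intros bX')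
    have PZ: "prob {\<omega>\<in>space M. x \<le> Z \<omega>} \<le> exp 1 * (R + E)"
    proof -
      have "prob {\<omega>\<in>space M. x \<le> Z \<omega>} = expectation (indicator {\<omega>\<in>space M. x \<le> Z \<omega>})" by simp
      also have "\<dots> \<le> expectation (\<lambda>\<omega>. exp (- h * x) * exp (h * Z \<omega>))"
      proof (rule integral_mono)
        show "integrable M (\<lambda>\<omega>. exp (- h * x) * exp (h * Z \<omega>))"
          using bZ by (intro bmeas_integrable bmeas_intros)
      qed (use h in \<open>auto simp: indicator_def mult_exp_exp intro!: exp_ge_zero bmeas_integrable bmeas_intros\<close>)
      also have "\<dots> = exp (- h * x) * expectation (\<lambda>\<omega>. \<Prod>i\<in>I. exp (h * X' i \<omega>))"
        by (simp add: Z_def sum_distrib_left exp_sum I)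
      also have "expectation (\<lambda>\<omega>. \<Prod>i\<in>I. exp (h * X' i \<omega>)) = (\<Prod>i\<in>I. expectation (\<lambda>\<omega>. exp (h * X' i \<omega>)))"
        by (intro indep_vars_lebesgue_integral I indX' bmeas_integrable bmeas_intros bX')
      also have "\<dots> \<le> (\<Prod>i\<in>I. exp (2 * exp q * h\<^sup>2 * a\<^sup>2 + exp (h * y) * (a powr q / y powr q)))"
        by (intro prod_mono conjI mgf integral_nonneg) auto
      also have "\<dots> = exp (real (card I) * (2 * exp q * h\<^sup>2 * a\<^sup>2 + exp (h * y) * (a powr q / y powr q)))"
        by (simp add: exp_of_nat_mult)
      also have "\<dots> \<le> exp (N * (2 * exp q * h\<^sup>2 * a\<^sup>2 + exp (h * y) * (a powr q / y powr q)))"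
        using I by (auto intro!: mult_right_mono)
      finally have "prob {\<omega>\<in>space M. x \<le> Z \<omega>} \<le> exp (- h * x + N * (2 * exp q * h\<^sup>2 * a\<^sup>2 + exp (h * y) * (a powr q / y powr q)))"
        unfolding exp_add by (simp add: mult_left_mono)
      also have "\<dots> \<le> exp (1 - 3/4 * (h * x))" using hb by (simp add: y_def)
      also have "\<dots> = exp 1 * exp (- (3/4 * (h * x)))" by (simp add: mult_exp_exp)
      also have "\<dots> \<le> exp 1 * (R + E)" using he by (intro mult_left_mono) auto
      finally show ?thesis .
    qed
    have sI: "{\<omega>\<in>space M. y \<le> \<bar>X i \<omega>\<bar>} \<in> sets M" if "i \<in> I" for i
      using that by measurable
    have "prob {\<omega>\<in>space M. x \<le> (\<Sum>i\<in>I. X i \<omega>)} \<le> prob ((\<Union>i\<in>I. {\<omega>\<in>space M. y \<le> \<bar>X i \<omega>\<bar>}) \<union> {\<omega>\<in>space M. x \<le> Z \<omega>})"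
    proof (rule finite_measure_mono)
      show "{\<omega>\<in>space M. x \<le> (\<Sum>i\<in>I. X i \<omega>)} \<subseteq> (\<Union>i\<in>I. {\<omega>\<in>space M. y \<le> \<bar>X i \<omega>\<bar>}) \<union> {\<omega>\<in>space M. x \<le> Z \<omega>}"
      proof
        fix \<omega> assume \<omega>: "\<omega> \<in> {\<omega>\<in>space M. x \<le> (\<Sum>i\<in>I. X i \<omega>)}"
        show "\<omega> \<in> (\<Union>i\<in>I. {\<omega>\<in>space M. y \<le> \<bar>X i \<omega>\<bar>}) \<union> {\<omega>\<in>space M. x \<le> Z \<omega>}"
        proof (cases "\<exists>i\<in>I. y \<le> \<bar>X i \<omega>\<bar>")
          case False
          then have "X' i \<omega> = X i \<omega>" if "i \<in> I" for i using that by (auto simp: X'_def)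
          then have "Z \<omega> = (\<Sum>i\<in>I. X i \<omega>)" by (simp add: Z_def)
          then show ?thesis using \<omega> by simp
        qed (use \<omega> in auto)
      qed
    qed (use I sI in \<open>auto intro!: sets.Un sets.finite_UN\<close>)
    also have "\<dots> \<le> prob (\<Union>i\<in>I. {\<omega>\<in>space M. y \<le> \<bar>X i \<omega>\<bar>}) + prob {\<omega>\<in>space M. x \<le> Z \<omega>}"
      using I sI by (intro measure_Un_le sets.finite_UN) auto
    also have "prob (\<Union>i\<in>I. {\<omega>\<in>space M. y \<le> \<bar>X i \<omega>\<bar>}) \<le> (\<Sum>i\<in>I. prob {\<omega>\<in>space M. y \<le> \<bar>X i \<omega>\<bar>})"
      using I sI by (intro finite_measure_subadditive_finite) auto
    also have "\<dots> \<le> (\<Sum>i\<in>I. a powr q / y powr q)"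
    proof (rule sum_mono)
      fix i assume i: "i \<in> I"
      have "prob {\<omega>\<in>space M. y \<le> \<bar>X i \<omega>\<bar>} \<le> expectation (\<lambda>x. \<bar>X i x\<bar> powr q) / y powr q"
        using X[OF i] q y by (intro bmeas_markov) auto
      also have "\<dots> \<le> a powr q / y powr q" using le[OF i] by (intro divide_right_mono) auto
      finally show "prob {\<omega>\<in>space M. y \<le> \<bar>X i \<omega>\<bar>} \<le> a powr q / y powr q" .
    qed
    also have "\<dots> \<le> R"
      using I mult_right_mono[of "real (card I)" N "a powr q / y powr q"] by (simp add: R_def y_def)
    also note PZ
    also have "exp 1 * (R + E) \<le> 4 * (R + E)"
      using R0 E0 exp_le by (intro mult_right_mono) auto
    finally show ?thesis by simp
  qed
  then show ?thesis by (simp add: R_eq E_def)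
qed

text \<open>Explicit constants, since they must not depend on the probability space.\<close>

definition nagaev_const :: "real \<Rightarrow> real" where
  "nagaev_const q = 2 * (5 * 2 powr q)"

definition nagaev_rate :: "real \<Rightarrow> real" where
  "nagaev_rate q = 3 / (32 * exp q)"

lemma nagaev_rate_pos: "nagaev_rate q > 0"
  by (simp add: nagaev_rate_def)

lemma nagaev_const_pos: "nagaev_const q > 0"
  by (simp add: nagaev_const_def)

lemma (in prob_space) nagaev_two_sided:
  fixes q :: real and X :: "'i \<Rightarrow> 'a \<Rightarrow> real"
  assumes q: "q > 2" and I: "finite I" "real (card I) \<le> N" "N > 0"
    and X: "\<And>i. i \<in> I \<Longrightarrow> bmeas M (X i)" and ind: "indep_vars (\<lambda>_. borel) X I"
    and zero: "\<And>i. i \<in> I \<Longrightarrow> (\<integral>\<omega>. X i \<omega> \<partial>M) = 0"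
    and le: "\<And>i. i \<in> I \<Longrightarrow> (\<integral>\<omega>. \<bar>X i \<omega>\<bar> powr q \<partial>M) \<le> a powr q"
    and a: "a > 0" and x: "x > 0"
  shows "prob {\<omega>\<in>space M. x \<le> \<bar>\<Sum>i\<in>I. X i \<omega>\<bar>} \<le>
    nagaev_const q * (N * a powr q / x powr q + exp (- (nagaev_rate q * x\<^sup>2 / (N * a\<^sup>2))))"
proof -
  define c where "c = nagaev_rate q"
  define K where "K = nagaev_const q"
  have p1: "1 \<le> 2 powr q" using q by (intro ge_one_powr_ge_zero) auto
    define b where "b = 4 * (2 powr q * (N * a powr q / x powr q) + exp (- (c * x\<^sup>2 / (N * a\<^sup>2)))) + (2 powr q * (N * a powr q / x powr q))"
    note [measurable] = bmeas_measurable[OF X]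
    have 1: "prob {\<omega>\<in>space M. x \<le> (\<Sum>i\<in>I. X i \<omega>)} \<le> b"
      unfolding b_def c_def nagaev_rate_def using X zero le by (intro nagaev_one_sided q I ind a x) auto
    have ind': "indep_vars (\<lambda>_. borel) (\<lambda>i \<omega>. - X i \<omega>) I"
      by (rule indep_vars_compose2[OF ind]) measurable
    have 2: "prob {\<omega>\<in>space M. x \<le> (\<Sum>i\<in>I. - X i \<omega>)} \<le> b"
      unfolding b_def c_def nagaev_rate_def using X zero le by (intro nagaev_one_sided q I ind' a x) (auto intro!: bmeas_intros)
    have "prob {\<omega>\<in>space M. x \<le> \<bar>\<Sum>i\<in>I. X i \<omega>\<bar>} \<le> prob ({\<omega>\<in>space M. x \<le> (\<Sum>i\<in>I. X i \<omega>)} \<union> {\<omega>\<in>space M. x \<le> (\<Sum>i\<in>I. - X i \<omega>)})"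
      by (rule finite_measure_mono) (auto simp: sum_negf abs_if split: if_splits)
    also have "\<dots> \<le> prob {\<omega>\<in>space M. x \<le> (\<Sum>i\<in>I. X i \<omega>)} + prob {\<omega>\<in>space M. x \<le> (\<Sum>i\<in>I. - X i \<omega>)}"
      by (rule measure_Un_le) auto
    also have "\<dots> \<le> 2 * b" using 1 2 by simp
    also have "\<dots> \<le> K * (N * a powr q / x powr q + exp (- (c * x\<^sup>2 / (N * a\<^sup>2))))"
      using p1 mult_right_mono[OF p1, of "exp (- (c * x\<^sup>2 / (N * a\<^sup>2)))"] I
      by (simp add: b_def K_def nagaev_const_def algebra_simps)
    finally show ?thesis by (simp add: K_def c_def)
qed

section \<open>Truncated second moments\<close>

definition trunc_sq :: "real \<Rightarrow> real \<Rightarrow> real" where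
  "trunc_sq w t = (if w \<le> \<bar>t\<bar> then t\<^sup>2 else 0)"

lemma trunc_sq_nonneg [simp]: "trunc_sq w t \<ge> 0"
  by (simp add: trunc_sq_def)

lemma trunc_sq_le: "trunc_sq w t \<le> t\<^sup>2"
  by (simp add: trunc_sq_def)

lemma trunc_sq_measurable [measurable]: "trunc_sq w \<in> borel_measurable borel"
  unfolding trunc_sq_def by measurable

lemma bmeas_trunc_sq [bmeas_intros]: "bmeas M f \<Longrightarrow> bmeas M (\<lambda>x. trunc_sq w (f x))"
proof (rule bmeas_comp[where \<phi> = "trunc_sq w"])
  show "\<exists>B'. \<forall>x. \<bar>x\<bar> \<le> B \<longrightarrow> \<bar>trunc_sq w x\<bar> \<le> B'" for B
    by (intro exI[of _ "B\<^sup>2"]) (auto intro!: order_trans[OF trunc_sq_le] simp: abs_le_square_iff[symmetric])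
qed auto

text \<open>Layers for a square: for |t| between 2^k w and 2^(k+1) w the k-th summand alone is
  (2^(k+1) w)^2. Finitely many layers suffice for a bounded variable.\<close>

lemma trunc_sq_dyadic:
  fixes w t :: real
  assumes w: "w > 0" and n: "\<bar>t\<bar> < 2 ^ n * w"
  shows "trunc_sq w t \<le> (\<Sum>k<n. 4 * 4 ^ k * w\<^sup>2 * (if 2 ^ k * w \<le> \<bar>t\<bar> then 1 else 0))"
proof (cases "w \<le> \<bar>t\<bar>")
  case True
  define m where "m = (LEAST m. \<bar>t\<bar> < 2 ^ m * w)"
  have m: "\<bar>t\<bar> < 2 ^ m * w" unfolding m_def using n by (rule LeastI)
  have mn: "m \<le> n" unfolding m_def using n by (rule Least_le)
  have "m \<noteq> 0" using m True by (cases m) auto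
  then obtain k where k: "m = Suc k" by (cases m) auto
  have kk: "2 ^ k * w \<le> \<bar>t\<bar>" using not_less_Least[of k "\<lambda>m. \<bar>t\<bar> < 2 ^ m * w"] k m_def by auto
  have "t\<^sup>2 \<le> (2 ^ m * w)\<^sup>2" using m w by (intro abs_le_square_iff[THEN iffD1]) auto
  also have "(2 ^ m * w)\<^sup>2 = 4 * 4 ^ k * w\<^sup>2"
    by (simp add: k power2_eq_square power_mult_distrib[symmetric] mult_ac)
  also have "\<dots> = (\<Sum>j\<in>{k}. 4 * 4 ^ j * w\<^sup>2 * (if 2 ^ j * w \<le> \<bar>t\<bar> then 1 else 0))"
    using kk by simp
  also have "\<dots> \<le> (\<Sum>k<n. 4 * 4 ^ k * w\<^sup>2 * (if 2 ^ k * w \<le> \<bar>t\<bar> then 1 else 0))"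
    using mn k by (intro sum_mono2) auto
  finally show ?thesis using True by (simp add: trunc_sq_def)
qed (auto simp: trunc_sq_def intro!: sum_nonneg)

lemma geometric_sum_le:
  fixes r :: real
  assumes "0 \<le> r" "r < 1" shows "(\<Sum>k<n. r ^ k) \<le> 1 / (1 - r)"
proof -
  have "(\<Sum>k<n. r ^ k) \<le> (\<Sum>k. r ^ k)"
    using assms by (intro sum_le_suminf summable_geometric) auto
  then show ?thesis using assms by (simp add: suminf_geometric)
qed

lemma exp_minus_le_inverse_square:
  fixes s :: real assumes "s > 0" shows "exp (- s) \<le> 2 / s\<^sup>2"
proof -
  have "s\<^sup>2 / 2 \<le> exp s" using exp_lower_Taylor_quadratic[of s] assms by simp
  then have "inverse (exp s) \<le> inverse (s\<^sup>2 / 2)" using assms by (intro le_imp_inverse_le) auto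
  then show ?thesis by (simp add: exp_minus)
qed

text \<open>Summing the tails over the layers 2^k w, the polynomial part is geometric with ratio
  2^(2-q) < 1, and the Gaussian part converges at the cost of half its exponent, hence c / 2. This
  needs w \<ge> J; for w < J the exponential factor is bounded below and the plain second moment
  does the work. The three summands of \<open>K\<close> belong to these three estimates.\<close>

lemma trunc_sq_from_tails:
  fixes q c K\<^sub>0 :: real
  assumes q: "q > 2" and c: "c > 0" and K0: "K\<^sub>0 > 0"
  shows "\<exists>K>0. \<forall>(M::'a measure) T w J L. prob_space M \<longrightarrow> bmeas M T \<longrightarrow> w > 0 \<longrightarrow> J > 0 \<longrightarrow> L \<ge> 0 \<longrightarrow>
    (\<forall>v>0. measure M {\<omega>\<in>space M. v \<le> \<bar>T \<omega>\<bar>} \<le> K\<^sub>0 * (L / v powr q + exp (- (c * v\<^sup>2 / J\<^sup>2)))) \<longrightarrow>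
    (\<integral>\<omega>. (T \<omega>)\<^sup>2 \<partial>M) \<le> K\<^sub>0 * J\<^sup>2 \<longrightarrow>
    (\<integral>\<omega>. trunc_sq w (T \<omega>) \<partial>M) \<le> K * (L * w powr (2 - q) + (J\<^sup>2 + w\<^sup>2) * exp (- (c / 2 * w\<^sup>2 / J\<^sup>2)))"
proof -
  define r where "r = (2::real) powr (2 - q)"
  have r: "0 < r" "r < 1" using q powr_less_mono[of "2 - q" 0 "2::real"] by (auto simp: r_def)
  define K where "K = K\<^sub>0 * exp (c/2) + 4 * K\<^sub>0 / (1 - r) + 4 * K\<^sub>0 * (8 / c\<^sup>2 * (4/3))"
  have Kpos: "K > 0" using K0 r c by (auto simp: K_def intro!: add_pos_pos)
  have K1: "K\<^sub>0 * exp (c/2) \<le> K" and K2: "4 * K\<^sub>0 / (1 - r) \<le> K" and K3: "4 * K\<^sub>0 * (8 / c\<^sup>2 * (4/3)) \<le> K"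
    using K0 r c by (auto simp: K_def)
  show ?thesis
  proof (intro exI[of _ K] conjI allI impI Kpos)
    fix M :: "'a measure" and T and w J L :: real
    assume M: "prob_space M" and T: "bmeas M T" and w: "w > 0" and J: "J > 0" and L: "L \<ge> 0"
      and tail: "\<forall>v>0. measure M {\<omega>\<in>space M. v \<le> \<bar>T \<omega>\<bar>} \<le> K\<^sub>0 * (L / v powr q + exp (- (c * v\<^sup>2 / J\<^sup>2)))"
      and sq: "(\<integral>\<omega>. (T \<omega>)\<^sup>2 \<partial>M) \<le> K\<^sub>0 * J\<^sup>2"
    interpret prob_space M by fact
    note [measurable] = bmeas_measurable[OF T]
    have it: "integrable M (\<lambda>\<omega>. trunc_sq w (T \<omega>))" using T by (intro bmeas_integrable bmeas_intros)
    define E where "E = exp (- (c / 2 * w\<^sup>2 / J\<^sup>2))"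
    have E: "E > 0" by (simp add: E_def)
    show "(\<integral>\<omega>. trunc_sq w (T \<omega>) \<partial>M) \<le> K * (L * w powr (2 - q) + (J\<^sup>2 + w\<^sup>2) * exp (- (c / 2 * w\<^sup>2 / J\<^sup>2)))"
    proof (cases "w < J")
      case True
      have "(\<integral>\<omega>. trunc_sq w (T \<omega>) \<partial>M) \<le> (\<integral>\<omega>. (T \<omega>)\<^sup>2 \<partial>M)"
        using T by (intro integral_mono it trunc_sq_le bmeas_integrable bmeas_intros)
      also have "\<dots> \<le> K\<^sub>0 * J\<^sup>2 * 1" using sq by simp
      also have "1 \<le> exp (c/2) * E"
      proof -
        have "w\<^sup>2 \<le> J\<^sup>2" using True w by (intro power_mono) auto
        then have "c / 2 * w\<^sup>2 / J\<^sup>2 \<le> c / 2" using c J by (simp add: divide_simps)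
        then show ?thesis by (simp add: E_def mult_exp_exp)
      qed
      then have "K\<^sub>0 * J\<^sup>2 * 1 \<le> K\<^sub>0 * J\<^sup>2 * (exp (c/2) * E)" using K0 by (intro mult_left_mono) auto
      also have "\<dots> = (K\<^sub>0 * exp (c/2)) * (J\<^sup>2 * E)" by simp
      also have "\<dots> \<le> K * (J\<^sup>2 * E)" using E by (intro mult_right_mono K1) auto
      also have "\<dots> \<le> K * (L * w powr (2 - q) + (J\<^sup>2 + w\<^sup>2) * E)"
      proof (rule mult_left_mono)
        have "J\<^sup>2 * E \<le> (J\<^sup>2 + w\<^sup>2) * E" using E by (intro mult_right_mono) auto
        moreover have "0 \<le> L * w powr (2 - q)" using L by simp
        ultimately show "J\<^sup>2 * E \<le> L * w powr (2 - q) + (J\<^sup>2 + w\<^sup>2) * E" by linarith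
      qed (use Kpos in simp)
      finally show ?thesis by (simp add: E_def)
    next
      case False
      define y where "y = w\<^sup>2 / J\<^sup>2"
      have y: "y \<ge> 1" using False J power_mono[of J w 2] by (simp add: y_def)
      obtain B where B: "B > 0" "\<And>x. \<bar>T x\<bar> \<le> B" using T bmeasE by blast
      obtain n where n: "B / w < 2 ^ n" using real_arch_pow[of 2 "B/w"] by auto
      have bn: "\<bar>T x\<bar> < 2 ^ n * w" for x
        using n w B(2)[of x] by (simp add: divide_less_eq)
      have "(\<integral>\<omega>. trunc_sq w (T \<omega>) \<partial>M) \<le> (\<integral>\<omega>. (\<Sum>k<n. 4 * 4 ^ k * w\<^sup>2 * indicator {\<omega>\<in>space M. 2 ^ k * w \<le> \<bar>T \<omega>\<bar>} \<omega>) \<partial>M)"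
      proof (intro integral_mono it)
        fix \<omega> assume "\<omega> \<in> space M"
        then have "indicator {\<omega>\<in>space M. 2 ^ k * w \<le> \<bar>T \<omega>\<bar>} \<omega> = (if 2 ^ k * w \<le> \<bar>T \<omega>\<bar> then 1 else 0 :: real)" for k
          by (simp add: indicator_def)
        then show "trunc_sq w (T \<omega>) \<le> (\<Sum>k<n. 4 * 4 ^ k * w\<^sup>2 * indicator {\<omega>\<in>space M. 2 ^ k * w \<le> \<bar>T \<omega>\<bar>} \<omega>)"
          using trunc_sq_dyadic[OF w bn, of \<omega>] by presburger
      qed (rule bmeas_integrable, intro bmeas_intros, measurable)
      also have "\<dots> = (\<Sum>k<n. 4 * 4 ^ k * w\<^sup>2 * prob {\<omega>\<in>space M. 2 ^ k * w \<le> \<bar>T \<omega>\<bar>})"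
        by (subst Bochner_Integration.integral_sum) (auto intro!: bmeas_integrable bmeas_intros)
      also have "\<dots> \<le> (\<Sum>k<n. 4 * K\<^sub>0 * L * w powr (2 - q) * r ^ k + 4 * K\<^sub>0 * w\<^sup>2 * E * (8 / c\<^sup>2) * (1/4) ^ k)"
      proof (rule sum_mono)
        fix k
        have p2: "(2::real) ^ k > 0" "(4::real)^k > 0" by auto
        have sq4: "((2::real) ^ k)\<^sup>2 = 4 ^ k" by (simp add: power2_eq_square power_mult_distrib[symmetric])
        have "4 ^ k * w\<^sup>2 / (2 ^ k * w) powr q = (2 ^ k * w) powr (2 - q)"
          using w by (simp add: powr_diff power_mult_distrib sq4)
        also have "\<dots> = w powr (2 - q) * r ^ k"
          using w by (simp add: powr_mult r_def powr_powr powr_realpow[symmetric] mult.commute)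
        finally have t1: "4 ^ k * w\<^sup>2 / (2 ^ k * w) powr q = w powr (2 - q) * r ^ k" .
        have "c * (2 ^ k * w)\<^sup>2 / J\<^sup>2 = c * 4 ^ k * y" by (simp add: y_def power_mult_distrib sq4)
        \<comment> \<open>Both y and 4^k are at least 1, so twice their product exceeds their sum.
          One half of the exponent becomes \<open>E\<close>, the other one beats the factor 4^k of
          the layer.\<close>
        also have "\<dots> \<ge> c / 2 * y + c / 2 * 4 ^ k"
        proof -
          have "1 * y \<le> 4 ^ k * y" using y by (intro mult_right_mono) auto
          moreover have "4 ^ k * 1 \<le> 4 ^ k * y" using y by (intro mult_left_mono) auto
          ultimately have "y + 4 ^ k \<le> 2 * (4 ^ k * y)" by linarith
          then have "c * (y + 4 ^ k) \<le> c * (2 * (4 ^ k * y))" using c by (intro mult_left_mono) auto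
          then show ?thesis by (simp add: field_simps)
        qed
        finally have "exp (- (c * (2 ^ k * w)\<^sup>2 / J\<^sup>2)) \<le> exp (- (c/2 * y) + - (c/2 * 4 ^ k))" by simp
        also have "\<dots> = E * exp (- (c/2 * 4 ^ k))" by (simp add: E_def y_def exp_add[symmetric])
        also have "\<dots> \<le> E * (2 / (c/2 * 4 ^ k)\<^sup>2)"
          using E c by (intro mult_left_mono exp_minus_le_inverse_square) auto
        also have "\<dots> = E * (8 / c\<^sup>2) * (1/4)^k / 4 ^ k"
          by (simp add: power2_eq_square field_simps power_one_over)
        finally have t2: "4 ^ k * exp (- (c * (2 ^ k * w)\<^sup>2 / J\<^sup>2)) \<le> E * (8 / c\<^sup>2) * (1/4)^k"
          using mult_left_mono[of "exp (- (c * (2 ^ k * w)\<^sup>2 / J\<^sup>2))" "E * (8 / c\<^sup>2) * (1/4)^k / 4 ^ k" "4 ^ k"] by simp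
        have "prob {\<omega>\<in>space M. 2 ^ k * w \<le> \<bar>T \<omega>\<bar>} \<le> K\<^sub>0 * (L / (2 ^ k * w) powr q + exp (- (c * (2 ^ k * w)\<^sup>2 / J\<^sup>2)))"
          using tail w by simp
        then have "4 * 4 ^ k * w\<^sup>2 * prob {\<omega>\<in>space M. 2 ^ k * w \<le> \<bar>T \<omega>\<bar>} \<le> 4 * 4 ^ k * w\<^sup>2 * (K\<^sub>0 * (L / (2 ^ k * w) powr q + exp (- (c * (2 ^ k * w)\<^sup>2 / J\<^sup>2))))"
          by (intro mult_left_mono) auto
        also have "\<dots> = 4 * K\<^sub>0 * L * (4 ^ k * w\<^sup>2 / (2 ^ k * w) powr q) + 4 * K\<^sub>0 * w\<^sup>2 * (4 ^ k * exp (- (c * (2 ^ k * w)\<^sup>2 / J\<^sup>2)))"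
          by (simp add: distrib_left mult_ac)
        also have "\<dots> \<le> 4 * K\<^sub>0 * L * (w powr (2 - q) * r ^ k) + 4 * K\<^sub>0 * w\<^sup>2 * (E * (8 / c\<^sup>2) * (1/4)^k)"
          using t2 K0 unfolding t1 by (intro add_left_mono mult_left_mono) auto
        finally show "4 * 4 ^ k * w\<^sup>2 * prob {\<omega>\<in>space M. 2 ^ k * w \<le> \<bar>T \<omega>\<bar>}
          \<le> 4 * K\<^sub>0 * L * w powr (2 - q) * r ^ k + 4 * K\<^sub>0 * w\<^sup>2 * E * (8 / c\<^sup>2) * (1/4) ^ k"
          by (simp add: mult.assoc)
      qed
      also have "\<dots> = 4 * K\<^sub>0 * L * w powr (2 - q) * (\<Sum>k<n. r ^ k) + 4 * K\<^sub>0 * w\<^sup>2 * E * (8 / c\<^sup>2) * (\<Sum>k<n. (1/4) ^ k)"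
        by (simp add: sum.distrib sum_distrib_left)
      also have "\<dots> \<le> 4 * K\<^sub>0 * L * w powr (2 - q) * (1 / (1 - r)) + 4 * K\<^sub>0 * w\<^sup>2 * E * (8 / c\<^sup>2) * (1 / (1 - 1/4))"
        using K0 L E r by (intro add_mono mult_left_mono geometric_sum_le) auto
      also have "\<dots> = 4 * K\<^sub>0 / (1 - r) * (L * w powr (2 - q)) + 4 * K\<^sub>0 * (8 / c\<^sup>2 * (4/3)) * (w\<^sup>2 * E)"
        by simp
      also have "\<dots> \<le> K * (L * w powr (2 - q)) + K * (w\<^sup>2 * E)"
        using L E by (intro add_mono mult_right_mono K2 K3) auto
      also have "\<dots> \<le> K * (L * w powr (2 - q) + (J\<^sup>2 + w\<^sup>2) * E)"
        using Kpos L E by (simp add: algebra_simps)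
      finally show ?thesis by (simp add: E_def)
    qed
  qed
qed

text \<open>\<open>trunc_sq\<close> is neither continuous nor bounded. Halving the threshold for the
  approximants repairs the first: where |S - T| < w/2 and |S| \<ge> w, one has |T| \<ge> w/2 and |S|
  \<le> 2 |T|, hence the factor 4. Capping at r^2 repairs the second: where |S - T| \<ge> w/2 the
  cap is at most r^2 (2/w) |S - T|, which vanishes with \<delta>. Monotone convergence then removes
  the cap.\<close>

lemma (in prob_space) trunc_sq_transfer:
  fixes S :: "'a \<Rightarrow> real"
  assumes S: "integrable M S" and w: "w > 0" and B: "B \<ge> 0"
    and approx: "\<And>\<delta>. \<delta> > 0 \<Longrightarrow> \<exists>T. bmeas M T \<and> (\<integral>\<omega>. \<bar>S \<omega> - T \<omega>\<bar> \<partial>M) \<le> \<delta> \<and> (\<integral>\<omega>. trunc_sq (w/2) (T \<omega>) \<partial>M) \<le> B"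
  shows "(\<integral>\<^sup>+\<omega>. ennreal (trunc_sq w (S \<omega>)) \<partial>M) \<le> ennreal (4 * B)"
proof -
  have [measurable]: "S \<in> borel_measurable M" using S by auto
  have bound: "(\<integral>\<^sup>+\<omega>. ennreal (min (trunc_sq w (S \<omega>)) ((real r)\<^sup>2)) \<partial>M) \<le> ennreal (4 * B)" for r :: nat
  proof -
    define m where "m = (\<lambda>\<omega>. min (trunc_sq w (S \<omega>)) ((real r)\<^sup>2))"
    have m: "bmeas M m"
      by (rule bmeasI[of _ _ "(real r)\<^sup>2"]) (auto simp: m_def)
    have "expectation m \<le> 4 * B + 2 * (real r)\<^sup>2 / w * \<delta>" if \<delta>: "\<delta> > 0" for \<delta>
    proof -
      obtain T where T: "bmeas M T" "(\<integral>\<omega>. \<bar>S \<omega> - T \<omega>\<bar> \<partial>M) \<le> \<delta>" "(\<integral>\<omega>. trunc_sq (w/2) (T \<omega>) \<partial>M) \<le> B"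
        using approx[OF \<delta>] by blast
      have iT: "integrable M T" "integrable M (\<lambda>\<omega>. trunc_sq (w/2) (T \<omega>))"
        using T by (auto intro!: bmeas_integrable bmeas_intros)
      have "expectation m \<le> expectation (\<lambda>\<omega>. 4 * trunc_sq (w/2) (T \<omega>) + 2 * (real r)\<^sup>2 / w * \<bar>S \<omega> - T \<omega>\<bar>)"
      proof (rule integral_mono)
        fix \<omega>
        show "m \<omega> \<le> 4 * trunc_sq (w/2) (T \<omega>) + 2 * (real r)\<^sup>2 / w * \<bar>S \<omega> - T \<omega>\<bar>"
        proof (cases "w \<le> \<bar>S \<omega>\<bar>")
          case False
          then show ?thesis using w by (simp add: m_def trunc_sq_def min_def)
        next
          case True
          show ?thesis
          proof (cases "w / 2 \<le> \<bar>S \<omega> - T \<omega>\<bar>")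
            case True
            have "m \<omega> \<le> (real r)\<^sup>2 * 1" by (simp add: m_def)
            also have "\<dots> \<le> (real r)\<^sup>2 * (2 / w * \<bar>S \<omega> - T \<omega>\<bar>)"
              using True w by (intro mult_left_mono) (auto simp: divide_simps)
            also have "\<dots> = 2 * (real r)\<^sup>2 / w * \<bar>S \<omega> - T \<omega>\<bar>" by simp
            finally show ?thesis using trunc_sq_nonneg[of "w/2" "T \<omega>"] by linarith
          next
            case F: False
            then have T2: "w / 2 \<le> \<bar>T \<omega>\<bar>" "\<bar>S \<omega>\<bar> \<le> \<bar>2 * T \<omega>\<bar>" using True by linarith+
            have "m \<omega> \<le> (S \<omega>)\<^sup>2" unfolding m_def by (intro min.coboundedI1 trunc_sq_le)
            also have "\<dots> \<le> (2 * T \<omega>)\<^sup>2" using T2 by (simp only: abs_le_square_iff)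
            also have "\<dots> = 4 * trunc_sq (w/2) (T \<omega>)" using T2 by (simp add: trunc_sq_def power_mult_distrib)
            finally show ?thesis using w by (simp add: add_increasing2)
          qed
        qed
      qed (use m iT S in \<open>auto intro!: bmeas_integrable\<close>)
      also have "\<dots> = 4 * expectation (\<lambda>\<omega>. trunc_sq (w/2) (T \<omega>)) + 2 * (real r)\<^sup>2 / w * expectation (\<lambda>\<omega>. \<bar>S \<omega> - T \<omega>\<bar>)"
        using iT S by simp
      also have "\<dots> \<le> 4 * B + 2 * (real r)\<^sup>2 / w * \<delta>"
        using T w by (intro add_mono mult_left_mono) auto
      finally show ?thesis .
    qed
    then have *: "expectation m \<le> 4 * B + e" if "e > 0" for e
      using that w by (cases "r = 0") (force, auto dest!: meta_spec[of _ "e * w / (2 * (real r)\<^sup>2)"])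
    have "expectation m \<le> 4 * B" by (rule field_le_epsilon) (use * in auto)
    then show ?thesis
      using m by (subst m_def[symmetric, THEN fun_cong], subst nn_integral_eq_integral)
        (auto intro!: bmeas_integrable ennreal_leI simp: m_def)
  qed
  have "(\<integral>\<^sup>+\<omega>. ennreal (trunc_sq w (S \<omega>)) \<partial>M) = (\<integral>\<^sup>+\<omega>. (SUP r. ennreal (min (trunc_sq w (S \<omega>)) ((real r)\<^sup>2))) \<partial>M)"
  proof (intro nn_integral_cong antisym)
    fix \<omega>
    obtain r :: nat where "trunc_sq w (S \<omega>) \<le> real r" using real_arch_simple by blast
    also have "\<dots> \<le> (real r)\<^sup>2" by (cases r) (auto simp: power2_eq_square)
    finally show "ennreal (trunc_sq w (S \<omega>)) \<le> (SUP r. ennreal (min (trunc_sq w (S \<omega>)) ((real r)\<^sup>2)))"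
      by (intro SUP_upper2[of r]) (auto simp: min_def)
    show "(SUP r. ennreal (min (trunc_sq w (S \<omega>)) ((real r)\<^sup>2))) \<le> ennreal (trunc_sq w (S \<omega>))"
      by (intro SUP_least ennreal_leI) auto
  qed
  also have "\<dots> = (SUP r. \<integral>\<^sup>+\<omega>. ennreal (min (trunc_sq w (S \<omega>)) ((real r)\<^sup>2)) \<partial>M)"
    by (intro nn_integral_monotone_convergence_SUP)
       (auto simp: incseq_def le_fun_def intro!: ennreal_leI min.mono[OF order_refl] power_mono simp del: min.bounded_iff)
  also have "\<dots> \<le> ennreal (4 * B)" by (intro SUP_least bound)
  finally show ?thesis .
qed

section \<open>Sequences of independent innovations\<close>

definition depends_on :: "'i set \<Rightarrow> (('i \<Rightarrow> 'e) \<Rightarrow> 'b) \<Rightarrow> bool" where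
  "depends_on A f \<longleftrightarrow> (\<forall>\<omega> \<omega>'. (\<forall>i\<in>A. \<omega> i = \<omega>' i) \<longrightarrow> f \<omega> = f \<omega>')"

lemma depends_onD: "depends_on A f \<Longrightarrow> (\<And>i. i \<in> A \<Longrightarrow> \<omega> i = \<omega>' i) \<Longrightarrow> f \<omega> = f \<omega>'"
  by (auto simp: depends_on_def)

lemma depends_on_mono: "depends_on A f \<Longrightarrow> A \<subseteq> B \<Longrightarrow> depends_on B f"
  by (auto simp: depends_on_def)

definition mrg :: "int \<Rightarrow> (int \<Rightarrow> 'e) \<Rightarrow> (int \<Rightarrow> 'e) \<Rightarrow> int \<Rightarrow> 'e" where
  "mrg k \<omega> \<omega>' = (\<lambda>i. if k \<le> i then \<omega> i else \<omega>' i)"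

text \<open>One format for every way of assembling a sequence from two independent ones: merging at
  a time, or picking a spare copy of a coordinate. Injectivity of \<open>f\<close> will mean that no
  coordinate is used twice.\<close>

definition glue :: "('j \<Rightarrow> 'i + 'i) \<Rightarrow> ('i \<Rightarrow> 'e) \<times> ('i \<Rightarrow> 'e) \<Rightarrow> 'j \<Rightarrow> 'e" where
  "glue f p = (\<lambda>j. case f j of Inl i \<Rightarrow> fst p i | Inr i \<Rightarrow> snd p i)"

locale iid_space = base: prob_space \<nu> for \<nu> :: "'e measure"
begin

abbreviation seqs :: "('i \<Rightarrow> 'e) measure" where
  "seqs \<equiv> PiM UNIV (\<lambda>_. \<nu>)"

abbreviation Q :: "(int \<Rightarrow> 'e) measure" where
  "Q \<equiv> seqs"

sublocale Q: prob_space Q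
  by (intro prob_space_PiM) unfold_locales

sublocale QQ: pair_prob_space Q Q
  by unfold_locales

lemma glue_measurable [measurable]:
  "glue f \<in> (seqs :: ('i \<Rightarrow> 'e) measure) \<Otimes>\<^sub>M seqs \<rightarrow>\<^sub>M (seqs :: ('j \<Rightarrow> 'e) measure)"
proof (rule measurable_PiM_single')
  fix j
  show "(\<lambda>p. glue f p j) \<in> (seqs :: ('i \<Rightarrow> 'e) measure) \<Otimes>\<^sub>M seqs \<rightarrow>\<^sub>M \<nu>"
    unfolding glue_def by (cases "f j") simp_all
next
  show "(\<lambda>p i. glue f p i) \<in> space ((seqs :: ('i \<Rightarrow> 'e) measure) \<Otimes>\<^sub>M seqs) \<rightarrow> (\<Pi>\<^sub>E i\<in>UNIV. space \<nu>)"
    by (auto simp: glue_def space_pair_measure space_PiM PiE_iff split: sum.splits)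
qed

text \<open>A cylinder condition on the glued sequence separates into conditions on disjoint sets of
  coordinates of the two sources, since \<open>f\<close> is injective; so its probability is the
  product over the coordinates.\<close>

lemma distr_glue:
  fixes f :: "'j \<Rightarrow> 'i + 'i"
  assumes f: "inj f"
  shows "distr ((seqs :: ('i \<Rightarrow> 'e) measure) \<Otimes>\<^sub>M seqs) seqs (glue f) = seqs" (is "?D = _")
proof -
  interpret J: product_prob_space "\<lambda>_::'j. \<nu>" UNIV by unfold_locales
  interpret I: product_prob_space "\<lambda>_::'i. \<nu>" UNIV by unfold_locales
  show ?thesis
  proof (rule J.PiM_eq)
    fix J :: "'j set" and F assume J: "finite J" "J \<subseteq> UNIV" and F: "\<And>j. j \<in> J \<Longrightarrow> F j \<in> sets \<nu>"
    let ?X = "prod_emb UNIV (\<lambda>_. \<nu>) J (\<Pi>\<^sub>E j\<in>J. F j)"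
    define g where "g = inv f"
    have g[simp]: "g (f j) = j" for j using f by (simp add: g_def)
    define J1 where "J1 = Inl -` (f ` J)"
    define J2 where "J2 = Inr -` (f ` J)"
    have fin: "finite J1" "finite J2"
      using J by (auto simp: J1_def J2_def intro!: finite_vimageI)
    have im: "f ` J = Inl ` J1 \<union> Inr ` J2"
    proof
      show "f ` J \<subseteq> Inl ` J1 \<union> Inr ` J2"
      proof
        fix s assume "s \<in> f ` J"
        then show "s \<in> Inl ` J1 \<union> Inr ` J2" by (cases s) (auto simp: J1_def J2_def)
      qed
    qed (auto simp: J1_def J2_def)
    have F1: "F (g (Inl i)) \<in> sets \<nu>" if "i \<in> J1" for i using that F by (force simp: J1_def)
    have F2: "F (g (Inr i)) \<in> sets \<nu>" if "i \<in> J2" for i using that F by (force simp: J2_def)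
    let ?A = "{\<omega>\<in>space (seqs :: ('i \<Rightarrow> 'e) measure). \<forall>i\<in>J1. \<omega> i \<in> F (g (Inl i))}"
    let ?B = "{\<omega>\<in>space (seqs :: ('i \<Rightarrow> 'e) measure). \<forall>i\<in>J2. \<omega> i \<in> F (g (Inr i))}"
    have sAB: "?A \<in> sets seqs" "?B \<in> sets seqs"
      using fin F1 F2 by (auto intro!: sets.sets_Collect_finite_All' sets_Collect_single')
    have "glue f -` ?X \<inter> space ((seqs :: ('i \<Rightarrow> 'e) measure) \<Otimes>\<^sub>M seqs) = ?A \<times> ?B"
    proof -
      have "(\<forall>j\<in>J. glue f (\<omega>, \<omega>') j \<in> F j) \<longleftrightarrow> (\<forall>i\<in>J1. \<omega> i \<in> F (g (Inl i))) \<and> (\<forall>i\<in>J2. \<omega>' i \<in> F (g (Inr i)))" for \<omega> \<omega>'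
      proof -
        have "(\<forall>j\<in>J. glue f (\<omega>, \<omega>') j \<in> F j) \<longleftrightarrow> (\<forall>s\<in>f ` J. (case s of Inl i \<Rightarrow> \<omega> i | Inr i \<Rightarrow> \<omega>' i) \<in> F (g s))"
          by (simp add: glue_def ball_simps cong: sum.case_cong)
        also have "\<dots> \<longleftrightarrow> (\<forall>i\<in>J1. \<omega> i \<in> F (g (Inl i))) \<and> (\<forall>i\<in>J2. \<omega>' i \<in> F (g (Inr i)))"
          unfolding im by (simp add: ball_Un)
        finally show ?thesis .
      qed
      moreover have "glue f p \<in> space seqs" if "p \<in> space ((seqs :: ('i \<Rightarrow> 'e) measure) \<Otimes>\<^sub>M seqs)" for p
        using measurable_space[OF glue_measurable that] .
      ultimately show ?thesis
        by (fastforce simp: prod_emb_def space_pair_measure PiE_iff space_PiM)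
    qed
    then have "emeasure ?D ?X = emeasure (seqs \<Otimes>\<^sub>M seqs) (?A \<times> ?B)"
      using J F by (subst emeasure_distr) (auto intro!: sets_PiM_I)
    also have "\<dots> = emeasure seqs ?A * emeasure seqs ?B"
      using sAB by (intro I.P.emeasure_pair_measure_Times) auto
    also have "\<dots> = (\<Prod>i\<in>J1. emeasure \<nu> (F (g (Inl i)))) * (\<Prod>i\<in>J2. emeasure \<nu> (F (g (Inr i))))"
      using fin F1 F2 by (subst (1 2) I.emeasure_PiM_Collect) auto
    also have "\<dots> = (\<Prod>s\<in>Inl ` J1 \<union> Inr ` J2. emeasure \<nu> (F (g s)))"
      using fin by (subst prod.union_disjoint) (auto simp: prod.reindex)
    also have "\<dots> = (\<Prod>j\<in>J. emeasure \<nu> (F j))"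
      unfolding im[symmetric] using inj_on_subset[OF f] by (subst prod.reindex) auto
    finally show "emeasure ?D ?X = (\<Prod>j\<in>J. emeasure \<nu> (F j))" .
  qed simp
qed

lemma integral_glue:
  fixes f :: "'j \<Rightarrow> int + int" and h :: "('j \<Rightarrow> 'e) \<Rightarrow> real"
  assumes f: "inj f" and h: "bmeas seqs h"
  shows "(\<integral>\<omega>. (\<integral>\<omega>'. h (glue f (\<omega>, \<omega>')) \<partial>Q) \<partial>Q) = (\<integral>x. h x \<partial>seqs)"
proof -
  have [measurable]: "h \<in> borel_measurable seqs" using h by (rule bmeas_measurable)
  have "bmeas (Q \<Otimes>\<^sub>M Q) (\<lambda>p. h (glue f p))"
    using h unfolding bmeas_def by auto
  then have "integrable (Q \<Otimes>\<^sub>M Q) (\<lambda>p. h (glue f p))"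
    by (rule QQ.P.bmeas_integrable)
  then have "(\<integral>\<omega>. (\<integral>\<omega>'. h (glue f (\<omega>, \<omega>')) \<partial>Q) \<partial>Q) = (\<integral>p. h (glue f p) \<partial>(Q \<Otimes>\<^sub>M Q))"
    by (rule QQ.integral_fst')
  also have "\<dots> = (\<integral>x. h x \<partial>distr (Q \<Otimes>\<^sub>M Q) seqs (glue f))"
    by (intro integral_distr[symmetric]) auto
  finally show ?thesis by (simp add: distr_glue f)
qed

lemma mrg_glue: "mrg k \<omega> \<omega>' = glue (\<lambda>i. if k \<le> i then Inl i else Inr i) (\<omega>, \<omega>')"
  by (auto simp: mrg_def glue_def)

lemma mrg_inj: "inj (\<lambda>i::int. if k \<le> i then Inl i else Inr i :: int + int)"
  by (auto simp: inj_on_def split: if_splits)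

lemma mrg_measurable [measurable (raw)]:
  assumes "f \<in> N \<rightarrow>\<^sub>M Q" "g \<in> N \<rightarrow>\<^sub>M Q" shows "(\<lambda>x. mrg k (f x) (g x)) \<in> N \<rightarrow>\<^sub>M Q"
  unfolding mrg_glue using assms by measurable

text \<open>A version of the conditional expectation given the coordinates from \<open>k\<close> on; for bounded
  functions it is defined everywhere, so that no null sets arise.\<close>

definition CE :: "int \<Rightarrow> ((int \<Rightarrow> 'e) \<Rightarrow> real) \<Rightarrow> (int \<Rightarrow> 'e) \<Rightarrow> real" where
  "CE k f \<omega> = (\<integral>\<omega>'. f (mrg k \<omega> \<omega>') \<partial>Q)"

lemma bmeas_section:
  assumes f: "bmeas Q f" and \<omega>: "\<omega> \<in> space Q"
  shows "bmeas Q (\<lambda>\<omega>'. f (mrg k \<omega> \<omega>'))"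
proof -
  have [measurable]: "f \<in> borel_measurable Q" using f by (rule bmeas_measurable)
  have "(\<lambda>\<omega>'. f (mrg k \<omega> \<omega>')) \<in> borel_measurable Q" using \<omega> by measurable
  with f show ?thesis unfolding bmeas_def by auto
qed

lemma bmeas_CE [bmeas_intros]:
  assumes f: "bmeas Q f" shows "bmeas Q (CE k f)"
proof -
  obtain B where B: "B > 0" "\<And>x. \<bar>f x\<bar> \<le> B" using f bmeasE by blast
  have [measurable]: "f \<in> borel_measurable Q" using f by (rule bmeas_measurable)
  \<comment> \<open>\<open>bmeas\<close> asks for a bound at every point, also outside
    \<open>space Q\<close>, where a section may fail to be integrable. There the integral is 0 by
    convention.\<close>
  have "\<bar>CE k f \<omega>\<bar> \<le> B" for \<omega>
  proof (cases "integrable Q (\<lambda>\<omega>'. f (mrg k \<omega> \<omega>'))")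
    case True
    have "\<bar>CE k f \<omega>\<bar> \<le> (\<integral>\<omega>'. \<bar>f (mrg k \<omega> \<omega>')\<bar> \<partial>Q)"
      unfolding CE_def by (rule integral_abs_bound)
    also have "\<dots> \<le> (\<integral>\<omega>'. B \<partial>Q)"
      using True B by (intro integral_mono) auto
    finally show ?thesis by (simp add: Q.prob_space)
  next
    case False
    then show ?thesis using B by (simp add: CE_def not_integrable_integral_eq)
  qed
  moreover have "CE k f \<in> borel_measurable Q"
    unfolding CE_def by measurable
  ultimately show ?thesis by (intro bmeasI)
qed

lemma depends_on_CE: "depends_on A f \<Longrightarrow> depends_on (A \<inter> {k..}) (CE k f)"
  unfolding depends_on_def CE_def
proof (intro allI impI Bochner_Integration.integral_cong refl)
  fix \<omega> \<omega>' \<omega>'' :: "int \<Rightarrow> 'e"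
  assume *: "\<forall>\<omega> \<omega>'. (\<forall>i\<in>A. \<omega> i = \<omega>' i) \<longrightarrow> f \<omega> = f \<omega>'" and "\<forall>i\<in>A \<inter> {k..}. \<omega> i = \<omega>' i"
  then show "f (mrg k \<omega> \<omega>'') = f (mrg k \<omega>' \<omega>'')"
    by (intro *[rule_format]) (auto simp: mrg_def)
qed

text \<open>The characteristic property of conditional expectation. \<open>S\<close> does not see
  the coordinates that are integrated out, and merging two independent sequences gives back the law
  \<open>Q\<close>.\<close>

lemma integral_mult_CE:
  assumes S: "bmeas Q S" "depends_on {k..} S" and f: "bmeas Q f"
  shows "(\<integral>\<omega>. S \<omega> * CE k f \<omega> \<partial>Q) = (\<integral>\<omega>. S \<omega> * f \<omega> \<partial>Q)"
proof -
  have "(\<integral>\<omega>. S \<omega> * CE k f \<omega> \<partial>Q) = (\<integral>\<omega>. (\<integral>\<omega>'. S (mrg k \<omega> \<omega>') * f (mrg k \<omega> \<omega>') \<partial>Q) \<partial>Q)"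
  proof (rule Bochner_Integration.integral_cong[OF refl])
    fix \<omega>
    have "S (mrg k \<omega> \<omega>') = S \<omega>" for \<omega>'
      using S(2) by (rule depends_onD) (auto simp: mrg_def)
    then show "S \<omega> * CE k f \<omega> = (\<integral>\<omega>'. S (mrg k \<omega> \<omega>') * f (mrg k \<omega> \<omega>') \<partial>Q)"
      by (simp add: CE_def)
  qed
  also have "\<dots> = (\<integral>\<omega>. S \<omega> * f \<omega> \<partial>Q)"
    unfolding mrg_glue by (rule integral_glue[OF mrg_inj]) (intro bmeas_intros S f)
  finally show ?thesis .
qed

lemma integral_CE: "bmeas Q f \<Longrightarrow> (\<integral>\<omega>. CE k f \<omega> \<partial>Q) = (\<integral>\<omega>. f \<omega> \<partial>Q)"
  using integral_mult_CE[of "\<lambda>_. 1" k f] by (simp add: bmeas_const depends_on_def)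

lemma CE_const: "CE k (\<lambda>_. c) = (\<lambda>_. c)"
  by (simp add: CE_def fun_eq_iff Q.prob_space)

text \<open>The distance between two successive projections is bounded by a coupling: conditioning on
  one coordinate less amounts to averaging over an independent copy of that coordinate.\<close>

lemma CE_diff_powr_le:
  fixes h :: "(nat \<Rightarrow> 'e) \<Rightarrow> real" and q :: real
  assumes h: "bmeas seqs h" and q: "q > 1" and k: "k = i - int m"
  shows "(\<integral>\<omega>. \<bar>CE k (\<lambda>\<omega>. h (\<lambda>l. \<omega> (i - int l))) \<omega> - CE (k+1) (\<lambda>\<omega>. h (\<lambda>l. \<omega> (i - int l))) \<omega>\<bar> powr q \<partial>Q)
    \<le> (\<integral>x. \<bar>h (\<lambda>l. x (Some l)) - h (\<lambda>l. if l = m then x None else x (Some l))\<bar> powr q \<partial>seqs)"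
proof -
  have [measurable]: "h \<in> borel_measurable seqs" using h by (rule bmeas_measurable)
  define Y where "Y = (\<lambda>\<omega>::int \<Rightarrow> 'e. h (\<lambda>l. \<omega> (i - int l)))"
  have Y: "bmeas Q Y"
  proof -
    have "(\<lambda>\<omega> l. \<omega> (i - int l)) \<in> Q \<rightarrow>\<^sub>M seqs"
      by (rule measurable_PiM_single') (auto simp: space_PiM PiE_iff)
    then have "Y \<in> borel_measurable Q" unfolding Y_def by measurable
    then show ?thesis using h by (auto simp: bmeas_def Y_def)
  qed
  have [measurable]: "Y \<in> borel_measurable Q" using Y by (rule bmeas_measurable)
  define H where "H = (\<lambda>x. \<bar>h (\<lambda>l. x (Some l)) - h (\<lambda>l. if l = m then x None else x (Some l))\<bar> powr q)"
  have m1: "(\<lambda>x l. x (Some l)) \<in> (seqs :: (nat option \<Rightarrow> 'e) measure) \<rightarrow>\<^sub>M seqs"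
    by (rule measurable_PiM_single') (auto simp: space_PiM PiE_iff)
  have m2: "(\<lambda>x l. if l = m then x None else x (Some l)) \<in> (seqs :: (nat option \<Rightarrow> 'e) measure) \<rightarrow>\<^sub>M seqs"
    by (rule measurable_PiM_single') (auto simp: space_PiM PiE_iff)
  have bh: "bmeas (seqs :: (nat option \<Rightarrow> 'e) measure) (\<lambda>x. h (\<lambda>l. x (Some l)))"
     "bmeas (seqs :: (nat option \<Rightarrow> 'e) measure) (\<lambda>x. h (\<lambda>l. if l = m then x None else x (Some l)))"
    using h measurable_compose[OF m1, of h borel] measurable_compose[OF m2, of h borel] unfolding bmeas_def by auto
  have bH: "bmeas seqs H" unfolding H_def using bh q by (intro bmeas_intros) auto
  \<comment> \<open>Coordinate k of the second sequence is free in \<open>mrg k\<close>, so it can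
    serve as the independent copy \<open>None\<close>. Passing to \<open>mrg (k+1)\<close> then
    replaces exactly the innovation at lag m by this copy.\<close>
  define f :: "nat option \<Rightarrow> int + int" where
    "f = (\<lambda>j. case j of None \<Rightarrow> Inr k | Some l \<Rightarrow> if k \<le> i - int l then Inl (i - int l) else Inr (i - int l))"
  have f: "inj f"
    by (auto simp: inj_on_def f_def split: option.splits if_splits)
  have HY: "\<bar>Y (mrg k \<omega> \<omega>') - Y (mrg (k+1) \<omega> \<omega>')\<bar> powr q = H (glue f (\<omega>, \<omega>'))" for \<omega> \<omega>'
  proof -
    have "(\<lambda>l. mrg k \<omega> \<omega>' (i - int l)) = (\<lambda>l. glue f (\<omega>, \<omega>') (Some l))"
      by (auto simp: mrg_def glue_def f_def)
    moreover have "(\<lambda>l. mrg (k+1) \<omega> \<omega>' (i - int l)) = (\<lambda>l. if l = m then glue f (\<omega>, \<omega>') None else glue f (\<omega>, \<omega>') (Some l))"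
      by (rule ext) (auto simp: mrg_def glue_def f_def k)
    ultimately show ?thesis by (simp add: H_def Y_def)
  qed
  have bsec: "bmeas Q (\<lambda>\<omega>'. Y (mrg k \<omega> \<omega>') - Y (mrg (k+1) \<omega> \<omega>'))" if "\<omega> \<in> space Q" for \<omega>
    using that Y by (intro bmeas_intros bmeas_section)
  have bint: "bmeas Q (\<lambda>\<omega>. \<integral>\<omega>'. H (glue f (\<omega>, \<omega>')) \<partial>Q)"
  proof -
    obtain B where B: "B > 0" "\<And>x. \<bar>H x\<bar> \<le> B" using bH bmeasE by blast
    have [measurable]: "H \<in> borel_measurable seqs" using bH by (rule bmeas_measurable)
    have "\<bar>\<integral>\<omega>'. H (glue f (\<omega>, \<omega>')) \<partial>Q\<bar> \<le> B" for \<omega>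
    proof (cases "integrable Q (\<lambda>\<omega>'. H (glue f (\<omega>, \<omega>')))")
      case True
      have "\<bar>\<integral>\<omega>'. H (glue f (\<omega>, \<omega>')) \<partial>Q\<bar> \<le> (\<integral>\<omega>'. \<bar>H (glue f (\<omega>, \<omega>'))\<bar> \<partial>Q)"
        by (rule integral_abs_bound)
      also have "\<dots> \<le> (\<integral>\<omega>'. B \<partial>Q)"
        using True B by (intro integral_mono) auto
      finally show ?thesis by (simp add: Q.prob_space)
    qed (use B in \<open>simp add: not_integrable_integral_eq\<close>)
    then show ?thesis by (intro bmeasI) measurable
  qed
  have "(\<integral>\<omega>. \<bar>CE k Y \<omega> - CE (k+1) Y \<omega>\<bar> powr q \<partial>Q) \<le> (\<integral>\<omega>. (\<integral>\<omega>'. H (glue f (\<omega>, \<omega>')) \<partial>Q) \<partial>Q)"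
  proof (rule integral_mono)
    fix \<omega> assume \<omega>: "\<omega> \<in> space Q"
    have "CE k Y \<omega> - CE (k+1) Y \<omega> = (\<integral>\<omega>'. Y (mrg k \<omega> \<omega>') - Y (mrg (k+1) \<omega> \<omega>') \<partial>Q)"
      unfolding CE_def using Y \<omega> by (intro Bochner_Integration.integral_diff[symmetric] Q.bmeas_integrable bmeas_section)
    then have "\<bar>CE k Y \<omega> - CE (k+1) Y \<omega>\<bar> powr q \<le> (\<integral>\<omega>'. \<bar>Y (mrg k \<omega> \<omega>') - Y (mrg (k+1) \<omega> \<omega>')\<bar> powr q \<partial>Q)"
      using Q.bmeas_jensen[OF bsec[OF \<omega>] q] by simp
    also have "\<dots> = (\<integral>\<omega>'. H (glue f (\<omega>, \<omega>')) \<partial>Q)" by (simp add: HY)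
    finally show "\<bar>CE k Y \<omega> - CE (k+1) Y \<omega>\<bar> powr q \<le> (\<integral>\<omega>'. H (glue f (\<omega>, \<omega>')) \<partial>Q)" .
  qed (use Y bint q in \<open>auto intro!: Q.bmeas_integrable bmeas_intros\<close>)
  also have "\<dots> = (\<integral>x. H x \<partial>seqs)" by (rule integral_glue[OF f bH])
  finally show ?thesis by (simp add: H_def Y_def)
qed

lemma indep_vars_coordinates: "Q.indep_vars (\<lambda>_. \<nu>) (\<lambda>i \<omega>. \<omega> i) UNIV"
proof -
  have c: "distr Q \<nu> (\<lambda>\<omega>. \<omega> i) = \<nu>" for i
    using distr_PiM_component[of UNIV "\<lambda>_. \<nu>" i] base.prob_space_axioms by simp
  have "distr Q (\<Pi>\<^sub>M i\<in>UNIV. \<nu>) (\<lambda>x. \<lambda>i\<in>UNIV. x i) = distr Q Q (\<lambda>x. x)"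
    by (rule distr_cong) auto
  also have "\<dots> = (\<Pi>\<^sub>M i\<in>UNIV. distr Q \<nu> (\<lambda>\<omega>. \<omega> i))"
    by (simp add: distr_id c)
  finally show ?thesis by (subst Q.indep_vars_iff_distr_eq_PiM) auto
qed

text \<open>A function that depends on the coordinates in \<open>K j\<close> becomes a function of
  the restricted sequence once a fixed point \<open>e\<close> of the space is filled in elsewhere;
  restrictions to disjoint sets are independent.\<close>

lemma indep_vars_blocks:
  fixes F :: "'l \<Rightarrow> (int \<Rightarrow> 'e) \<Rightarrow> real"
  assumes F: "\<And>j. j \<in> L \<Longrightarrow> F j \<in> borel_measurable Q" and dep: "\<And>j. j \<in> L \<Longrightarrow> depends_on (K j) (F j)"
    and K: "disjoint_family_on K L"
  shows "Q.indep_vars (\<lambda>_. borel) F L"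
proof -
  obtain e where e: "e \<in> space \<nu>" using base.not_empty by auto
  define G where "G = (\<lambda>j x. F j (\<lambda>i. if i \<in> K j then x i else e))"
  have "Q.indep_vars (\<lambda>j. PiM (K j) (\<lambda>_. \<nu>)) (\<lambda>j \<omega>. restrict (\<lambda>i. \<omega> i) (K j)) L"
    by (rule Q.indep_vars_restrict[OF indep_vars_coordinates _ K]) auto
  then have "Q.indep_vars (\<lambda>_. borel) (\<lambda>j \<omega>. G j (restrict (\<lambda>i. \<omega> i) (K j))) L"
  proof (rule Q.indep_vars_compose2)
    fix j assume j: "j \<in> L"
    have "(\<lambda>x i. if i \<in> K j then x i else e) \<in> PiM (K j) (\<lambda>_. \<nu>) \<rightarrow>\<^sub>M Q"
    proof (rule measurable_PiM_single')
      fix i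
      show "(\<lambda>x. if i \<in> K j then x i else e) \<in> PiM (K j) (\<lambda>_. \<nu>) \<rightarrow>\<^sub>M \<nu>"
        using e by (cases "i \<in> K j") auto
    qed (use e in \<open>auto simp: space_PiM PiE_iff\<close>)
    then show "G j \<in> PiM (K j) (\<lambda>_. \<nu>) \<rightarrow>\<^sub>M borel"
      unfolding G_def using F[OF j] by (rule measurable_compose)
  qed
  moreover have "G j (restrict (\<lambda>i. \<omega> i) (K j)) = F j \<omega>" if "j \<in> L" for j \<omega>
    unfolding G_def using dep[OF that] by (rule depends_onD) auto
  ultimately show ?thesis
    by (subst Q.indep_vars_cong[OF refl, of L F "\<lambda>j \<omega>. G j (restrict (\<lambda>i. \<omega> i) (K j))" "\<lambda>_. borel" "\<lambda>_. borel"]) (auto simp: fun_eq_iff)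
qed

section \<open>Conditional expectations approximate in L^1\<close>

definition L1dist :: "((int \<Rightarrow> 'e) \<Rightarrow> real) \<Rightarrow> int \<Rightarrow> real" where
  "L1dist f k = (\<integral>\<omega>. \<bar>f \<omega> - CE k f \<omega>\<bar> \<partial>Q)"

lemma CE_contract:
  assumes f: "bmeas Q f"
  shows "(\<integral>\<omega>. \<bar>CE k f \<omega>\<bar> \<partial>Q) \<le> (\<integral>\<omega>. \<bar>f \<omega>\<bar> \<partial>Q)"
proof -
  have "(\<integral>\<omega>. \<bar>CE k f \<omega>\<bar> \<partial>Q) \<le> (\<integral>\<omega>. CE k (\<lambda>\<omega>. \<bar>f \<omega>\<bar>) \<omega> \<partial>Q)"
  proof (intro integral_mono Q.bmeas_integrable bmeas_intros f)
    fix \<omega>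
    show "\<bar>CE k f \<omega>\<bar> \<le> CE k (\<lambda>\<omega>. \<bar>f \<omega>\<bar>) \<omega>"
      unfolding CE_def by (rule integral_abs_bound)
  qed
  also have "\<dots> = (\<integral>\<omega>. \<bar>f \<omega>\<bar> \<partial>Q)" by (intro integral_CE bmeas_intros f)
  finally show ?thesis .
qed

lemma CE_add:
  assumes "bmeas Q f" "bmeas Q g" "\<omega> \<in> space Q"
  shows "CE k (\<lambda>\<omega>. f \<omega> + g \<omega>) \<omega> = CE k f \<omega> + CE k g \<omega>"
  unfolding CE_def using assms
  by (intro Bochner_Integration.integral_add Q.bmeas_integrable bmeas_section)

lemma CE_diff:
  assumes "bmeas Q f" "bmeas Q g" "\<omega> \<in> space Q"
  shows "CE k (\<lambda>\<omega>. f \<omega> - g \<omega>) \<omega> = CE k f \<omega> - CE k g \<omega>"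
  unfolding CE_def using assms
  by (intro Bochner_Integration.integral_diff Q.bmeas_integrable bmeas_section)

lemma CE_cmult: "CE k (\<lambda>\<omega>. c * f \<omega>) \<omega> = c * CE k f \<omega>"
  by (simp add: CE_def)

lemma L1dist_nonneg: "L1dist f k \<ge> 0"
  by (simp add: L1dist_def)

lemma L1dist_add:
  assumes "bmeas Q f" "bmeas Q g"
  shows "L1dist (\<lambda>\<omega>. f \<omega> + g \<omega>) k \<le> L1dist f k + L1dist g k"
proof -
  have "L1dist (\<lambda>\<omega>. f \<omega> + g \<omega>) k \<le> (\<integral>\<omega>. \<bar>f \<omega> - CE k f \<omega>\<bar> + \<bar>g \<omega> - CE k g \<omega>\<bar> \<partial>Q)"
    unfolding L1dist_def
    by (intro integral_mono Q.bmeas_integrable bmeas_intros assms) (auto simp: CE_add[OF assms])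
  also have "\<dots> = L1dist f k + L1dist g k"
    unfolding L1dist_def
    by (intro Bochner_Integration.integral_add Q.bmeas_integrable bmeas_intros assms)
  finally show ?thesis .
qed

lemma L1dist_cmult: "L1dist (\<lambda>\<omega>. c * f \<omega>) k = \<bar>c\<bar> * L1dist f k"
  by (simp add: L1dist_def CE_cmult right_diff_distrib[symmetric] abs_mult)

text \<open>Write f as g + (f - g); conditional expectation contracts the L^1 norm, so the second
  part counts at most twice.\<close>

lemma L1dist_perturb:
  assumes f: "bmeas Q f" and g: "bmeas Q g"
  shows "L1dist f k \<le> L1dist g k + 2 * (\<integral>\<omega>. \<bar>f \<omega> - g \<omega>\<bar> \<partial>Q)"
proof -
  have b: "bmeas Q (\<lambda>\<omega>. f \<omega> - g \<omega>)" using f g by (intro bmeas_intros)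
  have "L1dist (\<lambda>\<omega>. f \<omega> - g \<omega>) k \<le> (\<integral>\<omega>. \<bar>f \<omega> - g \<omega>\<bar> + \<bar>CE k (\<lambda>\<omega>. f \<omega> - g \<omega>) \<omega>\<bar> \<partial>Q)"
    unfolding L1dist_def by (intro integral_mono Q.bmeas_integrable bmeas_intros b) linarith
  also have "\<dots> = (\<integral>\<omega>. \<bar>f \<omega> - g \<omega>\<bar> \<partial>Q) + (\<integral>\<omega>. \<bar>CE k (\<lambda>\<omega>. f \<omega> - g \<omega>) \<omega>\<bar> \<partial>Q)"
    by (intro Bochner_Integration.integral_add Q.bmeas_integrable bmeas_intros b)
  also have "\<dots> \<le> 2 * (\<integral>\<omega>. \<bar>f \<omega> - g \<omega>\<bar> \<partial>Q)" using CE_contract[OF b, of k] by simp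
  finally show ?thesis using L1dist_add[OF g b, of k] by simp
qed

text \<open>Dynkin's argument. A cylinder set involves finitely many coordinates, so its distance is
  0 once k lies below all of them; a complement has the same distance; a disjoint union is
  approximated in measure by finite unions, for which the distances add.\<close>

lemma L1dist_indicator:
  assumes A: "A \<in> sets Q"
  shows "(L1dist (indicator A) \<longlongrightarrow> 0) at_bot"
proof -
  let ?P = "\<lambda>A. (L1dist (indicator A) \<longlongrightarrow> 0) at_bot"
  let ?G = "prod_algebra (UNIV :: int set) (\<lambda>_. \<nu>)"
  have sp: "sigma_sets (space Q) ?G = sets Q" by (simp add: sets_PiM space_PiM)
  have "Int_stable ?G" by (rule Int_stable_prod_algebra)
  moreover have "?G \<subseteq> Pow (space Q)" by (simp add: space_PiM prod_algebra_sets_into_space)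
  moreover have "A \<in> sigma_sets (space Q) ?G" using A by (simp add: sp)
  ultimately show ?thesis
  proof (induction rule: sigma_sets_induct_disjoint)
    fix B assume B: "B \<in> ?G"
    obtain J F where J: "finite J" "\<And>i. i \<in> J \<Longrightarrow> F i \<in> sets \<nu>" "B = prod_emb UNIV (\<lambda>_. \<nu>) J (Pi\<^sub>E J F)"
      using prod_algebraE[OF B] by blast
    have zero: "L1dist (indicator B) k = 0" if k: "\<And>i. i \<in> J \<Longrightarrow> k \<le> i" for k
    proof -
      have "CE k (indicator B) \<omega> = indicator B \<omega>" if \<omega>: "\<omega> \<in> space Q" for \<omega>
      proof -
        have "indicator B (mrg k \<omega> \<omega>') = (indicator B \<omega> :: real)" if "\<omega>' \<in> space Q" for \<omega>'
          using \<omega> that k by (auto simp: J(3) indicator_def prod_emb_def space_PiM PiE_iff mrg_def)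
        then have "CE k (indicator B) \<omega> = (\<integral>\<omega>'. indicator B \<omega> \<partial>Q)"
          unfolding CE_def by (intro Bochner_Integration.integral_cong) auto
        then show ?thesis by (simp add: Q.prob_space)
      qed
      then have "L1dist (indicator B) k = (\<integral>\<omega>. 0 \<partial>Q)"
        unfolding L1dist_def by (intro Bochner_Integration.integral_cong) auto
      then show ?thesis by simp
    qed
    have "\<forall>\<^sub>F k in at_bot. L1dist (indicator B) k = 0"
      unfolding eventually_at_bot_linorder
      using J(1) by (intro exI[of _ "Min (insert 0 J)"]) (auto intro!: zero)
    then show "?P B" by (rule tendsto_eventually)
  next
    have "L1dist (indicator {}) = (\<lambda>_. 0)" by (simp add: L1dist_def CE_def fun_eq_iff)
    then show "?P {}" by simp
  next
    fix B assume B: "B \<in> sigma_sets (space Q) ?G" "?P B"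
    then have sB: "B \<in> sets Q" by (simp add: sp)
    have "L1dist (indicator (space Q - B)) = L1dist (indicator B)"
    proof
      fix k
      have mi: "\<omega> \<in> space Q \<Longrightarrow> \<omega>' \<in> space Q \<Longrightarrow> mrg k \<omega> \<omega>' \<in> space Q" for \<omega> \<omega>'
        by (auto simp: mrg_def space_PiM PiE_iff)
      have "CE k (indicator (space Q - B)) \<omega> = 1 - CE k (indicator B) \<omega>" if "\<omega> \<in> space Q" for \<omega>
      proof -
        have "CE k (indicator (space Q - B)) \<omega> = CE k (\<lambda>\<omega>. 1 - indicator B \<omega>) \<omega>"
          unfolding CE_def using that mi by (intro Bochner_Integration.integral_cong) (auto simp: indicator_def)
        then show ?thesis using CE_diff[OF bmeas_const bmeas_indicator[OF sB] that, of k 1] by (simp add: CE_const)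
      qed
      then show "L1dist (indicator (space Q - B)) k = L1dist (indicator B) k"
        unfolding L1dist_def by (intro Bochner_Integration.integral_cong) (auto simp: indicator_def abs_minus_commute)
    qed
    then show "?P (space Q - B)" using B by simp
  next
    fix B :: "nat \<Rightarrow> (int \<Rightarrow> 'e) set"
    assume disj: "disjoint_family B" and rB: "range B \<subseteq> sigma_sets (space Q) ?G" and PB: "\<And>i. ?P (B i)"
    have sB: "B i \<in> sets Q" for i using rB sp by auto
    show "?P (\<Union>i. B i)"
    proof (rule tendstoI)
      fix e :: real assume e: "e > 0"
      have "(\<lambda>n. measure Q (\<Union>i<n. B i)) \<longlonglongrightarrow> measure Q (\<Union>n. \<Union>i<n. B i)"
        using sB by (intro Q.finite_Lim_measure_incseq incseq_SucI) (auto simp: less_Suc_eq)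
      also have "(\<Union>n. \<Union>i<n. B i) = (\<Union>i. B i)" by blast
      finally obtain n where n: "dist (measure Q (\<Union>i<n. B i)) (measure Q (\<Union>i. B i)) < e/4"
        using e unfolding lim_sequentially by (metis divide_pos_pos order_refl zero_less_numeral)
      define g where "g = (\<lambda>\<omega>. \<Sum>i<n. indicator (B i) \<omega> :: real)"
      have bg: "bmeas Q g" unfolding g_def by (intro bmeas_intros sB)
      have bU: "bmeas Q (indicator (\<Union>i. B i))" using sB by (intro bmeas_intros) auto
      have g_eq: "g \<omega> = indicator (\<Union>i<n. B i) \<omega>" for \<omega>
        unfolding g_def using disj
        by (subst indicator_UN_disjoint[symmetric]) (auto simp: disjoint_family_on_def)
      have "(\<integral>\<omega>. \<bar>indicator (\<Union>i. B i) \<omega> - g \<omega>\<bar> \<partial>Q) = (\<integral>\<omega>. indicator (\<Union>i. B i) \<omega> - indicator (\<Union>i<n. B i) \<omega> \<partial>Q)"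
        unfolding g_eq by (intro Bochner_Integration.integral_cong) (auto simp: indicator_def)
      also have "\<dots> = measure Q (\<Union>i. B i) - measure Q (\<Union>i<n. B i)"
        using sB by (subst Bochner_Integration.integral_diff) (auto intro!: Q.bmeas_integrable bmeas_intros)
      also have "\<dots> < e/4" using n unfolding dist_real_def by linarith
      finally have d: "(\<integral>\<omega>. \<bar>indicator (\<Union>i. B i) \<omega> - g \<omega>\<bar> \<partial>Q) < e/4" .
      have gsum: "L1dist (\<lambda>\<omega>. \<Sum>i<m. indicator (B i) \<omega>) k \<le> (\<Sum>i<m. L1dist (indicator (B i)) k)" for m k
      proof (induction m)
        case 0
        show ?case by (simp add: L1dist_def CE_def)
      next
        case (Suc m)
        have "L1dist (\<lambda>\<omega>. (\<Sum>i<m. indicator (B i) \<omega>) + indicator (B m) \<omega>) k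
           \<le> L1dist (\<lambda>\<omega>. \<Sum>i<m. indicator (B i) \<omega>) k + L1dist (indicator (B m)) k"
          by (intro L1dist_add bmeas_intros sB)
        with Suc show ?case by simp
      qed
      have "((\<lambda>k. \<Sum>i<n. L1dist (indicator (B i)) k) \<longlongrightarrow> (\<Sum>i<n. 0)) at_bot"
        using PB by (intro tendsto_sum)
      then have "\<forall>\<^sub>F k in at_bot. (\<Sum>i<n. L1dist (indicator (B i)) k) < e/2"
        using e by (intro order_tendstoD(2)[of _ 0]) auto
      then show "\<forall>\<^sub>F k in at_bot. dist (L1dist (indicator (\<Union>i. B i)) k) 0 < e"
      proof eventually_elim
        case (elim k)
        have "L1dist (indicator (\<Union>i. B i)) k \<le> L1dist g k + 2 * (\<integral>\<omega>. \<bar>indicator (\<Union>i. B i) \<omega> - g \<omega>\<bar> \<partial>Q)"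
          by (rule L1dist_perturb[OF bU bg])
        also have "\<dots> < e/2 + 2 * (e/4)"
          using elim d gsum[of n k] by (simp add: g_def)
        finally show ?case using L1dist_nonneg[of "indicator (\<Union>i. B i)" k] by simp
      qed
    qed
  qed
qed

text \<open>This replaces the martingale convergence theorem.\<close>

lemma L1dist_tendsto:
  assumes f: "bmeas Q f"
  shows "(L1dist f \<longlongrightarrow> 0) at_bot"
proof (rule tendstoI)
  fix e :: real assume e: "e > 0"
  obtain B where B: "B > 0" "\<And>x. \<bar>f x\<bar> \<le> B" using f bmeasE by blast
  have [measurable]: "f \<in> borel_measurable Q" using f by (rule bmeas_measurable)
  \<comment> \<open>Rounding down to multiples of 1/N turns \<open>f\<close> into a finite
    combination of indicators within 1/N < e/4. By \<open>L1dist_perturb\<close> this costs e/2 and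
    leaves e/2 for the indicators.\<close>
  define N where "N = nat \<lceil>4 / e\<rceil> + 1"
  have N: "real N > 4 / e" "N > 0" unfolding N_def by linarith+
  define I where "I = {- \<lceil>real N * B\<rceil> - 1 .. \<lceil>real N * B\<rceil>}"
  define A where "A = (\<lambda>j. {\<omega>\<in>space Q. \<lfloor>real N * f \<omega>\<rfloor> = j})"
  have sA: "A j \<in> sets Q" for j unfolding A_def by measurable
  define g where "g = (\<lambda>\<omega>. \<Sum>j\<in>I. of_int j / real N * indicator (A j) \<omega>)"
  have bg: "bmeas Q g" unfolding g_def by (intro bmeas_intros sA)
  have gval: "g \<omega> = of_int \<lfloor>real N * f \<omega>\<rfloor> / real N" if \<omega>: "\<omega> \<in> space Q" for \<omega>
  proof -
    have "\<bar>real N * f \<omega>\<bar> \<le> real N * B" using B(2)[of \<omega>] by (simp add: abs_mult mult_left_mono)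
    then have "\<lfloor>real N * f \<omega>\<rfloor> \<in> I" unfolding I_def by (simp; linarith)
    moreover have "g \<omega> = (\<Sum>j\<in>I. if j = \<lfloor>real N * f \<omega>\<rfloor> then of_int j / real N else 0)"
      unfolding g_def using \<omega> by (intro sum.cong) (auto simp: A_def indicator_def)
    moreover have "finite I" by (simp add: I_def)
    ultimately show ?thesis by simp
  qed
  have close: "\<bar>f \<omega> - g \<omega>\<bar> \<le> 1 / real N" if \<omega>: "\<omega> \<in> space Q" for \<omega>
  proof -
    have "f \<omega> - g \<omega> = (real N * f \<omega> - of_int \<lfloor>real N * f \<omega>\<rfloor>) / real N"
      using N by (simp add: gval[OF \<omega>] diff_divide_distrib)
    moreover have "\<bar>real N * f \<omega> - of_int \<lfloor>real N * f \<omega>\<rfloor>\<bar> \<le> 1" by linarith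
    ultimately show ?thesis using N by (simp add: divide_right_mono)
  qed
  have "(\<integral>\<omega>. \<bar>f \<omega> - g \<omega>\<bar> \<partial>Q) \<le> (\<integral>\<omega>. 1 / real N \<partial>Q)"
    using close by (intro integral_mono Q.bmeas_integrable bmeas_intros f bg) auto
  also have "\<dots> < e / 4" using N e by (simp add: Q.prob_space field_simps)
  finally have d: "(\<integral>\<omega>. \<bar>f \<omega> - g \<omega>\<bar> \<partial>Q) < e / 4" .
  have fin: "finite I" by (simp add: I_def)
  have gsum: "finite I' \<Longrightarrow> L1dist (\<lambda>\<omega>. \<Sum>j\<in>I'. of_int j / real N * indicator (A j) \<omega>) k \<le> (\<Sum>j\<in>I'. \<bar>of_int j / real N\<bar> * L1dist (indicator (A j)) k)" for I' k
  proof (induction I' rule: finite_induct)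
    case empty
    show ?case by (simp add: L1dist_def CE_def)
  next
    case (insert j I')
    have "L1dist (\<lambda>\<omega>. of_int j / real N * indicator (A j) \<omega> + (\<Sum>j\<in>I'. of_int j / real N * indicator (A j) \<omega>)) k
       \<le> L1dist (\<lambda>\<omega>. of_int j / real N * indicator (A j) \<omega>) k + L1dist (\<lambda>\<omega>. \<Sum>j\<in>I'. of_int j / real N * indicator (A j) \<omega>) k"
      by (intro L1dist_add bmeas_intros sA)
    also have "L1dist (\<lambda>\<omega>. of_int j / real N * indicator (A j) \<omega>) k = \<bar>of_int j / real N\<bar> * L1dist (indicator (A j)) k"
      by (rule L1dist_cmult)
    finally show ?case using insert by simp
  qed
  have "((\<lambda>k. \<Sum>j\<in>I. \<bar>of_int j / real N\<bar> * L1dist (indicator (A j)) k) \<longlongrightarrow> (\<Sum>j\<in>I. \<bar>of_int j / real N\<bar> * 0)) at_bot"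
    by (intro tendsto_sum tendsto_mult tendsto_const L1dist_indicator sA)
  then have "\<forall>\<^sub>F k in at_bot. (\<Sum>j\<in>I. \<bar>of_int j / real N\<bar> * L1dist (indicator (A j)) k) < e/2"
    using e by (intro order_tendstoD(2)[of _ 0]) auto
  then show "\<forall>\<^sub>F k in at_bot. dist (L1dist f k) 0 < e"
  proof eventually_elim
    case (elim k)
    have "L1dist f k \<le> L1dist g k + 2 * (\<integral>\<omega>. \<bar>f \<omega> - g \<omega>\<bar> \<partial>Q)"
      by (rule L1dist_perturb[OF f bg])
    also have "\<dots> < e/2 + 2 * (e/4)"
      using elim d gsum[OF fin, of k] by (simp add: g_def)
    finally show ?case using L1dist_nonneg[of f k] by simp
  qed
qed

end

section \<open>Dyadic decomposition of a causal process\<close>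

text \<open>The index type \<open>nat option\<close> holds one past, ordered by lag, and a spare
  innovation \<open>None\<close> that replaces the one at lag \<open>m\<close>. Boundedness is
  obtained by clipping and is removed again in \<open>Sdev_trunc_sq\<close>.\<close>

locale coupled_seq = iid_space \<nu> for \<nu> :: "'e measure" +
  fixes h :: "(nat \<Rightarrow> 'e) \<Rightarrow> real" and \<delta> :: "nat \<Rightarrow> real" and q :: real
  assumes q: "q > 2"
    and h: "bmeas seqs h"
    and h_centered: "(\<integral>x. h x \<partial>seqs) = 0"
    and \<delta>_nonneg: "\<delta> m \<ge> 0"
    and coupling: "(\<integral>x. \<bar>h (\<lambda>l. x (Some l)) - h (\<lambda>l. if l = m then x None else x (Some l))\<bar> powr q \<partial>seqs) \<le> \<delta> m powr q"
begin

text \<open>Shifted by one: \<open>Y i\<close> is the observation at time i + 1, so that i < n runs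
  through the times 1 to n.\<close>

definition Y :: "nat \<Rightarrow> (int \<Rightarrow> 'e) \<Rightarrow> real" where
  "Y i \<omega> = h (\<lambda>l. \<omega> (int i + 1 - int l))"

text \<open>The part of \<open>Y i\<close> that is due to the innovation at lag \<open>m\<close>.\<close>

definition D :: "nat \<Rightarrow> nat \<Rightarrow> (int \<Rightarrow> 'e) \<Rightarrow> real" where
  "D m i \<omega> = CE (int i + 1 - int m) (Y i) \<omega> - CE (int i + 1 - int m + 1) (Y i) \<omega>"

lemma bmeas_Y [bmeas_intros]: "bmeas Q (Y i)"
proof -
  have [measurable]: "h \<in> borel_measurable seqs" using h by (rule bmeas_measurable)
  have "(\<lambda>\<omega> l. \<omega> (int i + 1 - int l)) \<in> Q \<rightarrow>\<^sub>M seqs"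
    by (rule measurable_PiM_single') (auto simp: space_PiM PiE_iff)
  then have "Y i \<in> borel_measurable Q" unfolding Y_def by measurable
  then show ?thesis using h by (auto simp: bmeas_def Y_def)
qed

lemma bmeas_D [bmeas_intros]: "bmeas Q (D m i)"
  unfolding D_def by (intro bmeas_intros)

lemma depends_on_Y: "depends_on {..int i + 1} (Y i)"
  unfolding depends_on_def Y_def by (intro allI impI arg_cong[of _ _ h] ext) auto

lemma depends_on_D: "depends_on {int i + 1 - int m..int i + 1} (D m i)"
proof -
  have "depends_on {int i + 1 - int m..int i + 1} (CE k (Y i))" if "k \<ge> int i + 1 - int m" for k
    using depends_on_CE[OF depends_on_Y, of i k] by (rule depends_on_mono) (use that in auto)
  from this[of "int i + 1 - int m"] this[of "int i + 1 - int m + 1"]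
  have "depends_on {int i + 1 - int m..int i + 1} (CE (int i + 1 - int m) (Y i))"
    "depends_on {int i + 1 - int m..int i + 1} (CE (int i + 1 - int m + 1) (Y i))" by simp_all
  then show ?thesis
    unfolding D_def depends_on_def by (intro allI impI arg_cong2[where f = "(-)"]) blast+
qed

lemma integral_Y: "(\<integral>\<omega>. Y i \<omega> \<partial>Q) = 0"
proof -
  have [measurable]: "h \<in> borel_measurable seqs" using h by (rule bmeas_measurable)
  have eq: "distr Q (\<Pi>\<^sub>M l\<in>UNIV. \<nu>) (\<lambda>\<omega>. \<lambda>l\<in>UNIV. \<omega> (int i + 1 - int l)) = (\<Pi>\<^sub>M l\<in>(UNIV::nat set). \<nu>)"
    using base.prob_space_axioms
    by (intro distr_PiM_reindex[where M = "\<lambda>_. \<nu>" and f = "\<lambda>l::nat. int i + 1 - int l" and K = UNIV]) (auto simp: inj_on_def)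
  have "(\<integral>x. h x \<partial>seqs) = (\<integral>x. h x \<partial>distr Q seqs (\<lambda>\<omega> l. \<omega> (int i + 1 - int l)))"
    by (simp only: eq[unfolded restrict_UNIV])
  also have "\<dots> = (\<integral>\<omega>. Y i \<omega> \<partial>Q)"
    unfolding Y_def
    by (intro integral_distr) (auto intro!: measurable_PiM_single' simp: space_PiM PiE_iff)
  finally show ?thesis by (simp add: h_centered)
qed

text \<open>Innovations from time i + 2 on carry no information about \<open>Y i\<close>; the
  telescoping sum over lags therefore starts at the mean, which is 0.\<close>

lemma CE_Y_top: "CE (int i + 2) (Y i) \<omega> = 0"
proof -
  have "Y i (mrg (int i + 2) \<omega> \<omega>') = Y i \<omega>'" for \<omega>'
    using depends_on_Y by (rule depends_onD) (auto simp: mrg_def)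
  then show ?thesis by (simp add: CE_def integral_Y)
qed

lemma sum_D: "(\<Sum>m<N. D m i \<omega>) = CE (int i + 2 - int N) (Y i) \<omega>"
proof (induction N)
  case (Suc N)
  then show ?case by (simp add: D_def algebra_simps)
qed (simp add: CE_Y_top)

lemma integral_D: "(\<integral>\<omega>. D m i \<omega> \<partial>Q) = 0"
  unfolding D_def
  by (subst Bochner_Integration.integral_diff) (auto intro!: Q.bmeas_integrable bmeas_intros simp: integral_CE bmeas_Y)

lemma D_moment: "(\<integral>\<omega>. \<bar>D m i \<omega>\<bar> powr q \<partial>Q) \<le> \<delta> m powr q"
proof -
  have "(\<integral>\<omega>. \<bar>D m i \<omega>\<bar> powr q \<partial>Q) \<le>
    (\<integral>x. \<bar>h (\<lambda>l. x (Some l)) - h (\<lambda>l. if l = m then x None else x (Some l))\<bar> powr q \<partial>seqs)"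
    unfolding D_def Y_def using h q by (intro CE_diff_powr_le) auto
  also note coupling
  finally show ?thesis .
qed

lemma sum_rev: "(\<Sum>i\<in>{u..<v}. f i) = (\<Sum>j<v - u. f (v - 1 - j))" for u v :: nat and f :: "nat \<Rightarrow> real"
  by (rule sum.reindex_bij_witness[of _ "\<lambda>j. v - 1 - j" "\<lambda>i. v - 1 - i"]) auto

text \<open>For fixed lag the projections are martingale differences when time runs backwards.\<close>

lemma sum_D_moment:
  "(\<integral>\<omega>. \<bar>\<Sum>i\<in>{u..<v}. D m i \<omega>\<bar> powr q \<partial>Q) \<le> (mart_const q * sqrt (real (v - u)) * \<delta> m) powr q"
  unfolding sum_rev
proof (rule Q.martingale_moment[OF q \<delta>_nonneg])
  fix j assume j: "j < v - u"
  define k where "k = int (v - 1 - j) + 1 - int m"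
  define F where "F = (\<lambda>\<omega>. sgn (\<Sum>i<j. D m (v - 1 - i) \<omega>) * \<bar>\<Sum>i<j. D m (v - 1 - i) \<omega>\<bar> powr (q - 1))"
  have bF: "bmeas Q F" unfolding F_def using q by (intro bmeas_intros) auto
  \<comment> \<open>The terms already summed belong to later times, so their windows start at k + 1
    or later. The two projections that make up the next difference thus have the same integral
    against \<open>F\<close>.\<close>
  have Deq: "D m (v - 1 - i) \<omega> = D m (v - 1 - i) \<omega>'" if "i < j" "\<forall>i\<in>{k + 1..}. \<omega> i = \<omega>' i" for i \<omega> \<omega>'
    using depends_on_D by (rule depends_onD) (use that j in \<open>auto simp: k_def\<close>)
  have Seq: "(\<Sum>i<j. D m (v - 1 - i) \<omega>) = (\<Sum>i<j. D m (v - 1 - i) \<omega>')" if "\<forall>i\<in>{k + 1..}. \<omega> i = \<omega>' i" for \<omega> \<omega>'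
    using that by (intro sum.cong refl Deq) auto
  have "depends_on {k + 1..} F"
    unfolding depends_on_def F_def
  proof (intro allI impI)
    fix \<omega> \<omega>' :: "int \<Rightarrow> 'e" assume "\<forall>i\<in>{k + 1..}. \<omega> i = \<omega>' i"
    from Seq[OF this]
    show "sgn (\<Sum>i<j. D m (v - 1 - i) \<omega>) * \<bar>\<Sum>i<j. D m (v - 1 - i) \<omega>\<bar> powr (q - 1) =
        sgn (\<Sum>i<j. D m (v - 1 - i) \<omega>') * \<bar>\<Sum>i<j. D m (v - 1 - i) \<omega>'\<bar> powr (q - 1)"
      by (simp only:)
  qed
  then have dF: "depends_on {k + 1..} F" "depends_on {k..} F" by (auto elim: depends_on_mono)
  have "(\<integral>\<omega>. F \<omega> * D m (v - 1 - j) \<omega> \<partial>Q) =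
      (\<integral>\<omega>. F \<omega> * CE k (Y (v - 1 - j)) \<omega> - F \<omega> * CE (k + 1) (Y (v - 1 - j)) \<omega> \<partial>Q)"
    by (simp add: D_def k_def right_diff_distrib)
  also have "\<dots> = (\<integral>\<omega>. F \<omega> * CE k (Y (v - 1 - j)) \<omega> \<partial>Q) - (\<integral>\<omega>. F \<omega> * CE (k + 1) (Y (v - 1 - j)) \<omega> \<partial>Q)"
    by (intro Bochner_Integration.integral_diff Q.bmeas_integrable bmeas_intros bF)
  also have "\<dots> = 0"
    by (simp add: integral_mult_CE[OF bF dF(1) bmeas_Y] integral_mult_CE[OF bF dF(2) bmeas_Y])
  finally show "(\<integral>\<omega>. sgn (\<Sum>i<j. D m (v - 1 - i) \<omega>) * \<bar>\<Sum>i<j. D m (v - 1 - i) \<omega>\<bar> powr (q - 1) * D m (v - 1 - j) \<omega> \<partial>Q) = 0"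
    by (simp add: F_def)
qed (auto intro!: bmeas_intros D_moment)

lemma double_sum_D_moment:
  assumes "finite \<Lambda>"
  shows "(\<integral>\<omega>. \<bar>\<Sum>i\<in>{u..<v}. \<Sum>m\<in>\<Lambda>. D m i \<omega>\<bar> powr q \<partial>Q) \<le> (mart_const q * sqrt (real (v - u)) * (\<Sum>m\<in>\<Lambda>. \<delta> m)) powr q"
proof -
  have "(\<integral>\<omega>. \<bar>\<Sum>m\<in>\<Lambda>. (\<Sum>i\<in>{u..<v}. D m i \<omega>)\<bar> powr q \<partial>Q) \<le> (\<Sum>m\<in>\<Lambda>. mart_const q * sqrt (real (v - u)) * \<delta> m) powr q"
    using q assms mart_const_ge_1[OF q] \<delta>_nonneg
    by (intro Q.bmeas_minkowski sum_D_moment bmeas_intros) auto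
  then show ?thesis
    by (subst sum.swap) (simp add: sum_distrib_left)
qed

text \<open>By integer division level 0 is the single lag 0; for l > 0 the level consists of the
  lags from 2^(l-1) to 2^l - 1.\<close>

definition level :: "nat \<Rightarrow> nat set" where
  "level l = {2 ^ l div 2..<2 ^ l}"

lemma finite_level [simp]: "finite (level l)"
  by (simp add: level_def)

lemma sum_levels: "(\<Sum>l\<le>L. \<Sum>m\<in>level l. f m) = (\<Sum>m<2 ^ L. f m)" for f :: "nat \<Rightarrow> real"
proof (induction L)
  case 0
  show ?case by (simp add: level_def lessThan_def atLeastLessThan_def)
next
  case (Suc L)
  have lev: "level (Suc L) = {2 ^ L..<2 ^ Suc L}" by (simp add: level_def)
  have le: "(2::nat) ^ L \<le> 2 ^ Suc L" by simp
  have un: "{..<2 ^ Suc L} = {..<2 ^ L} \<union> level (Suc L)"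
    unfolding lev using ivl_disj_un_one(2)[OF le] by simp
  have "sum f ({..<2 ^ L} \<union> level (Suc L)) = (\<Sum>m<2 ^ L. f m) + (\<Sum>m\<in>level (Suc L). f m)"
    by (rule sum.union_disjoint) (auto simp: lev)
  then have "(\<Sum>m<2 ^ Suc L. f m) = (\<Sum>m<2 ^ L. f m) + (\<Sum>m\<in>level (Suc L). f m)"
    by (simp only: un)
  then show ?case using Suc by simp
qed

section \<open>Blocks on one dyadic level\<close>

definition V :: "nat \<Rightarrow> nat \<Rightarrow> (int \<Rightarrow> 'e) \<Rightarrow> real" where
  "V l i \<omega> = (\<Sum>m\<in>level l. D m i \<omega>)"

definition block :: "nat \<Rightarrow> nat \<Rightarrow> nat \<Rightarrow> (int \<Rightarrow> 'e) \<Rightarrow> real" where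
  "block n l b \<omega> = (\<Sum>i\<in>{b * 2 ^ l..<min n (b * 2 ^ l + 2 ^ l)}. V l i \<omega>)"

lemma bmeas_V [bmeas_intros]: "bmeas Q (V l i)"
  unfolding V_def by (intro bmeas_intros)

lemma bmeas_block [bmeas_intros]: "bmeas Q (block n l b)"
  unfolding block_def by (intro bmeas_intros)

lemma depends_on_block:
  "depends_on {int b * 2 ^ l - 2 ^ l<..int b * 2 ^ l + 2 ^ l} (block n l b)"
  unfolding depends_on_def
proof (intro allI impI)
  fix \<omega> \<omega>' :: "int \<Rightarrow> 'e" assume eq: "\<forall>i\<in>{int b * 2 ^ l - 2 ^ l<..int b * 2 ^ l + 2 ^ l}. \<omega> i = \<omega>' i"
  show "block n l b \<omega> = block n l b \<omega>'"
    unfolding block_def V_def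
  proof (intro sum.cong refl)
    fix i m assume i: "i \<in> {b * 2 ^ l..<min n (b * 2 ^ l + 2 ^ l)}" and m: "m \<in> level l"
    have "m < 2 ^ l" using m by (simp add: level_def)
    then have m2: "int m < 2 ^ l" by (metis of_nat_less_iff of_nat_numeral of_nat_power)
    have "int (b * 2 ^ l) \<le> int i" "int i < int (b * 2 ^ l + 2 ^ l)"
      using i by (auto simp del: of_nat_power of_nat_mult of_nat_add)
    then have i2: "int b * 2 ^ l \<le> int i" "int i < int b * 2 ^ l + 2 ^ l" by simp_all
    have "{int i + 1 - int m..int i + 1} \<subseteq> {int b * 2 ^ l - 2 ^ l<..int b * 2 ^ l + 2 ^ l}"
    proof
      fix x assume "x \<in> {int i + 1 - int m..int i + 1}"
      then have x: "int i + 1 - int m \<le> x" "x \<le> int i + 1" by auto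
      have "int b * 2 ^ l - 2 ^ l < x" using x m2 i2 by linarith
      moreover have "x \<le> int b * 2 ^ l + 2 ^ l" using x i2 by linarith
      ultimately show "x \<in> {int b * 2 ^ l - 2 ^ l<..int b * 2 ^ l + 2 ^ l}" by simp
    qed
    then show "D m i \<omega> = D m i \<omega>'"
      using depends_on_D[of i m] eq by (auto intro!: depends_onD[of _ "D m i"])
  qed
qed

text \<open>Measured in block lengths, block b uses innovations in the half-open window (b - 1, b +
  1], because lags on its level are shorter than a block. The windows of b and b + 2 are adjacent
  and disjoint.\<close>

lemma indep_blocks:
  assumes "\<And>b b'. b \<in> P \<Longrightarrow> b' \<in> P \<Longrightarrow> b < b' \<Longrightarrow> b + 2 \<le> b'"
  shows "Q.indep_vars (\<lambda>_. borel) (block n l) P"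
proof (rule indep_vars_blocks[where K = "\<lambda>b. {int b * 2 ^ l - 2 ^ l<..int b * 2 ^ l + 2 ^ l}"])
  have disj: "{int b * 2 ^ l - 2 ^ l<..int b * 2 ^ l + 2 ^ l} \<inter> {int b' * 2 ^ l - 2 ^ l<..int b' * 2 ^ l + 2 ^ l} = {}"
    if "b + 2 \<le> b'" for b b'
  proof -
    have "(int b + 2) * 2 ^ l \<le> int b' * 2 ^ l" using that by (intro mult_right_mono) auto
    then show ?thesis by (auto simp: algebra_simps)
  qed
  show "disjoint_family_on (\<lambda>b. {int b * 2 ^ l - 2 ^ l<..int b * 2 ^ l + 2 ^ l}) P"
    unfolding disjoint_family_on_def
  proof (intro ballI impI)
    fix b b' assume b: "b \<in> P" "b' \<in> P" "b \<noteq> b'"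
    then consider "b < b'" | "b' < b" by linarith
    then show "{int b * 2 ^ l - 2 ^ l<..int b * 2 ^ l + 2 ^ l} \<inter> {int b' * 2 ^ l - 2 ^ l<..int b' * 2 ^ l + 2 ^ l} = {}"
    proof cases
      case 1 then show ?thesis using disj[of b b'] assms b by blast
    next
      case 2 then show ?thesis using disj[of b' b] assms b by blast
    qed
  qed
qed (auto intro: depends_on_block bmeas_measurable bmeas_block)

lemma integral_block: "(\<integral>\<omega>. block n l b \<omega> \<partial>Q) = 0"
proof -
  have "(\<integral>\<omega>. block n l b \<omega> \<partial>Q) = (\<Sum>i\<in>{b * 2 ^ l..<min n (b * 2 ^ l + 2 ^ l)}. \<Sum>m\<in>level l. (\<integral>\<omega>. D m i \<omega> \<partial>Q))"
    unfolding block_def V_def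
    by (subst Bochner_Integration.integral_sum)
      (auto intro!: Q.bmeas_integrable bmeas_intros sum.cong Bochner_Integration.integral_sum)
  then show ?thesis by (simp add: integral_D)
qed

lemma block_moment:
  assumes "(\<Sum>m\<in>level l. \<delta> m) \<le> \<Delta>"
  shows "(\<integral>\<omega>. \<bar>block n l b \<omega>\<bar> powr q \<partial>Q) \<le> (mart_const q * sqrt (2 ^ l) * \<Delta>) powr q"
proof -
  have "(\<integral>\<omega>. \<bar>block n l b \<omega>\<bar> powr q \<partial>Q) \<le> (mart_const q * sqrt (real (min n (b * 2 ^ l + 2 ^ l) - b * 2 ^ l)) * (\<Sum>m\<in>level l. \<delta> m)) powr q"
    unfolding block_def V_def by (intro double_sum_D_moment) auto
  also have "\<dots> \<le> (mart_const q * sqrt (2 ^ l) * \<Delta>) powr q"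
  proof (rule powr_mono2)
    have "real (min n (b * 2 ^ l + 2 ^ l) - b * 2 ^ l) \<le> real (2 ^ l)" by (intro of_nat_mono) auto
    then show "mart_const q * sqrt (real (min n (b * 2 ^ l + 2 ^ l) - b * 2 ^ l)) * (\<Sum>m\<in>level l. \<delta> m) \<le> mart_const q * sqrt (2 ^ l) * \<Delta>"
      using mart_const_ge_1[OF q] assms \<delta>_nonneg by (intro mult_mono) (auto intro: sum_nonneg)
  qed (use q mart_const_ge_1[OF q] \<delta>_nonneg in \<open>auto intro!: mult_nonneg_nonneg sum_nonneg\<close>)
  finally show ?thesis .
qed

lemma sum_blocks:
  assumes "n \<le> 2 ^ L" "l \<le> L"
  shows "(\<Sum>i<n. V l i \<omega>) = (\<Sum>b<2 ^ (L - l). block n l b \<omega>)"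
proof -
  define f where "f = (\<lambda>i. if i < n then V l i \<omega> else 0)"
  have p: "(2::nat) ^ (L - l) * 2 ^ l = 2 ^ L" using assms by (simp flip: power_add)
  have "(\<Sum>b<2 ^ (L - l). block n l b \<omega>) = (\<Sum>b<2 ^ (L - l). sum f {b * 2 ^ l..<b * 2 ^ l + 2 ^ l})"
    unfolding block_def f_def by (intro sum.cong refl sum.mono_neutral_cong_left) auto
  also have "\<dots> = sum f {..<2 ^ (L - l) * 2 ^ l}" by (rule sum.nat_group)
  also have "\<dots> = (\<Sum>i<n. V l i \<omega>)"
    unfolding p f_def using assms by (intro sum.mono_neutral_cong_right) auto
  finally show ?thesis by simp
qed

text \<open>Each parity class of blocks receives t/2. Either class is counted with all 2^(L-l)
  blocks, which costs no more than a constant.\<close>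

lemma level_tail:
  assumes n: "n \<le> 2 ^ L" "l \<le> L" and \<Delta>: "(\<Sum>m\<in>level l. \<delta> m) \<le> \<Delta>" "\<Delta> > 0" and t: "t > 0"
  defines "a \<equiv> mart_const q * sqrt (2 ^ l) * \<Delta>"
  shows "Q.prob {\<omega>\<in>space Q. t \<le> \<bar>\<Sum>i<n. V l i \<omega>\<bar>} \<le>
    2 * (nagaev_const q * (2 ^ (L - l) * a powr q / (t/2) powr q + exp (- (nagaev_rate q * (t/2)\<^sup>2 / (2 ^ (L - l) * a\<^sup>2)))))"
proof -
  have a: "a > 0" unfolding a_def using mart_const_ge_1[OF q] \<Delta> by simp
  have parity: "Q.prob {\<omega>\<in>space Q. t/2 \<le> \<bar>\<Sum>b\<in>P. block n l b \<omega>\<bar>} \<le>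
    nagaev_const q * (2 ^ (L - l) * a powr q / (t/2) powr q + exp (- (nagaev_rate q * (t/2)\<^sup>2 / (2 ^ (L - l) * a\<^sup>2))))"
    if P: "P \<subseteq> {..<2 ^ (L - l)}" "\<And>b b'. b \<in> P \<Longrightarrow> b' \<in> P \<Longrightarrow> b < b' \<Longrightarrow> b + 2 \<le> b'" for P
  proof (rule Q.nagaev_two_sided[OF q])
    have "card P \<le> 2 ^ (L - l)" using card_mono[OF finite_lessThan P(1)] by simp
    then show "real (card P) \<le> 2 ^ (L - l)" by (metis of_nat_le_iff of_nat_numeral of_nat_power)
  qed (use P a t \<Delta> in \<open>auto intro!: indep_blocks bmeas_intros integral_block block_moment finite_subset[OF P(1)] simp: a_def\<close>)
  define P0 where "P0 = {b. b < (2::nat) ^ (L - l) \<and> even b}"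
  define P1 where "P1 = {b. b < (2::nat) ^ (L - l) \<and> odd b}"
  have gap: "b + 2 \<le> b'" if "b < b'" "even b = even b'" for b b' :: nat
    using that by presburger
  have fin: "finite P0" "finite P1" by (auto simp: P0_def P1_def)
  have split: "(\<Sum>i<n. V l i \<omega>) = (\<Sum>b\<in>P0. block n l b \<omega>) + (\<Sum>b\<in>P1. block n l b \<omega>)" for \<omega>
  proof -
    have "{..<2 ^ (L - l)} = P0 \<union> P1" "P0 \<inter> P1 = {}" by (auto simp: P0_def P1_def)
    then show ?thesis unfolding sum_blocks[OF n] using fin by (simp add: sum.union_disjoint)
  qed
  have [measurable]: "block n l b \<in> borel_measurable Q" for b by (rule bmeas_measurable[OF bmeas_block])
  have "Q.prob {\<omega>\<in>space Q. t \<le> \<bar>\<Sum>i<n. V l i \<omega>\<bar>} \<le>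
      Q.prob ({\<omega>\<in>space Q. t/2 \<le> \<bar>\<Sum>b\<in>P0. block n l b \<omega>\<bar>} \<union> {\<omega>\<in>space Q. t/2 \<le> \<bar>\<Sum>b\<in>P1. block n l b \<omega>\<bar>})"
  proof (rule Q.finite_measure_mono)
    show "{\<omega>\<in>space Q. t \<le> \<bar>\<Sum>i<n. V l i \<omega>\<bar>} \<subseteq> {\<omega>\<in>space Q. t/2 \<le> \<bar>\<Sum>b\<in>P0. block n l b \<omega>\<bar>} \<union> {\<omega>\<in>space Q. t/2 \<le> \<bar>\<Sum>b\<in>P1. block n l b \<omega>\<bar>}"
      unfolding split by auto
  qed measurable
  also have "\<dots> \<le> Q.prob {\<omega>\<in>space Q. t/2 \<le> \<bar>\<Sum>b\<in>P0. block n l b \<omega>\<bar>} + Q.prob {\<omega>\<in>space Q. t/2 \<le> \<bar>\<Sum>b\<in>P1. block n l b \<omega>\<bar>}"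
    by (rule measure_Un_le) measurable
  also have "\<dots> \<le> 2 * (nagaev_const q * (2 ^ (L - l) * a powr q / (t/2) powr q + exp (- (nagaev_rate q * (t/2)\<^sup>2 / (2 ^ (L - l) * a\<^sup>2)))))"
  proof -
    have "P0 \<subseteq> {..<2 ^ (L - l)}" "P1 \<subseteq> {..<2 ^ (L - l)}" by (auto simp: P0_def P1_def)
    moreover have "b + 2 \<le> b'" if "b \<in> P0" "b' \<in> P0" "b < b'" for b b'
      using that by (intro gap) (simp_all add: P0_def)
    moreover have "b + 2 \<le> b'" if "b \<in> P1" "b' \<in> P1" "b < b'" for b b'
      using that by (intro gap) (simp_all add: P1_def)
    ultimately show ?thesis using add_mono[OF parity[of P0] parity[of P1]] by (simp only: mult_2)
  qed
  finally show ?thesis .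
qed

text \<open>The centred partial sum of the process whose memory is cut at lag \<open>N\<close>.\<close>

definition T :: "nat \<Rightarrow> nat \<Rightarrow> (int \<Rightarrow> 'e) \<Rightarrow> real" where
  "T N n \<omega> = (\<Sum>i<n. \<Sum>m<N. D m i \<omega>)"

lemma bmeas_T [bmeas_intros]: "bmeas Q (T N n)"
  unfolding T_def by (intro bmeas_intros)

lemma T_moment: "(\<integral>\<omega>. \<bar>T N n \<omega>\<bar> powr q \<partial>Q) \<le> (mart_const q * sqrt (real n) * (\<Sum>m<N. \<delta> m)) powr q"
  using double_sum_D_moment[of "{..<N}" 0 n] by (simp add: T_def atLeast0LessThan)

text \<open>The levels share one half of the deviation according to \<open>wt\<close>. The other
  half is left to the lags from 2^L on, where a block would be at least as long as the sample and no
  independence can be gained; there the moment bound with Markov's inequality is used.\<close>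

lemma T_tail:
  assumes n: "n \<le> 2 ^ L" and N: "2 ^ L \<le> N" and x: "x > 0"
    and \<Delta>: "\<And>l. l \<le> L \<Longrightarrow> (\<Sum>m\<in>level l. \<delta> m) \<le> \<Delta> l" "\<And>l. \<Delta> l > 0"
    and R: "(\<Sum>m\<in>{2^L..<N}. \<delta> m) \<le> R"
    and wt: "\<And>l. l \<le> L \<Longrightarrow> wt l > 0" "(\<Sum>l\<le>L. wt l) \<le> 1/2"
  shows "Q.prob {\<omega>\<in>space Q. x \<le> \<bar>T N n \<omega>\<bar>} \<le>
    (\<Sum>l\<le>L. 2 * (nagaev_const q * (2 ^ (L - l) * (mart_const q * sqrt (2 ^ l) * \<Delta> l) powr q / (wt l * x/2) powr q
       + exp (- (nagaev_rate q * (wt l * x/2)\<^sup>2 / (2 ^ (L - l) * (mart_const q * sqrt (2 ^ l) * \<Delta> l)\<^sup>2))))))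
    + (mart_const q * sqrt (real n) * R) powr q / (x/2) powr q"
    (is "_ \<le> (\<Sum>l\<le>L. ?b l) + ?r")
proof -
  define W where "W = (\<lambda>\<omega>. \<Sum>i\<in>{0..<n}. \<Sum>m\<in>{2^L..<N}. D m i \<omega>)"
  have bW: "bmeas Q W" unfolding W_def by (intro bmeas_intros)
  have split: "T N n \<omega> = (\<Sum>l\<le>L. \<Sum>i<n. V l i \<omega>) + W \<omega>" for \<omega>
  proof -
    have "(\<Sum>m<N. D m i \<omega>) = (\<Sum>l\<le>L. V l i \<omega>) + (\<Sum>m\<in>{2^L..<N}. D m i \<omega>)" for i
    proof -
      have "(\<Sum>m<N. D m i \<omega>) = (\<Sum>m<2 ^ L. D m i \<omega>) + (\<Sum>m\<in>{2^L..<N}. D m i \<omega>)"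
        using sum.atLeastLessThan_concat[of 0 "2 ^ L" N "\<lambda>m. D m i \<omega>"] N by (simp add: atLeast0LessThan)
      then show ?thesis by (simp add: V_def sum_levels)
    qed
    then have "T N n \<omega> = (\<Sum>i<n. \<Sum>l\<le>L. V l i \<omega>) + W \<omega>"
      by (simp add: T_def W_def sum.distrib atLeast0LessThan)
    then show ?thesis by (subst sum.swap)
  qed
  have [measurable]: "V l i \<in> borel_measurable Q" "W \<in> borel_measurable Q" for l i
    by (rule bmeas_measurable[OF bmeas_V], rule bmeas_measurable[OF bW])
  have W_tail: "Q.prob {\<omega>\<in>space Q. x/2 \<le> \<bar>W \<omega>\<bar>} \<le> ?r"
  proof -
    have "Q.prob {\<omega>\<in>space Q. x/2 \<le> \<bar>W \<omega>\<bar>} \<le> (\<integral>\<omega>. \<bar>W \<omega>\<bar> powr q \<partial>Q) / (x/2) powr q"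
      using q x by (intro Q.bmeas_markov bW) auto
    also have "(\<integral>\<omega>. \<bar>W \<omega>\<bar> powr q \<partial>Q) \<le> (mart_const q * sqrt (real (n - 0)) * (\<Sum>m\<in>{2^L..<N}. \<delta> m)) powr q"
      unfolding W_def by (rule double_sum_D_moment) simp
    also have "\<dots> \<le> (mart_const q * sqrt (real n) * R) powr q"
      using R q mart_const_ge_1[OF q] \<delta>_nonneg
      by (intro powr_mono2 mult_mono) (auto intro!: mult_nonneg_nonneg sum_nonneg)
    finally show ?thesis by (simp add: divide_right_mono)
  qed
  have "Q.prob {\<omega>\<in>space Q. x \<le> \<bar>T N n \<omega>\<bar>} \<le>
      Q.prob ((\<Union>l\<in>{..L}. {\<omega>\<in>space Q. wt l * x \<le> \<bar>\<Sum>i<n. V l i \<omega>\<bar>}) \<union> {\<omega>\<in>space Q. x/2 \<le> \<bar>W \<omega>\<bar>})"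
  proof (rule Q.finite_measure_mono)
    show "{\<omega>\<in>space Q. x \<le> \<bar>T N n \<omega>\<bar>} \<subseteq> (\<Union>l\<in>{..L}. {\<omega>\<in>space Q. wt l * x \<le> \<bar>\<Sum>i<n. V l i \<omega>\<bar>}) \<union> {\<omega>\<in>space Q. x/2 \<le> \<bar>W \<omega>\<bar>}"
    proof
      fix \<omega> assume \<omega>: "\<omega> \<in> {\<omega>\<in>space Q. x \<le> \<bar>T N n \<omega>\<bar>}"
      show "\<omega> \<in> (\<Union>l\<in>{..L}. {\<omega>\<in>space Q. wt l * x \<le> \<bar>\<Sum>i<n. V l i \<omega>\<bar>}) \<union> {\<omega>\<in>space Q. x/2 \<le> \<bar>W \<omega>\<bar>}"
      proof (rule ccontr)
        assume "\<not> ?thesis"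
        then have 2: "\<bar>W \<omega>\<bar> < x/2" and "\<not> (\<exists>l\<le>L. wt l * x \<le> \<bar>\<Sum>i<n. V l i \<omega>\<bar>)"
          using \<omega> by auto
        then have 1: "\<bar>\<Sum>i<n. V l i \<omega>\<bar> < wt l * x" if "l \<le> L" for l
          using that by (meson not_le)
        have "\<bar>\<Sum>l\<le>L. \<Sum>i<n. V l i \<omega>\<bar> \<le> (\<Sum>l\<le>L. wt l * x)"
          by (rule order_trans[OF sum_abs]) (rule sum_mono, rule less_imp_le, rule 1, simp)
        also have "\<dots> = (\<Sum>l\<le>L. wt l) * x" by (simp add: sum_distrib_right)
        also have "\<dots> \<le> 1/2 * x" using wt(2) x by (intro mult_right_mono) auto
        finally have "\<bar>T N n \<omega>\<bar> < x" using 2 unfolding split by linarith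
        then show False using \<omega> by simp
      qed
    qed
  qed measurable
  also have "\<dots> \<le> Q.prob (\<Union>l\<in>{..L}. {\<omega>\<in>space Q. wt l * x \<le> \<bar>\<Sum>i<n. V l i \<omega>\<bar>}) + Q.prob {\<omega>\<in>space Q. x/2 \<le> \<bar>W \<omega>\<bar>}"
    by (rule measure_Un_le) measurable
  also have "\<dots> \<le> (\<Sum>l\<le>L. Q.prob {\<omega>\<in>space Q. wt l * x \<le> \<bar>\<Sum>i<n. V l i \<omega>\<bar>}) + Q.prob {\<omega>\<in>space Q. x/2 \<le> \<bar>W \<omega>\<bar>}"
    by (intro add_right_mono Q.finite_measure_subadditive_finite) auto
  also have "\<dots> \<le> (\<Sum>l\<le>L. ?b l) + ?r"
    using n \<Delta> wt x by (intro add_mono W_tail sum_mono level_tail) auto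
  finally show ?thesis .
qed

text \<open>By \<open>sum_D\<close>, cutting the memory at lag N replaces each \<open>Y i\<close> by
  its projection on finitely many innovations, so \<open>L1dist_tendsto\<close> applies to each of
  the n terms.\<close>

lemma T_approx:
  assumes e: "e > 0"
  shows "\<exists>N0. \<forall>N\<ge>N0. (\<integral>\<omega>. \<bar>(\<Sum>i<n. Y i \<omega>) - T N n \<omega>\<bar> \<partial>Q) \<le> e"
proof -
  have "\<forall>\<^sub>F k in at_bot. (\<Sum>i<n. L1dist (Y i) (int i + 2 + k)) < e"
  proof (rule order_tendstoD(2)[OF _ e])
    have "((\<lambda>k. L1dist (Y i) (int i + 2 + k)) \<longlongrightarrow> 0) at_bot" for i
    proof (rule filterlim_compose[OF L1dist_tendsto[OF bmeas_Y]])
      have "\<exists>N. \<forall>k\<le>N. int i + 2 + k \<le> Z" for Z by (intro exI[of _ "Z - int i - 2"]) auto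
      then show "LIM k at_bot. int i + 2 + k :> at_bot"
        by (auto simp: filterlim_at_bot eventually_at_bot_linorder)
    qed
    then have "((\<lambda>k. \<Sum>i<n. L1dist (Y i) (int i + 2 + k)) \<longlongrightarrow> (\<Sum>i<n. 0)) at_bot"
      by (intro tendsto_sum)
    then show "((\<lambda>k. \<Sum>i<n. L1dist (Y i) (int i + 2 + k)) \<longlongrightarrow> 0) at_bot" by simp
  qed
  then obtain k0 where k0: "\<And>k. k \<le> k0 \<Longrightarrow> (\<Sum>i<n. L1dist (Y i) (int i + 2 + k)) < e"
    by (auto simp: eventually_at_bot_linorder)
  show ?thesis
  proof (intro exI[of _ "nat (- k0)"] allI impI)
    fix N assume N: "nat (- k0) \<le> N"
    have "(\<integral>\<omega>. \<bar>(\<Sum>i<n. Y i \<omega>) - T N n \<omega>\<bar> \<partial>Q) \<le> (\<integral>\<omega>. (\<Sum>i<n. \<bar>Y i \<omega> - CE (int i + 2 - int N) (Y i) \<omega>\<bar>) \<partial>Q)"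
    proof (intro integral_mono Q.bmeas_integrable bmeas_intros)
      fix \<omega>
      have "(\<Sum>i<n. Y i \<omega>) - T N n \<omega> = (\<Sum>i<n. Y i \<omega> - CE (int i + 2 - int N) (Y i) \<omega>)"
        by (simp add: T_def sum_D sum_subtractf)
      then show "\<bar>(\<Sum>i<n. Y i \<omega>) - T N n \<omega>\<bar> \<le> (\<Sum>i<n. \<bar>Y i \<omega> - CE (int i + 2 - int N) (Y i) \<omega>\<bar>)"
        by simp
    qed
    also have "\<dots> = (\<Sum>i<n. L1dist (Y i) (int i + 2 - int N))"
      unfolding L1dist_def by (intro Bochner_Integration.integral_sum Q.bmeas_integrable bmeas_intros)
    also have "\<dots> \<le> e"
    proof -
      have "- int N \<le> k0" using N by linarith
      then show ?thesis using k0[of "- int N"] by simp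
    qed
    finally show "(\<integral>\<omega>. \<bar>(\<Sum>i<n. Y i \<omega>) - T N n \<omega>\<bar> \<partial>Q) \<le> e" .
  qed
qed

end

section \<open>Weights of the dyadic levels\<close>

lemma sum_powr_geometric_le:
  fixes a :: real
  assumes "a < 0"
  shows "(\<Sum>l\<le>L. 2 powr (a * real l)) \<le> 1 / (1 - 2 powr a)"
proof -
  have r: "2 powr a < 1" using assms powr_less_mono[of a 0 "2::real"] by simp
  have "(\<Sum>l\<le>L. 2 powr (a * real l)) = (\<Sum>l<Suc L. (2 powr a) ^ l)"
    by (simp add: powr_powr[symmetric] powr_realpow lessThan_Suc_atMost)
  also have "\<dots> \<le> 1 / (1 - 2 powr a)" using r by (intro geometric_sum_le) auto
  finally show ?thesis .
qed

text \<open>Used to let the Gaussian exponents grow at least linearly in the level, so that their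
  exponentials form a geometric series.\<close>

lemma two_powr_ge_linear: "1 + a * ln 2 * real l \<le> 2 powr (a * real l)" for a :: real
  using exp_ge_add_one_self[of "a * real l * ln 2"] by (simp add: powr_def mult_ac)

section \<open>The rates \<open>L_alpha\<close> and \<open>J_alpha\<close>\<close>

lemma L_alpha_powr:
  assumes "q > 2" "n \<ge> 2"
  shows "L_alpha q \<alpha> n powr q =
    (if \<alpha> > 1/2 - 1/q then real n powr (1 - q)
     else if \<alpha> = 1/2 - 1/q then real n powr (1 - q) * ln (real n) powr (1 + q)
     else real n powr (- q * (\<alpha> + 1/2)))"
proof -
  have "(1/q - 1) * q = 1 - q" "(1 + 1/q) * q = 1 + q" "(- \<alpha> - 1/2) * q = - q * (\<alpha> + 1/2)"
    using assms by (simp_all add: field_simps)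
  then show ?thesis by (simp add: L_alpha_def powr_mult powr_powr)
qed

lemma L_alpha_pos: "n \<ge> 2 \<Longrightarrow> L_alpha q \<alpha> n > 0"
  by (simp add: L_alpha_def)

lemma J_alpha_pos: "n \<ge> 2 \<Longrightarrow> J_alpha q \<alpha> n > 0"
  by (simp add: J_alpha_def)

lemma J_alpha_sq:
  assumes "n \<ge> 2"
  shows "(J_alpha q \<alpha> n)\<^sup>2 =
    (if \<alpha> > 1/2 - 1/q then 1 / real n
     else if \<alpha> = 1/2 - 1/q then (ln (real n))\<^sup>2 / real n
     else real n powr (- beta_t q \<alpha>))"
proof -
  have sq: "(real n powr x)\<^sup>2 = real n powr (2 * x)" for x
    by (simp add: power2_eq_square powr_add[symmetric])
  have "(real n powr (- 1/2))\<^sup>2 = 1 / real n"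
    using assms by (simp only: sq) (simp add: powr_minus_divide)
  moreover have "(real n powr (- beta_t q \<alpha> / 2))\<^sup>2 = real n powr (- beta_t q \<alpha>)"
    by (simp only: sq) simp
  ultimately show ?thesis by (simp only: J_alpha_def power_mult_distrib if_distrib[of "\<lambda>x. x\<^sup>2"]) simp
qed

lemma ln2_bounds: "1/2 \<le> ln (2::real)" "ln (2::real) < 1"
  using ln2_ge_two_thirds ln2_le_25_over_36 by linarith+

text \<open>The variance of the mean has order 1/n and must fit under the scale
  \<open>J_alpha\<close>. The factor 4 is due to small n in the critical case, where (ln n)^2 may be
  below 1 but ln 2 \<ge> 1/2.\<close>

lemma inverse_n_le_J_alpha_sq:
  assumes "q > 2" "n \<ge> 2"
  shows "1 / real n \<le> 4 * (J_alpha q \<alpha> n)\<^sup>2"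
proof -
  consider "\<alpha> > 1/2 - 1/q" | "\<alpha> = 1/2 - 1/q" | "\<alpha> < 1/2 - 1/q" by linarith
  then show ?thesis
  proof cases
    case 2
    have "ln 2 \<le> ln (real n)" using assms by simp
    then have "(1/2)\<^sup>2 \<le> (ln (real n))\<^sup>2" using ln2_bounds by (intro power_mono) auto
    then have "1 / real n \<le> 4 * (ln (real n))\<^sup>2 / real n"
      by (intro divide_right_mono) (auto simp: power2_eq_square)
    then show ?thesis using 2 assms by (simp add: J_alpha_sq)
  next
    case 3
    have "beta_t q \<alpha> \<le> 1" using 3 assms by (simp add: beta_t_def alpha_t_def field_simps min_def)
    then have "real n powr (- 1) \<le> real n powr (- beta_t q \<alpha>)" using assms by (intro powr_mono) auto
    then have "1 / real n \<le> real n powr (- beta_t q \<alpha>)" using assms by (simp add: powr_minus_divide)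
    also have "\<dots> \<le> 4 * real n powr (- beta_t q \<alpha>)" by simp
    finally show ?thesis using 3 assms by (simp add: J_alpha_sq)
  qed (use assms in \<open>auto simp: J_alpha_sq divide_simps\<close>)
qed

text \<open>The share of the deviation granted to the dyadic level \<open>l\<close> decays in \<open>l\<close> when low lags dominate,
  is uniform in the critical case, and decays in \<open>L - l\<close> when high lags dominate.\<close>

lemma level_weights:
  fixes q \<alpha> :: real
  assumes q: "q > 2" and \<alpha>: "\<alpha> > 0"
  defines "\<kappa> \<equiv> q / 2 - \<alpha> * q - 1"
  shows "\<exists>C>0. \<exists>c>0. \<exists>\<gamma>>0. \<forall>n L. n \<ge> 2 \<longrightarrow> n \<le> 2 ^ L \<longrightarrow> 2 ^ L \<le> 2 * n \<longrightarrow>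
    real n powr (- q * (\<alpha> + 1/2)) \<le> C * L_alpha q \<alpha> n powr q \<and>
    (\<exists>wt. (\<forall>l\<le>L. wt l > 0) \<and> (\<Sum>l\<le>L. wt l) \<le> 1/2 \<and>
      (\<Sum>l\<le>L. real n powr (1 - q) * 2 powr (\<kappa> * real l) * wt l powr (- q)) \<le> C * L_alpha q \<alpha> n powr q \<and>
      (\<forall>l\<le>L. c * (1 + \<gamma> * real l) / (J_alpha q \<alpha> n)\<^sup>2 \<le> (wt l)\<^sup>2 * 2 powr (2 * \<alpha> * real l) * real n))"
proof -
  have sq: "(2 powr x)\<^sup>2 = 2 powr (2 * x)" for x :: real
    by (simp add: power2_eq_square powr_add[symmetric])
  consider (short) "\<alpha> > 1/2 - 1/q" | (crit) "\<alpha> = 1/2 - 1/q" | (long) "\<alpha> < 1/2 - 1/q" by linarith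
  then show ?thesis
  proof cases
    case short
    have \<kappa>: "\<kappa> < 0" using short q by (simp add: \<kappa>_def field_simps)
    \<comment> \<open>Shares proportional to 2^(-\<epsilon> l), with \<epsilon> small enough for two
      purposes: the polynomial series keeps a negative exponent, at most \<kappa>/2, and the
      Gaussian exponents still grow like 2^(\<alpha> l). The constant \<open>c0\<close> normalises
      the total share to at most 1/2.\<close>
    define \<epsilon> where "\<epsilon> = min (\<alpha>/2) (- \<kappa> / (2 * q))"
    have \<epsilon>: "\<epsilon> > 0" "2 * \<alpha> - 2 * \<epsilon> \<ge> \<alpha>" "\<kappa> + \<epsilon> * q \<le> \<kappa> / 2"
    proof -
      show "\<epsilon> > 0" using \<alpha> \<kappa> q by (auto simp: \<epsilon>_def divide_neg_pos)
      show "2 * \<alpha> - 2 * \<epsilon> \<ge> \<alpha>" by (simp add: \<epsilon>_def)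
      have "\<epsilon> * q \<le> - \<kappa> / (2 * q) * q" using q by (intro mult_right_mono) (auto simp: \<epsilon>_def)
      then show "\<kappa> + \<epsilon> * q \<le> \<kappa> / 2" using q by simp
    qed
    define c0 where "c0 = (1 - 2 powr (-\<epsilon>)) / 2"
    have c0: "c0 > 0" using \<epsilon> powr_less_mono[of "-\<epsilon>" 0 "2::real"] by (simp add: c0_def)
    define C where "C = c0 powr (- q) * (1 / (1 - 2 powr (\<kappa>/2))) + 1"
    have Cg: "0 < 1 / (1 - 2 powr (\<kappa>/2))" using \<kappa> powr_less_mono[of "\<kappa>/2" 0 "2::real"] by simp
    show ?thesis
    proof (rule exI[of _ C], rule conjI, goal_cases)
      case 1
      show ?case using Cg by (auto simp: C_def intro!: add_nonneg_pos mult_nonneg_nonneg)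
    next
      case 2
      show ?case
      proof (rule exI[of _ "c0\<^sup>2"], rule conjI, simp add: c0 less_imp_neq[OF c0, symmetric], rule exI[of _ "\<alpha> * ln 2"], intro conjI allI impI)
        show "0 < \<alpha> * ln 2" using \<alpha> by simp
        fix n L :: nat assume n: "n \<ge> 2" and L: "n \<le> 2 ^ L" "2 ^ L \<le> 2 * n"
        have La: "L_alpha q \<alpha> n powr q = real n powr (1 - q)" using short n q by (simp add: L_alpha_powr)
        have "- q * (\<alpha> + 1/2) \<le> 1 - q" using short q by (simp add: field_simps)
        then have "real n powr (- q * (\<alpha> + 1/2)) \<le> real n powr (1 - q)" using n by (intro powr_mono) auto
        also have "\<dots> \<le> C * real n powr (1 - q)"
          using Cg mult_right_mono[of 1 C "real n powr (1 - q)"] by (simp add: C_def)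
        finally show "real n powr (- q * (\<alpha> + 1/2)) \<le> C * L_alpha q \<alpha> n powr q" by (simp add: La)
        define wt where "wt = (\<lambda>l::nat. c0 * 2 powr (- \<epsilon> * real l))"
        show "\<exists>wt. (\<forall>l\<le>L. wt l > 0) \<and> (\<Sum>l\<le>L. wt l) \<le> 1/2 \<and>
          (\<Sum>l\<le>L. real n powr (1 - q) * 2 powr (\<kappa> * real l) * wt l powr (- q)) \<le> C * L_alpha q \<alpha> n powr q \<and>
          (\<forall>l\<le>L. c0\<^sup>2 * (1 + \<alpha> * ln 2 * real l) / (J_alpha q \<alpha> n)\<^sup>2 \<le> (wt l)\<^sup>2 * 2 powr (2 * \<alpha> * real l) * real n)"
        proof (intro exI[of _ wt] conjI allI impI)
          show "wt l > 0" for l using c0 by (simp add: wt_def)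
          have "(\<Sum>l\<le>L. wt l) = c0 * (\<Sum>l\<le>L. 2 powr (- \<epsilon> * real l))" by (simp add: wt_def sum_distrib_left)
          also have "\<dots> \<le> c0 * (1 / (1 - 2 powr (-\<epsilon>)))"
            using c0 \<epsilon> by (intro mult_left_mono sum_powr_geometric_le) auto
          also have "\<dots> = 1/2" using c0 \<epsilon> by (simp add: c0_def divide_simps)
          finally show "(\<Sum>l\<le>L. wt l) \<le> 1/2" .
          have "(\<Sum>l\<le>L. real n powr (1 - q) * 2 powr (\<kappa> * real l) * wt l powr (- q))
              \<le> (\<Sum>l\<le>L. real n powr (1 - q) * (c0 powr (- q) * 2 powr (\<kappa>/2 * real l)))"
          proof (rule sum_mono)
            fix l
            have "2 powr (\<kappa> * real l) * wt l powr (- q) = c0 powr (- q) * 2 powr ((\<kappa> + \<epsilon> * q) * real l)"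
              using c0 by (simp add: wt_def powr_mult powr_powr powr_add[symmetric] algebra_simps)
            also have "\<dots> \<le> c0 powr (- q) * 2 powr (\<kappa>/2 * real l)"
              using \<epsilon> by (intro mult_left_mono powr_mono mult_right_mono) auto
            finally show "real n powr (1 - q) * 2 powr (\<kappa> * real l) * wt l powr (- q)
              \<le> real n powr (1 - q) * (c0 powr (- q) * 2 powr (\<kappa>/2 * real l))"
              by (simp add: mult.assoc mult_left_mono)
          qed
          also have "\<dots> = real n powr (1 - q) * (c0 powr (- q) * (\<Sum>l\<le>L. 2 powr (\<kappa>/2 * real l)))"
            by (simp add: sum_distrib_left)
          also have "\<dots> \<le> real n powr (1 - q) * (c0 powr (- q) * (1 / (1 - 2 powr (\<kappa>/2))))"
            using \<kappa> by (intro mult_left_mono sum_powr_geometric_le) auto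
          also have "\<dots> \<le> real n powr (1 - q) * C" by (intro mult_left_mono) (auto simp: C_def)
          finally show "(\<Sum>l\<le>L. real n powr (1 - q) * 2 powr (\<kappa> * real l) * wt l powr (- q)) \<le> C * L_alpha q \<alpha> n powr q"
            by (simp add: La mult.commute)
          fix l
          have "c0\<^sup>2 * (1 + \<alpha> * ln 2 * real l) / (J_alpha q \<alpha> n)\<^sup>2 = c0\<^sup>2 * (1 + \<alpha> * ln 2 * real l) * real n"
            using short n by (simp add: J_alpha_sq)
          also have "\<dots> \<le> c0\<^sup>2 * 2 powr ((2 * \<alpha> - 2 * \<epsilon>) * real l) * real n"
          proof (intro mult_right_mono mult_left_mono)
            have "1 + \<alpha> * ln 2 * real l \<le> 2 powr (\<alpha> * real l)" by (rule two_powr_ge_linear)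
            also have "\<dots> \<le> 2 powr ((2 * \<alpha> - 2 * \<epsilon>) * real l)"
              using \<epsilon> by (intro powr_mono mult_right_mono) auto
            finally show "1 + \<alpha> * ln 2 * real l \<le> 2 powr ((2 * \<alpha> - 2 * \<epsilon>) * real l)" .
          qed auto
          also have "\<dots> = (wt l)\<^sup>2 * 2 powr (2 * \<alpha> * real l) * real n"
            by (simp add: wt_def power_mult_distrib sq powr_add[symmetric] algebra_simps)
          finally show "c0\<^sup>2 * (1 + \<alpha> * ln 2 * real l) / (J_alpha q \<alpha> n)\<^sup>2 \<le> (wt l)\<^sup>2 * 2 powr (2 * \<alpha> * real l) * real n" .
        qed
      qed
    qed
  next
    case crit
    have \<kappa>: "\<kappa> = 0" using crit q by (simp add: \<kappa>_def field_simps)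
    have aq: "- q * (\<alpha> + 1/2) = 1 - q" using crit q by (simp add: field_simps)
    define C where "C = 2 powr (1 + q) + 12 powr q * 6"
    show ?thesis
    proof (rule exI[of _ C], rule conjI, goal_cases)
      case 1
      show ?case by (auto simp: C_def intro!: add_pos_pos)
    next
      case 2
      show ?case
      proof (rule exI[of _ "1/144"], rule conjI, simp, rule exI[of _ "2 * \<alpha> * ln 2"], intro conjI allI impI)
        show "0 < 2 * \<alpha> * ln 2" using \<alpha> by simp
        fix n L :: nat assume n: "n \<ge> 2" and L: "n \<le> 2 ^ L" "2 ^ L \<le> 2 * n"
        define lg where "lg = ln (real n)"
        have lg2: "ln 2 \<le> lg" using n by (simp add: lg_def)
        then have lg: "lg \<ge> 1/2" using ln2_bounds by simp
        have La: "L_alpha q \<alpha> n powr q = real n powr (1 - q) * lg powr (1 + q)"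
          using crit n q by (simp add: L_alpha_powr lg_def)
        have "1 \<le> 2 powr (1 + q) * lg powr (1 + q)"
          using lg q by (simp add: powr_mult[symmetric] ge_one_powr_ge_zero)
        also have "\<dots> \<le> C * lg powr (1 + q)" by (intro mult_right_mono) (auto simp: C_def)
        finally have "real n powr (1 - q) * 1 \<le> real n powr (1 - q) * (C * lg powr (1 + q))"
          by (intro mult_left_mono) auto
        then show "real n powr (- q * (\<alpha> + 1/2)) \<le> C * L_alpha q \<alpha> n powr q"
          unfolding aq by (simp add: La mult_ac)
        have "real (2 ^ L) \<le> real (2 * n)" using L(2) by (rule of_nat_mono)
        then have "ln (2 ^ L) \<le> ln (2 * real n)" using n by (subst ln_le_cancel_iff) auto
        then have "real L * ln 2 \<le> ln 2 + lg" using n by (simp add: ln_realpow ln_mult lg_def)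
        then have "real L * (1/2) \<le> 2 * lg" using ln2_bounds lg2 mult_left_mono[of "1/2" "ln 2" "real L"] by linarith
        then have L6: "real L + 1 \<le> 6 * lg" using lg by linarith
        \<comment> \<open>With \<kappa> = 0 all levels weigh the same and get equal shares. Their
          number is of order log n: one power comes from summing the levels and q powers from the
          shares, which gives (log n)^(1+q).\<close>
        define w where "w = 1 / (2 * (real L + 1))"
        have w: "w > 0" by (simp add: w_def)
        show "\<exists>wt. (\<forall>l\<le>L. wt l > 0) \<and> (\<Sum>l\<le>L. wt l) \<le> 1/2 \<and>
          (\<Sum>l\<le>L. real n powr (1 - q) * 2 powr (\<kappa> * real l) * wt l powr (- q)) \<le> C * L_alpha q \<alpha> n powr q \<and>
          (\<forall>l\<le>L. 1/144 * (1 + 2 * \<alpha> * ln 2 * real l) / (J_alpha q \<alpha> n)\<^sup>2 \<le> (wt l)\<^sup>2 * 2 powr (2 * \<alpha> * real l) * real n)"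
        proof (intro exI[of _ "\<lambda>_. w"] conjI allI impI)
          show "w > 0" by fact
          show "(\<Sum>l\<le>L. w) \<le> 1/2" by (simp add: w_def field_simps)
          have "(\<Sum>l\<le>L. real n powr (1 - q) * 2 powr (\<kappa> * real l) * w powr (- q)) = real n powr (1 - q) * ((real L + 1) * (2 * (real L + 1)) powr q)"
            by (simp add: \<kappa> w_def powr_minus powr_divide field_simps)
          also have "\<dots> \<le> real n powr (1 - q) * (6 * lg * (12 * lg) powr q)"
          proof (rule mult_left_mono, rule mult_mono)
            show "(2 * (real L + 1)) powr q \<le> (12 * lg) powr q" using L6 q by (intro powr_mono2) auto
          qed (use L6 lg in auto)
          also have "6 * lg * (12 * lg) powr q = 12 powr q * 6 * lg powr (1 + q)"
            using lg by (simp add: powr_mult powr_add)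
          also have "real n powr (1 - q) * \<dots> \<le> real n powr (1 - q) * (C * lg powr (1 + q))"
            by (intro mult_left_mono mult_right_mono) (auto simp: C_def)
          finally show "(\<Sum>l\<le>L. real n powr (1 - q) * 2 powr (\<kappa> * real l) * w powr (- q)) \<le> C * L_alpha q \<alpha> n powr q"
            by (simp add: La mult_ac)
          fix l
          have "1/144 * (1 + 2 * \<alpha> * ln 2 * real l) / (J_alpha q \<alpha> n)\<^sup>2 = (1 / (12 * lg))\<^sup>2 * (1 + 2 * \<alpha> * ln 2 * real l) * real n"
            using crit n lg by (simp add: J_alpha_sq lg_def[symmetric] power_divide power_mult_distrib)
          also have "\<dots> \<le> w\<^sup>2 * 2 powr (2 * \<alpha> * real l) * real n"
          proof (intro mult_right_mono mult_mono two_powr_ge_linear power_mono)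
            show "1 / (12 * lg) \<le> w" using L6 lg by (simp add: w_def frac_le)
          qed (use lg \<alpha> in auto)
          finally show "1/144 * (1 + 2 * \<alpha> * ln 2 * real l) / (J_alpha q \<alpha> n)\<^sup>2 \<le> w\<^sup>2 * 2 powr (2 * \<alpha> * real l) * real n" .
        qed
      qed
    qed
  next
    case long
    have \<kappa>: "\<kappa> > 0" using long q by (simp add: \<kappa>_def field_simps)
    \<comment> \<open>Chosen so that \<kappa> - \<epsilon> q = \<epsilon>: away from the top level
      the shares and the polynomial contributions decay at the same rate. The Gaussian scale then
      loses n^(2 \<epsilon>), and 1 - 2 \<epsilon> is exactly \<open>beta_t\<close>.\<close>
    define \<epsilon> where "\<epsilon> = \<kappa> / (1 + q)"
    have \<epsilon>: "\<epsilon> > 0" using \<kappa> q by (simp add: \<epsilon>_def)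
    have \<epsilon>q: "\<kappa> - \<epsilon> * q = \<epsilon>" using q by (simp add: \<epsilon>_def field_simps)
    have beta: "1 - 2 * \<epsilon> = beta_t q \<alpha>" using long q
      by (simp add: \<epsilon>_def beta_t_def alpha_t_def \<kappa>_def min_def field_simps)
    define c0 where "c0 = (1 - 2 powr (-\<epsilon>)) / 2"
    have c0: "c0 > 0" using \<epsilon> powr_less_mono[of "-\<epsilon>" 0 "2::real"] by (simp add: c0_def)
    define C where "C = c0 powr (- q) * 2 powr \<kappa> * (1 / (1 - 2 powr (-\<epsilon>))) + 1"
    have Cg: "0 < 1 / (1 - 2 powr (-\<epsilon>))" using c0 by (simp add: c0_def)
    have rev: "(\<Sum>l\<le>L. f (L - l)) = (\<Sum>l\<le>L. f l)" for f :: "nat \<Rightarrow> real" and L :: nat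
      by (rule sum.reindex_bij_witness[of _ "\<lambda>l. L - l" "\<lambda>l. L - l"]) auto
    show ?thesis
    proof (rule exI[of _ C], rule conjI, goal_cases)
      case 1
      show ?case using Cg by (auto simp: C_def intro!: add_nonneg_pos mult_nonneg_nonneg)
    next
      case 2
      show ?case
      proof (rule exI[of _ "c0\<^sup>2 * 2 powr (-2 * \<epsilon>)"], rule conjI, simp add: c0 less_imp_neq[OF c0, symmetric], rule exI[of _ "2 * \<alpha> * ln 2"], intro conjI allI impI)
        show "0 < 2 * \<alpha> * ln 2" using \<alpha> by simp
        fix n L :: nat assume n: "n \<ge> 2" and L: "n \<le> 2 ^ L" "2 ^ L \<le> 2 * n"
        have "real (2 ^ L) \<le> real (2 * n)" using L(2) by (rule of_nat_mono)
        then have L2: "2 powr real L \<le> 2 * real n" by (simp add: powr_realpow)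
        have La: "L_alpha q \<alpha> n powr q = real n powr (- q * (\<alpha> + 1/2))" using long n q by (simp add: L_alpha_powr)
        show "real n powr (- q * (\<alpha> + 1/2)) \<le> C * L_alpha q \<alpha> n powr q"
          using Cg mult_right_mono[of 1 C "real n powr (- q * (\<alpha> + 1/2))"] by (simp add: La C_def)
        define wt where "wt = (\<lambda>l::nat. c0 * 2 powr (- \<epsilon> * real (L - l)))"
        show "\<exists>wt. (\<forall>l\<le>L. wt l > 0) \<and> (\<Sum>l\<le>L. wt l) \<le> 1/2 \<and>
          (\<Sum>l\<le>L. real n powr (1 - q) * 2 powr (\<kappa> * real l) * wt l powr (- q)) \<le> C * L_alpha q \<alpha> n powr q \<and>
          (\<forall>l\<le>L. c0\<^sup>2 * 2 powr (-2 * \<epsilon>) * (1 + 2 * \<alpha> * ln 2 * real l) / (J_alpha q \<alpha> n)\<^sup>2 \<le> (wt l)\<^sup>2 * 2 powr (2 * \<alpha> * real l) * real n)"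
        proof (intro exI[of _ wt] conjI allI impI)
          show "wt l > 0" for l using c0 by (simp add: wt_def)
          have "(\<Sum>l\<le>L. wt l) = c0 * (\<Sum>l\<le>L. 2 powr (- \<epsilon> * real l))"
            unfolding wt_def rev[of "\<lambda>l. c0 * 2 powr (- \<epsilon> * real l)"] by (simp add: sum_distrib_left)
          also have "\<dots> \<le> c0 * (1 / (1 - 2 powr (-\<epsilon>)))"
            using c0 \<epsilon> by (intro mult_left_mono sum_powr_geometric_le) auto
          also have "\<dots> = 1/2" using c0 \<epsilon> by (simp add: c0_def divide_simps)
          finally show "(\<Sum>l\<le>L. wt l) \<le> 1/2" .
          have "(\<Sum>l\<le>L. real n powr (1 - q) * 2 powr (\<kappa> * real l) * wt l powr (- q))
              = (\<Sum>l\<le>L. real n powr (1 - q) * (c0 powr (- q) * (2 powr (\<kappa> * real L) * 2 powr (- \<epsilon> * real (L - l)))))"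
          proof (intro sum.cong refl)
            fix l assume l: "l \<in> {..L}"
            have "2 powr (\<kappa> * real l) * wt l powr (- q) = c0 powr (- q) * 2 powr (\<kappa> * real l + \<epsilon> * q * real (L - l))"
              using c0 by (simp add: wt_def powr_mult powr_powr powr_add mult_ac)
            also have "\<kappa> * real l + \<epsilon> * q * real (L - l) = \<kappa> * real L - (\<kappa> - \<epsilon> * q) * real (L - l)"
              using l by (simp add: of_nat_diff algebra_simps)
            also have "\<dots> = \<kappa> * real L + - \<epsilon> * real (L - l)" unfolding \<epsilon>q by simp
            finally show "real n powr (1 - q) * 2 powr (\<kappa> * real l) * wt l powr (- q)
              = real n powr (1 - q) * (c0 powr (- q) * (2 powr (\<kappa> * real L) * 2 powr (- \<epsilon> * real (L - l))))"
              unfolding powr_add by (simp only: mult.assoc)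
          qed
          also have "\<dots> = real n powr (1 - q) * (c0 powr (- q) * (2 powr (\<kappa> * real L) * (\<Sum>l\<le>L. 2 powr (- \<epsilon> * real l))))"
            unfolding rev[of "\<lambda>l. real n powr (1 - q) * (c0 powr (- q) * (2 powr (\<kappa> * real L) * 2 powr (- \<epsilon> * real l)))"]
            by (simp add: sum_distrib_left)
          also have "\<dots> \<le> real n powr (1 - q) * (c0 powr (- q) * ((2 * real n) powr \<kappa> * (1 / (1 - 2 powr (-\<epsilon>)))))"
          proof (intro mult_left_mono mult_mono)
            have "2 powr (\<kappa> * real L) = (2 powr real L) powr \<kappa>" by (simp add: powr_powr mult.commute)
            also have "\<dots> \<le> (2 * real n) powr \<kappa>" using L2 \<kappa> by (intro powr_mono2) auto
            finally show "2 powr (\<kappa> * real L) \<le> (2 * real n) powr \<kappa>" .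
            show "(\<Sum>l\<le>L. 2 powr (- \<epsilon> * real l)) \<le> 1 / (1 - 2 powr (-\<epsilon>))" using \<epsilon> by (intro sum_powr_geometric_le) auto
          qed (auto intro!: sum_nonneg)
          also have "\<dots> = (c0 powr (- q) * 2 powr \<kappa> * (1 / (1 - 2 powr (-\<epsilon>)))) * (real n powr (1 - q) * real n powr \<kappa>)"
            by (simp add: powr_mult)
          also have "real n powr (1 - q) * real n powr \<kappa> = real n powr (- q * (\<alpha> + 1/2))"
            by (simp add: powr_add[symmetric] \<kappa>_def field_simps)
          also have "(c0 powr (- q) * 2 powr \<kappa> * (1 / (1 - 2 powr (-\<epsilon>)))) * \<dots> \<le> C * \<dots>"
            by (intro mult_right_mono) (auto simp: C_def)
          finally show "(\<Sum>l\<le>L. real n powr (1 - q) * 2 powr (\<kappa> * real l) * wt l powr (- q)) \<le> C * L_alpha q \<alpha> n powr q"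
            by (simp add: La)
          fix l assume l: "l \<le> L"
          have Jinv: "inverse ((J_alpha q \<alpha> n)\<^sup>2) = real n powr (1 - 2 * \<epsilon>)"
            using long n by (simp add: J_alpha_sq beta powr_minus)
          have "c0\<^sup>2 * 2 powr (-2 * \<epsilon>) * (1 + 2 * \<alpha> * ln 2 * real l) / (J_alpha q \<alpha> n)\<^sup>2 =
             c0\<^sup>2 * (2 powr (-2 * \<epsilon>) * (real n powr (1 - 2 * \<epsilon>) * (1 + 2 * \<alpha> * ln 2 * real l)))"
            unfolding divide_inverse Jinv by (simp only: mult_ac)
          also have "\<dots> = c0\<^sup>2 * ((2 * real n) powr (-2 * \<epsilon>) * (real n * (1 + 2 * \<alpha> * ln 2 * real l)))"
            using n by (simp add: powr_mult powr_diff powr_minus field_simps)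
          also have "\<dots> \<le> c0\<^sup>2 * (2 powr (-2 * \<epsilon> * real L) * (real n * 2 powr ((2 * \<alpha> + 2 * \<epsilon>) * real l)))"
          proof (intro mult_left_mono mult_mono)
            have "(2 * real n) powr (-2 * \<epsilon>) \<le> (2 powr real L) powr (-2 * \<epsilon>)"
              using L2 \<epsilon> by (intro powr_mono2') auto
            then show "(2 * real n) powr (-2 * \<epsilon>) \<le> 2 powr (-2 * \<epsilon> * real L)"
              by (simp add: powr_powr mult.commute)
            have "1 + 2 * \<alpha> * ln 2 * real l \<le> 2 powr (2 * \<alpha> * real l)" by (rule two_powr_ge_linear)
            also have "\<dots> \<le> 2 powr ((2 * \<alpha> + 2 * \<epsilon>) * real l)"
              using \<epsilon> by (intro powr_mono mult_right_mono) auto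
            finally show "1 + 2 * \<alpha> * ln 2 * real l \<le> 2 powr ((2 * \<alpha> + 2 * \<epsilon>) * real l)" .
          qed (use \<alpha> in auto)
          also have "\<dots> = (wt l)\<^sup>2 * 2 powr (2 * \<alpha> * real l) * real n"
          proof -
            have "2 powr (-2 * \<epsilon> * real L) * 2 powr ((2 * \<alpha> + 2 * \<epsilon>) * real l) = 2 powr (2 * (- \<epsilon> * real (L - l))) * 2 powr (2 * \<alpha> * real l)"
              unfolding powr_add[symmetric] using l by (simp add: of_nat_diff algebra_simps)
            then show ?thesis by (simp add: wt_def power_mult_distrib sq mult_ac)
          qed
          finally show "c0\<^sup>2 * 2 powr (-2 * \<epsilon>) * (1 + 2 * \<alpha> * ln 2 * real l) / (J_alpha q \<alpha> n)\<^sup>2 \<le> (wt l)\<^sup>2 * 2 powr (2 * \<alpha> * real l) * real n" .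
        qed
      qed
    qed
  qed
qed

section \<open>Deviations of a bounded causal process\<close>

text \<open>Lag 0 has a bound of its own: since \<open>0 powr x = 0\<close>, the power bound taken
  at a = 0 would force the coefficients to vanish.\<close>

definition dep_tail :: "real \<Rightarrow> real \<Rightarrow> (nat \<Rightarrow> real) \<Rightarrow> bool" where
  "dep_tail A \<alpha> \<delta> \<longleftrightarrow> \<delta> 0 \<le> A \<and> (\<forall>a\<ge>1. \<forall>b. (\<Sum>m\<in>{a..<b}. \<delta> m) \<le> A * real a powr (- \<alpha>))"

lemma ex_power_two_between:
  assumes "n \<ge> 1" shows "\<exists>L. n \<le> 2 ^ L \<and> 2 ^ L \<le> 2 * (n::nat)"
proof -
  define L where "L = (LEAST L. n \<le> 2 ^ L)"
  have n: "n \<le> 2 ^ L" unfolding L_def by (rule LeastI[of _ n]) (simp add: less_imp_le)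
  have "2 ^ L \<le> 2 * n"
  proof (cases L)
    case (Suc k)
    then have "\<not> n \<le> 2 ^ k" using not_less_Least[of k "\<lambda>L. n \<le> 2 ^ L"] by (simp add: L_def)
    then show ?thesis by (simp add: Suc)
  qed (use assms in simp)
  with n show ?thesis by blast
qed

context coupled_seq
begin

text \<open>For l > 0 the level begins at 2^(l-1); expressing the bound through 2^l costs the factor
  2^\<alpha>, which at the same time covers level 0.\<close>

lemma level_sum_le:
  assumes dep: "dep_tail A \<alpha> \<delta>" and A: "A > 0" and \<alpha>: "\<alpha> > 0"
  shows "(\<Sum>m\<in>level l. \<delta> m) \<le> A * 2 powr \<alpha> * 2 powr (- \<alpha> * real l)"
proof (cases l)
  case 0
  have "A * 1 \<le> A * 2 powr \<alpha>" using A \<alpha> by (intro mult_left_mono) (auto simp: ge_one_powr_ge_zero)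
  moreover have "level 0 = {0}" by (auto simp: level_def)
  ultimately show ?thesis using dep 0 by (simp add: dep_tail_def)
next
  case (Suc k)
  have "level l = {2 ^ k..<2 ^ l}" by (simp add: level_def Suc)
  moreover have "(\<Sum>m\<in>{2 ^ k..<2 ^ l}. \<delta> m) \<le> A * real (2 ^ k) powr (- \<alpha>)"
    using dep unfolding dep_tail_def by (metis one_le_numeral one_le_power)
  moreover have "real (2 ^ k) powr (- \<alpha>) = 2 powr \<alpha> * 2 powr (- \<alpha> * real l)"
    by (simp add: Suc powr_realpow[symmetric] powr_powr powr_add[symmetric] algebra_simps)
  ultimately show ?thesis by simp
qed

lemma total_sum_le:
  assumes dep: "dep_tail A \<alpha> \<delta>" and A: "A > 0"
  shows "(\<Sum>m<N. \<delta> m) \<le> 2 * A"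
proof -
  have "(\<Sum>m<N. \<delta> m) \<le> \<delta> 0 + (\<Sum>m\<in>{1..<N}. \<delta> m)"
  proof (cases N)
    case (Suc k)
    then show ?thesis by (simp add: sum.atLeast_Suc_lessThan lessThan_atLeast0 del: sum.lessThan_Suc)
  qed (simp add: \<delta>_nonneg)
  also have "(\<Sum>m\<in>{1..<N}. \<delta> m) \<le> A * real 1 powr (- \<alpha>)"
    using dep unfolding dep_tail_def by blast
  finally show ?thesis using dep by (simp add: dep_tail_def)
qed

lemma scaled_moment:
  assumes dep: "dep_tail A \<alpha> \<delta>" and A: "A > 0" and n: "n \<ge> 2"
  shows "(\<integral>\<omega>. \<bar>T N n \<omega> / real n\<bar> powr q \<partial>Q) \<le> (2 * mart_const q * A) powr q * real n powr (- q/2)"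
proof -
  have k: "mart_const q \<ge> 1" by (rule mart_const_ge_1[OF q])
  have "(\<integral>\<omega>. \<bar>T N n \<omega> / real n\<bar> powr q \<partial>Q) = (\<integral>\<omega>. \<bar>T N n \<omega>\<bar> powr q \<partial>Q) / real n powr q"
    by (simp add: powr_divide)
  also have "(\<integral>\<omega>. \<bar>T N n \<omega>\<bar> powr q \<partial>Q) \<le> (mart_const q * sqrt (real n) * (\<Sum>m<N. \<delta> m)) powr q"
    by (rule T_moment)
  also have "\<dots> \<le> (mart_const q * sqrt (real n) * (2 * A)) powr q"
    using total_sum_le[OF dep A] k q \<delta>_nonneg A
    by (intro powr_mono2 mult_left_mono) (auto intro!: mult_nonneg_nonneg sum_nonneg)
  also have "\<dots> = (2 * mart_const q * A) powr q * real n powr (q/2)"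
    using n by (simp add: powr_mult powr_half_sqrt[symmetric] powr_powr)
  also have "\<dots> / real n powr q = (2 * mart_const q * A) powr q * (real n powr (q/2) / real n powr q)" by simp
  also have "real n powr (q/2) / real n powr q = real n powr (- q/2)"
    by (simp add: powr_diff[symmetric])
  finally show ?thesis by (simp add: divide_right_mono)
qed

text \<open>For v \<ge> J the hypotheses on \<open>wt\<close> sum the level bounds: the polynomial
  parts directly, the Gaussian parts as a geometric series with ratio exp(-r \<gamma>). For v < J
  the summand \<open>exp r\<close> alone makes the right-hand side at least 1. In \<open>r\<close>
  the factor 8 is 4 for halving the deviation by parity times 2 for 2^L \<le> 2n.\<close>

lemma scaled_tail:
  fixes \<alpha> A C c \<gamma> :: real
  assumes \<alpha>: "\<alpha> > 0" and A: "A > 0" and n: "n \<ge> 2" and dep: "dep_tail A \<alpha> \<delta>"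
    and L: "n \<le> 2 ^ L" "2 ^ L \<le> 2 * n" and N: "2 ^ L \<le> N" and v: "v > 0"
    and C: "C > 0" and c: "c > 0" and \<gamma>: "\<gamma> > 0" and J: "J > 0"
    and w0: "real n powr (- q * (\<alpha> + 1/2)) \<le> C * Lq"
    and wt: "\<And>l. l \<le> L \<Longrightarrow> wt l > 0" "(\<Sum>l\<le>L. wt l) \<le> 1/2"
    and w1: "(\<Sum>l\<le>L. real n powr (1 - q) * 2 powr ((q / 2 - \<alpha> * q - 1) * real l) * wt l powr (- q)) \<le> C * Lq"
    and w2: "\<And>l. l \<le> L \<Longrightarrow> c * (1 + \<gamma> * real l) / J\<^sup>2 \<le> (wt l)\<^sup>2 * 2 powr (2 * \<alpha> * real l) * real n"
  defines "a \<equiv> mart_const q * (A * 2 powr \<alpha>)"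
  defines "r \<equiv> nagaev_rate q / (8 * a\<^sup>2) * c"
  shows "Q.prob {\<omega>\<in>space Q. v \<le> \<bar>T N n \<omega> / real n\<bar>} \<le>
    (2 * nagaev_const q * (a powr q * (2 * 2 powr q)) * C + (2 * mart_const q * A) powr q * C) * (Lq / v powr q)
    + (2 * nagaev_const q * (1 / (1 - exp (- r * \<gamma>))) + exp r) * exp (- (r * v\<^sup>2 / J\<^sup>2))"
proof (cases "v < J")
  case True
  have k: "mart_const q \<ge> 1" by (rule mart_const_ge_1[OF q])
  have a: "a > 0" using k A by (simp add: a_def)
  have r: "r > 0" using c a nagaev_rate_pos by (simp add: r_def)
  have Lq: "Lq > 0" using w0 C n by (smt (verit) powr_gt_zero of_nat_0_less_iff zero_less_mult_pos mult_nonneg_nonpos zero_less_numeral order_less_le_trans of_nat_0_less_iff)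
  have g: "exp (- r * \<gamma>) < 1" using r \<gamma> by simp
  have "v\<^sup>2 \<le> J\<^sup>2" using True v by (intro power_mono) auto
  then have "r * v\<^sup>2 / J\<^sup>2 \<le> r" using r J by (simp add: divide_simps)
  then have 1: "1 \<le> exp r * exp (- (r * v\<^sup>2 / J\<^sup>2))" by (simp add: mult_exp_exp)
  have 2: "0 \<le> (2 * nagaev_const q * (a powr q * (2 * 2 powr q)) * C + (2 * mart_const q * A) powr q * C) * (Lq / v powr q)"
    using Lq C nagaev_const_pos[of q] by simp
  have 3: "0 \<le> 2 * nagaev_const q * (1 / (1 - exp (- r * \<gamma>))) * exp (- (r * v\<^sup>2 / J\<^sup>2))"
    using g nagaev_const_pos[of q] by (intro mult_nonneg_nonneg) auto
  have "Q.prob {\<omega>\<in>space Q. v \<le> \<bar>T N n \<omega> / real n\<bar>} \<le> 1" by simp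
  then show ?thesis using 1 2 3 unfolding distrib_right[of _ "exp r"] by linarith
next
  case False
  define y where "y = v\<^sup>2 / J\<^sup>2"
  have y: "y \<ge> 1" using False J power_mono[of J v 2] by (simp add: y_def)
  have k: "mart_const q \<ge> 1" by (rule mart_const_ge_1[OF q])
  have a: "a > 0" using k A by (simp add: a_def)
  have r: "r > 0" using c a nagaev_rate_pos by (simp add: r_def)
  define \<kappa> where "\<kappa> = q / 2 - \<alpha> * q - 1"
  define x where "x = real n * v"
  have x: "x > 0" using n v by (simp add: x_def)
  have "real (2 ^ L) \<le> real (2 * n)" using L(2) by (rule of_nat_mono)
  then have L2: "2 powr real L \<le> 2 * real n" by (simp add: powr_realpow)
  have "real n \<le> real (2 ^ L)" using L(1) by (rule of_nat_mono)
  then have L1: "real n \<le> 2 powr real L" by (simp add: powr_realpow)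
  define \<Delta> where "\<Delta> = (\<lambda>l::nat. A * 2 powr \<alpha> * 2 powr (- \<alpha> * real l))"
  define R where "R = A * real n powr (- \<alpha>)"
  have ale: "mart_const q * sqrt (2 ^ l) * \<Delta> l = a * 2 powr ((1/2 - \<alpha>) * real l)" for l
  proof -
    have "sqrt (2 ^ l) = 2 powr (1/2 * real l)"
      by (simp add: powr_half_sqrt[symmetric] powr_realpow[symmetric] powr_powr)
    then have "sqrt (2 ^ l) * 2 powr (- \<alpha> * real l) = 2 powr ((1/2 - \<alpha>) * real l)"
      by (simp add: powr_add[symmetric] algebra_simps)
    then show ?thesis unfolding \<Delta>_def a_def by (metis (no_types, lifting) mult.assoc mult.left_commute)
  qed
  have pL: "2 ^ (L - l) = 2 powr real L * 2 powr (- real l)" if "l \<le> L" for l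
    using that by (simp add: powr_realpow[symmetric] powr_add[symmetric] of_nat_diff)
  have poly: "2 ^ (L - l) * (mart_const q * sqrt (2 ^ l) * \<Delta> l) powr q / (wt l * x/2) powr q
      \<le> a powr q * (2 * 2 powr q) / v powr q * (real n powr (1 - q) * 2 powr (\<kappa> * real l) * wt l powr (- q))"
    if l: "l \<le> L" for l
  proof -
    have "2 ^ (L - l) * (mart_const q * sqrt (2 ^ l) * \<Delta> l) powr q = 2 powr real L * (a powr q * (2 powr (- real l) * 2 powr ((1/2 - \<alpha>) * real l * q)))"
      unfolding ale pL[OF l] powr_mult powr_powr by (simp only: mult_ac)
    also have "2 powr (- real l) * 2 powr ((1/2 - \<alpha>) * real l * q) = 2 powr (\<kappa> * real l)"
      by (simp add: powr_add[symmetric] \<kappa>_def algebra_simps)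
    also have "2 powr real L * (a powr q * 2 powr (\<kappa> * real l)) \<le> 2 * real n * (a powr q * 2 powr (\<kappa> * real l))"
      using L2 by (intro mult_right_mono) auto
    finally have "2 ^ (L - l) * (mart_const q * sqrt (2 ^ l) * \<Delta> l) powr q / (wt l * x/2) powr q
      \<le> 2 * real n * (a powr q * 2 powr (\<kappa> * real l)) / (wt l * x/2) powr q"
      by (rule divide_right_mono) simp
    also have "\<dots> = a powr q * (2 * 2 powr q) / v powr q * (real n powr (1 - q) * 2 powr (\<kappa> * real l) * wt l powr (- q))"
      using wt(1)[OF l] n v by (simp add: x_def powr_mult powr_divide powr_diff powr_minus field_simps)
    finally show ?thesis .
  qed
  have expo: "exp (- (nagaev_rate q * (wt l * x/2)\<^sup>2 / (2 ^ (L - l) * (mart_const q * sqrt (2 ^ l) * \<Delta> l)\<^sup>2)))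
      \<le> exp (- (r * y)) * exp (- r * \<gamma>) ^ l" if l: "l \<le> L" for l
  proof -
    have den: "2 ^ (L - l) * (mart_const q * sqrt (2 ^ l) * \<Delta> l)\<^sup>2 = a\<^sup>2 * 2 powr real L * 2 powr (- 2 * \<alpha> * real l)"
    proof -
      have "2 powr (- real l) * (2 powr ((1/2 - \<alpha>) * real l))\<^sup>2 = 2 powr (- 2 * \<alpha> * real l)"
        by (simp add: power2_eq_square powr_add[symmetric] algebra_simps)
      then show ?thesis unfolding ale pL[OF l] power_mult_distrib by (metis (no_types, lifting) mult.assoc mult.left_commute)
    qed
    have "r * (1 + \<gamma> * real l) * y = nagaev_rate q / (8 * a\<^sup>2) * v\<^sup>2 * (c * (1 + \<gamma> * real l) / J\<^sup>2)"
      by (simp add: r_def y_def)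
    also have "\<dots> \<le> nagaev_rate q / (8 * a\<^sup>2) * v\<^sup>2 * ((wt l)\<^sup>2 * 2 powr (2 * \<alpha> * real l) * real n)"
      using w2[OF l] nagaev_rate_pos[of q] by (intro mult_left_mono) auto
    also have "\<dots> = nagaev_rate q * (wt l * x/2)\<^sup>2 / (a\<^sup>2 * (2 * real n) * 2 powr (- 2 * \<alpha> * real l))"
      using n a by (simp add: x_def powr_minus power2_eq_square field_simps)
    also have "\<dots> \<le> nagaev_rate q * (wt l * x/2)\<^sup>2 / (a\<^sup>2 * 2 powr real L * 2 powr (- 2 * \<alpha> * real l))"
      using L2 a n nagaev_rate_pos[of q] by (intro divide_left_mono mult_right_mono mult_left_mono mult_pos_pos mult_nonneg_nonneg) auto
    finally have "r * (1 + \<gamma> * real l) * y \<le> nagaev_rate q * (wt l * x/2)\<^sup>2 / (2 ^ (L - l) * (mart_const q * sqrt (2 ^ l) * \<Delta> l)\<^sup>2)"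
      unfolding den .
    \<comment> \<open>As y \<ge> 1, the part growing with the level may drop its factor y, so the
      ratio of the geometric series does not depend on v.\<close>
    moreover have "r * y + r * \<gamma> * real l \<le> r * (1 + \<gamma> * real l) * y"
    proof -
      have "r * \<gamma> * real l * 1 \<le> r * \<gamma> * real l * y" using y r \<gamma> by (intro mult_left_mono) auto
      then show ?thesis by (simp add: algebra_simps)
    qed
    ultimately have "exp (- (nagaev_rate q * (wt l * x/2)\<^sup>2 / (2 ^ (L - l) * (mart_const q * sqrt (2 ^ l) * \<Delta> l)\<^sup>2)))
        \<le> exp (- (r * y) + real l * (- r * \<gamma>))"
      by (subst exp_le_cancel_iff) (simp add: mult_ac)
    also have "\<dots> = exp (- (r * y)) * exp (- r * \<gamma>) ^ l" by (simp only: exp_add exp_of_nat_mult)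
    finally show ?thesis .
  qed
  have rem: "(mart_const q * sqrt (real n) * R) powr q / (x/2) powr q = (2 * mart_const q * A) powr q * (real n powr (- q * (\<alpha> + 1/2)) / v powr q)"
  proof -
    have "(mart_const q * sqrt (real n) * R) powr q / (x/2) powr q = (2 * mart_const q * A) powr q * ((real n powr (1/2) * real n powr (- \<alpha>) / real n) powr q / v powr q)"
      using n v k A by (simp add: x_def R_def powr_mult powr_divide powr_half_sqrt[symmetric])
    also have "real n powr (1/2) * real n powr (- \<alpha>) / real n = real n powr (- \<alpha> - 1/2)"
    proof -
      have "- \<alpha> - 1/2 = (1/2 + - \<alpha>) - 1" by simp
      then show ?thesis using n by (simp only: powr_add powr_diff) simp
    qed
    also have "(real n powr (- \<alpha> - 1/2)) powr q = real n powr (- q * (\<alpha> + 1/2))"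
      by (simp add: powr_powr algebra_simps)
    finally show ?thesis .
  qed
  have R: "(\<Sum>m\<in>{2^L..<N}. \<delta> m) \<le> R"
  proof -
    have "(\<Sum>m\<in>{2^L..<N}. \<delta> m) \<le> A * real (2 ^ L) powr (- \<alpha>)"
      using dep unfolding dep_tail_def by (metis one_le_numeral one_le_power)
    also have "\<dots> \<le> R" unfolding R_def
      using L1 n A \<alpha> by (intro mult_left_mono powr_mono2') (auto simp: powr_realpow)
    finally show ?thesis .
  qed
  have "Q.prob {\<omega>\<in>space Q. v \<le> \<bar>T N n \<omega> / real n\<bar>} = Q.prob {\<omega>\<in>space Q. x \<le> \<bar>T N n \<omega>\<bar>}"
    using n by (simp add: x_def field_simps)
  also have "\<dots> \<le> (\<Sum>l\<le>L. 2 * (nagaev_const q * (2 ^ (L - l) * (mart_const q * sqrt (2 ^ l) * \<Delta> l) powr q / (wt l * x/2) powr q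
       + exp (- (nagaev_rate q * (wt l * x/2)\<^sup>2 / (2 ^ (L - l) * (mart_const q * sqrt (2 ^ l) * \<Delta> l)\<^sup>2))))))
    + (mart_const q * sqrt (real n) * R) powr q / (x/2) powr q"
  proof (rule T_tail)
    show "(\<Sum>m\<in>level l. \<delta> m) \<le> \<Delta> l" for l
      unfolding \<Delta>_def by (rule level_sum_le[OF dep A \<alpha>])
    show "\<Delta> l > 0" for l using A by (simp add: \<Delta>_def)
  qed (use L N x R wt in auto)
  also have "\<dots> \<le> (\<Sum>l\<le>L. 2 * (nagaev_const q * (a powr q * (2 * 2 powr q) / v powr q * (real n powr (1 - q) * 2 powr (\<kappa> * real l) * wt l powr (- q))
       + exp (- (r * y)) * exp (- r * \<gamma>) ^ l)))
    + (2 * mart_const q * A) powr q * (C * Lq / v powr q)"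
    unfolding rem using nagaev_const_pos[of q] w0
    by (intro add_mono sum_mono mult_left_mono poly expo divide_right_mono) auto
  also have "(\<Sum>l\<le>L. 2 * (nagaev_const q * (a powr q * (2 * 2 powr q) / v powr q * (real n powr (1 - q) * 2 powr (\<kappa> * real l) * wt l powr (- q))
       + exp (- (r * y)) * exp (- r * \<gamma>) ^ l))) =
     2 * nagaev_const q * (a powr q * (2 * 2 powr q)) / v powr q * (\<Sum>l\<le>L. real n powr (1 - q) * 2 powr (\<kappa> * real l) * wt l powr (- q))
     + 2 * nagaev_const q * exp (- (r * y)) * (\<Sum>l<Suc L. exp (- r * \<gamma>) ^ l)"
    by (simp add: sum.distrib sum_distrib_left distrib_left lessThan_Suc_atMost mult_ac)
  also have "\<dots> \<le> 2 * nagaev_const q * (a powr q * (2 * 2 powr q)) / v powr q * (C * Lq) + 2 * nagaev_const q * exp (- (r * y)) * (1 / (1 - exp (- r * \<gamma>)))"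
    using w1 nagaev_const_pos[of q] r \<gamma> by (intro add_mono mult_left_mono geometric_sum_le) (auto simp: \<kappa>_def)
  finally have "Q.prob {\<omega>\<in>space Q. v \<le> \<bar>T N n \<omega> / real n\<bar>} \<le>
     2 * nagaev_const q * (a powr q * (2 * 2 powr q)) / v powr q * (C * Lq) + 2 * nagaev_const q * exp (- (r * y)) * (1 / (1 - exp (- r * \<gamma>)))
     + (2 * mart_const q * A) powr q * (C * Lq / v powr q)" by simp
  also have "\<dots> = (2 * nagaev_const q * (a powr q * (2 * 2 powr q)) * C + (2 * mart_const q * A) powr q * C) * (Lq / v powr q)
    + (2 * nagaev_const q * (1 / (1 - exp (- r * \<gamma>)))) * exp (- (r * y))"
    by (simp add: distrib_left distrib_right mult_ac)
  also have "\<dots> \<le> (2 * nagaev_const q * (a powr q * (2 * 2 powr q)) * C + (2 * mart_const q * A) powr q * C) * (Lq / v powr q)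
    + (2 * nagaev_const q * (1 / (1 - exp (- r * \<gamma>))) + exp r) * exp (- (r * y))"
    by (intro add_left_mono mult_right_mono) auto
  finally show ?thesis by (simp add: y_def)
qed

end

text \<open>The arguments of the minimum come from the variance, the q-th moment and the Nagaev
  bound, in this order. Up to constants they are the squares of the three competitors in the last
  term of the theorem.\<close>

definition dev_bound :: "real \<Rightarrow> real \<Rightarrow> real \<Rightarrow> nat \<Rightarrow> real \<Rightarrow> real" where
  "dev_bound q \<alpha> c n w = min (1 / real n) (min (w powr (2 - q) * real n powr (- q/2))
     (L_alpha q \<alpha> n powr q * w powr (2 - q) + ((J_alpha q \<alpha> n)\<^sup>2 + w\<^sup>2) * exp (- (c * w\<^sup>2 / (J_alpha q \<alpha> n)\<^sup>2))))"

text \<open>Constants are chosen before the law \<nu> and the function \<open>h\<close>, and the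
  bound does not depend on the memory N once N \<ge> 2^L, the range in which all levels are present.
  Both uniformities are needed for the limits taken afterwards.\<close>

lemma coupled_trunc_sq:
  fixes q \<alpha> A :: real
  assumes q: "q > 2" and \<alpha>: "\<alpha> > 0" and A: "A > 0"
  shows "\<exists>K>0. \<exists>c>0. \<forall>(\<nu>::'e measure) h \<delta> n w. coupled_seq \<nu> h \<delta> q \<longrightarrow> dep_tail A \<alpha> \<delta> \<longrightarrow> n \<ge> 2 \<longrightarrow> w > 0 \<longrightarrow>
    (\<exists>N0. \<forall>N\<ge>N0. (\<integral>\<omega>. trunc_sq w (coupled_seq.T \<nu> h N n \<omega> / real n) \<partial>(PiM UNIV (\<lambda>_. \<nu>))) \<le> K * dev_bound q \<alpha> c n w)"
proof -
  obtain C c \<gamma> where C: "C > 0" and c: "c > 0" and \<gamma>: "\<gamma> > 0" and W: "\<And>n L. n \<ge> 2 \<Longrightarrow> n \<le> 2 ^ L \<Longrightarrow> 2 ^ L \<le> 2 * n \<Longrightarrow>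
    real n powr (- q * (\<alpha> + 1/2)) \<le> C * L_alpha q \<alpha> n powr q \<and>
    (\<exists>wt. (\<forall>l\<le>L. wt l > 0) \<and> (\<Sum>l\<le>L. wt l) \<le> 1/2 \<and>
      (\<Sum>l\<le>L. real n powr (1 - q) * 2 powr ((q / 2 - \<alpha> * q - 1) * real l) * wt l powr (- q)) \<le> C * L_alpha q \<alpha> n powr q \<and>
      (\<forall>l\<le>L. c * (1 + \<gamma> * real l) / (J_alpha q \<alpha> n)\<^sup>2 \<le> (wt l)\<^sup>2 * 2 powr (2 * \<alpha> * real l) * real n))"
    using level_weights[OF q \<alpha>] by blast
  define a where "a = mart_const q * (A * 2 powr \<alpha>)"
  define r where "r = nagaev_rate q / (8 * a\<^sup>2) * c"
  define m where "m = (2 * mart_const q * A) powr q"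
  define K1 where "K1 = 2 * nagaev_const q * (a powr q * (2 * 2 powr q)) * C + m * C"
  define K2 where "K2 = 2 * nagaev_const q * (1 / (1 - exp (- r * \<gamma>))) + exp r"
  have a: "a > 0" using mart_const_ge_1[OF q] A by (simp add: a_def)
  have r: "r > 0" using c a nagaev_rate_pos by (simp add: r_def)
  have m: "m > 0" using mart_const_ge_1[OF q] A by (simp add: m_def)
  have K1: "K1 > 0" unfolding K1_def using C nagaev_const_pos[of q] a m by (intro add_pos_pos mult_pos_pos) auto
  have K2: "K2 > 0" unfolding K2_def using r \<gamma> nagaev_const_pos[of q] by (intro add_nonneg_pos mult_nonneg_nonneg) auto
  \<comment> \<open>The summand 4 (1 + m) expresses the second moment, which is at most (1 + m) / n,
    in units of J^2.\<close>
  define K0 where "K0 = K1 + K2 + 4 * (1 + m)"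
  have K0: "K0 > 0" using K1 K2 m by (simp add: K0_def)
  obtain K3 where K3: "K3 > 0" and tr: "\<And>(M::(int \<Rightarrow> 'e) measure) T w J L. prob_space M \<Longrightarrow> bmeas M T \<Longrightarrow> w > 0 \<Longrightarrow> J > 0 \<Longrightarrow> L \<ge> 0 \<Longrightarrow>
    (\<And>v. v > 0 \<Longrightarrow> measure M {\<omega>\<in>space M. v \<le> \<bar>T \<omega>\<bar>} \<le> K0 * (L / v powr q + exp (- (r * v\<^sup>2 / J\<^sup>2)))) \<Longrightarrow>
    (\<integral>\<omega>. (T \<omega>)\<^sup>2 \<partial>M) \<le> K0 * J\<^sup>2 \<Longrightarrow>
    (\<integral>\<omega>. trunc_sq w (T \<omega>) \<partial>M) \<le> K3 * (L * w powr (2 - q) + (J\<^sup>2 + w\<^sup>2) * exp (- (r / 2 * w\<^sup>2 / J\<^sup>2)))"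
    using trunc_sq_from_tails[OF q r K0] by blast
  define K where "K = K3 + m + (1 + m)"
  have K: "K > 0" "K3 \<le> K" "m \<le> K" "1 + m \<le> K" using K3 m by (auto simp: K_def)
  show ?thesis
  proof (rule exI[of _ K], intro conjI K(1) exI[of _ "r/2"] allI impI)
    show "r / 2 > 0" using r by simp
    fix \<nu> :: "'e measure" and h \<delta> and n :: nat and w :: real
    assume cs: "coupled_seq \<nu> h \<delta> q" and dep: "dep_tail A \<alpha> \<delta>" and n: "n \<ge> 2" and w: "w > 0"
    interpret coupled_seq \<nu> h \<delta> q by fact
    define J where "J = J_alpha q \<alpha> n"
    have J: "J > 0" using J_alpha_pos[OF n] by (simp add: J_def)
    define Lq where "Lq = L_alpha q \<alpha> n powr q"
    obtain L where L: "n \<le> 2 ^ L" "2 ^ L \<le> 2 * n" using ex_power_two_between[of n] n by auto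
    obtain wt where w0: "real n powr (- q * (\<alpha> + 1/2)) \<le> C * Lq"
      and wt: "\<And>l. l \<le> L \<Longrightarrow> wt l > 0" "(\<Sum>l\<le>L. wt l) \<le> 1/2"
      and w1: "(\<Sum>l\<le>L. real n powr (1 - q) * 2 powr ((q / 2 - \<alpha> * q - 1) * real l) * wt l powr (- q)) \<le> C * Lq"
      and w2: "\<And>l. l \<le> L \<Longrightarrow> c * (1 + \<gamma> * real l) / J\<^sup>2 \<le> (wt l)\<^sup>2 * 2 powr (2 * \<alpha> * real l) * real n"
      using W[OF n L] unfolding Lq_def J_def by blast
    show "\<exists>N0. \<forall>N\<ge>N0. (\<integral>\<omega>. trunc_sq w (T N n \<omega> / real n) \<partial>Q) \<le> K * dev_bound q \<alpha> (r/2) n w"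
    proof (intro exI[of _ "2 ^ L"] allI impI)
      fix N :: nat assume N: "2 ^ L \<le> N"
      define X where "X = (\<lambda>\<omega>. T N n \<omega> / real n)"
      have X: "bmeas Q X" unfolding X_def by (intro bmeas_intros)
      have iX: "integrable Q (\<lambda>\<omega>. trunc_sq w (X \<omega>))" "integrable Q (\<lambda>\<omega>. (X \<omega>)\<^sup>2)" "integrable Q (\<lambda>\<omega>. \<bar>X \<omega>\<bar> powr q)"
        using X q by (auto intro!: Q.bmeas_integrable bmeas_intros)
      have mom: "(\<integral>\<omega>. \<bar>X \<omega>\<bar> powr q \<partial>Q) \<le> m * real n powr (- q/2)"
        unfolding X_def m_def by (rule scaled_moment[OF dep A n])
      have var: "(\<integral>\<omega>. (X \<omega>)\<^sup>2 \<partial>Q) \<le> (1 + m) * (1 / real n)"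
      proof -
        have "(\<integral>\<omega>. (X \<omega>)\<^sup>2 \<partial>Q) \<le> (\<integral>\<omega>. 1 / real n * (1 + real n powr (q/2) * \<bar>X \<omega>\<bar> powr q) \<partial>Q)"
        proof (rule integral_mono)
          fix \<omega>
          define u where "u = sqrt (real n) * \<bar>X \<omega>\<bar>"
          have u: "u \<ge> 0" by (simp add: u_def)
          have "u\<^sup>2 \<le> 1 + u powr q"
          proof (cases "u \<le> 1")
            case True
            then have "u\<^sup>2 \<le> 1" using u by (simp add: power_le_one)
            then show ?thesis by (simp add: add_increasing2)
          next
            case False
            then have "u\<^sup>2 = u powr 2" using u by simp
            also have "\<dots> \<le> u powr q" using False q by (intro powr_mono) auto
            finally show ?thesis by simp
          qed
          moreover have "u\<^sup>2 = real n * (X \<omega>)\<^sup>2" by (simp add: u_def power_mult_distrib)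
          moreover have "u powr q = real n powr (q/2) * \<bar>X \<omega>\<bar> powr q"
            by (simp add: u_def powr_mult powr_half_sqrt[symmetric] powr_powr)
          ultimately have "real n * (X \<omega>)\<^sup>2 \<le> 1 + real n powr (q/2) * \<bar>X \<omega>\<bar> powr q" by simp
          then have "(X \<omega>)\<^sup>2 \<le> (1 + real n powr (q/2) * \<bar>X \<omega>\<bar> powr q) / real n"
            using n by (simp add: pos_le_divide_eq mult.commute)
          then show "(X \<omega>)\<^sup>2 \<le> 1 / real n * (1 + real n powr (q/2) * \<bar>X \<omega>\<bar> powr q)" by simp
        qed (use iX in auto)
        also have "\<dots> = 1 / real n * (1 + real n powr (q/2) * (\<integral>\<omega>. \<bar>X \<omega>\<bar> powr q \<partial>Q))"
          using iX by (simp add: Q.prob_space)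
        also have "\<dots> \<le> 1 / real n * (1 + real n powr (q/2) * (m * real n powr (- q/2)))"
          using mom by (intro mult_left_mono add_left_mono) auto
        also have "\<dots> = (1 + m) * (1 / real n)" using n by (simp add: powr_minus field_simps)
        finally show ?thesis .
      qed
      have b1: "(\<integral>\<omega>. trunc_sq w (X \<omega>) \<partial>Q) \<le> K * (1 / real n)"
      proof -
        have "(\<integral>\<omega>. trunc_sq w (X \<omega>) \<partial>Q) \<le> (\<integral>\<omega>. (X \<omega>)\<^sup>2 \<partial>Q)"
          using iX by (intro integral_mono trunc_sq_le)
        also note var
        also have "(1 + m) * (1 / real n) \<le> K * (1 / real n)" using K by (intro mult_right_mono) auto
        finally show ?thesis .
      qed
      have b2: "(\<integral>\<omega>. trunc_sq w (X \<omega>) \<partial>Q) \<le> K * (w powr (2 - q) * real n powr (- q/2))"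
      proof -
        have "(\<integral>\<omega>. trunc_sq w (X \<omega>) \<partial>Q) \<le> (\<integral>\<omega>. w powr (2 - q) * \<bar>X \<omega>\<bar> powr q \<partial>Q)"
        proof (rule integral_mono)
          fix \<omega>
          show "trunc_sq w (X \<omega>) \<le> w powr (2 - q) * \<bar>X \<omega>\<bar> powr q"
          proof (cases "w \<le> \<bar>X \<omega>\<bar>")
            case True
            then have "(X \<omega>)\<^sup>2 = \<bar>X \<omega>\<bar> powr (2 - q) * \<bar>X \<omega>\<bar> powr q"
              using w by (simp add: powr_add[symmetric])
            also have "\<dots> \<le> w powr (2 - q) * \<bar>X \<omega>\<bar> powr q"
              using True w q by (intro mult_right_mono powr_mono2') auto
            finally show ?thesis using True by (simp add: trunc_sq_def)
          qed (simp add: trunc_sq_def)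
        qed (use iX in auto)
        also have "\<dots> = w powr (2 - q) * (\<integral>\<omega>. \<bar>X \<omega>\<bar> powr q \<partial>Q)" by simp
        also have "\<dots> \<le> w powr (2 - q) * (m * real n powr (- q/2))" using mom by (intro mult_left_mono) auto
        also have "\<dots> = m * (w powr (2 - q) * real n powr (- q/2))" by simp
        also have "\<dots> \<le> K * (w powr (2 - q) * real n powr (- q/2))" using K by (intro mult_right_mono) auto
        finally show ?thesis .
      qed
      have b3: "(\<integral>\<omega>. trunc_sq w (X \<omega>) \<partial>Q) \<le> K * (Lq * w powr (2 - q) + (J\<^sup>2 + w\<^sup>2) * exp (- (r / 2 * w\<^sup>2 / J\<^sup>2)))"
      proof -
        have "(\<integral>\<omega>. trunc_sq w (X \<omega>) \<partial>Q) \<le> K3 * (Lq * w powr (2 - q) + (J\<^sup>2 + w\<^sup>2) * exp (- (r / 2 * w\<^sup>2 / J\<^sup>2)))"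
        proof (rule tr)
          show "prob_space Q" by (rule Q.prob_space_axioms)
          show "Lq \<ge> 0" by (simp add: Lq_def)
          have "(1 + m) * (1 / real n) \<le> (1 + m) * (4 * J\<^sup>2)"
            unfolding J_def using m by (intro mult_left_mono inverse_n_le_J_alpha_sq q n) auto
          also have "\<dots> \<le> K0 * J\<^sup>2" using K1 K2 by (simp add: K0_def algebra_simps)
          finally show "(\<integral>\<omega>. (X \<omega>)\<^sup>2 \<partial>Q) \<le> K0 * J\<^sup>2" using var by simp
          fix v :: real assume v: "v > 0"
          have "Q.prob {\<omega>\<in>space Q. v \<le> \<bar>X \<omega>\<bar>} \<le> K1 * (Lq / v powr q) + K2 * exp (- (r * v\<^sup>2 / J\<^sup>2))"
            unfolding X_def K1_def K2_def m_def r_def a_def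
            by (rule scaled_tail[OF \<alpha> A n dep L N v C c \<gamma> J w0 wt w1 w2])
          also have "\<dots> \<le> K0 * (Lq / v powr q) + K0 * exp (- (r * v\<^sup>2 / J\<^sup>2))"
            using K1 K2 m by (intro add_mono mult_right_mono) (auto simp: K0_def Lq_def)
          finally show "Q.prob {\<omega>\<in>space Q. v \<le> \<bar>X \<omega>\<bar>} \<le> K0 * (Lq / v powr q + exp (- (r * v\<^sup>2 / J\<^sup>2)))"
            by (simp add: distrib_left)
        qed (use X w J in auto)
        also have "\<dots> \<le> K * (Lq * w powr (2 - q) + (J\<^sup>2 + w\<^sup>2) * exp (- (r / 2 * w\<^sup>2 / J\<^sup>2)))"
          using K by (intro mult_right_mono) (auto simp: Lq_def)
        finally show ?thesis .
      qed
      have "(\<integral>\<omega>. trunc_sq w (X \<omega>) \<partial>Q) / K \<le> dev_bound q \<alpha> (r/2) n w"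
        using b1 b2 b3 K(1) unfolding dev_bound_def J_def[symmetric] Lq_def[symmetric]
        by (simp add: pos_divide_le_eq mult.commute)
      then show "(\<integral>\<omega>. trunc_sq w (T N n \<omega> / real n) \<partial>Q) \<le> K * dev_bound q \<alpha> (r/2) n w"
        using K(1) by (simp add: X_def pos_divide_le_eq mult.commute)
    qed
  qed
qed

section \<open>Products of unbounded causal processes\<close>

text \<open>Finiteness of the integral has to be extracted first, since \<open>enn2real\<close> maps
  infinity to 0.\<close>

lemma nn_integral_le_of_Lnorm:
  assumes "Lnorm M w X \<le> ennreal c" "c \<ge> 0" "w > 0"
  shows "(\<integral>\<^sup>+x. ennreal (\<bar>X x\<bar> powr w) \<partial>M) \<le> ennreal (c powr w)"
proof -
  define I where "I = (\<integral>\<^sup>+x. ennreal (\<bar>X x\<bar> powr w) \<partial>M)"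
  have fin: "I \<noteq> \<infinity>" using assms(1) by (auto simp: Lnorm_def I_def[symmetric] Let_def top_unique split: if_splits)
  then have "ennreal (enn2real I powr (1/w)) \<le> ennreal c"
    using assms(1) by (simp add: Lnorm_def I_def[symmetric] Let_def)
  then have "enn2real I powr (1/w) \<le> c" using assms(2) by simp
  then have "(enn2real I powr (1/w)) powr w \<le> c powr w" using assms by (intro powr_mono2) auto
  then have "enn2real I \<le> c powr w" using assms by (simp add: powr_powr)
  then have "ennreal (enn2real I) \<le> ennreal (c powr w)" by (rule ennreal_leI)
  moreover have "ennreal (enn2real I) = I" using fin by (simp add: less_top)
  ultimately show ?thesis unfolding I_def[symmetric] by metis
qed

lemma Lnorm_le_of_nn_integral:
  assumes "(\<integral>\<^sup>+x. ennreal (\<bar>X x\<bar> powr w) \<partial>M) \<le> ennreal (c powr w)" "c \<ge> 0" "w > 0"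
  shows "Lnorm M w X \<le> ennreal c"
proof -
  define I where "I = (\<integral>\<^sup>+x. ennreal (\<bar>X x\<bar> powr w) \<partial>M)"
  have I: "I \<le> ennreal (c powr w)" using assms by (simp add: I_def)
  then have fin: "I \<noteq> \<infinity>" by (auto simp: top_unique)
  have "enn2real I \<le> c powr w" using enn2real_mono[OF I] by simp
  then have "enn2real I powr (1/w) \<le> (c powr w) powr (1/w)" using assms by (intro powr_mono2) auto
  also have "\<dots> = c" using assms by (simp add: powr_powr)
  finally show ?thesis using fin by (simp add: Lnorm_def I_def[symmetric] Let_def ennreal_leI)
qed

text \<open>Truncation by projection on an interval is 1-Lipschitz, so it does not increase coupling
  distances; setting large values to 0 would.\<close>

definition clip :: "real \<Rightarrow> real \<Rightarrow> real" where
  "clip R t = max (- R) (min R t)"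

lemma clip_measurable [measurable]: "clip R \<in> borel_measurable borel"
  unfolding clip_def by measurable

lemma abs_clip_le: "R \<ge> 0 \<Longrightarrow> \<bar>clip R t\<bar> \<le> R" "R \<ge> 0 \<Longrightarrow> \<bar>clip R t\<bar> \<le> \<bar>t\<bar>"
  by (auto simp: clip_def)

lemma abs_clip_diff_le: "\<bar>clip R s - clip R t\<bar> \<le> \<bar>s - t\<bar>"
  by (auto simp: clip_def)

lemma clip_eq: "\<bar>t\<bar> \<le> R \<Longrightarrow> clip R t = t"
  by (auto simp: clip_def)

context prob_space
begin

lemma bmeas_integral_le:
  assumes f: "bmeas M f" "\<And>x. f x \<ge> 0" and le: "(\<integral>\<^sup>+x. ennreal (f x) \<partial>M) \<le> ennreal c" and c: "c \<ge> 0"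
  shows "expectation f \<le> c"
proof -
  have "ennreal (expectation f) = (\<integral>\<^sup>+x. ennreal (f x) \<partial>M)"
    using f by (intro nn_integral_eq_integral[symmetric] bmeas_integrable) auto
  then show ?thesis using le c by (metis ennreal_le_iff)
qed

text \<open>Cauchy-Schwarz from a b \<le> a^2/2 + b^2/2 with both factors normalised. The bound
  \<open>t\<close> is a coupling coefficient and may be 0, so it is enlarged by \<eta>, which then
  tends to 0.\<close>

lemma bmeas_cauchy_schwarz_powr:
  assumes q: "q > 0" and X: "bmeas M X" and Y: "bmeas M Y" and s: "s > 0" and t: "t \<ge> 0"
    and EX: "expectation (\<lambda>x. \<bar>X x\<bar> powr (2 * q)) \<le> s powr (2 * q)"
    and EY: "expectation (\<lambda>x. \<bar>Y x\<bar> powr (2 * q)) \<le> t powr (2 * q)"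
  shows "expectation (\<lambda>x. \<bar>X x * Y x\<bar> powr q) \<le> (s * t) powr q"
proof -
  have iX: "integrable M (\<lambda>x. \<bar>X x\<bar> powr (2 * q))" "integrable M (\<lambda>x. \<bar>Y x\<bar> powr (2 * q))"
    "integrable M (\<lambda>x. \<bar>X x * Y x\<bar> powr q)"
    using X Y q by (auto intro!: bmeas_integrable bmeas_intros)
  have *: "expectation (\<lambda>x. \<bar>X x * Y x\<bar> powr q) \<le> (s * (t + \<eta>)) powr q" if \<eta>: "\<eta> > 0" for \<eta>
  proof -
    define u where "u = t + \<eta>"
    have u: "u > 0" using t \<eta> by (simp add: u_def)
    have sq: "(a powr q)\<^sup>2 = a powr (2 * q)" for a :: real by (simp add: power2_eq_square powr_add[symmetric])
    have "expectation (\<lambda>x. \<bar>X x * Y x\<bar> powr q) \<le>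
      expectation (\<lambda>x. (s * u) powr q * (\<bar>X x\<bar> powr (2 * q) / s powr (2 * q) / 2 + \<bar>Y x\<bar> powr (2 * q) / u powr (2 * q) / 2))"
    proof (rule integral_mono)
      fix x
      define a b where "a = \<bar>X x\<bar> powr q / s powr q" and "b = \<bar>Y x\<bar> powr q / u powr q"
      have "a * b \<le> a\<^sup>2 / 2 + b\<^sup>2 / 2" using sum_squares_bound[of a b] by simp
      then have "(s * u) powr q * (a * b) \<le> (s * u) powr q * (a\<^sup>2 / 2 + b\<^sup>2 / 2)"
        by (rule mult_left_mono) simp
      moreover have "(s * u) powr q * (a * b) = \<bar>X x * Y x\<bar> powr q"
        using s u by (simp add: a_def b_def powr_mult abs_mult)
      ultimately show "\<bar>X x * Y x\<bar> powr q \<le> (s * u) powr q * (\<bar>X x\<bar> powr (2 * q) / s powr (2 * q) / 2 + \<bar>Y x\<bar> powr (2 * q) / u powr (2 * q) / 2)"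
        by (simp add: a_def b_def power_divide sq)
    qed (use iX in auto)
    also have "\<dots> = (s * u) powr q * (expectation (\<lambda>x. \<bar>X x\<bar> powr (2 * q)) / s powr (2 * q) / 2 + expectation (\<lambda>x. \<bar>Y x\<bar> powr (2 * q)) / u powr (2 * q) / 2)"
      using iX by simp
    also have "\<dots> \<le> (s * u) powr q * (1 / 2 + 1 / 2)"
    proof (intro mult_left_mono add_mono divide_right_mono)
      show "expectation (\<lambda>x. \<bar>X x\<bar> powr (2 * q)) / s powr (2 * q) \<le> 1" using EX s by simp
      have "t powr (2 * q) \<le> u powr (2 * q)" using t \<eta> q by (intro powr_mono2) (auto simp: u_def)
      then show "expectation (\<lambda>x. \<bar>Y x\<bar> powr (2 * q)) / u powr (2 * q) \<le> 1" using EY u by simp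
    qed auto
    finally show ?thesis by (simp add: u_def)
  qed
  have lim: "((\<lambda>\<eta>. (s * (t + \<eta>)) powr q) \<longlongrightarrow> (s * (t + 0)) powr q) (at_right 0)"
    using q s t by (intro tendsto_powr' tendsto_intros)
      (auto simp: eventually_at_right_field intro!: exI[of _ 1])
  have "expectation (\<lambda>x. \<bar>X x * Y x\<bar> powr q) \<le> (s * (t + 0)) powr q"
    by (rule tendsto_lowerbound[OF lim]) (use * in \<open>auto simp: eventually_at_right_field intro!: exI[of _ 1]\<close>)
  then show ?thesis by simp
qed

lemma bmeas_add_powr_le:
  assumes q: "q > 1" and X: "bmeas M X" "bmeas M Y" and ab: "a \<ge> 0" "b \<ge> 0"
    and EX: "expectation (\<lambda>x. \<bar>X x\<bar> powr q) \<le> a powr q" and EY: "expectation (\<lambda>x. \<bar>Y x\<bar> powr q) \<le> b powr q"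
  shows "expectation (\<lambda>x. \<bar>X x + Y x\<bar> powr q) \<le> (a + b) powr q"
  using bmeas_minkowski[of q "UNIV :: bool set" "\<lambda>i. if i then X else Y" "\<lambda>i. if i then a else b"] assms
  by (simp add: UNIV_bool add.commute)

end

text \<open>Pays for the halved threshold of \<open>trunc_sq_transfer\<close>: a constant factor and
  a quarter of the Gaussian rate.\<close>

lemma dev_bound_half:
  assumes q: "q > 2" and n: "n \<ge> 2" and w: "w > 0" and c: "c > 0"
  shows "dev_bound q \<alpha> c n (w/2) \<le> 2 powr q * dev_bound q \<alpha> (c/4) n w"
proof -
  have p: "(w/2) powr (2 - q) \<le> 2 powr q * w powr (2 - q)"
  proof -
    have "(w/2) powr (2 - q) = 2 powr (q - 2) * w powr (2 - q)"
      using w by (simp add: powr_divide powr_diff field_simps)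
    also have "\<dots> \<le> 2 powr q * w powr (2 - q)" by (intro mult_right_mono powr_mono) auto
    finally show ?thesis .
  qed
  have q1: "1 \<le> 2 powr q" using q by (intro ge_one_powr_ge_zero) auto
  define J where "J = J_alpha q \<alpha> n"
  define E where "E = exp (- (c/4 * w\<^sup>2 / J\<^sup>2))"
  have E: "exp (- (c * (w/2)\<^sup>2 / J\<^sup>2)) = E" by (simp add: E_def power_divide)
  have 1: "1 / real n \<le> 2 powr q * (1 / real n)" using mult_right_mono[OF q1, of "1 / real n"] by simp
  have 2: "(w/2) powr (2 - q) * real n powr (- q/2) \<le> 2 powr q * (w powr (2 - q) * real n powr (- q/2))"
    using mult_right_mono[OF p, of "real n powr (- q/2)"] by (simp add: mult.assoc)
  have 3: "L_alpha q \<alpha> n powr q * (w/2) powr (2 - q) + (J\<^sup>2 + (w/2)\<^sup>2) * E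
      \<le> 2 powr q * (L_alpha q \<alpha> n powr q * w powr (2 - q) + (J\<^sup>2 + w\<^sup>2) * E)"
  proof -
    have a: "L_alpha q \<alpha> n powr q * (w/2) powr (2 - q) \<le> L_alpha q \<alpha> n powr q * (2 powr q * w powr (2 - q))"
      by (intro mult_left_mono p) auto
    have "(J\<^sup>2 + (w/2)\<^sup>2) * E \<le> (J\<^sup>2 + w\<^sup>2) * E"
      by (intro mult_right_mono) (auto simp: E_def power_divide)
    also have "1 * ((J\<^sup>2 + w\<^sup>2) * E) \<le> 2 powr q * ((J\<^sup>2 + w\<^sup>2) * E)"
      by (intro mult_right_mono q1) (auto simp: E_def)
    finally show ?thesis using a by (simp add: distrib_left mult_ac)
  qed
  show ?thesis
    unfolding dev_bound_def J_def[symmetric] E E_def[symmetric]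
    using 1 2 3 by (auto simp: min_def)
qed

context iid_space
begin

definition Sdev :: "((nat \<Rightarrow> 'e) \<Rightarrow> real) \<Rightarrow> nat \<Rightarrow> (int \<Rightarrow> 'e) \<Rightarrow> real" where
  "Sdev f n \<omega> = (\<Sum>i<n. f (\<lambda>l. \<omega> (int i + 1 - int l))) / real n - (\<integral>x. f x \<partial>seqs)"

definition couple :: "nat \<Rightarrow> (nat option \<Rightarrow> 'e) \<Rightarrow> nat \<Rightarrow> 'e" where
  "couple m x l = (if l = m then x None else x (Some l))"

lemma seqs_measurable_shift [measurable]:
  "(\<lambda>\<omega> l. \<omega> (i - int l)) \<in> Q \<rightarrow>\<^sub>M seqs"
  "(\<lambda>x l. x (Some l)) \<in> (seqs :: (nat option \<Rightarrow> 'e) measure) \<rightarrow>\<^sub>M seqs"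
  "couple m \<in> (seqs :: (nat option \<Rightarrow> 'e) measure) \<rightarrow>\<^sub>M seqs"
proof -
  show "(\<lambda>\<omega> l. \<omega> (i - int l)) \<in> Q \<rightarrow>\<^sub>M seqs" "(\<lambda>x l. x (Some l)) \<in> (seqs :: (nat option \<Rightarrow> 'e) measure) \<rightarrow>\<^sub>M seqs"
    by (auto intro!: measurable_PiM_single' simp: space_PiM PiE_iff)
  have "(\<lambda>x l. couple m x l) \<in> (seqs :: (nat option \<Rightarrow> 'e) measure) \<rightarrow>\<^sub>M seqs"
    unfolding couple_def by (rule measurable_PiM_single') (auto simp: space_PiM PiE_iff)
  then show "couple m \<in> (seqs :: (nat option \<Rightarrow> 'e) measure) \<rightarrow>\<^sub>M seqs" by simp
qed

lemma prob_space_seqs: "prob_space (seqs :: ('i \<Rightarrow> 'e) measure)"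
  by (intro prob_space_PiM base.prob_space_axioms)

lemma distr_reindex:
  assumes "inj f"
  shows "distr seqs (seqs :: ('j \<Rightarrow> 'e) measure) (\<lambda>\<omega> j. \<omega> (f j)) = seqs"
proof -
  have "distr (PiM UNIV (\<lambda>_. \<nu>)) (\<Pi>\<^sub>M j\<in>UNIV. \<nu>) (\<lambda>\<omega>. \<lambda>j\<in>UNIV. \<omega> (f j)) = (\<Pi>\<^sub>M j\<in>UNIV. \<nu>)"
    using assms base.prob_space_axioms
    by (intro distr_PiM_reindex[where M = "\<lambda>_. \<nu>" and f = f and K = UNIV]) auto
  then show ?thesis unfolding restrict_UNIV .
qed

lemma distr_couple: "distr seqs seqs (couple m) = (seqs :: (nat \<Rightarrow> 'e) measure)"
proof -
  have "couple m = (\<lambda>\<omega> j. \<omega> (if j = m then None else Some j))" by (auto simp: couple_def fun_eq_iff)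
  then show ?thesis by (simp only:) (rule distr_reindex, auto simp: inj_on_def split: if_splits)
qed

lemma nn_integral_couple:
  assumes [measurable]: "f \<in> borel_measurable seqs"
  shows "(\<integral>\<^sup>+x. f (couple m x) \<partial>seqs) = (\<integral>\<^sup>+x. f x \<partial>(seqs :: (nat \<Rightarrow> 'e) measure))"
    "(\<integral>\<^sup>+x. f (\<lambda>l. x (Some l)) \<partial>seqs) = (\<integral>\<^sup>+x. f x \<partial>(seqs :: (nat \<Rightarrow> 'e) measure))"
proof -
  show "(\<integral>\<^sup>+x. f (couple m x) \<partial>seqs) = (\<integral>\<^sup>+x. f x \<partial>(seqs :: (nat \<Rightarrow> 'e) measure))"
  proof -
    have "(\<integral>\<^sup>+x. f (couple m x) \<partial>seqs) = (\<integral>\<^sup>+x. f x \<partial>distr seqs seqs (couple m))"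
      by (intro nn_integral_distr[symmetric]) auto
    then show ?thesis by (simp only: distr_couple)
  qed
  show "(\<integral>\<^sup>+x. f (\<lambda>l. x (Some l)) \<partial>seqs) = (\<integral>\<^sup>+x. f x \<partial>(seqs :: (nat \<Rightarrow> 'e) measure))"
  proof -
    have "(\<integral>\<^sup>+x. f (\<lambda>l. x (Some l)) \<partial>seqs) = (\<integral>\<^sup>+x. f x \<partial>distr seqs seqs (\<lambda>x l. x (Some l)))"
      by (intro nn_integral_distr[symmetric]) auto
    then show ?thesis by (simp only: distr_reindex[OF inj_Some])
  qed
qed

text \<open>Clipping each factor before multiplying keeps its moments and its coupling distances
  under control. The clipped product has a new mean; subtracting it restores centring and leaves
  differences of coupled values unchanged.\<close>

lemma coupled_seq_clip:
  fixes q \<mu> :: real and g1 g2 :: "(nat \<Rightarrow> 'e) \<Rightarrow> real"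
  assumes q: "q > 2" and \<mu>: "\<mu> > 0" and R: "R \<ge> 0"
    and g[measurable]: "g1 \<in> borel_measurable seqs" "g2 \<in> borel_measurable seqs"
    and mom: "(\<integral>\<^sup>+x. ennreal (\<bar>g1 x\<bar> powr (2*q)) \<partial>seqs) \<le> ennreal (\<mu> powr (2*q))"
      "(\<integral>\<^sup>+x. ennreal (\<bar>g2 x\<bar> powr (2*q)) \<partial>seqs) \<le> ennreal (\<mu> powr (2*q))"
    and \<theta>: "\<And>m. \<theta>1 m \<ge> 0" "\<And>m. \<theta>2 m \<ge> 0"
      "\<And>m. (\<integral>\<^sup>+x. ennreal (\<bar>g1 (\<lambda>l. x (Some l)) - g1 (couple m x)\<bar> powr (2*q)) \<partial>seqs) \<le> ennreal (\<theta>1 m powr (2*q))"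
      "\<And>m. (\<integral>\<^sup>+x. ennreal (\<bar>g2 (\<lambda>l. x (Some l)) - g2 (couple m x)\<bar> powr (2*q)) \<partial>seqs) \<le> ennreal (\<theta>2 m powr (2*q))"
  defines "f \<equiv> \<lambda>x. clip R (g1 x) * clip R (g2 x)"
  shows "coupled_seq \<nu> (\<lambda>x. f x - (\<integral>y. f y \<partial>seqs)) (\<lambda>m. \<mu> * (\<theta>1 m + \<theta>2 m)) q"
proof -
  interpret N: prob_space "seqs :: (nat \<Rightarrow> 'e) measure" by (rule prob_space_seqs)
  interpret O: prob_space "seqs :: (nat option \<Rightarrow> 'e) measure" by (rule prob_space_seqs)
  have bc: "bmeas seqs (\<lambda>x. clip R (g1 x))" "bmeas seqs (\<lambda>x. clip R (g2 x))"
    using abs_clip_le R by (auto intro!: bmeasI)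
  have bf: "bmeas seqs f" unfolding f_def by (intro bmeas_intros bc)
  show ?thesis
  proof (unfold_locales, rule q)
    show "bmeas seqs (\<lambda>x. f x - (\<integral>y. f y \<partial>seqs))" by (intro bmeas_intros bf)
    show "(\<integral>x. f x - (\<integral>y. f y \<partial>seqs) \<partial>seqs) = 0"
      using N.bmeas_integrable[OF bf] by (simp add: N.prob_space)
    fix m
    show "0 \<le> \<mu> * (\<theta>1 m + \<theta>2 m)" using \<mu> \<theta> by simp
    let ?S = "\<lambda>(x :: nat option \<Rightarrow> 'e) l. x (Some l)"
    define a1 where "a1 = (\<lambda>x. clip R (g1 (?S x)))"
    define a2 where "a2 = (\<lambda>x. clip R (g2 (?S x)))"
    define b1 where "b1 = (\<lambda>x. clip R (g1 (couple m x)))"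
    define b2 where "b2 = (\<lambda>x. clip R (g2 (couple m x)))"
    have bb: "bmeas seqs a1" "bmeas seqs a2" "bmeas seqs b1" "bmeas seqs b2"
      unfolding a1_def a2_def b1_def b2_def using abs_clip_le(1)[OF R] by (auto intro!: bmeasI)
    have le_of: "O.expectation (\<lambda>x. \<bar>F x\<bar> powr (2*q)) \<le> t powr (2*q)"
      if "bmeas seqs F" "\<And>x. \<bar>F x\<bar> \<le> \<bar>G x\<bar>" "(\<integral>\<^sup>+x. ennreal (\<bar>G x\<bar> powr (2*q)) \<partial>seqs) \<le> ennreal (t powr (2*q))" for F G t
    proof (rule O.bmeas_integral_le)
      show "bmeas seqs (\<lambda>x. \<bar>F x\<bar> powr (2*q))" using that q by (intro bmeas_intros) auto
      have "(\<integral>\<^sup>+x. ennreal (\<bar>F x\<bar> powr (2*q)) \<partial>seqs) \<le> (\<integral>\<^sup>+x. ennreal (\<bar>G x\<bar> powr (2*q)) \<partial>seqs)"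
        using that q by (intro nn_integral_mono ennreal_leI powr_mono2) auto
      then show "(\<integral>\<^sup>+x. ennreal (\<bar>F x\<bar> powr (2*q)) \<partial>seqs) \<le> ennreal (t powr (2*q))" using that by order
    qed auto
    have m1: "O.expectation (\<lambda>x. \<bar>b1 x\<bar> powr (2*q)) \<le> \<mu> powr (2*q)"
    proof (rule le_of[OF bb(3), of "\<lambda>x. g1 (couple m x)"])
      show "\<bar>b1 x\<bar> \<le> \<bar>g1 (couple m x)\<bar>" for x unfolding b1_def by (rule abs_clip_le(2)[OF R])
      show "(\<integral>\<^sup>+x. ennreal (\<bar>g1 (couple m x)\<bar> powr (2*q)) \<partial>seqs) \<le> ennreal (\<mu> powr (2*q))"
        using mom(1) nn_integral_couple(1)[of "\<lambda>x. ennreal (\<bar>g1 x\<bar> powr (2*q))" m] by simp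
    qed
    have m2: "O.expectation (\<lambda>x. \<bar>a2 x\<bar> powr (2*q)) \<le> \<mu> powr (2*q)"
    proof (rule le_of[OF bb(2), of "\<lambda>x. g2 (?S x)"])
      show "\<bar>a2 x\<bar> \<le> \<bar>g2 (?S x)\<bar>" for x unfolding a2_def by (rule abs_clip_le(2)[OF R])
      show "(\<integral>\<^sup>+x. ennreal (\<bar>g2 (?S x)\<bar> powr (2*q)) \<partial>seqs) \<le> ennreal (\<mu> powr (2*q))"
        using mom(2) nn_integral_couple(2)[of "\<lambda>x. ennreal (\<bar>g2 x\<bar> powr (2*q))"] by simp
    qed
    have d1: "O.expectation (\<lambda>x. \<bar>a1 x - b1 x\<bar> powr (2*q)) \<le> \<theta>1 m powr (2*q)"
      by (rule le_of[OF bmeas_diff[OF bb(1) bb(3)] _ \<theta>(3)]) (simp add: a1_def b1_def abs_clip_diff_le)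
    have d2: "O.expectation (\<lambda>x. \<bar>a2 x - b2 x\<bar> powr (2*q)) \<le> \<theta>2 m powr (2*q)"
      by (rule le_of[OF bmeas_diff[OF bb(2) bb(4)] _ \<theta>(4)]) (simp add: a2_def b2_def abs_clip_diff_le)
    have "O.expectation (\<lambda>x. \<bar>a2 x * (a1 x - b1 x) + b1 x * (a2 x - b2 x)\<bar> powr q) \<le> (\<mu> * \<theta>1 m + \<mu> * \<theta>2 m) powr q"
    proof (rule O.bmeas_add_powr_le)
      show "O.expectation (\<lambda>x. \<bar>a2 x * (a1 x - b1 x)\<bar> powr q) \<le> (\<mu> * \<theta>1 m) powr q"
        using q \<mu> \<theta> by (intro O.bmeas_cauchy_schwarz_powr m2 d1 bmeas_intros bb) auto
      show "O.expectation (\<lambda>x. \<bar>b1 x * (a2 x - b2 x)\<bar> powr q) \<le> (\<mu> * \<theta>2 m) powr q"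
        using q \<mu> \<theta> by (intro O.bmeas_cauchy_schwarz_powr m1 d2 bmeas_intros bb) auto
    qed (use q \<mu> \<theta> in \<open>auto intro!: bmeas_intros bb\<close>)
    moreover have "a2 x * (a1 x - b1 x) + b1 x * (a2 x - b2 x) = f (?S x) - f (couple m x)" for x
      by (simp add: a1_def a2_def b1_def b2_def f_def algebra_simps)
    moreover have "couple m x = (\<lambda>l. if l = m then x None else x (Some l))" for x
      by (simp add: couple_def fun_eq_iff)
    ultimately show "O.expectation (\<lambda>x. \<bar>f (?S x) - (\<integral>y. f y \<partial>seqs) - (f (\<lambda>l. if l = m then x None else x (Some l)) - (\<integral>y. f y \<partial>seqs))\<bar> powr q)
        \<le> (\<mu> * (\<theta>1 m + \<theta>2 m)) powr q"
      by (simp add: distrib_left)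
  qed
qed

lemma integrable_mult_of_moments:
  fixes q :: real and g1 g2 :: "(nat \<Rightarrow> 'e) \<Rightarrow> real"
  assumes q: "q > 2"
    and g[measurable]: "g1 \<in> borel_measurable seqs" "g2 \<in> borel_measurable seqs"
    and mom: "(\<integral>\<^sup>+x. ennreal (\<bar>g1 x\<bar> powr (2*q)) \<partial>seqs) \<le> ennreal (\<mu> powr (2*q))"
      "(\<integral>\<^sup>+x. ennreal (\<bar>g2 x\<bar> powr (2*q)) \<partial>seqs) \<le> ennreal (\<mu> powr (2*q))"
  shows "integrable seqs (\<lambda>x. g1 x * g2 x)"
proof (rule integrableI_bounded)
  interpret N: prob_space "seqs :: (nat \<Rightarrow> 'e) measure" by (rule prob_space_seqs)
  have sq: "t\<^sup>2 \<le> 1 + \<bar>t\<bar> powr (2*q)" for t :: real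
  proof (cases "\<bar>t\<bar> \<le> 1")
    case True
    then have "t\<^sup>2 \<le> 1" by (simp add: abs_square_le_1)
    then show ?thesis by (simp add: add_increasing2)
  next
    case False
    then have "t\<^sup>2 = \<bar>t\<bar> powr 2" by simp
    also have "\<dots> \<le> \<bar>t\<bar> powr (2*q)" using False q by (intro powr_mono) auto
    finally show ?thesis by simp
  qed
  have "norm (g1 x * g2 x) \<le> 2 + \<bar>g1 x\<bar> powr (2*q) + \<bar>g2 x\<bar> powr (2*q)" for x
  proof -
    have "2 * (\<bar>g1 x\<bar> * \<bar>g2 x\<bar>) \<le> (g1 x)\<^sup>2 + (g2 x)\<^sup>2"
      using sum_squares_bound[of "\<bar>g1 x\<bar>" "\<bar>g2 x\<bar>"] by simp
    then show ?thesis using sq[of "g1 x"] sq[of "g2 x"] by (simp add: abs_mult) (smt (verit) mult_nonneg_nonneg abs_ge_zero)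
  qed
  then have "(\<integral>\<^sup>+x. ennreal (norm (g1 x * g2 x)) \<partial>seqs) \<le> (\<integral>\<^sup>+x. 2 + ennreal (\<bar>g1 x\<bar> powr (2*q)) + ennreal (\<bar>g2 x\<bar> powr (2*q)) \<partial>seqs)"
    by (intro nn_integral_mono) (metis (no_types, lifting) add_nonneg_nonneg ennreal_leI ennreal_numeral ennreal_plus powr_ge_zero zero_le_numeral)
  also have "\<dots> = 2 + (\<integral>\<^sup>+x. ennreal (\<bar>g1 x\<bar> powr (2*q)) \<partial>seqs) + (\<integral>\<^sup>+x. ennreal (\<bar>g2 x\<bar> powr (2*q)) \<partial>seqs)"
    by (simp add: nn_integral_add N.emeasure_space_1)
  also have "\<dots> \<le> 2 + ennreal (\<mu> powr (2*q)) + ennreal (\<mu> powr (2*q))"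
    using mom by (intro add_mono) auto
  also have "\<dots> < \<infinity>" by (simp add: ennreal_add_eq_top less_top[symmetric])
  finally show "(\<integral>\<^sup>+x. ennreal (norm (g1 x * g2 x)) \<partial>seqs) < \<infinity>" .
qed measurable

lemma clip_product_tendsto:
  fixes g1 g2 :: "(nat \<Rightarrow> 'e) \<Rightarrow> real"
  assumes g[measurable]: "g1 \<in> borel_measurable seqs" "g2 \<in> borel_measurable seqs"
    and int: "integrable seqs (\<lambda>x. g1 x * g2 x)"
  shows "(\<lambda>r::nat. \<integral>x. \<bar>g1 x * g2 x - clip (real r) (g1 x) * clip (real r) (g2 x)\<bar> \<partial>seqs) \<longlonglongrightarrow> 0"
proof -
  have "(\<lambda>r::nat. \<integral>x. \<bar>g1 x * g2 x - clip (real r) (g1 x) * clip (real r) (g2 x)\<bar> \<partial>seqs) \<longlonglongrightarrow> (\<integral>x. 0 \<partial>(seqs :: (nat \<Rightarrow> 'e) measure))"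
  proof (rule integral_dominated_convergence[where w = "\<lambda>x. 2 * \<bar>g1 x * g2 x\<bar>"])
    show "AE x in seqs. (\<lambda>r::nat. \<bar>g1 x * g2 x - clip (real r) (g1 x) * clip (real r) (g2 x)\<bar>) \<longlonglongrightarrow> 0"
    proof (rule AE_I2)
      fix x
      obtain r0 :: nat where r0: "max \<bar>g1 x\<bar> \<bar>g2 x\<bar> \<le> real r0" using real_arch_simple by blast
      have "\<forall>\<^sub>F r in sequentially. \<bar>g1 x * g2 x - clip (real r) (g1 x) * clip (real r) (g2 x)\<bar> = 0"
        using eventually_ge_at_top[of r0]
      proof eventually_elim
        case (elim r)
        then have "\<bar>g1 x\<bar> \<le> real r" "\<bar>g2 x\<bar> \<le> real r" using r0 by auto
        then show ?case by (simp add: clip_eq)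
      qed
      then show "(\<lambda>r::nat. \<bar>g1 x * g2 x - clip (real r) (g1 x) * clip (real r) (g2 x)\<bar>) \<longlonglongrightarrow> 0"
        by (rule tendsto_eventually)
    qed
    show "AE x in seqs. norm \<bar>g1 x * g2 x - clip (real r) (g1 x) * clip (real r) (g2 x)\<bar> \<le> 2 * \<bar>g1 x * g2 x\<bar>" for r :: nat
    proof (rule AE_I2)
      fix x
      have "\<bar>clip (real r) (g1 x) * clip (real r) (g2 x)\<bar> \<le> \<bar>g1 x * g2 x\<bar>"
        unfolding abs_mult by (intro mult_mono abs_clip_le) auto
      then show "norm \<bar>g1 x * g2 x - clip (real r) (g1 x) * clip (real r) (g2 x)\<bar> \<le> 2 * \<bar>g1 x * g2 x\<bar>"
        unfolding real_norm_def by linarith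
    qed
  qed (use int in auto)
  then show ?thesis by simp
qed

lemma integral_shift:
  fixes f :: "(nat \<Rightarrow> 'e) \<Rightarrow> real"
  assumes [measurable]: "f \<in> borel_measurable seqs"
  shows "(\<integral>\<omega>. f (\<lambda>l. \<omega> (i - int l)) \<partial>Q) = (\<integral>x. f x \<partial>seqs)"
    and "integrable Q (\<lambda>\<omega>. f (\<lambda>l. \<omega> (i - int l))) \<longleftrightarrow> integrable seqs f"
proof -
  have eq: "distr Q seqs (\<lambda>\<omega> l. \<omega> (i - int l)) = (seqs :: (nat \<Rightarrow> 'e) measure)"
    by (rule distr_reindex) (auto simp: inj_on_def)
  show "(\<integral>\<omega>. f (\<lambda>l. \<omega> (i - int l)) \<partial>Q) = (\<integral>x. f x \<partial>seqs)"
  proof -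
    have "(\<integral>\<omega>. f (\<lambda>l. \<omega> (i - int l)) \<partial>Q) = (\<integral>x. f x \<partial>distr Q seqs (\<lambda>\<omega> l. \<omega> (i - int l)))"
      by (intro integral_distr[symmetric]) auto
    then show ?thesis by (simp only: eq)
  qed
  show "integrable Q (\<lambda>\<omega>. f (\<lambda>l. \<omega> (i - int l))) \<longleftrightarrow> integrable seqs f"
  proof -
    have "integrable (distr Q seqs (\<lambda>\<omega> l. \<omega> (i - int l))) f \<longleftrightarrow> integrable Q (\<lambda>\<omega>. f (\<lambda>l. \<omega> (i - int l)))"
      by (intro integrable_distr_eq) auto
    then show ?thesis by (simp only: eq)
  qed
qed

lemma integrable_Sdev:
  assumes [measurable]: "f \<in> borel_measurable seqs" and f: "integrable seqs f"
  shows "integrable Q (Sdev f n)"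
proof -
  have i: "integrable Q (\<lambda>\<omega>. f (\<lambda>l. \<omega> (k - int l)))" for k using f by (simp add: integral_shift)
  show ?thesis unfolding Sdev_def
    by (intro Bochner_Integration.integrable_diff integrable_divide_zero Bochner_Integration.integrable_sum i) auto
qed

text \<open>By stationarity the average and the subtracted mean each contribute one L^1 distance of
  the two functions.\<close>

lemma Sdev_L1_le:
  assumes [measurable]: "f1 \<in> borel_measurable seqs" "f2 \<in> borel_measurable seqs"
    and f: "integrable seqs f1" "integrable seqs f2" and n: "n > 0"
  shows "(\<integral>\<omega>. \<bar>Sdev f1 n \<omega> - Sdev f2 n \<omega>\<bar> \<partial>Q) \<le> 2 * (\<integral>x. \<bar>f1 x - f2 x\<bar> \<partial>seqs)"
proof -
  define e where "e = (\<integral>x. \<bar>f1 x - f2 x\<bar> \<partial>seqs)"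
  let ?s = "\<lambda>i \<omega>. (\<lambda>l::nat. \<omega> (int i + 1 - int l) :: 'e)"
  have i: "integrable Q (\<lambda>\<omega>. f1 (?s i \<omega>))" "integrable Q (\<lambda>\<omega>. f2 (?s i \<omega>))" for i
    using f by (auto simp: integral_shift)
  have d: "\<bar>(\<integral>x. f1 x \<partial>seqs) - (\<integral>x. f2 x \<partial>seqs)\<bar> \<le> e"
  proof -
    have "(\<integral>x. f1 x \<partial>seqs) - (\<integral>x. f2 x \<partial>seqs) = (\<integral>x. f1 x - f2 x \<partial>seqs)" using f by simp
    also have "\<bar>\<dots>\<bar> \<le> e" unfolding e_def by (rule integral_abs_bound)
    finally show ?thesis .
  qed
  have "(\<integral>\<omega>. \<bar>Sdev f1 n \<omega> - Sdev f2 n \<omega>\<bar> \<partial>Q) \<le> (\<integral>\<omega>. (\<Sum>i<n. \<bar>f1 (?s i \<omega>) - f2 (?s i \<omega>)\<bar>) / real n + e \<partial>Q)"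
  proof (rule integral_mono)
    fix \<omega>
    have "Sdev f1 n \<omega> - Sdev f2 n \<omega> = (\<Sum>i<n. f1 (?s i \<omega>) - f2 (?s i \<omega>)) / real n - ((\<integral>x. f1 x \<partial>seqs) - (\<integral>x. f2 x \<partial>seqs))"
      by (simp add: Sdev_def sum_subtractf diff_divide_distrib)
    moreover have "\<bar>(\<Sum>i<n. f1 (?s i \<omega>) - f2 (?s i \<omega>)) / real n\<bar> \<le> (\<Sum>i<n. \<bar>f1 (?s i \<omega>) - f2 (?s i \<omega>)\<bar>) / real n"
      by (simp add: divide_right_mono)
    ultimately show "\<bar>Sdev f1 n \<omega> - Sdev f2 n \<omega>\<bar> \<le> (\<Sum>i<n. \<bar>f1 (?s i \<omega>) - f2 (?s i \<omega>)\<bar>) / real n + e"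
      using d by linarith
  qed (use i f in \<open>auto intro!: integrable_Sdev integrable_abs Bochner_Integration.integrable_diff\<close>)
  also have "\<dots> = (\<Sum>i<n. (\<integral>\<omega>. \<bar>f1 (?s i \<omega>) - f2 (?s i \<omega>)\<bar> \<partial>Q)) / real n + e"
    using i by (simp add: Q.prob_space)
  also have "\<dots> = (\<Sum>i<n. e) / real n + e"
    unfolding e_def using integral_shift(1)[of "\<lambda>x. \<bar>f1 x - f2 x\<bar>"] by simp
  finally show ?thesis using n by (simp add: e_def)
qed

text \<open>Two approximations, by clipping and by cutting the memory, each within e/2 in L^1; the
  clipping error must be below e/4 because \<open>Sdev_L1_le\<close> doubles it. The bound
  \<open>B\<close> is the same for all approximants since the coupling coefficients do not depend on
  the clipping level.\<close>

lemma Sdev_trunc_sq: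
  fixes q \<mu> K c :: real and g1 g2 :: "(nat \<Rightarrow> 'e) \<Rightarrow> real"
  assumes q: "q > 2" and \<mu>: "\<mu> > 0" and n: "n \<ge> 2" and w: "w > 0" and B: "B \<ge> 0"
    and g[measurable]: "g1 \<in> borel_measurable seqs" "g2 \<in> borel_measurable seqs"
    and mom: "(\<integral>\<^sup>+x. ennreal (\<bar>g1 x\<bar> powr (2*q)) \<partial>seqs) \<le> ennreal (\<mu> powr (2*q))"
      "(\<integral>\<^sup>+x. ennreal (\<bar>g2 x\<bar> powr (2*q)) \<partial>seqs) \<le> ennreal (\<mu> powr (2*q))"
    and \<theta>: "\<And>m. \<theta>1 m \<ge> 0" "\<And>m. \<theta>2 m \<ge> 0"
      "\<And>m. (\<integral>\<^sup>+x. ennreal (\<bar>g1 (\<lambda>l. x (Some l)) - g1 (couple m x)\<bar> powr (2*q)) \<partial>seqs) \<le> ennreal (\<theta>1 m powr (2*q))"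
      "\<And>m. (\<integral>\<^sup>+x. ennreal (\<bar>g2 (\<lambda>l. x (Some l)) - g2 (couple m x)\<bar> powr (2*q)) \<partial>seqs) \<le> ennreal (\<theta>2 m powr (2*q))"
    and bd: "\<And>h. coupled_seq \<nu> h (\<lambda>m. \<mu> * (\<theta>1 m + \<theta>2 m)) q \<Longrightarrow>
      \<exists>N0. \<forall>N\<ge>N0. (\<integral>\<omega>. trunc_sq (w/2) (coupled_seq.T \<nu> h N n \<omega> / real n) \<partial>Q) \<le> B"
  shows "(\<integral>\<^sup>+\<omega>. ennreal (trunc_sq w (Sdev (\<lambda>x. g1 x * g2 x) n \<omega>)) \<partial>Q) \<le> ennreal (4 * B)"
proof (rule Q.trunc_sq_transfer[OF _ w B])
  interpret N: prob_space "seqs :: (nat \<Rightarrow> 'e) measure" by (rule prob_space_seqs)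
  have int: "integrable seqs (\<lambda>x. g1 x * g2 x)" by (rule integrable_mult_of_moments[OF q g mom])
  show "integrable Q (Sdev (\<lambda>x. g1 x * g2 x) n)" by (intro integrable_Sdev int) auto
  fix e :: real assume e: "e > 0"
  have "\<forall>\<^sub>F r in sequentially. (\<integral>x. \<bar>g1 x * g2 x - clip (real r) (g1 x) * clip (real r) (g2 x)\<bar> \<partial>seqs) < e / 4"
    using clip_product_tendsto[OF g int] e by (intro order_tendstoD(2)[of _ 0]) auto
  then obtain r :: nat where r: "(\<integral>x. \<bar>g1 x * g2 x - clip (real r) (g1 x) * clip (real r) (g2 x)\<bar> \<partial>seqs) < e / 4"
    by (auto simp: eventually_sequentially)
  define f where "f = (\<lambda>x. clip (real r) (g1 x) * clip (real r) (g2 x))"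
  define h where "h = (\<lambda>x. f x - (\<integral>y. f y \<partial>seqs))"
  have cs: "coupled_seq \<nu> h (\<lambda>m. \<mu> * (\<theta>1 m + \<theta>2 m)) q"
    unfolding h_def f_def by (rule coupled_seq_clip[OF q \<mu> _ g mom \<theta>]) simp
  interpret C: coupled_seq \<nu> h "\<lambda>m. \<mu> * (\<theta>1 m + \<theta>2 m)" q by (rule cs)
  have bf: "bmeas seqs f" unfolding f_def
    by (rule bmeas_mult; rule bmeasI[of _ _ "real r"]) (auto simp: abs_clip_le)
  have [measurable]: "f \<in> borel_measurable seqs" using bf by (rule bmeas_measurable)
  have int_f: "integrable seqs f" by (rule N.bmeas_integrable[OF bf])
  obtain N0 where N0: "\<And>N. N \<ge> N0 \<Longrightarrow> (\<integral>\<omega>. trunc_sq (w/2) (C.T N n \<omega> / real n) \<partial>Q) \<le> B"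
    using bd[OF cs] by blast
  obtain N1 where N1: "\<And>N. N \<ge> N1 \<Longrightarrow> (\<integral>\<omega>. \<bar>(\<Sum>i<n. C.Y i \<omega>) - C.T N n \<omega>\<bar> \<partial>Q) \<le> e / 2"
    using C.T_approx[of "e/2" n] e by auto
  define N where "N = max N0 N1"
  define T where "T = (\<lambda>\<omega>. C.T N n \<omega> / real n)"
  have bT: "bmeas Q T" unfolding T_def by (intro bmeas_intros C.bmeas_T)
  have S_eq: "Sdev f n \<omega> = (\<Sum>i<n. C.Y i \<omega>) / real n" for \<omega>
  proof -
    have "C.Y i \<omega> = f (\<lambda>l. \<omega> (int i + 1 - int l)) - (\<integral>y. f y \<partial>seqs)" for i
      unfolding C.Y_def by (simp only: h_def)
    then show ?thesis using n by (simp add: Sdev_def sum_subtractf diff_divide_distrib)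
  qed
  have bS: "bmeas Q (Sdev f n)" unfolding S_eq[abs_def] by (intro bmeas_intros C.bmeas_Y)
  have "(\<integral>\<omega>. \<bar>Sdev (\<lambda>x. g1 x * g2 x) n \<omega> - T \<omega>\<bar> \<partial>Q) \<le> (\<integral>\<omega>. \<bar>Sdev (\<lambda>x. g1 x * g2 x) n \<omega> - Sdev f n \<omega>\<bar> + \<bar>Sdev f n \<omega> - T \<omega>\<bar> \<partial>Q)"
    using int int_f bS bT by (intro integral_mono Bochner_Integration.integrable_add integrable_abs Bochner_Integration.integrable_diff integrable_Sdev) (auto intro!: Q.bmeas_integrable)
  also have "\<dots> = (\<integral>\<omega>. \<bar>Sdev (\<lambda>x. g1 x * g2 x) n \<omega> - Sdev f n \<omega>\<bar> \<partial>Q) + (\<integral>\<omega>. \<bar>Sdev f n \<omega> - T \<omega>\<bar> \<partial>Q)"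
    using int int_f bS bT by (intro Bochner_Integration.integral_add integrable_abs Bochner_Integration.integrable_diff integrable_Sdev) (auto intro!: Q.bmeas_integrable)
  also have "(\<integral>\<omega>. \<bar>Sdev (\<lambda>x. g1 x * g2 x) n \<omega> - Sdev f n \<omega>\<bar> \<partial>Q) \<le> 2 * (\<integral>x. \<bar>g1 x * g2 x - f x\<bar> \<partial>seqs)"
    using n int_f int by (intro Sdev_L1_le) auto
  also have "\<dots> \<le> e / 2" using r by (simp add: f_def)
  also have "(\<integral>\<omega>. \<bar>Sdev f n \<omega> - T \<omega>\<bar> \<partial>Q) = (\<integral>\<omega>. \<bar>(\<Sum>i<n. C.Y i \<omega>) - C.T N n \<omega>\<bar> / real n \<partial>Q)"
    by (simp add: S_eq T_def diff_divide_distrib[symmetric])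
  also have "\<dots> = (\<integral>\<omega>. \<bar>(\<Sum>i<n. C.Y i \<omega>) - C.T N n \<omega>\<bar> \<partial>Q) / real n" by simp
  also have "\<dots> \<le> (\<integral>\<omega>. \<bar>(\<Sum>i<n. C.Y i \<omega>) - C.T N n \<omega>\<bar> \<partial>Q) / 1"
    using n by (intro divide_left_mono) auto
  also have "\<dots> \<le> e / 2" using N1[of N] by (simp add: N_def)
  finally have "(\<integral>\<omega>. \<bar>Sdev (\<lambda>x. g1 x * g2 x) n \<omega> - T \<omega>\<bar> \<partial>Q) \<le> e" by simp
  moreover have "(\<integral>\<omega>. trunc_sq (w/2) (T \<omega>) \<partial>Q) \<le> B" using N0[of N] by (simp add: N_def T_def)
  ultimately show "\<exists>T. bmeas Q T \<and> (\<integral>\<omega>. \<bar>Sdev (\<lambda>x. g1 x * g2 x) n \<omega> - T \<omega>\<bar> \<partial>Q) \<le> e \<and> (\<integral>\<omega>. trunc_sq (w/2) (T \<omega>) \<partial>Q) \<le> B"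
    using bT by blast
qed

end

section \<open>Entries of the sample covariance matrix\<close>

lemma dev_bound_nonneg: "w > 0 \<Longrightarrow> dev_bound q \<alpha> c n w \<ge> 0"
  by (simp add: dev_bound_def)

locale iid_process = prob_space M for M :: "'a measure" +
  fixes E :: "'e measure" and eps :: "int \<Rightarrow> 'a \<Rightarrow> 'e" and eps0' :: "'a \<Rightarrow> 'e"
  assumes iid: "iid_innov M E eps eps0'"
begin

definition innov :: "int option \<Rightarrow> 'a \<Rightarrow> 'e" where
  "innov oi = (case oi of None \<Rightarrow> eps0' | Some i \<Rightarrow> eps i)"

definition \<nu> :: "'e measure" where
  "\<nu> = distr M E (eps 0)"

lemma sets_\<nu> [measurable_cong, simp]: "sets \<nu> = sets E"
  by (simp add: \<nu>_def)

lemma innov_measurable [measurable]: "innov oi \<in> M \<rightarrow>\<^sub>M E"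
  using iid by (auto simp: iid_innov_def indep_vars_def innov_def)

lemma distr_innov: "distr M E (innov oi) = \<nu>"
  using iid by (auto simp: iid_innov_def innov_def \<nu>_def split: option.split)

sublocale iid_space \<nu>
proof -
  have "prob_space (distr M E (innov (Some 0)))" by (rule prob_space_distr) measurable
  then show "iid_space \<nu>" by (simp add: distr_innov iid_space_def)
qed

lemma innov_seq_measurable [measurable]:
  "(\<lambda>\<omega> j. innov (f j) \<omega>) \<in> M \<rightarrow>\<^sub>M seqs"
proof (rule measurable_PiM_single')
  show "(\<lambda>\<omega>. innov (f j) \<omega>) \<in> M \<rightarrow>\<^sub>M \<nu>" for j
    using innov_measurable by (simp add: measurable_cong_sets[OF refl sets_\<nu>])
  then show "(\<lambda>\<omega> j. innov (f j) \<omega>) \<in> space M \<rightarrow> (\<Pi>\<^sub>E j\<in>UNIV. space \<nu>)"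
    by (auto simp: PiE_iff dest: measurable_space)
qed

text \<open>Any injective selection from the innovations and the extra copy is again an i.i.d.
  sequence with law \<nu>. Every passage between \<open>M\<close> and a canonical sequence space
  rests on this.\<close>

lemma distr_innov_seq:
  assumes "inj f"
  shows "distr M (seqs :: ('j \<Rightarrow> 'e) measure) (\<lambda>\<omega> j. innov (f j) \<omega>) = seqs"
proof -
  have "indep_vars (\<lambda>_. E) innov UNIV"
    using iid by (auto simp: iid_innov_def innov_def[abs_def])
  then have "distr M (\<Pi>\<^sub>M i\<in>UNIV. E) (\<lambda>x. \<lambda>i\<in>UNIV. innov i x) = (\<Pi>\<^sub>M i\<in>UNIV. distr M E (innov i))"
    by (subst (asm) indep_vars_iff_distr_eq_PiM) auto
  then have "distr M (\<Pi>\<^sub>M i\<in>UNIV. E) (\<lambda>x i. innov i x) = (seqs :: (int option \<Rightarrow> 'e) measure)"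
    by (simp only: restrict_UNIV distr_innov)
  moreover have "distr M (\<Pi>\<^sub>M i\<in>UNIV. E) (\<lambda>x i. innov i x) = distr M seqs (\<lambda>x i. innov i x)"
    by (intro distr_cong refl sets_PiM_cong) auto
  ultimately have full: "distr M seqs (\<lambda>x i. innov i x) = (seqs :: (int option \<Rightarrow> 'e) measure)" by simp
  have "(seqs :: ('j \<Rightarrow> 'e) measure) = distr (seqs :: (int option \<Rightarrow> 'e) measure) seqs (\<lambda>\<omega> j. \<omega> (f j))"
    by (rule distr_reindex[OF assms, symmetric])
  also have "\<dots> = distr (distr M (seqs :: (int option \<Rightarrow> 'e) measure) (\<lambda>x i. innov i x)) seqs (\<lambda>\<omega> j. \<omega> (f j))"
    by (simp only: full)
  also have "\<dots> = distr M seqs (\<lambda>\<omega> j. innov (f j) \<omega>)"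
    by (subst distr_distr) (auto intro!: innov_seq_measurable[of "\<lambda>i. i"] measurable_PiM_single' simp: comp_def space_PiM PiE_iff)
  finally show ?thesis by simp
qed

lemma nn_integral_innov_seq:
  assumes f: "inj f" and [measurable]: "F \<in> borel_measurable (seqs :: ('j \<Rightarrow> 'e) measure)"
  shows "(\<integral>\<^sup>+\<omega>. F (\<lambda>j. innov (f j) \<omega>) \<partial>M) = (\<integral>\<^sup>+x. F x \<partial>seqs)"
proof -
  have "(\<integral>\<^sup>+\<omega>. F (\<lambda>j. innov (f j) \<omega>) \<partial>M) = (\<integral>\<^sup>+x. F x \<partial>distr M seqs (\<lambda>\<omega> j. innov (f j) \<omega>))"
    by (intro nn_integral_distr[symmetric]) auto
  then show ?thesis by (simp only: distr_innov_seq[OF f])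
qed

lemma integral_innov_seq:
  fixes F :: "('j \<Rightarrow> 'e) \<Rightarrow> real"
  assumes f: "inj f" and [measurable]: "F \<in> borel_measurable (seqs :: ('j \<Rightarrow> 'e) measure)"
  shows "(\<integral>\<omega>. F (\<lambda>j. innov (f j) \<omega>) \<partial>M) = (\<integral>x. F x \<partial>seqs)"
proof -
  have "(\<integral>\<omega>. F (\<lambda>j. innov (f j) \<omega>) \<partial>M) = (\<integral>x. F x \<partial>distr M seqs (\<lambda>\<omega> j. innov (f j) \<omega>))"
    by (intro integral_distr[symmetric]) auto
  then show ?thesis by (simp only: distr_innov_seq[OF f])
qed

lemma Zproc_innov: "Zproc g eps j i \<omega> = g j (\<lambda>l. innov (Some (i - int l)) \<omega>)"
  by (simp add: Zproc_def innov_def)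

lemma inj_lag: "inj (\<lambda>l::nat. Some (i - int l))"
  by (auto simp: inj_on_def)

definition lag_opt :: "nat \<Rightarrow> nat option \<Rightarrow> int option" where
  "lag_opt m = map_option (\<lambda>l. int m - int l)"

lemma inj_lag_opt: "inj (lag_opt m)"
  unfolding lag_opt_def by (rule option.inj_map) (auto simp: inj_on_def)

text \<open>At time m the innovation of index 0 sits at lag m, so replacing it is
  \<open>couple m\<close>; \<open>lag_opt\<close> translates lags at time m into indices.\<close>

lemma Zproc_Zcoup_innov:
  "Zproc g eps j (int m) \<omega> - Zcoup g eps eps0' j (int m) \<omega> =
    g j (\<lambda>l. innov (lag_opt m (Some l)) \<omega>) - g j (couple m (\<lambda>oi. innov (lag_opt m oi) \<omega>))"
proof -
  have "couple m (\<lambda>oi. innov (lag_opt m oi) \<omega>) = (\<lambda>k. if int m - int k = 0 then eps0' \<omega> else eps (int m - int k) \<omega>)"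
    by (auto simp: couple_def lag_opt_def innov_def fun_eq_iff)
  then show ?thesis by (simp add: Zproc_def Zcoup_def lag_opt_def innov_def)
qed

lemma Sdev_innov:
  assumes "g j \<in> borel_measurable seqs" "g k \<in> borel_measurable seqs"
  shows "Sigma_hat n g eps \<omega> j k - Sigma_cov M g eps j k = Sdev (\<lambda>x. g j x * g k x) n (\<lambda>i. innov (Some i) \<omega>)"
proof -
  have "Sigma_cov M g eps j k = (\<integral>x. g j x * g k x \<partial>seqs)"
    unfolding Sigma_cov_def Zproc_innov using assms
    by (intro integral_innov_seq[OF inj_lag, where F = "\<lambda>x. g j x * g k x"]) auto
  moreover have "Sigma_hat n g eps \<omega> j k = (\<Sum>i<n. g j (\<lambda>l. innov (Some (int i + 1 - int l)) \<omega>) * g k (\<lambda>l. innov (Some (int i + 1 - int l)) \<omega>)) / real n"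
    unfolding Sigma_hat_def Zproc_innov by (simp add: sum.atLeast1_atMost_eq add.commute)
  ultimately show ?thesis by (simp add: Sdev_def)
qed

text \<open>The two coupled values have the same law, so their distance is controlled by the moment
  alone. Splitting the difference costs 2^q, and the factor 2 for the two equal moments is absorbed
  by another 2^q.\<close>

lemma coupling_zero:
  fixes q \<mu> :: real and g :: "(nat \<Rightarrow> 'e) \<Rightarrow> real"
  assumes q1: "q \<ge> 1" and [measurable]: "g \<in> borel_measurable seqs"
    and mom: "(\<integral>\<^sup>+x. ennreal (\<bar>g x\<bar> powr q) \<partial>seqs) \<le> ennreal (\<mu> powr q)"
  shows "(\<integral>\<^sup>+x. ennreal (\<bar>g (\<lambda>l. x (Some l)) - g (couple m x)\<bar> powr q) \<partial>seqs) \<le> ennreal ((4 * \<mu>) powr q)"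
proof -
  have "(\<integral>\<^sup>+x. ennreal (\<bar>g (\<lambda>l. x (Some l)) - g (couple m x)\<bar> powr q) \<partial>seqs) \<le>
    (\<integral>\<^sup>+x. ennreal (2 powr q) * (ennreal (\<bar>g (\<lambda>l. x (Some l))\<bar> powr q) + ennreal (\<bar>g (couple m x)\<bar> powr q)) \<partial>seqs)"
  proof (rule nn_integral_mono)
    fix x :: "nat option \<Rightarrow> 'e"
    define a b where "a = g (\<lambda>l. x (Some l))" and "b = g (couple m x)"
    have "\<bar>a - b\<bar> powr q \<le> (2 * max \<bar>a\<bar> \<bar>b\<bar>) powr q" using q1 by (intro powr_mono2) auto
    also have "\<dots> = 2 powr q * (max \<bar>a\<bar> \<bar>b\<bar>) powr q" by (simp add: powr_mult)
    also have "\<dots> \<le> 2 powr q * (\<bar>a\<bar> powr q + \<bar>b\<bar> powr q)" by (intro mult_left_mono) (auto simp: max_def)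
    finally have "ennreal (\<bar>a - b\<bar> powr q) \<le> ennreal (2 powr q * (\<bar>a\<bar> powr q + \<bar>b\<bar> powr q))" by (rule ennreal_leI)
    then show "ennreal (\<bar>a - b\<bar> powr q) \<le> ennreal (2 powr q) * (ennreal (\<bar>a\<bar> powr q) + ennreal (\<bar>b\<bar> powr q))"
      by (simp add: ennreal_mult)
  qed
  also have "\<dots> = ennreal (2 powr q) * ((\<integral>\<^sup>+x. ennreal (\<bar>g (\<lambda>l. x (Some l))\<bar> powr q) \<partial>seqs) + (\<integral>\<^sup>+x. ennreal (\<bar>g (couple m x)\<bar> powr q) \<partial>seqs))"
    by (simp add: nn_integral_cmult nn_integral_add)
  also have "\<dots> = ennreal (2 powr q) * ((\<integral>\<^sup>+x. ennreal (\<bar>g x\<bar> powr q) \<partial>seqs) + (\<integral>\<^sup>+x. ennreal (\<bar>g x\<bar> powr q) \<partial>seqs))"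
    using nn_integral_couple[of "\<lambda>x. ennreal (\<bar>g x\<bar> powr q)"] by simp
  also have "\<dots> \<le> ennreal (2 powr q) * (ennreal (\<mu> powr q) + ennreal (\<mu> powr q))"
    using mom by (intro mult_left_mono add_mono) auto
  also have "\<dots> = ennreal (2 powr q * 2 * \<mu> powr q)"
    by (simp add: ennreal_mult[symmetric] ennreal_plus[symmetric] del: ennreal_plus)
  also have "\<dots> \<le> ennreal ((4 * \<mu>) powr q)"
  proof (rule ennreal_leI)
    have "(2::real) \<le> 2 powr q" using q1 powr_mono[of 1 q 2] by simp
    then have "2 powr q * 2 * \<mu> powr q \<le> 2 powr q * 2 powr q * \<mu> powr q" by (intro mult_right_mono mult_left_mono) auto
    also have "\<dots> = (4 * \<mu>) powr q" by (simp add: powr_mult[symmetric])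
    finally show "2 powr q * 2 * \<mu> powr q \<le> (4 * \<mu>) powr q" .
  qed
  finally show ?thesis .
qed

end

text \<open>The uniform dependence bound \<open>A\<close> makes the constants the same for all pairs
  of entries. Measurability of the sample covariances is part of the conclusion because these bounds
  are integrated and summed later.\<close>

lemma entry_bound:
  fixes q \<alpha> \<mu> C\<^sub>0 :: real
  assumes q: "q > 2" and \<alpha>: "\<alpha> > 0"
  shows "\<exists>K>0. \<exists>c>0. \<forall>(n::nat) (p::nat) (M::'a measure) (E::'e measure)
            (eps :: int \<Rightarrow> 'a \<Rightarrow> 'e) (eps0' :: 'a \<Rightarrow> 'e) (g :: nat \<Rightarrow> (nat \<Rightarrow> 'e) \<Rightarrow> real).
    n \<ge> 2 \<longrightarrow> prob_space M \<longrightarrow> iid_innov M E eps eps0' \<longrightarrow>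
    (\<forall>j<p. g j \<in> borel_measurable (PiM (UNIV :: nat set) (\<lambda>_. E))) \<longrightarrow>
    (\<forall>j<p. Lnorm M (2 * q) (Zproc g eps j 0) \<le> ennreal \<mu>) \<longrightarrow>
    (\<forall>m\<ge>1. Theta_dep M g eps eps0' p m (2 * q) \<le> ennreal (C\<^sub>0 * real m powr (- \<alpha>))) \<longrightarrow>
    (\<forall>j<p. \<forall>k<p. (\<lambda>\<omega>. Sigma_hat n g eps \<omega> j k) \<in> borel_measurable M \<and>
       (\<forall>w>0. (\<integral>\<^sup>+\<omega>. ennreal (trunc_sq w (Sigma_hat n g eps \<omega> j k - Sigma_cov M g eps j k)) \<partial>M)
        \<le> ennreal (K * dev_bound q \<alpha> c n w)))"
proof -
  \<comment> \<open>The parameters \<mu> and \<open>C\<^sub>0\<close> are arbitrary reals; enlarging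
    them makes them positive.\<close>
  define \<mu>' where "\<mu>' = max \<mu> 1"
  define C' where "C' = max C\<^sub>0 1"
  \<comment> \<open>Two coefficient tails times \<mu>' give the first summand; at lag 0 both
    coefficients equal 4 \<mu>', which gives the second.\<close>
  define A where "A = 2 * \<mu>' * C' + 8 * \<mu>'\<^sup>2"
  have \<mu>': "\<mu>' > 0" "\<mu> \<le> \<mu>'" by (auto simp: \<mu>'_def)
  have C': "C' > 0" "C\<^sub>0 \<le> C'" by (auto simp: C'_def)
  have A: "A > 0" unfolding A_def using \<mu>' C' by (intro add_pos_pos mult_pos_pos) auto
  obtain K c where K: "K > 0" and c: "c > 0" and bd: "\<And>(\<nu>::'e measure) h \<delta> n w. coupled_seq \<nu> h \<delta> q \<Longrightarrow> dep_tail A \<alpha> \<delta> \<Longrightarrow> n \<ge> 2 \<Longrightarrow> w > 0 \<Longrightarrow>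
    (\<exists>N0. \<forall>N\<ge>N0. (\<integral>\<omega>. trunc_sq w (coupled_seq.T \<nu> h N n \<omega> / real n) \<partial>(PiM UNIV (\<lambda>_. \<nu>))) \<le> K * dev_bound q \<alpha> c n w)"
    using coupled_trunc_sq[OF q \<alpha> A] by blast
  show ?thesis
  proof (rule exI[of _ "4 * K * 2 powr q"], rule conjI, simp add: K, rule exI[of _ "c/4"], intro conjI allI impI)
    show "c / 4 > 0" using c by simp
    fix n p :: nat and M :: "'a measure" and E :: "'e measure" and eps :: "int \<Rightarrow> 'a \<Rightarrow> 'e" and eps0' :: "'a \<Rightarrow> 'e"
      and g :: "nat \<Rightarrow> (nat \<Rightarrow> 'e) \<Rightarrow> real" and j k :: nat
    assume n: "n \<ge> 2" and M: "prob_space M" and iid: "iid_innov M E eps eps0'"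
      and gm: "\<forall>j<p. g j \<in> borel_measurable (PiM (UNIV :: nat set) (\<lambda>_. E))"
      and mom: "\<forall>j<p. Lnorm M (2 * q) (Zproc g eps j 0) \<le> ennreal \<mu>"
      and dep: "\<forall>m\<ge>1. Theta_dep M g eps eps0' p m (2 * q) \<le> ennreal (C\<^sub>0 * real m powr (- \<alpha>))"
      and jk: "j < p" "k < p"
    interpret prob_space M by fact
    interpret iid_process M E eps eps0' by unfold_locales (rule iid)
    have sE: "sets (seqs :: (nat \<Rightarrow> 'e) measure) = sets (PiM UNIV (\<lambda>_. E))" by (intro sets_PiM_cong) auto
    have gm': "g i \<in> borel_measurable seqs" if "i < p" for i
      using gm that by (simp add: measurable_cong_sets[OF sE refl])
    note [measurable] = gm'[OF jk(1)] gm'[OF jk(2)]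
    have seqm: "(\<lambda>\<omega> i. innov (Some i) \<omega>) \<in> M \<rightarrow>\<^sub>M Q" by (rule innov_seq_measurable)
    have Sdevm[measurable]: "Sdev (\<lambda>x. g j x * g k x) n \<in> borel_measurable Q"
    proof -
      have "(\<lambda>\<omega>. (\<lambda>x. g j x * g k x) (\<lambda>l. \<omega> (i - int l))) \<in> borel_measurable Q" for i
        by (rule measurable_compose[OF seqs_measurable_shift(1)]) measurable
      then show ?thesis unfolding Sdev_def by measurable
    qed
    have Shat: "Sigma_hat n g eps \<omega> j k = Sdev (\<lambda>x. g j x * g k x) n (\<lambda>i. innov (Some i) \<omega>) + Sigma_cov M g eps j k" for \<omega>
      using Sdev_innov[of g j k n \<omega>] by simp
    show "(\<lambda>\<omega>. Sigma_hat n g eps \<omega> j k) \<in> borel_measurable M"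
      unfolding Shat by (intro borel_measurable_add borel_measurable_const measurable_compose[OF seqm Sdevm])
    have mom': "(\<integral>\<^sup>+x. ennreal (\<bar>g i x\<bar> powr (2*q)) \<partial>seqs) \<le> ennreal (\<mu>' powr (2*q))" if i: "i < p" for i
    proof -
      have [measurable]: "g i \<in> borel_measurable seqs" by (rule gm'[OF i])
      have "Lnorm M (2 * q) (Zproc g eps i 0) \<le> ennreal \<mu>'" using mom i \<mu>' by (meson ennreal_leI order_trans)
      then have "(\<integral>\<^sup>+\<omega>. ennreal (\<bar>Zproc g eps i 0 \<omega>\<bar> powr (2*q)) \<partial>M) \<le> ennreal (\<mu>' powr (2*q))"
        using \<mu>' q by (intro nn_integral_le_of_Lnorm) auto
      also have "(\<integral>\<^sup>+\<omega>. ennreal (\<bar>Zproc g eps i 0 \<omega>\<bar> powr (2*q)) \<partial>M) = (\<integral>\<^sup>+x. ennreal (\<bar>g i x\<bar> powr (2*q)) \<partial>seqs)"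
        unfolding Zproc_innov by (rule nn_integral_innov_seq[OF inj_lag]) measurable
      finally show ?thesis .
    qed
    text \<open>The hypothesis on \<open>Theta_dep\<close> starts at lag 1; lag 0 is covered by the moment bound.\<close>
    define \<theta> where "\<theta> = (\<lambda>i m. if m = 0 then 4 * \<mu>' else enn2real (theta_dep M g eps eps0' (int m) (2*q) i))"
    have \<theta>0: "\<theta> i m \<ge> 0" for i m using \<mu>' by (simp add: \<theta>_def)
    have tail_le: "(\<Sum>m\<in>{a..<b}. theta_dep M g eps eps0' (int m) (2*q) i) \<le> ennreal (C' * real a powr (- \<alpha>))"
      if i: "i < p" and a: "a \<ge> 1" for i a b
    proof -
      have "(\<Sum>m\<in>{a..<b}. theta_dep M g eps eps0' (int m) (2*q) i) = (\<Sum>l<b - a. theta_dep M g eps eps0' (int (l + a)) (2*q) i)"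
        by (rule sum.reindex_bij_witness[of _ "\<lambda>l. l + a" "\<lambda>m. m - a"]) auto
      also have "\<dots> \<le> (\<Sum>l. theta_dep M g eps eps0' (int (l + a)) (2*q) i)"
        by (rule sum_le_suminf) auto
      also have "\<dots> \<le> Theta_dep M g eps eps0' p a (2*q)"
        unfolding Theta_dep_def using i by (intro Max_ge) auto
      also have "\<dots> \<le> ennreal (C\<^sub>0 * real a powr (- \<alpha>))" using dep a by blast
      also have "\<dots> \<le> ennreal (C' * real a powr (- \<alpha>))" using C' by (intro ennreal_leI mult_right_mono) auto
      finally show ?thesis .
    qed
    have \<theta>_ennreal: "ennreal (\<theta> i m) = theta_dep M g eps eps0' (int m) (2*q) i" if i: "i < p" and m: "m \<noteq> 0" for i m
    proof -
      have "theta_dep M g eps eps0' (int m) (2*q) i \<le> ennreal (C' * real m powr (- \<alpha>))"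
        using tail_le[OF i, of m "Suc m"] m by simp
      then have "theta_dep M g eps eps0' (int m) (2*q) i < \<top>" by (metis ennreal_less_top order_le_less_trans)
      then show ?thesis using m by (simp add: \<theta>_def)
    qed
    have \<theta>_coup: "(\<integral>\<^sup>+x. ennreal (\<bar>g i (\<lambda>l. x (Some l)) - g i (couple m x)\<bar> powr (2*q)) \<partial>seqs) \<le> ennreal (\<theta> i m powr (2*q))"
      if i: "i < p" for i m
    proof (cases "m = 0")
      case True
      then show ?thesis using coupling_zero[OF _ gm'[OF i] mom'[OF i], of m] q by (simp add: \<theta>_def)
    next
      case False
      have [measurable]: "g i \<in> borel_measurable seqs" by (rule gm'[OF i])
      have "Lnorm M (2*q) (\<lambda>\<omega>. Zproc g eps i (int m) \<omega> - Zcoup g eps eps0' i (int m) \<omega>) \<le> ennreal (\<theta> i m)"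
        using \<theta>_ennreal[OF i False] by (simp add: theta_dep_def)
      then have "(\<integral>\<^sup>+\<omega>. ennreal (\<bar>Zproc g eps i (int m) \<omega> - Zcoup g eps eps0' i (int m) \<omega>\<bar> powr (2*q)) \<partial>M) \<le> ennreal (\<theta> i m powr (2*q))"
        using \<theta>0 q by (intro nn_integral_le_of_Lnorm) auto
      also have "(\<integral>\<^sup>+\<omega>. ennreal (\<bar>Zproc g eps i (int m) \<omega> - Zcoup g eps eps0' i (int m) \<omega>\<bar> powr (2*q)) \<partial>M)
          = (\<integral>\<^sup>+x. ennreal (\<bar>g i (\<lambda>l. x (Some l)) - g i (couple m x)\<bar> powr (2*q)) \<partial>seqs)"
        unfolding Zproc_Zcoup_innov
        by (rule nn_integral_innov_seq[OF inj_lag_opt, where F = "\<lambda>x. ennreal (\<bar>g i (\<lambda>l. x (Some l)) - g i (couple m x)\<bar> powr (2*q))"]) measurable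
      finally show ?thesis .
    qed
    have \<theta>_sum: "(\<Sum>m\<in>{a..<b}. \<theta> i m) \<le> C' * real a powr (- \<alpha>)" if i: "i < p" and a: "a \<ge> 1" for i a b
    proof -
      have "ennreal (\<Sum>m\<in>{a..<b}. \<theta> i m) = (\<Sum>m\<in>{a..<b}. ennreal (\<theta> i m))" using \<theta>0 by (simp add: sum_ennreal)
      also have "\<dots> = (\<Sum>m\<in>{a..<b}. theta_dep M g eps eps0' (int m) (2*q) i)"
        using i a by (intro sum.cong refl \<theta>_ennreal) auto
      also have "\<dots> \<le> ennreal (C' * real a powr (- \<alpha>))" by (rule tail_le[OF i a])
      finally show ?thesis using C' by (subst (asm) ennreal_le_iff) auto
    qed
    have dt: "dep_tail A \<alpha> (\<lambda>m. \<mu>' * (\<theta> j m + \<theta> k m))"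
      unfolding dep_tail_def
    proof (intro conjI allI impI)
      show "\<mu>' * (\<theta> j 0 + \<theta> k 0) \<le> A" using \<mu>' C' by (simp add: \<theta>_def A_def power2_eq_square)
      fix a b :: nat assume a: "a \<ge> 1"
      have "(\<Sum>m\<in>{a..<b}. \<mu>' * (\<theta> j m + \<theta> k m)) = \<mu>' * ((\<Sum>m\<in>{a..<b}. \<theta> j m) + (\<Sum>m\<in>{a..<b}. \<theta> k m))"
        by (simp add: sum_distrib_left sum.distrib distrib_left)
      also have "\<dots> \<le> \<mu>' * (C' * real a powr (- \<alpha>) + C' * real a powr (- \<alpha>))"
        using \<mu>' jk a by (intro mult_left_mono add_mono \<theta>_sum) auto
      also have "\<dots> = 2 * \<mu>' * C' * real a powr (- \<alpha>)" by simp
      also have "\<dots> \<le> A * real a powr (- \<alpha>)" by (intro mult_right_mono) (auto simp: A_def)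
      finally show "(\<Sum>m\<in>{a..<b}. \<mu>' * (\<theta> j m + \<theta> k m)) \<le> A * real a powr (- \<alpha>)" .
    qed
    fix w :: real assume w: "w > 0"
    have "(\<integral>\<^sup>+\<omega>. ennreal (trunc_sq w (Sigma_hat n g eps \<omega> j k - Sigma_cov M g eps j k)) \<partial>M)
        = (\<integral>\<^sup>+\<omega>. ennreal (trunc_sq w (Sdev (\<lambda>x. g j x * g k x) n (\<lambda>i. innov (Some i) \<omega>))) \<partial>M)"
      by (simp add: Shat)
    also have "\<dots> = (\<integral>\<^sup>+\<omega>. ennreal (trunc_sq w (Sdev (\<lambda>x. g j x * g k x) n \<omega>)) \<partial>Q)"
      by (rule nn_integral_innov_seq[OF inj_Some, where F = "\<lambda>\<omega>. ennreal (trunc_sq w (Sdev (\<lambda>x. g j x * g k x) n \<omega>))"]) measurable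
    also have "\<dots> \<le> ennreal (4 * (K * dev_bound q \<alpha> c n (w/2)))"
    proof (rule Sdev_trunc_sq[OF q \<mu>'(1) n w _ gm'[OF jk(1)] gm'[OF jk(2)] mom'[OF jk(1)] mom'[OF jk(2)] \<theta>0 \<theta>0 \<theta>_coup[OF jk(1)] \<theta>_coup[OF jk(2)]])
      show "0 \<le> K * dev_bound q \<alpha> c n (w/2)" using K dev_bound_nonneg[of "w/2"] w by simp
      fix h assume cs: "coupled_seq \<nu> h (\<lambda>m. \<mu>' * (\<theta> j m + \<theta> k m)) q"
      then show "\<exists>N0. \<forall>N\<ge>N0. (\<integral>\<omega>. trunc_sq (w/2) (coupled_seq.T \<nu> h N n \<omega> / real n) \<partial>Q) \<le> K * dev_bound q \<alpha> c n (w/2)"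
        using w by (intro bd[OF cs dt n]) auto
    qed
    also have "\<dots> \<le> ennreal (4 * K * 2 powr q * dev_bound q \<alpha> (c/4) n w)"
      using K dev_bound_half[OF q n w c, of \<alpha>] by (intro ennreal_leI) (simp add: mult.assoc mult_left_mono)
    finally show "(\<integral>\<^sup>+\<omega>. ennreal (trunc_sq w (Sigma_hat n g eps \<omega> j k - Sigma_cov M g eps j k)) \<partial>M)
        \<le> ennreal (4 * K * 2 powr q * dev_bound q \<alpha> (c/4) n w)" .
  qed
qed

section \<open>Spectral norm of the thresholded matrix\<close>

text \<open>Cauchy-Schwarz after distributing \<open>sqrt (a j k)\<close> to both factors: the row
  sums bound the first factor, and the column sums appear when the second is summed over j.\<close>

lemma schur_test:
  fixes a :: "nat \<Rightarrow> nat \<Rightarrow> real"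
  assumes a: "\<And>j k. a j k \<ge> 0" and row: "\<And>j. j < p \<Longrightarrow> (\<Sum>k<p. a j k) \<le> R" and col: "\<And>k. k < p \<Longrightarrow> (\<Sum>j<p. a j k) \<le> R"
    and R: "R \<ge> 0"
  shows "(\<Sum>j<p. (\<Sum>k<p. a j k * \<bar>x k\<bar>)\<^sup>2) \<le> R\<^sup>2 * (\<Sum>k<p. (x k)\<^sup>2)"
proof -
  have "(\<Sum>j<p. (\<Sum>k<p. a j k * \<bar>x k\<bar>)\<^sup>2) \<le> (\<Sum>j<p. R * (\<Sum>k<p. a j k * (x k)\<^sup>2))"
  proof (rule sum_mono)
    fix j assume j: "j \<in> {..<p}"
    have "(\<Sum>k<p. a j k * \<bar>x k\<bar>)\<^sup>2 = (\<Sum>k<p. sqrt (a j k) * (sqrt (a j k) * \<bar>x k\<bar>))\<^sup>2"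
      using a by (simp add: mult.assoc[symmetric])
    also have "\<dots> \<le> (\<Sum>k<p. (sqrt (a j k))\<^sup>2) * (\<Sum>k<p. (sqrt (a j k) * \<bar>x k\<bar>)\<^sup>2)"
      by (rule Cauchy_Schwarz_ineq_sum)
    also have "\<dots> = (\<Sum>k<p. a j k) * (\<Sum>k<p. a j k * (x k)\<^sup>2)"
      using a by (simp add: power_mult_distrib)
    also have "\<dots> \<le> R * (\<Sum>k<p. a j k * (x k)\<^sup>2)"
      using a row j by (intro mult_right_mono sum_nonneg) auto
    finally show "(\<Sum>k<p. a j k * \<bar>x k\<bar>)\<^sup>2 \<le> R * (\<Sum>k<p. a j k * (x k)\<^sup>2)" .
  qed
  also have "\<dots> = R * (\<Sum>k<p. (\<Sum>j<p. a j k) * (x k)\<^sup>2)"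
    unfolding sum_distrib_left[symmetric] by (subst sum.swap) (simp add: sum_distrib_right)
  also have "\<dots> \<le> R * (\<Sum>k<p. R * (x k)\<^sup>2)"
    using R col by (intro mult_left_mono sum_mono mult_right_mono) auto
  also have "\<dots> = R\<^sup>2 * (\<Sum>k<p. (x k)\<^sup>2)" by (simp add: sum_distrib_left[symmetric] power2_eq_square mult.assoc)
  finally show ?thesis .
qed

lemma frobenius_test:
  fixes b :: "nat \<Rightarrow> nat \<Rightarrow> real"
  shows "(\<Sum>j<p. (\<Sum>k<p. b j k * \<bar>x k\<bar>)\<^sup>2) \<le> (\<Sum>j<p. \<Sum>k<p. (b j k)\<^sup>2) * (\<Sum>k<p. (x k)\<^sup>2)"
proof -
  have "(\<Sum>j<p. (\<Sum>k<p. b j k * \<bar>x k\<bar>)\<^sup>2) \<le> (\<Sum>j<p. (\<Sum>k<p. (b j k)\<^sup>2) * (\<Sum>k<p. \<bar>x k\<bar>\<^sup>2))"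
    by (intro sum_mono Cauchy_Schwarz_ineq_sum)
  then show ?thesis by (simp add: sum_distrib_right)
qed

lemma spec_norm_sq_le:
  fixes A a b :: "nat \<Rightarrow> nat \<Rightarrow> real"
  assumes p: "p \<ge> 1" and A: "\<And>j k. j < p \<Longrightarrow> k < p \<Longrightarrow> \<bar>A j k\<bar> \<le> a j k + b j k"
    and a: "\<And>j k. a j k \<ge> 0" and row: "\<And>j. j < p \<Longrightarrow> (\<Sum>k<p. a j k) \<le> R" and col: "\<And>k. k < p \<Longrightarrow> (\<Sum>j<p. a j k) \<le> R"
    and R: "R \<ge> 0" and b: "\<And>j k. b j k \<ge> 0"
  shows "(spec_norm p A)\<^sup>2 \<le> 2 * R\<^sup>2 + 2 * (\<Sum>j<p. \<Sum>k<p. (b j k)\<^sup>2)"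
proof -
  define U where "U = 2 * R\<^sup>2 + 2 * (\<Sum>j<p. \<Sum>k<p. (b j k)\<^sup>2)"
  define X where "X = {sqrt (\<Sum>j<p. (\<Sum>k<p. A j k * x k)\<^sup>2) | x. (\<Sum>k<p. (x k)\<^sup>2) = 1}"
  have le: "s \<le> sqrt U" if s_in: "s \<in> X" for s
  proof -
    obtain x where s: "s = sqrt (\<Sum>j<p. (\<Sum>k<p. A j k * x k)\<^sup>2)" and x: "(\<Sum>k<p. (x k)\<^sup>2) = 1"
      using s_in unfolding X_def by blast
    have "(\<Sum>j<p. (\<Sum>k<p. A j k * x k)\<^sup>2) \<le> (\<Sum>j<p. 2 * (\<Sum>k<p. a j k * \<bar>x k\<bar>)\<^sup>2 + 2 * (\<Sum>k<p. b j k * \<bar>x k\<bar>)\<^sup>2)"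
    proof (rule sum_mono)
      fix j assume j: "j \<in> {..<p}"
      define y z where "y = (\<Sum>k<p. a j k * \<bar>x k\<bar>)" and "z = (\<Sum>k<p. b j k * \<bar>x k\<bar>)"
      have "\<bar>\<Sum>k<p. A j k * x k\<bar> \<le> (\<Sum>k<p. \<bar>A j k * x k\<bar>)" by (rule sum_abs)
      also have "\<dots> \<le> (\<Sum>k<p. (a j k + b j k) * \<bar>x k\<bar>)"
        using A j by (intro sum_mono) (auto simp: abs_mult intro!: mult_right_mono)
      also have "\<dots> = y + z" by (simp add: y_def z_def distrib_right sum.distrib)
      finally have "\<bar>\<Sum>k<p. A j k * x k\<bar> \<le> \<bar>y + z\<bar>" by simp
      then have "(\<Sum>k<p. A j k * x k)\<^sup>2 \<le> (y + z)\<^sup>2" by (simp only: abs_le_square_iff)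
      also have "\<dots> \<le> 2 * y\<^sup>2 + 2 * z\<^sup>2" using sum_squares_bound[of y z] by (simp add: power2_sum)
      finally show "(\<Sum>k<p. A j k * x k)\<^sup>2 \<le> 2 * (\<Sum>k<p. a j k * \<bar>x k\<bar>)\<^sup>2 + 2 * (\<Sum>k<p. b j k * \<bar>x k\<bar>)\<^sup>2"
        by (simp add: y_def z_def)
    qed
    also have "\<dots> = 2 * (\<Sum>j<p. (\<Sum>k<p. a j k * \<bar>x k\<bar>)\<^sup>2) + 2 * (\<Sum>j<p. (\<Sum>k<p. b j k * \<bar>x k\<bar>)\<^sup>2)"
      by (simp add: sum.distrib sum_distrib_left)
    also have "\<dots> \<le> U"
      using schur_test[OF a row col R, where x = x] frobenius_test[where p = p and b = b and x = x] x by (simp add: U_def)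
    finally show ?thesis by (simp add: s)
  qed
  \<comment> \<open>The first unit vector, available since p \<ge> 1, makes the set nonempty.
    Together with the bound this turns \<open>Sup\<close> into a genuine, nonnegative supremum that
    can be squared.\<close>
  have "(\<Sum>k<p. (if k = 0 then 1 else 0 :: real)\<^sup>2) = 1"
    using p by (subst sum.cong[OF refl, of _ _ "\<lambda>k. if k = 0 then 1 else 0"]) auto
  then have ne: "sqrt (\<Sum>j<p. (\<Sum>k<p. A j k * (if k = 0 then 1 else 0))\<^sup>2) \<in> X"
    unfolding X_def by (intro CollectI exI[of _ "\<lambda>k::nat. if k = 0 then 1 else 0"] conjI refl)
  have "0 \<le> sqrt (\<Sum>j<p. (\<Sum>k<p. A j k * (if k = 0 then 1 else 0))\<^sup>2)" by (simp add: sum_nonneg)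
  also have "\<dots> \<le> Sup X" using ne le by (intro cSup_upper bdd_aboveI[of _ "sqrt U"]) auto
  finally have 0: "0 \<le> Sup X" .
  have "Sup X \<le> sqrt U" using ne le by (intro cSup_least) auto
  then have "(Sup X)\<^sup>2 \<le> (sqrt U)\<^sup>2" using 0 by (intro power_mono) auto
  also have "\<dots> = U" by (simp add: U_def sum_nonneg)
  finally show ?thesis by (simp add: spec_norm_def X_def U_def)
qed

text \<open>A kept entry whose true value is below u/2 must have an error of at least u/2. A
  discarded one satisfies |S| < u + |X|, where the excess over u matters only if |S| is large, so
  that X is among the counted errors.\<close>

lemma thresh_error_le:
  fixes u :: real
  assumes "u > 0"
  shows "\<bar>thresh u H j k - S j k\<bar> \<le> ((if \<bar>S j k\<bar> \<ge> u/2 then \<bar>H j k - S j k\<bar> else 0) + 2 * min \<bar>S j k\<bar> u)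
    + sqrt (trunc_sq (u/2) (H j k - S j k))"
proof (cases "u \<le> \<bar>H j k\<bar>")
  case True
  show ?thesis
  proof (cases "\<bar>S j k\<bar> \<ge> u/2")
    case False
    then have "u/2 \<le> \<bar>H j k - S j k\<bar>" using True by linarith
    then show ?thesis using True False assms by (simp add: thresh_def trunc_sq_def)
  qed (use True assms in \<open>auto simp: thresh_def trunc_sq_def\<close>)
next
  case False
  then have "\<bar>S j k\<bar> \<le> (if \<bar>S j k\<bar> \<ge> u/2 then \<bar>H j k - S j k\<bar> else 0) + 2 * min \<bar>S j k\<bar> u"
    using assms by (simp add: min_def) linarith
  moreover have "0 \<le> sqrt (trunc_sq (u/2) (H j k - S j k))" by simp
  moreover have "\<bar>thresh u H j k - S j k\<bar> = \<bar>S j k\<bar>" using False by (simp add: thresh_def)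
  ultimately show ?thesis by linarith
qed

section \<open>Row sums of the large covariances\<close>

lemma N_star_ge:
  assumes "k < p" shows "real (card {j. j < p \<and> v \<le> \<bar>S j k\<bar>}) \<le> N_star p S v"
proof -
  have "real (card {j. j < p \<and> v \<le> \<bar>S j k\<bar>}) = (\<Sum>j<p. if \<bar>S j k\<bar> \<ge> v then 1 else 0)"
    by (simp add: sum.If_cases Int_def)
  also have "\<dots> \<le> N_star p S v" unfolding N_star_def using assms by (intro Max_ge) auto
  finally show ?thesis .
qed

text \<open>A maximum of counts is integral. The gap between 0 and 1 is what later allows real p
  \<le> p N in the choice of the level w.\<close>

lemma N_star_cases:
  assumes "p \<ge> 1" shows "N_star p S v = 0 \<or> N_star p S v \<ge> 1"
proof -
  have "N_star p S v \<in> (\<lambda>k. \<Sum>j<p. if \<bar>S j k\<bar> \<ge> v then 1 else 0) ` {..<p}"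
    unfolding N_star_def using assms by (intro Max_in) (auto simp: lessThan_empty_iff)
  then obtain k where "N_star p S v = real (card {j. j < p \<and> v \<le> \<bar>S j k\<bar>})"
    by (auto simp: sum.If_cases Int_def)
  then show ?thesis by (cases "card {j. j < p \<and> v \<le> \<bar>S j k\<bar>}") auto
qed

lemma N_star_le: 
  assumes "p \<ge> 1" shows "N_star p S v \<le> real p"
proof -
  have "(\<Sum>j<p. if \<bar>S j k\<bar> \<ge> v then 1 else 0 :: real) \<le> (\<Sum>j<p. 1)" for k by (intro sum_mono) auto
  then show ?thesis unfolding N_star_def using assms by (subst Max_le_iff) (auto simp: lessThan_empty_iff)
qed

lemma D_star_ge: "k < p \<Longrightarrow> (\<Sum>j<p. min \<bar>S j k\<bar> u) \<le> D_star p S u"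
  unfolding D_star_def by (intro Max_ge) auto

lemma D_star_nonneg:
  assumes "p \<ge> 1" "u > 0" shows "D_star p S u \<ge> 0"
proof -
  have "0 \<le> (\<Sum>j<p. min \<bar>S j 0\<bar> u)" using assms by (intro sum_nonneg) auto
  also have "\<dots> \<le> D_star p S u" using assms by (intro D_star_ge) auto
  finally show ?thesis .
qed

text \<open>Each error is split at w, and Cauchy-Schwarz over at most N entries handles the excess.
  The excess is then summed over all columns, so the bound holds for the maximal column and its
  expectation needs no maximal inequality.\<close>

lemma large_entries_sum_le:
  fixes X S :: "nat \<Rightarrow> nat \<Rightarrow> real" and v :: real
  assumes k: "k < p" and w: "w > 0"
  defines "N \<equiv> N_star p S v"
  shows "(\<Sum>j<p. if v \<le> \<bar>S j k\<bar> then \<bar>X j k\<bar> else 0) \<le> N * w + sqrt (N * (\<Sum>k<p. \<Sum>j<p. if v \<le> \<bar>S j k\<bar> then trunc_sq w (X j k) else 0))"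
proof -
  define P where "P = (\<lambda>k. {j. j < p \<and> v \<le> \<bar>S j k\<bar>})"
  have fin: "finite (P k)" for k by (simp add: P_def)
  have restr: "(\<Sum>j<p. if v \<le> \<bar>S j k\<bar> then f j else 0) = (\<Sum>j\<in>P k. f j)" for f :: "nat \<Rightarrow> real" and k
    by (simp add: sum.If_cases P_def Int_def)
  have cN: "real (card (P k)) \<le> N" unfolding N_def P_def by (rule N_star_ge[OF k])
  have sq: "\<bar>t\<bar> \<le> w + sqrt (trunc_sq w t)" for t using w by (auto simp: trunc_sq_def)
  have "(\<Sum>j\<in>P k. \<bar>X j k\<bar>) \<le> (\<Sum>j\<in>P k. w + sqrt (trunc_sq w (X j k)))" by (intro sum_mono sq)
  also have "\<dots> = real (card (P k)) * w + (\<Sum>j\<in>P k. 1 * sqrt (trunc_sq w (X j k)))" by (simp add: sum.distrib)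
  also have "(\<Sum>j\<in>P k. 1 * sqrt (trunc_sq w (X j k))) \<le> sqrt (real (card (P k)) * (\<Sum>j\<in>P k. trunc_sq w (X j k)))"
    using Cauchy_Schwarz_ineq_sum[of "\<lambda>_. 1" "\<lambda>j. sqrt (trunc_sq w (X j k))" "P k"]
    by (intro real_le_rsqrt) simp
  also have "\<dots> \<le> sqrt (N * (\<Sum>k<p. \<Sum>j\<in>P k. trunc_sq w (X j k)))"
  proof (intro real_sqrt_le_mono mult_mono cN)
    have "(\<Sum>j\<in>P k. trunc_sq w (X j k)) = (\<Sum>k\<in>{k}. \<Sum>j\<in>P k. trunc_sq w (X j k))" by simp
    also have "\<dots> \<le> (\<Sum>k<p. \<Sum>j\<in>P k. trunc_sq w (X j k))"
      using k by (intro sum_mono2 sum_nonneg) auto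
    finally show "(\<Sum>j\<in>P k. trunc_sq w (X j k)) \<le> (\<Sum>k<p. \<Sum>j\<in>P k. trunc_sq w (X j k))" .
  qed (use cN in \<open>auto intro!: sum_nonneg\<close>)
  also have "real (card (P k)) * w \<le> N * w" using cN w by (intro mult_right_mono) auto
  finally show ?thesis unfolding restr by simp
qed

text \<open>By symmetry one bound serves rows and columns in the Schur test. The numerical factors
  come from squaring a sum of three terms in two binary steps.\<close>

lemma spec_norm_thresh_le:
  fixes H S :: "nat \<Rightarrow> nat \<Rightarrow> real"
  assumes p: "p \<ge> 1" and u: "u > 0" and w: "w > 0"
    and symH: "\<And>j k. H j k = H k j" and symS: "\<And>j k. S j k = S k j"
  defines "N \<equiv> N_star p S (u/2)"
  shows "(spec_norm p (\<lambda>j k. thresh u H j k - S j k))\<^sup>2 \<le> 16 * (D_star p S u)\<^sup>2 + 8 * N\<^sup>2 * w\<^sup>2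
    + 8 * N * (\<Sum>k<p. \<Sum>j<p. if u/2 \<le> \<bar>S j k\<bar> then trunc_sq w (H j k - S j k) else 0)
    + 2 * (\<Sum>j<p. \<Sum>k<p. trunc_sq (u/2) (H j k - S j k))"
proof -
  define X where "X = (\<lambda>j k. H j k - S j k)"
  define a where "a = (\<lambda>j k. (if \<bar>S j k\<bar> \<ge> u/2 then \<bar>X j k\<bar> else 0) + 2 * min \<bar>S j k\<bar> u)"
  define b where "b = (\<lambda>j k. sqrt (trunc_sq (u/2) (X j k)))"
  define W where "W = (\<Sum>k<p. \<Sum>j<p. if u/2 \<le> \<bar>S j k\<bar> then trunc_sq w (X j k) else 0)"
  have W: "W \<ge> 0" unfolding W_def by (intro sum_nonneg) auto
  have N: "N \<ge> 0" using N_star_cases[OF p, of S "u/2"] by (auto simp: N_def)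
  define R where "R = N * w + sqrt (N * W) + 2 * D_star p S u"
  have R: "R \<ge> 0" unfolding R_def using N W w D_star_nonneg[OF p u, of S] by (intro add_nonneg_nonneg mult_nonneg_nonneg) auto
  have col: "(\<Sum>j<p. a j k) \<le> R" if k: "k < p" for k
    using large_entries_sum_le[OF k w, where v = "u/2" and S = S and X = X] D_star_ge[OF k, of S u]
    by (simp add: a_def R_def N_def W_def sum.distrib sum_distrib_left[symmetric])
  have asym: "a j k = a k j" for j k by (simp add: a_def X_def symH[of j k] symS[of j k])
  have row: "(\<Sum>k<p. a j k) \<le> R" if "j < p" for j using col[OF that] by (simp add: asym[of _ j])
  have "(spec_norm p (\<lambda>j k. thresh u H j k - S j k))\<^sup>2 \<le> 2 * R\<^sup>2 + 2 * (\<Sum>j<p. \<Sum>k<p. (b j k)\<^sup>2)"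
  proof (rule spec_norm_sq_le[OF p _ _ row col R])
    show "\<bar>thresh u H j k - S j k\<bar> \<le> a j k + b j k" for j k
      unfolding a_def b_def X_def by (rule thresh_error_le[OF u])
    show "a j k \<ge> 0" for j k using u by (simp add: a_def)
    show "b j k \<ge> 0" for j k by (simp add: b_def)
  qed
  also have "(\<Sum>j<p. \<Sum>k<p. (b j k)\<^sup>2) = (\<Sum>j<p. \<Sum>k<p. trunc_sq (u/2) (X j k))" by (simp add: b_def)
  also have "R\<^sup>2 \<le> 4 * (N * w)\<^sup>2 + 4 * (N * W) + 8 * (D_star p S u)\<^sup>2"
  proof -
    define y z d where "y = N * w" and "z = sqrt (N * W)" and "d = 2 * D_star p S u"
    have "(y + z + d)\<^sup>2 \<le> 2 * (y + z)\<^sup>2 + 2 * d\<^sup>2" using sum_squares_bound[of "y + z" d] by (simp add: power2_sum)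
    also have "(y + z)\<^sup>2 \<le> 2 * y\<^sup>2 + 2 * z\<^sup>2" using sum_squares_bound[of y z] by (simp add: power2_sum)
    finally have "(y + z + d)\<^sup>2 \<le> 4 * y\<^sup>2 + 4 * z\<^sup>2 + 2 * d\<^sup>2" by simp
    moreover have "z\<^sup>2 = N * W" using N W by (simp add: z_def)
    ultimately show ?thesis by (simp add: R_def y_def z_def d_def power_mult_distrib)
  qed
  finally show ?thesis unfolding W_def X_def power_mult_distrib by (simp add: algebra_simps)
qed

section \<open>Comparison with the rates of the theorem\<close>

lemma H_fun_eq:
  assumes "q > 2" "n \<ge> 2" shows "H_fun q \<alpha> n u = L_alpha q \<alpha> n powr q * u powr (2 - q)"
  unfolding H_fun_def L_alpha_powr[OF assms] by simp

text \<open>In every regime the coefficient in the exponent of \<open>G_fun\<close> is the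
  reciprocal of J^2, so the three cases collapse into one formula.\<close>

lemma G_fun_eq:
  assumes "n \<ge> 2"
  shows "G_fun q \<alpha> n u = ((J_alpha q \<alpha> n)\<^sup>2 + u\<^sup>2) * exp (- (u\<^sup>2 / (J_alpha q \<alpha> n)\<^sup>2))"
proof -
  have "ln (real n) powr (-2) = 1 / (ln (real n))\<^sup>2"
    using assms by (simp add: powr_minus_divide)
  moreover have "1 / real n powr (- beta_t q \<alpha>) = real n powr beta_t q \<alpha>"
    by (simp add: powr_minus_divide)
  then have "u\<^sup>2 / real n powr (- beta_t q \<alpha>) = real n powr beta_t q \<alpha> * u\<^sup>2"
    by (metis mult.commute mult.right_neutral times_divide_eq_right)
  ultimately show ?thesis unfolding G_fun_def J_alpha_sq[OF assms] by simp
qed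

definition min_rate :: "real \<Rightarrow> real \<Rightarrow> real \<Rightarrow> nat \<Rightarrow> real \<Rightarrow> real" where
  "min_rate q \<alpha> C n u = min (1 / sqrt (real n)) (min (u powr (1 - q / 2) / real n powr (q / 4))
     (sqrt (H_fun q \<alpha> n u + G_fun q \<alpha> n (C * u))))"

text \<open>Evaluating at u/2 reduces the Gaussian rate to c/4; matching it with G(C u) forces C^2 =
  c/4. The prefactor of \<open>G_fun\<close> then contains C^2 u^2 instead of u^2, which costs the
  factor 1 + 1/C^2.\<close>

lemma dev_bound_le_min_rate:
  assumes q: "q > 2" and n: "n \<ge> 2" and u: "u > 0" and c: "c > 0"
  defines "C \<equiv> sqrt c / 2"
  shows "dev_bound q \<alpha> c n (u/2) \<le> 2 powr q * (1 + 1 / C\<^sup>2) * (min_rate q \<alpha> C n u)\<^sup>2"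
proof -
  have C: "C > 0" "C\<^sup>2 = c/4" using c by (auto simp: C_def power_divide)
  define B where "B = 1 + 1 / C\<^sup>2"
  have B: "B \<ge> 1" using C by (simp add: B_def)
  define L where "L = L_alpha q \<alpha> n powr q * u powr (2 - q)"
  define J where "J = (J_alpha q \<alpha> n)\<^sup>2"
  define e where "e = exp (- (c/4 * u\<^sup>2 / J))"
  have L: "L \<ge> 0" by (simp add: L_def)
  have J: "J \<ge> 0" by (simp add: J_def)
  have y: "H_fun q \<alpha> n u + G_fun q \<alpha> n (C * u) = L + (J + C\<^sup>2 * u\<^sup>2) * e"
    by (simp add: H_fun_eq[OF q n] G_fun_eq[OF n] L_def J_def e_def C(2)[symmetric] power_mult_distrib)
  have x: "(u powr (1 - q / 2) / real n powr (q / 4))\<^sup>2 = u powr (2 - q) * real n powr (- q/2)"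
  proof -
    have "(u powr (1 - q/2))\<^sup>2 = u powr (2 - q)" "(real n powr (q/4))\<^sup>2 = real n powr (q/2)"
      by (simp_all add: power2_eq_square powr_add[symmetric])
    moreover have "real n powr (- q/2) = 1 / real n powr (q/2)" using powr_minus_divide[of "real n" "q/2"] by simp
    ultimately show ?thesis by (simp only: power_divide times_divide_eq_right mult_1_right)
  qed
  have sqmin: "(min a b)\<^sup>2 = min (a\<^sup>2) (b\<^sup>2)" if "a \<ge> 0" "b \<ge> 0" for a b :: real
    using that power_mono[of a b 2] power_mono[of b a 2] by (auto simp: min_def)
  have y0: "0 \<le> L + (J + C\<^sup>2 * u\<^sup>2) * e" using L J by (simp add: e_def)
  have mr: "(min_rate q \<alpha> C n u)\<^sup>2 = min (1 / real n) (min (u powr (2 - q) * real n powr (- q/2)) (L + (J + C\<^sup>2 * u\<^sup>2) * e))"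
  proof -
    have "(min_rate q \<alpha> C n u)\<^sup>2 = min ((1 / sqrt (real n))\<^sup>2) (min ((u powr (1 - q / 2) / real n powr (q / 4))\<^sup>2) ((sqrt (L + (J + C\<^sup>2 * u\<^sup>2) * e))\<^sup>2))"
      unfolding min_rate_def y by (subst sqmin, simp, simp add: y0)+ (rule refl)
    moreover have "(1 / sqrt (real n))\<^sup>2 = 1 / real n" by (simp add: power_divide)
    moreover have "(sqrt (L + (J + C\<^sup>2 * u\<^sup>2) * e))\<^sup>2 = L + (J + C\<^sup>2 * u\<^sup>2) * e" using y0 by simp
    ultimately show ?thesis by (simp only: x)
  qed
  have l1: "1 / real n \<le> B * (1 / real n)" using mult_right_mono[OF B, of "1 / real n"] by simp
  have l2: "u powr (2 - q) * real n powr (- q/2) \<le> B * (u powr (2 - q) * real n powr (- q/2))"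
    using mult_right_mono[OF B, of "u powr (2 - q) * real n powr (- q/2)"] by simp
  have l3: "L + (J + u\<^sup>2) * e \<le> B * (L + (J + C\<^sup>2 * u\<^sup>2) * e)"
  proof -
    have 1: "1 * L \<le> B * L" "1 * (J * e) \<le> B * (J * e)" using B L J by (intro mult_right_mono; simp add: e_def)+
    have "1 / C\<^sup>2 * C\<^sup>2 \<le> B * C\<^sup>2" by (intro mult_right_mono) (auto simp: B_def)
    moreover have "1 / C\<^sup>2 * C\<^sup>2 = 1" using C(1) by simp
    ultimately have "1 \<le> B * C\<^sup>2" by linarith
    then have "1 * (u\<^sup>2 * e) \<le> B * C\<^sup>2 * (u\<^sup>2 * e)" by (intro mult_right_mono) (auto simp: e_def)
    with 1 show ?thesis by (simp add: algebra_simps)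
  qed
  have "dev_bound q \<alpha> (c/4) n u \<le> B * (min_rate q \<alpha> C n u)\<^sup>2"
  proof -
    have "B * min a (min b d) = min (B * a) (min (B * b) (B * d))" for a b d
      using B by (simp add: min_mult_distrib_left)
    then show ?thesis
      unfolding dev_bound_def mr J_def[symmetric] e_def[symmetric] L_def[symmetric]
      using l1 l2 l3 by (simp only:)
  qed
  then have "2 powr q * dev_bound q \<alpha> (c/4) n u \<le> 2 powr q * (B * (min_rate q \<alpha> C n u)\<^sup>2)"
    by (intro mult_left_mono) auto
  with dev_bound_half[OF q n u c, of \<alpha>] show ?thesis
    unfolding B_def[symmetric] mult.assoc by (rule order_trans)
qed

lemma min_rate_nonneg: "min_rate q \<alpha> C n u \<ge> 0"
proof -
  have "0 \<le> H_fun q \<alpha> n u + G_fun q \<alpha> n (C * u)"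
    unfolding H_fun_def G_fun_def by simp
  then show ?thesis by (simp add: min_rate_def)
qed

text \<open>For such small u no competitor in the minimum is of smaller order than 1 / sqrt n. For
  the third one, u^2 \<le> 1/n \<le> 4 J^2 keeps the exponential bounded below.\<close>

lemma inverse_sqrt_le_min_rate:
  assumes q: "q > 2" and n: "n \<ge> 2" and u: "u > 0" "u \<le> 1 / sqrt (real n)"
  shows "1 / sqrt (real n) \<le> 2 * exp (2 * C\<^sup>2) * min_rate q \<alpha> C n u"
proof -
  define r where "r = 1 / sqrt (real n)"
  have r: "r > 0" "r\<^sup>2 = 1 / real n" using n by (auto simp: r_def power_divide)
  have e1: "1 \<le> 2 * exp (2 * C\<^sup>2)" by (smt (verit) one_le_exp_iff zero_le_power2)
  have r1: "r \<le> 2 * exp (2 * C\<^sup>2) * r" using mult_right_mono[OF e1, of r] r by simp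
  have r2: "r \<le> 2 * exp (2 * C\<^sup>2) * (u powr (1 - q/2) / real n powr (q/4))"
  proof -
    have "r = r powr (1 - q/2) / real n powr (q/4)"
    proof -
      have "r = real n powr (-1/2)" using n by (simp add: r_def powr_half_sqrt[symmetric] powr_minus_divide)
      then have "r powr (1 - q/2) / real n powr (q/4) = real n powr (-1/2 * (1 - q/2) - q/4)"
        by (simp only: powr_powr powr_diff[of _ "-1/2 * (1 - q/2)" "q/4"])
      also have "-1/2 * (1 - q/2) - q/4 = -1/2" by (simp add: field_simps)
      finally show ?thesis using \<open>r = real n powr (-1/2)\<close> by simp
    qed
    also have "\<dots> \<le> u powr (1 - q/2) / real n powr (q/4)"
      using u q r by (intro divide_right_mono powr_mono2') (auto simp: r_def)
    also have "1 * \<dots> \<le> 2 * exp (2 * C\<^sup>2) * \<dots>" by (intro mult_right_mono e1) auto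
    finally show ?thesis by simp
  qed
  have r3: "r \<le> 2 * exp (2 * C\<^sup>2) * sqrt (H_fun q \<alpha> n u + G_fun q \<alpha> n (C * u))"
  proof -
    define J where "J = (J_alpha q \<alpha> n)\<^sup>2"
    have J: "J > 0" unfolding J_def by (intro zero_less_power J_alpha_pos n)
    have nJ: "1 / real n \<le> 4 * J" unfolding J_def by (rule inverse_n_le_J_alpha_sq[OF q n])
    have "u\<^sup>2 \<le> r\<^sup>2" using u by (intro power_mono) (auto simp: r_def)
    then have "u\<^sup>2 \<le> 4 * J" using r nJ by simp
    then have "u\<^sup>2 / J \<le> 4" using J by (simp add: divide_simps)
    then have "C\<^sup>2 * (u\<^sup>2 / J) \<le> C\<^sup>2 * 4" by (intro mult_left_mono) auto
    then have e: "exp (- (C\<^sup>2 * 4)) \<le> exp (- ((C * u)\<^sup>2 / J))" by (simp add: power_mult_distrib)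
    have "r\<^sup>2 \<le> 4 * J * (exp (2 * C\<^sup>2 + 2 * C\<^sup>2) * exp (- (C\<^sup>2 * 4)))" using r nJ by (simp add: mult_exp_exp)
    also have "\<dots> \<le> 4 * J * (exp (2 * C\<^sup>2 + 2 * C\<^sup>2) * exp (- ((C * u)\<^sup>2 / J)))"
      using J e by (intro mult_left_mono) auto
    also have "\<dots> = (2 * exp (2 * C\<^sup>2))\<^sup>2 * (J * exp (- ((C * u)\<^sup>2 / J)))"
    proof -
      have "exp (2 * C\<^sup>2 + 2 * C\<^sup>2) = (exp (2 * C\<^sup>2))\<^sup>2" by (simp only: power2_eq_square exp_add)
      then show ?thesis by (simp only: power_mult_distrib) simp
    qed
    also have "\<dots> \<le> (2 * exp (2 * C\<^sup>2))\<^sup>2 * (H_fun q \<alpha> n u + G_fun q \<alpha> n (C * u))"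
    proof (intro mult_left_mono)
      have "J * exp (- ((C * u)\<^sup>2 / J)) \<le> (J + (C * u)\<^sup>2) * exp (- ((C * u)\<^sup>2 / J))"
        by (intro mult_right_mono) auto
      also have "\<dots> = G_fun q \<alpha> n (C * u)" by (simp add: G_fun_eq[OF n] J_def)
      also have "\<dots> \<le> H_fun q \<alpha> n u + G_fun q \<alpha> n (C * u)" by (simp add: H_fun_def)
      finally show "J * exp (- ((C * u)\<^sup>2 / J)) \<le> H_fun q \<alpha> n u + G_fun q \<alpha> n (C * u)" .
    qed auto
    finally have "sqrt (r\<^sup>2) \<le> sqrt ((2 * exp (2 * C\<^sup>2))\<^sup>2 * (H_fun q \<alpha> n u + G_fun q \<alpha> n (C * u)))"
      by (rule real_sqrt_le_mono)
    then show ?thesis using r(1) by (simp add: real_sqrt_mult)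
  qed
  have "min_rate q \<alpha> C n u = r \<or> min_rate q \<alpha> C n u = u powr (1 - q/2) / real n powr (q/4) \<or>
      min_rate q \<alpha> C n u = sqrt (H_fun q \<alpha> n u + G_fun q \<alpha> n (C * u))"
    unfolding min_rate_def r_def by (auto simp: min_def)
  then have "r \<le> 2 * exp (2 * C\<^sup>2) * min_rate q \<alpha> C n u" using r1 r2 r3 by auto
  then show ?thesis by (simp add: r_def)
qed

text \<open>The level \<open>w\<close> balances the two parts of the tail of the maximum of at most \<open>p N\<close> entries.\<close>

lemma large_entries_dev:
  fixes q \<alpha> c :: real and p n :: nat
  assumes q: "q > 2" and n: "n \<ge> 2" and c: "c > 0" and p: "p \<ge> 2" and N: "N \<ge> 1"
  defines "w \<equiv> L_alpha q \<alpha> n * (real p * N) powr (1/q) + sqrt (2 / c) * J_alpha q \<alpha> n * sqrt (ln (real p))"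
  shows "w > 0" "real p * dev_bound q \<alpha> c n w \<le> (2 + c) * w\<^sup>2"
proof -
  define L where "L = L_alpha q \<alpha> n"
  define J where "J = J_alpha q \<alpha> n"
  have L: "L > 0" and J: "J > 0" using L_alpha_pos[OF n] J_alpha_pos[OF n] by (auto simp: L_def J_def)
  define w1 where "w1 = L * (real p * N) powr (1/q)"
  define w2 where "w2 = sqrt (2 / c) * J * sqrt (ln (real p))"
  have w_eq: "w = w1 + w2" by (simp add: w_def w1_def w2_def L_def J_def)
  have pN: "real p * N > 0" using p N by simp
  have "(real p * N) powr (1/q) > 0" using pN by (metis less_irrefl powr_gt_zero)
  then have w1: "w1 > 0" using L by (simp only: w1_def mult_pos_pos)
  have w2: "w2 \<ge> 0" using c J p by (simp add: w2_def)
  show w: "w > 0" using w1 w2 by (simp add: w_eq)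
  have w1w: "w1\<^sup>2 \<le> w\<^sup>2" using w1 w2 by (intro power_mono) (auto simp: w_eq)
  have w2w: "w2\<^sup>2 \<le> w\<^sup>2" using w1 w2 by (intro power_mono) (auto simp: w_eq)
  have w2sq: "w2\<^sup>2 = 2 / c * J\<^sup>2 * ln (real p)" using c p by (simp add: w2_def power_mult_distrib)
  have poly: "real p * (L powr q * w powr (2 - q)) \<le> w\<^sup>2"
  proof -
    have "real p * (L powr q * w powr (2 - q)) \<le> real p * (L powr q * w1 powr (2 - q))"
      using w1 w2 q by (intro mult_left_mono powr_mono2') (auto simp: w_eq)
    also have "\<dots> \<le> (real p * N) * (L powr q * w1 powr (2 - q))"
      using N p by (intro mult_right_mono) auto
    also have "\<dots> = (L * (real p * N) powr (1/q)) powr q * w1 powr (2 - q)"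
    proof -
      have "(L * (real p * N) powr (1/q)) powr q = L powr q * (real p * N)"
        using q N by (simp add: powr_mult powr_powr)
      then show ?thesis by simp
    qed
    also have "\<dots> = w1 powr q * w1 powr (2 - q)" by (simp only: w1_def)
    also have "\<dots> = w1\<^sup>2" using w1 by (simp add: powr_add[symmetric])
    finally show ?thesis using w1w by simp
  qed
  have gauss: "real p * ((J\<^sup>2 + w\<^sup>2) * exp (- (c * w\<^sup>2 / J\<^sup>2))) \<le> (1 + c) * w\<^sup>2"
  proof -
    \<comment> \<open>The factor sqrt(2/c) in w makes the Gaussian exponent at least 2 ln p, so the
      exponential compensates the factor p.\<close>
    have "2 * ln (real p) = c * w2\<^sup>2 / J\<^sup>2" using c J by (simp add: w2sq)
    also have "\<dots> \<le> c * w\<^sup>2 / J\<^sup>2" using c w2w by (intro divide_right_mono mult_left_mono) auto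
    finally have "2 * ln (real p) \<le> c * w\<^sup>2 / J\<^sup>2" .
    moreover have "0 \<le> ln (real p)" using p by simp
    ultimately have "ln (real p) \<le> c * w\<^sup>2 / J\<^sup>2" by linarith
    then have "exp (- (c * w\<^sup>2 / J\<^sup>2)) \<le> exp (- ln (real p))" by simp
    also have "\<dots> = 1 / real p" using p by (simp add: exp_minus inverse_eq_divide)
    finally have e: "real p * exp (- (c * w\<^sup>2 / J\<^sup>2)) \<le> 1" using p by (simp add: field_simps)
    \<comment> \<open>Here p \<ge> 2 enters: ln p is bounded away from 0, and J^2 is therefore at
      most c w^2.\<close>
    have "ln 2 \<le> ln (real p)" using p by simp
    then have "1 \<le> 2 * ln (real p)" using ln2_bounds by linarith
    then have "J\<^sup>2 * 1 \<le> J\<^sup>2 * (2 * ln (real p))" by (intro mult_left_mono) auto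
    also have "\<dots> = c * w2\<^sup>2" using c by (simp add: w2sq)
    also have "\<dots> \<le> c * w\<^sup>2" using c w2w by (intro mult_left_mono) auto
    finally have Jw: "J\<^sup>2 \<le> c * w\<^sup>2" by simp
    have "real p * ((J\<^sup>2 + w\<^sup>2) * exp (- (c * w\<^sup>2 / J\<^sup>2))) = (J\<^sup>2 + w\<^sup>2) * (real p * exp (- (c * w\<^sup>2 / J\<^sup>2)))" by simp
    also have "\<dots> \<le> (J\<^sup>2 + w\<^sup>2) * 1" using e by (intro mult_left_mono) auto
    also have "\<dots> \<le> (1 + c) * w\<^sup>2" using Jw by (simp add: algebra_simps)
    finally show ?thesis .
  qed
  have "dev_bound q \<alpha> c n w \<le> L powr q * w powr (2 - q) + (J\<^sup>2 + w\<^sup>2) * exp (- (c * w\<^sup>2 / J\<^sup>2))"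
    by (simp add: dev_bound_def L_def J_def)
  then have "real p * dev_bound q \<alpha> c n w \<le> real p * (L powr q * w powr (2 - q) + (J\<^sup>2 + w\<^sup>2) * exp (- (c * w\<^sup>2 / J\<^sup>2)))"
    by (intro mult_left_mono) auto
  also have "\<dots> \<le> (2 + c) * w\<^sup>2" using poly gauss by (simp add: distrib_left algebra_simps)
  finally show "real p * dev_bound q \<alpha> c n w \<le> (2 + c) * w\<^sup>2" .
qed

lemma sum_indicator_le_N_star:
  assumes p: "p \<ge> 1" and b: "b \<ge> 0"
  shows "(\<Sum>k<p. \<Sum>j<p. if v \<le> \<bar>S j k\<bar> then b else 0) \<le> real p * N_star p S v * b"
proof -
  have "(\<Sum>k<p. \<Sum>j<p. if v \<le> \<bar>S j k\<bar> then b else 0) = (\<Sum>k<p. real (card {j. j < p \<and> v \<le> \<bar>S j k\<bar>}) * b)"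
    by (simp add: sum.If_cases Int_def)
  also have "\<dots> \<le> (\<Sum>k<p. N_star p S v * b)"
    using b by (intro sum_mono mult_right_mono N_star_ge) auto
  finally show ?thesis by simp
qed

text \<open>For \<open>p = 1\<close> the term \<open>J_alpha * sqrt (ln p)\<close> vanishes; the fluctuation of the single entry is then
  absorbed by \<open>D_star\<close> when \<open>u \<ge> 1 / sqrt n\<close> and by the last term otherwise.\<close>

lemma ex_level_le_rates:
  fixes q \<alpha> c :: real and S :: "nat \<Rightarrow> nat \<Rightarrow> real"
  assumes q: "q > 2" and c: "c > 0"
  defines "C \<equiv> sqrt c / 2"
  defines "K1 \<equiv> 1 + sqrt (2 / c) + 4 * exp (2 * C\<^sup>2)"
  assumes n: "n \<ge> 2" and p: "p \<ge> 1" and u: "u > 0"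
  defines "N \<equiv> N_star p S (u/2)"
  defines "Rt \<equiv> D_star p S u + M_star q \<alpha> n p S (u/2) + real p * min_rate q \<alpha> C n u"
  shows "\<exists>w>0. N * w \<le> K1 * Rt \<and> N\<^sup>2 * real p * dev_bound q \<alpha> c n w \<le> (2 + c) * (K1 * Rt)\<^sup>2"
proof -
  have D: "D_star p S u \<ge> 0" by (rule D_star_nonneg[OF p u])
  have N0: "N = 0 \<or> N \<ge> 1" unfolding N_def by (rule N_star_cases[OF p])
  then have Nn: "N \<ge> 0" by auto
  have M: "M_star q \<alpha> n p S (u/2) \<ge> 0"
    using L_alpha_pos[OF n, of q \<alpha>] J_alpha_pos[OF n, of q \<alpha>] Nn p
    unfolding M_star_def N_def[symmetric] by (intro add_nonneg_nonneg mult_nonneg_nonneg) auto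
  have m0: "min_rate q \<alpha> C n u \<ge> 0" by (rule min_rate_nonneg)
  have parts: "D_star p S u \<le> Rt" "M_star q \<alpha> n p S (u/2) \<le> Rt" "real p * min_rate q \<alpha> C n u \<le> Rt"
    using D M m0 by (auto simp: Rt_def)
  have Rt: "Rt \<ge> 0" using D parts by linarith
  have K1: "K1 \<ge> 1" "sqrt (2 / c) \<le> K1" "4 * exp (2 * C\<^sup>2) \<le> K1" using c by (auto simp: K1_def)
  \<comment> \<open>At most p N large entries are summed and weighted with another N, so it is
    enough that p times a single truncated second moment has order w^2.\<close>
  have suff: ?thesis if "w > 0" "N * w \<le> K1 * Rt" "real p * dev_bound q \<alpha> c n w \<le> (2 + c) * w\<^sup>2" for w
  proof (intro exI[of _ w] conjI that)
    have "N\<^sup>2 * (real p * dev_bound q \<alpha> c n w) \<le> N\<^sup>2 * ((2 + c) * w\<^sup>2)" using that by (intro mult_left_mono) auto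
    also have "\<dots> = (2 + c) * (N * w)\<^sup>2" by (simp add: power_mult_distrib)
    also have "\<dots> \<le> (2 + c) * (K1 * Rt)\<^sup>2" using that Nn c by (intro mult_left_mono power_mono) auto
    finally show "N\<^sup>2 * real p * dev_bound q \<alpha> c n w \<le> (2 + c) * (K1 * Rt)\<^sup>2" by (simp add: mult.assoc)
  qed
  show ?thesis
  proof (cases "N = 0")
    case True
    show ?thesis using True K1 Rt c by (intro exI[of _ 1]) simp
  next
    case False
    then have N1: "N \<ge> 1" using N0 by simp
    show ?thesis
    proof (cases "p = 1")
      case False
      then have p2: "p \<ge> 2" using p by simp
      define w where "w = L_alpha q \<alpha> n * (real p * N) powr (1/q) + sqrt (2 / c) * J_alpha q \<alpha> n * sqrt (ln (real p))"
      show ?thesis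
      proof (rule suff)
        show "w > 0" "real p * dev_bound q \<alpha> c n w \<le> (2 + c) * w\<^sup>2"
          unfolding w_def by (rule large_entries_dev[OF q n c p2 N1])+
        \<comment> \<open>This product is the origin of the exponent 1 + 1/q in
          \<open>M_star\<close>: N entries per column, each at a level containing (p
          N)^(1/q).\<close>
        have "N * w = L_alpha q \<alpha> n * real p powr (1/q) * N powr (1 + 1/q) + sqrt (2 / c) * (J_alpha q \<alpha> n * sqrt (ln (real p)) * N)"
          using N1 by (simp add: w_def powr_mult powr_add algebra_simps)
        also have "\<dots> \<le> K1 * (L_alpha q \<alpha> n * real p powr (1/q) * N powr (1 + 1/q)) + K1 * (J_alpha q \<alpha> n * sqrt (ln (real p)) * N)"
        proof (rule add_mono)
          have "1 * (L_alpha q \<alpha> n * real p powr (1/q) * N powr (1 + 1/q)) \<le> K1 * (L_alpha q \<alpha> n * real p powr (1/q) * N powr (1 + 1/q))"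
            using K1 L_alpha_pos[OF n, of q \<alpha>] by (intro mult_right_mono) auto
          then show "L_alpha q \<alpha> n * real p powr (1/q) * N powr (1 + 1/q) \<le> K1 * (L_alpha q \<alpha> n * real p powr (1/q) * N powr (1 + 1/q))" by simp
          show "sqrt (2 / c) * (J_alpha q \<alpha> n * sqrt (ln (real p)) * N) \<le> K1 * (J_alpha q \<alpha> n * sqrt (ln (real p)) * N)"
            using K1 J_alpha_pos[OF n, of q \<alpha>] Nn p2 by (intro mult_right_mono mult_nonneg_nonneg) auto
        qed
        also have "\<dots> = K1 * M_star q \<alpha> n p S (u/2)" by (simp add: M_star_def N_def distrib_left)
        also have "\<dots> \<le> K1 * Rt" using K1 parts by (intro mult_left_mono) auto
        finally show "N * w \<le> K1 * Rt" .
      qed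
    next
      case True
      \<comment> \<open>For a single entry the standard deviation is the right level, and the first
        argument of \<open>dev_bound\<close> is exactly w^2.\<close>
      define w where "w = 1 / sqrt (real n)"
      have w: "w > 0" "w\<^sup>2 = 1 / real n" using n by (auto simp: w_def power_divide)
      have "N \<le> 1" using N_star_le[OF p, of S "u/2"] True by (simp add: N_def)
      then have N: "N = 1" using N1 by simp
      have "N_star 1 S (u/2) = (if u/2 \<le> \<bar>S 0 0\<bar> then 1 else 0)" by (simp add: N_star_def lessThan_Suc)
      then have S: "u/2 \<le> \<bar>S 0 0\<bar>" using N True by (auto simp: N_def split: if_splits)
      have "D_star p S u = min \<bar>S 0 0\<bar> u" using True by (simp add: D_star_def lessThan_Suc)
      then have Du: "u \<le> 2 * D_star p S u" using S u by simp
      show ?thesis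
      proof (rule suff[OF w(1)])
        have "dev_bound q \<alpha> c n w \<le> w\<^sup>2" by (simp add: dev_bound_def w)
        also have "1 * w\<^sup>2 \<le> (2 + c) * w\<^sup>2" using c by (intro mult_right_mono) auto
        finally show "real p * dev_bound q \<alpha> c n w \<le> (2 + c) * w\<^sup>2" using True by simp
        show "N * w \<le> K1 * Rt"
        proof (cases "u \<le> w")
          case True
          have "w \<le> 2 * exp (2 * C\<^sup>2) * min_rate q \<alpha> C n u"
            unfolding w_def using True u by (intro inverse_sqrt_le_min_rate q n) (auto simp: w_def)
          also have "\<dots> \<le> K1 * min_rate q \<alpha> C n u"
            using K1 m0 by (intro mult_right_mono) (auto intro: order_trans[of _ "4 * exp (2 * C\<^sup>2)"])
          also have "\<dots> \<le> K1 * Rt" using K1 parts \<open>p = 1\<close> by (intro mult_left_mono) auto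
          finally show ?thesis by (simp add: N)
        next
          case False
          have e: "1 \<le> exp (2 * C\<^sup>2)" by simp
          have "w \<le> 2 * D_star p S u" using False Du by simp
          also have "\<dots> \<le> K1 * D_star p S u" using e K1 D by (intro mult_right_mono) linarith+
          also have "\<dots> \<le> K1 * Rt" using K1 parts by (intro mult_left_mono) auto
          finally show ?thesis by (simp add: N)
        qed
      qed
    qed
  qed
qed

lemma nn_integral_sum_le:
  fixes F :: "'i \<Rightarrow> 'a \<Rightarrow> real"
  assumes F: "\<And>i. i \<in> I \<Longrightarrow> F i \<in> borel_measurable M" "\<And>i x. i \<in> I \<Longrightarrow> F i x \<ge> 0"
    and le: "\<And>i. i \<in> I \<Longrightarrow> (\<integral>\<^sup>+x. ennreal (F i x) \<partial>M) \<le> ennreal (b i)" and b: "\<And>i. i \<in> I \<Longrightarrow> b i \<ge> 0"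
  shows "(\<integral>\<^sup>+x. ennreal (\<Sum>i\<in>I. F i x) \<partial>M) \<le> ennreal (\<Sum>i\<in>I. b i)"
proof -
  have "(\<integral>\<^sup>+x. ennreal (\<Sum>i\<in>I. F i x) \<partial>M) = (\<integral>\<^sup>+x. (\<Sum>i\<in>I. ennreal (F i x)) \<partial>M)"
    using F(2) by (intro nn_integral_cong sum_ennreal[symmetric]) auto
  also have "\<dots> = (\<Sum>i\<in>I. \<integral>\<^sup>+x. ennreal (F i x) \<partial>M)"
    using F(1) by (intro nn_integral_sum) auto
  also have "\<dots> \<le> (\<Sum>i\<in>I. ennreal (b i))" by (intro sum_mono le)
  also have "\<dots> = ennreal (\<Sum>i\<in>I. b i)" using b by (rule sum_ennreal)
  finally show ?thesis .
qed

text \<open>For n = 1 the logarithm vanishes and with it \<open>L_alpha\<close> and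
  \<open>J_alpha\<close> in the critical regime; the estimate is therefore stated from n = 2
  on.\<close>

theorem theorem2p3:
  fixes q \<alpha> \<mu> C\<^sub>0 :: real
  assumes "q > 2" and "\<alpha> > 0"
  shows "\<exists>C>0. \<exists>K>0. \<forall>(n::nat) (p::nat) (M::'a measure) (E::'e measure)
            (eps :: int \<Rightarrow> 'a \<Rightarrow> 'e) (eps0' :: 'a \<Rightarrow> 'e) (g :: nat \<Rightarrow> (nat \<Rightarrow> 'e) \<Rightarrow> real).
    n \<ge> 2 \<longrightarrow> p \<ge> 1 \<longrightarrow>
    prob_space M \<longrightarrow>
    iid_innov M E eps eps0' \<longrightarrow>
    (\<forall>j<p. g j \<in> borel_measurable (PiM (UNIV :: nat set) (\<lambda>_. E))) \<longrightarrow>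
    (\<forall>j<p. \<forall>i. (\<integral>\<omega>. Zproc g eps j i \<omega> \<partial>M) = 0) \<longrightarrow>
    (\<forall>j<p. \<forall>i. Lnorm M (2 * q) (Zproc g eps j i) \<le> ennreal \<mu>) \<longrightarrow>
    (\<forall>m\<ge>1. Theta_dep M g eps eps0' p m (2 * q) \<le> ennreal (C\<^sub>0 * real m powr (- \<alpha>))) \<longrightarrow>
    (\<forall>u>0.
       Lnorm M 2 (\<lambda>\<omega>. spec_norm p (\<lambda>j k. thresh u (Sigma_hat n g eps \<omega>) j k - Sigma_cov M g eps j k))
       \<le> ennreal (K * (D_star p (Sigma_cov M g eps) u
                        + M_star q \<alpha> n p (Sigma_cov M g eps) (u / 2)
                        + real p * min (1 / sqrt (real n))
                              (min (u powr (1 - q / 2) / real n powr (q / 4))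
                                   (sqrt (H_fun q \<alpha> n u + G_fun q \<alpha> n (C * u)))))))"
proof -
  note q = assms(1) and \<alpha> = assms(2)
  from entry_bound[OF q \<alpha>, of \<mu> C\<^sub>0, where ?'a = 'a and ?'e = 'e] obtain K0 c where K0: "K0 > 0" and c: "c > 0"
    and entry: "\<forall>(n::nat) (p::nat) (M::'a measure) (E::'e measure)
            (eps :: int \<Rightarrow> 'a \<Rightarrow> 'e) (eps0' :: 'a \<Rightarrow> 'e) (g :: nat \<Rightarrow> (nat \<Rightarrow> 'e) \<Rightarrow> real).
    n \<ge> 2 \<longrightarrow> prob_space M \<longrightarrow> iid_innov M E eps eps0' \<longrightarrow>
    (\<forall>j<p. g j \<in> borel_measurable (PiM (UNIV :: nat set) (\<lambda>_. E))) \<longrightarrow>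
    (\<forall>j<p. Lnorm M (2 * q) (Zproc g eps j 0) \<le> ennreal \<mu>) \<longrightarrow>
    (\<forall>m\<ge>1. Theta_dep M g eps eps0' p m (2 * q) \<le> ennreal (C\<^sub>0 * real m powr (- \<alpha>))) \<longrightarrow>
    (\<forall>j<p. \<forall>k<p. (\<lambda>\<omega>. Sigma_hat n g eps \<omega> j k) \<in> borel_measurable M \<and>
       (\<forall>w>0. (\<integral>\<^sup>+\<omega>. ennreal (trunc_sq w (Sigma_hat n g eps \<omega> j k - Sigma_cov M g eps j k)) \<partial>M)
        \<le> ennreal (K0 * dev_bound q \<alpha> c n w)))"
    by (elim exE conjE)
  \<comment> \<open>Dictated by \<open>dev_bound_le_min_rate\<close>, where the threshold u/2
    quarters the rate c.\<close>
  define C where "C = sqrt c / 2"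
  have C: "C > 0" using c by (simp add: C_def)
  \<comment> \<open>The three summands serve the polynomial part of w, its Gaussian part, and the
    case p = 1.\<close>
  define K1 where "K1 = 1 + sqrt (2 / c) + 4 * exp (2 * C\<^sup>2)"
  define B where "B = 2 powr q * (1 + 1 / C\<^sup>2)"
  have B: "B > 0" unfolding B_def using C by (intro mult_pos_pos) (auto simp: add_pos_pos)
  \<comment> \<open>One summand for each term of \<open>spec_norm_thresh_le\<close>, in the same
    order, expressed as a multiple of the squared rate.\<close>
  define V where "V = 16 + 8 * K1\<^sup>2 + 8 * (K0 * ((2 + c) * K1\<^sup>2)) + 2 * (K0 * B)"
  have V: "V > 0" unfolding V_def using K0 c B by (intro add_pos_nonneg add_nonneg_nonneg mult_nonneg_nonneg) auto
  show ?thesis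
  proof (rule exI[of _ C], rule conjI[OF C], rule exI[of _ "sqrt V"], intro conjI allI impI)
    show "sqrt V > 0" using V by simp
    fix n p :: nat and M :: "'a measure" and E :: "'e measure" and eps :: "int \<Rightarrow> 'a \<Rightarrow> 'e" and eps0' :: "'a \<Rightarrow> 'e"
      and g :: "nat \<Rightarrow> (nat \<Rightarrow> 'e) \<Rightarrow> real" and u :: real
    assume n: "n \<ge> 2" and p: "p \<ge> 1" and M: "prob_space M" and iid: "iid_innov M E eps eps0'"
      and gm: "\<forall>j<p. g j \<in> borel_measurable (PiM (UNIV :: nat set) (\<lambda>_. E))"
      and mom: "\<forall>j<p. \<forall>i. Lnorm M (2 * q) (Zproc g eps j i) \<le> ennreal \<mu>"
      and dep: "\<forall>m\<ge>1. Theta_dep M g eps eps0' p m (2 * q) \<le> ennreal (C\<^sub>0 * real m powr (- \<alpha>))"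
      and u: "u > 0"
    interpret prob_space M by fact
    define S where "S = Sigma_cov M g eps"
    define H where "H = Sigma_hat n g eps"
    define N where "N = N_star p S (u/2)"
    define Rt where "Rt = D_star p S u + M_star q \<alpha> n p S (u/2) + real p * min_rate q \<alpha> C n u"
    have mom0: "\<forall>j<p. Lnorm M (2 * q) (Zproc g eps j 0) \<le> ennreal \<mu>" using mom by blast
    note ent0 = entry[THEN spec, THEN spec, THEN spec, THEN spec, THEN spec, THEN spec, THEN spec,
        THEN mp, OF n, THEN mp, OF M, THEN mp, OF iid, THEN mp, OF gm, THEN mp, OF mom0, THEN mp, OF dep,
        folded S_def H_def, rule_format]
    have ent: "(\<lambda>\<omega>. H \<omega> j k) \<in> borel_measurable M"
      "w > 0 \<Longrightarrow> (\<integral>\<^sup>+\<omega>. ennreal (trunc_sq w (H \<omega> j k - S j k)) \<partial>M) \<le> ennreal (K0 * dev_bound q \<alpha> c n w)"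
      if "j < p" "k < p" for j k w
      using ent0[OF that] by auto
    obtain w where w: "w > 0" and w1: "N * w \<le> K1 * Rt" and w2: "N\<^sup>2 * real p * dev_bound q \<alpha> c n w \<le> (2 + c) * (K1 * Rt)\<^sup>2"
      using ex_level_le_rates[OF q c n p u, of S \<alpha>] unfolding N_def Rt_def K1_def C_def by blast
    have D: "D_star p S u \<ge> 0" by (rule D_star_nonneg[OF p u])
    have Nn: "N \<ge> 0" using N_star_cases[OF p, of S "u/2"] by (auto simp: N_def)
    have Ms: "M_star q \<alpha> n p S (u/2) \<ge> 0"
      using L_alpha_pos[OF n, of q \<alpha>] J_alpha_pos[OF n, of q \<alpha>] Nn p
      unfolding M_star_def N_def[symmetric] by (intro add_nonneg_nonneg mult_nonneg_nonneg) auto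
    have m0: "min_rate q \<alpha> C n u \<ge> 0" by (rule min_rate_nonneg)
    have parts: "D_star p S u \<le> Rt" "real p * min_rate q \<alpha> C n u \<le> Rt" "Rt \<ge> 0"
      using D Ms m0 by (auto simp: Rt_def)
    have symH: "H \<omega> j k = H \<omega> k j" for \<omega> j k by (simp add: H_def Sigma_hat_def mult.commute)
    have symS: "S j k = S k j" for j k by (simp add: S_def Sigma_cov_def mult.commute)
    define F1 where "F1 = (\<lambda>\<omega>. \<Sum>k<p. \<Sum>j<p. if u/2 \<le> \<bar>S j k\<bar> then trunc_sq w (H \<omega> j k - S j k) else 0)"
    define F2 where "F2 = (\<lambda>\<omega>. \<Sum>j<p. \<Sum>k<p. trunc_sq (u/2) (H \<omega> j k - S j k))"
    have F0: "F1 \<omega> \<ge> 0" "F2 \<omega> \<ge> 0" for \<omega> by (auto simp: F1_def F2_def intro!: sum_nonneg)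
    have mt: "(\<lambda>\<omega>. trunc_sq v (H \<omega> j k - S j k)) \<in> borel_measurable M" if "j < p" "k < p" for j k v
    proof -
      have [measurable]: "(\<lambda>\<omega>. H \<omega> j k) \<in> borel_measurable M" using ent that by simp
      show ?thesis by measurable
    qed
    have mif: "(\<lambda>\<omega>. if u/2 \<le> \<bar>S j k\<bar> then trunc_sq w (H \<omega> j k - S j k) else 0) \<in> borel_measurable M"
      if "j < p" "k < p" for j k
      using mt[OF that] by (cases "u/2 \<le> \<bar>S j k\<bar>") simp_all
    have m1: "F1 \<in> borel_measurable M" unfolding F1_def
      by (intro borel_measurable_sum mif) simp_all
    have m2: "F2 \<in> borel_measurable M" unfolding F2_def
      by (intro borel_measurable_sum mt) simp_all
    have I1: "(\<integral>\<^sup>+\<omega>. ennreal (F1 \<omega>) \<partial>M) \<le> ennreal (real p * N * (K0 * dev_bound q \<alpha> c n w))"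
    proof -
      have db: "0 \<le> K0 * dev_bound q \<alpha> c n w" using K0 dev_bound_nonneg[OF w] by simp
      have "(\<integral>\<^sup>+\<omega>. ennreal (F1 \<omega>) \<partial>M) \<le> ennreal (\<Sum>k<p. \<Sum>j<p. if u/2 \<le> \<bar>S j k\<bar> then K0 * dev_bound q \<alpha> c n w else 0)"
        unfolding F1_def
      proof (intro nn_integral_sum_le borel_measurable_sum sum_nonneg mif)
        fix j k assume jk: "k \<in> {..<p}" "j \<in> {..<p}"
        show "(\<integral>\<^sup>+\<omega>. ennreal (if u/2 \<le> \<bar>S j k\<bar> then trunc_sq w (H \<omega> j k - S j k) else 0) \<partial>M)
            \<le> ennreal (if u/2 \<le> \<bar>S j k\<bar> then K0 * dev_bound q \<alpha> c n w else 0)"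
          using ent(2)[OF _ _ w, of j k] jk by (cases "u/2 \<le> \<bar>S j k\<bar>") simp_all
      qed (use db in simp_all)
      also have "\<dots> \<le> ennreal (real p * N * (K0 * dev_bound q \<alpha> c n w))"
        unfolding N_def by (intro ennreal_leI sum_indicator_le_N_star p db)
      finally show ?thesis .
    qed
    have I2: "(\<integral>\<^sup>+\<omega>. ennreal (F2 \<omega>) \<partial>M) \<le> ennreal ((real p)\<^sup>2 * (K0 * dev_bound q \<alpha> c n (u/2)))"
    proof -
      have u2: "u/2 > 0" using u by simp
      have db: "0 \<le> K0 * dev_bound q \<alpha> c n (u/2)" using K0 dev_bound_nonneg[OF u2] by simp
      have "(\<integral>\<^sup>+\<omega>. ennreal (F2 \<omega>) \<partial>M) \<le> ennreal (\<Sum>j<p. \<Sum>k<p. K0 * dev_bound q \<alpha> c n (u/2))"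
        unfolding F2_def
        by (intro nn_integral_sum_le borel_measurable_sum sum_nonneg mt ent(2)[OF _ _ u2]) (use db in simp_all)
      also have "(\<Sum>j<p. \<Sum>k<p. K0 * dev_bound q \<alpha> c n (u/2)) = (real p)\<^sup>2 * (K0 * dev_bound q \<alpha> c n (u/2))"
        by (simp add: power2_eq_square)
      finally show ?thesis .
    qed
    \<comment> \<open>The nonnegative integral is monotone for arbitrary integrands, so
      measurability is established only for the majorant built from \<open>F1\<close> and
      \<open>F2\<close>.\<close>
    let ?f = "\<lambda>\<omega>. spec_norm p (\<lambda>j k. thresh u (H \<omega>) j k - S j k)"
    have "(\<integral>\<^sup>+\<omega>. ennreal (\<bar>?f \<omega>\<bar> powr 2) \<partial>M) \<le>
       (\<integral>\<^sup>+\<omega>. ennreal (16 * (D_star p S u)\<^sup>2 + 8 * N\<^sup>2 * w\<^sup>2) + (ennreal (8 * N) * ennreal (F1 \<omega>) + ennreal 2 * ennreal (F2 \<omega>)) \<partial>M)"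
    proof (rule nn_integral_mono)
      fix \<omega>
      have "\<bar>?f \<omega>\<bar> powr 2 = (?f \<omega>)\<^sup>2" by simp
      also have "\<dots> \<le> (16 * (D_star p S u)\<^sup>2 + 8 * N\<^sup>2 * w\<^sup>2) + (8 * N * F1 \<omega> + 2 * F2 \<omega>)"
        using spec_norm_thresh_le[OF p u w symH[of \<omega>] symS] unfolding F1_def F2_def N_def by (simp only: add.assoc)
      finally have "ennreal (\<bar>?f \<omega>\<bar> powr 2) \<le> ennreal ((16 * (D_star p S u)\<^sup>2 + 8 * N\<^sup>2 * w\<^sup>2) + (8 * N * F1 \<omega> + 2 * F2 \<omega>))"
        by (rule ennreal_leI)
      also have "\<dots> = ennreal (16 * (D_star p S u)\<^sup>2 + 8 * N\<^sup>2 * w\<^sup>2) + (ennreal (8 * N) * ennreal (F1 \<omega>) + ennreal 2 * ennreal (F2 \<omega>))"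
      proof -
        have "ennreal (8 * N * F1 \<omega>) = ennreal (8 * N) * ennreal (F1 \<omega>)" using Nn by (intro ennreal_mult') simp
        moreover have "ennreal (2 * F2 \<omega>) = ennreal 2 * ennreal (F2 \<omega>)" by (rule ennreal_mult') simp
        moreover have "0 \<le> 8 * N * F1 \<omega>" "0 \<le> 2 * F2 \<omega>" "0 \<le> 16 * (D_star p S u)\<^sup>2 + 8 * N\<^sup>2 * w\<^sup>2"
          using Nn F0[of \<omega>] by auto
        ultimately show ?thesis by (simp only: ennreal_plus add_nonneg_nonneg)
      qed
      finally show "ennreal (\<bar>?f \<omega>\<bar> powr 2) \<le> ennreal (16 * (D_star p S u)\<^sup>2 + 8 * N\<^sup>2 * w\<^sup>2) + (ennreal (8 * N) * ennreal (F1 \<omega>) + ennreal 2 * ennreal (F2 \<omega>))" .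
    qed
    also have "\<dots> = ennreal (16 * (D_star p S u)\<^sup>2 + 8 * N\<^sup>2 * w\<^sup>2) + (ennreal (8 * N) * (\<integral>\<^sup>+\<omega>. ennreal (F1 \<omega>) \<partial>M) + ennreal 2 * (\<integral>\<^sup>+\<omega>. ennreal (F2 \<omega>) \<partial>M))"
      using m1 m2 by (simp add: nn_integral_add nn_integral_cmult emeasure_space_1)
    also have "\<dots> \<le> ennreal (16 * (D_star p S u)\<^sup>2 + 8 * N\<^sup>2 * w\<^sup>2) + (ennreal (8 * N) * ennreal (real p * N * (K0 * dev_bound q \<alpha> c n w))
        + ennreal 2 * ennreal ((real p)\<^sup>2 * (K0 * dev_bound q \<alpha> c n (u/2))))"
      by (intro add_mono mult_left_mono I1 I2) auto
    also have "\<dots> = ennreal ((16 * (D_star p S u)\<^sup>2 + 8 * N\<^sup>2 * w\<^sup>2) + (8 * N * (real p * N * (K0 * dev_bound q \<alpha> c n w))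
        + 2 * ((real p)\<^sup>2 * (K0 * dev_bound q \<alpha> c n (u/2)))))"
    proof -
      have "0 \<le> dev_bound q \<alpha> c n w" "0 \<le> dev_bound q \<alpha> c n (u/2)"
        using dev_bound_nonneg[OF w] dev_bound_nonneg[of "u/2"] u by auto
      then have nn: "0 \<le> 8 * N * (real p * N * (K0 * dev_bound q \<alpha> c n w))" "0 \<le> 2 * ((real p)\<^sup>2 * (K0 * dev_bound q \<alpha> c n (u/2)))"
        using K0 Nn by auto
      moreover have "0 \<le> 16 * (D_star p S u)\<^sup>2 + 8 * N\<^sup>2 * w\<^sup>2" by simp
      moreover have "ennreal (8 * N * (real p * N * (K0 * dev_bound q \<alpha> c n w))) = ennreal (8 * N) * ennreal (real p * N * (K0 * dev_bound q \<alpha> c n w))"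
        using Nn by (intro ennreal_mult') simp
      moreover have "ennreal (2 * ((real p)\<^sup>2 * (K0 * dev_bound q \<alpha> c n (u/2)))) = ennreal 2 * ennreal ((real p)\<^sup>2 * (K0 * dev_bound q \<alpha> c n (u/2)))"
        by (rule ennreal_mult') simp
      ultimately show ?thesis by (simp only: ennreal_plus add_nonneg_nonneg)
    qed
    also have "\<dots> \<le> ennreal ((sqrt V * Rt) powr 2)"
    proof (rule ennreal_leI)
      have a1: "16 * (D_star p S u)\<^sup>2 \<le> 16 * Rt\<^sup>2" using D parts by (intro mult_left_mono power_mono) auto
      have "(N * w)\<^sup>2 \<le> (K1 * Rt)\<^sup>2" using w1 Nn w by (intro power_mono) auto
      then have a2: "8 * N\<^sup>2 * w\<^sup>2 \<le> 8 * K1\<^sup>2 * Rt\<^sup>2" by (simp add: power_mult_distrib)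
      have "8 * N * (real p * N * (K0 * dev_bound q \<alpha> c n w)) = 8 * (K0 * (N\<^sup>2 * real p * dev_bound q \<alpha> c n w))"
        by (simp add: power2_eq_square)
      also have "\<dots> \<le> 8 * (K0 * ((2 + c) * (K1 * Rt)\<^sup>2))" using w2 K0 by (intro mult_left_mono) auto
      also have "\<dots> = 8 * (K0 * ((2 + c) * K1\<^sup>2)) * Rt\<^sup>2" by (simp add: power_mult_distrib)
      finally have a3: "8 * N * (real p * N * (K0 * dev_bound q \<alpha> c n w)) \<le> 8 * (K0 * ((2 + c) * K1\<^sup>2)) * Rt\<^sup>2" .
      have "2 * ((real p)\<^sup>2 * (K0 * dev_bound q \<alpha> c n (u/2))) \<le> 2 * ((real p)\<^sup>2 * (K0 * (B * (min_rate q \<alpha> C n u)\<^sup>2)))"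
        using dev_bound_le_min_rate[OF q n u c, of \<alpha>] K0 unfolding B_def C_def by (intro mult_left_mono) auto
      also have "\<dots> = 2 * (K0 * B) * (real p * min_rate q \<alpha> C n u)\<^sup>2" by (simp add: power_mult_distrib)
      also have "\<dots> \<le> 2 * (K0 * B) * Rt\<^sup>2" using K0 B parts m0 by (intro mult_left_mono power_mono) auto
      finally have a4: "2 * ((real p)\<^sup>2 * (K0 * dev_bound q \<alpha> c n (u/2))) \<le> 2 * (K0 * B) * Rt\<^sup>2" .
      have "(16 * (D_star p S u)\<^sup>2 + 8 * N\<^sup>2 * w\<^sup>2) + (8 * N * (real p * N * (K0 * dev_bound q \<alpha> c n w))
        + 2 * ((real p)\<^sup>2 * (K0 * dev_bound q \<alpha> c n (u/2)))) \<le> V * Rt\<^sup>2"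
        using a1 a2 a3 a4 unfolding V_def distrib_right by linarith
      also have "\<dots> = (sqrt V * Rt) powr 2" using V parts by (simp add: power_mult_distrib)
      finally show "(16 * (D_star p S u)\<^sup>2 + 8 * N\<^sup>2 * w\<^sup>2) + (8 * N * (real p * N * (K0 * dev_bound q \<alpha> c n w))
        + 2 * ((real p)\<^sup>2 * (K0 * dev_bound q \<alpha> c n (u/2)))) \<le> (sqrt V * Rt) powr 2" .
    qed
    finally have "(\<integral>\<^sup>+\<omega>. ennreal (\<bar>?f \<omega>\<bar> powr 2) \<partial>M) \<le> ennreal ((sqrt V * Rt) powr 2)" .
    then have "Lnorm M 2 ?f \<le> ennreal (sqrt V * Rt)"
      using V parts by (intro Lnorm_le_of_nn_integral) auto
    then show "Lnorm M 2 (\<lambda>\<omega>. spec_norm p (\<lambda>j k. thresh u (Sigma_hat n g eps \<omega>) j k - Sigma_cov M g eps j k))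
       \<le> ennreal (sqrt V * (D_star p (Sigma_cov M g eps) u
                        + M_star q \<alpha> n p (Sigma_cov M g eps) (u / 2)
                        + real p * min (1 / sqrt (real n))
                              (min (u powr (1 - q / 2) / real n powr (q / 4))
                                   (sqrt (H_fun q \<alpha> n u + G_fun q \<alpha> n (C * u))))))"
      by (simp add: H_def S_def Rt_def min_rate_def)
  qed
qed

end
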